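(* The cluster structure $\mathcal C_{CG}(n)$ (on $\operatorname{Mat}_n$, and on $SL_n$) is regular: every cluster variable in every seed of $\mathcal C_{CG}(n)$ is a regular function (a polynomial in the matrix entries).
   Context: $\mathcal C_{CG}(n)$ on $\operatorname{Mat}_n$ is the cluster structure (skew-symmetric, geometric type, mutations $x_kx_k'=\prod_{b_{ki}>0}x_i^{b_{ki}}+\prod_{b_{ki}<0}x_i^{-b_{ki}}$ with the usual quiver mutation) generated by the following initial seed. For a matrix $A$, $A_{I}^{J}$ is the submatrix with rows $I$ and columns $J$. For $n\times n$ matrices $X,Y$ let $\mathcal X=[X_{[2,n]}\ 0]$ (rows $2..n$ of $X$ then a zero column) and $\mathcal Y=[0\ Y_{[1,n-1]}]$ (a zero column then rows $1..n-1$ of $Y$). Let $k=\lfloor (n+1)/2\rfloor$, $N=k(n-1)$, $M=N$ if $n$ even, $M=N-n+1$ if $n$ odd. $U(X,Y)$ is the $k(n-1)\times(k+1)(n+1)$ block matrix whose $i$-th block row has $\mathcal Y$ in block column $i$ and $\mathcal X$ in block column $i+1$ (block columns of width $n+1$), zeros elsewhere. Extended cluster: $\theta_i(X)=\det X_{[n-i+1,n]}^{[n-i+1,n]}$, $i\in[n]$; $\varphi_p(X,X)$, $p\in[N]$, with $\varphi_p(X,Y)=\det U(X,Y)_{[N-p+1,N]}^{[k(n+1)-p+1,\,k(n+1)]}$; $\psi_q(X,X)$, $q\in[M]$, with $\psi_q(X,Y)=\det U(X,Y)_{[N-q+1,N]}^{[k(n+1)-q+2,\,k(n+1)+1]}$;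 stable variables $\theta_n,\varphi_N,\psi_M$. Each function is placed at the vertex $(i,j)\in[n]\times[n]$ with $x_{ij}$ the upper-left entry of its defining submatrix (a bijection). Quiver $Q_{CG}(n)$: arrows $(i,j+1)\to(i,j)$ ($i\in[n],j\in[n-1]$, except $(1,n-1)$); $(i+1,j)\to(i,j)$ ($i\in[n-1],j\in[n]$, except $(1,1)$); $(i,j)\to(i+1,j+1)$ ($i,j\in[n-1]$); $(n,j)\to(1,j)$, $(1,j)\to(n,j+1)$ ($j\in[2,n-1]$); $(i,n)\to(i+2,1)$, $(i+2,1)\to(i+1,n)$ ($i\in[1,n-2]$). On $SL_n$ one deletes $\theta_n$ and vertex $(1,1)$. *)

theory Defs
  imports Complex_Main "HOL-Combinatorics.Permutations"
begin

type_synonym mat = "nat \<Rightarrow> nat \<Rightarrow> complex"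

definition Mat :: "nat \<Rightarrow> mat set" where
  "Mat n = {X. \<forall>i j. \<not> (i \<in> {1..n} \<and> j \<in> {1..n}) \<longrightarrow> X i j = 0}"

definition detm :: "nat \<Rightarrow> mat \<Rightarrow> complex" where
  "detm m A = (\<Sum>\<sigma> | \<sigma> permutes {1..m}. of_int (sign \<sigma>) * (\<Prod>i=1..m. A i (\<sigma> i)))"

definition SL :: "nat \<Rightarrow> mat set" where
  "SL n = {X \<in> Mat n. detm n X = 1}"

definition minor :: "mat \<Rightarrow> nat \<Rightarrow> nat \<Rightarrow> nat \<Rightarrow> complex" where
  "minor A r c m = detm m (\<lambda>i j. A (r + i - 1) (c + j - 1))"

definition kk :: "nat \<Rightarrow> nat" where "kk n = (n + 1) div 2"
definition NN :: "nat \<Rightarrow> nat" where "NN n = kk n * (n - 1)"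
definition MM :: "nat \<Rightarrow> nat" where "MM n = (if even n then NN n else NN n + 1 - n)"

text \<open>calX = [X_[2,n] 0] and calY = [0 Y_[1,n-1]], both (n-1) x (n+1).\<close>
definition calX :: "nat \<Rightarrow> mat \<Rightarrow> mat" where
  "calX n X a c = (if c \<le> n then X (a + 1) c else 0)"
definition calY :: "nat \<Rightarrow> mat \<Rightarrow> mat" where
  "calY n Y a c = (if c = 1 then 0 else Y a (c - 1))"

text \<open>U(X,Y): block row i (rows (i-1)(n-1)+1 .. i(n-1)) has calY in block column i and
  calX in block column i+1 (block columns of width n+1), zeros elsewhere.\<close>
definition Umat :: "nat \<Rightarrow> mat \<Rightarrow> mat \<Rightarrow> mat" where
  "Umat n X Y r c =
    (let i = (r - 1) div (n - 1) + 1; a = (r - 1) mod (n - 1) + 1;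
         b = (c - 1) div (n + 1) + 1; c' = (c - 1) mod (n + 1) + 1
     in if b = i then calY n Y a c' else if b = i + 1 then calX n X a c' else 0)"

text \<open>Index (i,j) of the entry x_ij (of X or Y) sitting at position (r,c) of U(X,Y);
  (0,0) for positions in zero blocks.\<close>
definition Usrc :: "nat \<Rightarrow> nat \<Rightarrow> nat \<Rightarrow> nat \<times> nat" where
  "Usrc n r c =
    (let i = (r - 1) div (n - 1) + 1; a = (r - 1) mod (n - 1) + 1;
         b = (c - 1) div (n + 1) + 1; c' = (c - 1) mod (n + 1) + 1
     in if b = i then (if c' = 1 then (0,0) else (a, c' - 1))
        else if b = i + 1 then (if c' = n + 1 then (0,0) else (a + 1, c'))
        else (0,0))"

definition theta :: "nat \<Rightarrow> nat \<Rightarrow> mat \<Rightarrow> complex" where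
  "theta n i X = minor X (n - i + 1) (n - i + 1) i"

definition phi :: "nat \<Rightarrow> nat \<Rightarrow> mat \<Rightarrow> mat \<Rightarrow> complex" where
  "phi n p X Y = minor (Umat n X Y) (NN n - p + 1) (kk n * (n + 1) - p + 1) p"

definition psi :: "nat \<Rightarrow> nat \<Rightarrow> mat \<Rightarrow> mat \<Rightarrow> complex" where
  "psi n q X Y = minor (Umat n X Y) (NN n - q + 1) (kk n * (n + 1) - q + 2) q"

text \<open>Vertex of each function: the (i,j) of the upper-left entry x_ij of its defining submatrix.\<close>
definition pos_theta :: "nat \<Rightarrow> nat \<Rightarrow> nat \<times> nat" where
  "pos_theta n i = (n - i + 1, n - i + 1)"
definition pos_phi :: "nat \<Rightarrow> nat \<Rightarrow> nat \<times> nat" where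
  "pos_phi n p = Usrc n (NN n - p + 1) (kk n * (n + 1) - p + 1)"
definition pos_psi :: "nat \<Rightarrow> nat \<Rightarrow> nat \<times> nat" where
  "pos_psi n q = Usrc n (NN n - q + 1) (kk n * (n + 1) - q + 2)"

definition init_cluster :: "nat \<Rightarrow> nat \<times> nat \<Rightarrow> mat \<Rightarrow> complex" where
  "init_cluster n v =
    (if \<exists>i\<in>{1..n}. pos_theta n i = v
       then theta n (SOME i. i \<in> {1..n} \<and> pos_theta n i = v)
     else if \<exists>p\<in>{1..NN n}. pos_phi n p = v
       then (\<lambda>X. phi n (SOME p. p \<in> {1..NN n} \<and> pos_phi n p = v) X X)
     else if \<exists>q\<in>{1..MM n}. pos_psi n q = v
       then (\<lambda>X. psi n (SOME q. q \<in> {1..MM n} \<and> pos_psi n q = v) X X)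
     else (\<lambda>X. 0))"

definition verts :: "nat \<Rightarrow> (nat \<times> nat) set" where
  "verts n = {1..n} \<times> {1..n}"

definition frozen :: "nat \<Rightarrow> (nat \<times> nat) set" where
  "frozen n = {pos_theta n n} \<union> (if 1 \<le> NN n then {pos_phi n (NN n)} else {})
              \<union> (if 1 \<le> MM n then {pos_psi n (MM n)} else {})"

definition mutable :: "nat \<Rightarrow> (nat \<times> nat) set" where
  "mutable n = verts n - frozen n"

text \<open>On SL_n: delete theta_n and the vertex (1,1).\<close>
definition verts_SL :: "nat \<Rightarrow> (nat \<times> nat) set" where
  "verts_SL n = verts n - {(1,1)}"
definition mutable_SL :: "nat \<Rightarrow> (nat \<times> nat) set" where
  "mutable_SL n = verts_SL n - frozen n"

definition arrows :: "nat \<Rightarrow> nat \<times> nat \<Rightarrow> nat \<times> nat \<Rightarrow> nat" where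
  "arrows n u v =
     of_bool (\<exists>i j. i \<in> {1..n} \<and> j \<in> {1..n-1} \<and> (i, j) \<noteq> (1, n-1) \<and> u = (i, j+1) \<and> v = (i, j))
   + of_bool (\<exists>i j. i \<in> {1..n-1} \<and> j \<in> {1..n} \<and> (i, j) \<noteq> (1, 1) \<and> u = (i+1, j) \<and> v = (i, j))
   + of_bool (\<exists>i j. i \<in> {1..n-1} \<and> j \<in> {1..n-1} \<and> u = (i, j) \<and> v = (i+1, j+1))
   + of_bool (\<exists>j. j \<in> {2..n-1} \<and> u = (n, j) \<and> v = (1, j))
   + of_bool (\<exists>j. j \<in> {2..n-1} \<and> u = (1, j) \<and> v = (n, j+1))
   + of_bool (\<exists>i. i \<in> {1..n-2} \<and> u = (i, n) \<and> v = (i+2, 1))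
   + of_bool (\<exists>i. i \<in> {1..n-2} \<and> u = (i+2, 1) \<and> v = (i+1, n))"

definition B0 :: "nat \<Rightarrow> nat \<times> nat \<Rightarrow> nat \<times> nat \<Rightarrow> int" where
  "B0 n u v = int (arrows n u v) - int (arrows n v u)"

type_synonym seed = "(nat \<times> nat \<Rightarrow> nat \<times> nat \<Rightarrow> int) \<times> (nat \<times> nat \<Rightarrow> mat \<Rightarrow> complex)"

definition mutB :: "nat \<times> nat \<Rightarrow> (nat \<times> nat \<Rightarrow> nat \<times> nat \<Rightarrow> int) \<Rightarrow> nat \<times> nat \<Rightarrow> nat \<times> nat \<Rightarrow> int" where
  "mutB k B i j = (if i = k \<or> j = k then - B i j
                   else B i j + (\<bar>B i k\<bar> * B k j + B i k * \<bar>B k j\<bar>) div 2)"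

definition mutx :: "(nat \<times> nat) set \<Rightarrow> nat \<times> nat \<Rightarrow> (nat \<times> nat \<Rightarrow> nat \<times> nat \<Rightarrow> int)
                    \<Rightarrow> (nat \<times> nat \<Rightarrow> mat \<Rightarrow> complex) \<Rightarrow> nat \<times> nat \<Rightarrow> mat \<Rightarrow> complex" where
  "mutx V k B x = x(k := (\<lambda>X.
      ((\<Prod>w\<in>V. if B k w > 0 then x w X ^ nat (B k w) else 1)
     + (\<Prod>w\<in>V. if B k w < 0 then x w X ^ nat (- B k w) else 1)) / x k X))"

definition mutate :: "(nat \<times> nat) set \<Rightarrow> nat \<times> nat \<Rightarrow> seed \<Rightarrow> seed" where
  "mutate V k s = (mutB k (fst s), mutx V k (fst s) (snd s))"

inductive_set polyfun :: "nat \<Rightarrow> (mat \<Rightarrow> complex) set" for n where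
  pf_const: "(\<lambda>X. c) \<in> polyfun n"
| pf_coord: "i \<in> {1..n} \<Longrightarrow> j \<in> {1..n} \<Longrightarrow> (\<lambda>X. X i j) \<in> polyfun n"
| pf_add: "f \<in> polyfun n \<Longrightarrow> g \<in> polyfun n \<Longrightarrow> (\<lambda>X. f X + g X) \<in> polyfun n"
| pf_mult: "f \<in> polyfun n \<Longrightarrow> g \<in> polyfun n \<Longrightarrow> (\<lambda>X. f X * g X) \<in> polyfun n"

text \<open>A (rational) function f on the irreducible variety S (Mat_n or SL_n), given by a formula that
  is valid on a nonempty Zariski-open subset of S, is regular iff it coincides with a polynomial
  on a nonempty Zariski-open subset {h \<noteq> 0} of S.\<close>
definition regular_on :: "mat set \<Rightarrow> nat \<Rightarrow> (mat \<Rightarrow> complex) \<Rightarrow> bool" where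
  "regular_on S n f \<longleftrightarrow>
     (\<exists>g \<in> polyfun n. \<exists>h \<in> polyfun n. (\<exists>X\<in>S. h X \<noteq> 0) \<and> (\<forall>X\<in>S. h X \<noteq> 0 \<longrightarrow> f X = g X))"

end

theory Submission
  imports Defs "HOL-Computational_Algebra.Polynomial" "Jordan_Normal_Form.Determinant"
begin

text \<open>
  The argument is a starfish lemma. Clusters are evaluated pointwise, and at matrices where all
  initial variables are positive the Laurent phenomenon (proved with the Fomin--Zelevinsky
  caterpillar argument; the initial exchange matrix has full rank) writes a cluster variable as a Laurent
  polynomial both in the initial cluster and in each of the adjacent clusters, with only mutable variables in the
  denominators. Such matrices are Zariski dense, so both expansions are identities of rational functions
  on matrix space. Comparing them, an initial variable \<open>x\<^sub>v\<close> cancels from the denominator as soon as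
  it is prime, distinct from the other initial variables up to constants, and does not divide the
  polynomial \<open>x\<^sub>v'\<close>.

  The initial variables are contiguous minors of the band matrix \<open>U\<close>. The three-term Pluecker relations of
  consecutive minors, eliminated pairwise, show that each \<open>x\<^sub>v'\<close> is a polynomial. For the weights
  \<open>\<omega>0\<close> every \<open>2 \<times> 2\<close> window of \<open>U\<close> has positive excess, so the leading form of a
  contiguous minor is its diagonal product; lowering one window to excess \<open>0\<close> turns two consecutive
  diagonal factors into a \<open>2 \<times> 2\<close> determinant, which forces these two factors into the same
  factor of the minor. Hence the minors are irreducible, and prime because polynomials form a
  factorial ring.
\<close>

subsection \<open>Polynomial functions\<close>

text \<open>The excess of a weight at a mutable vertex \<open>v\<close> is its value at
  \<open>v\<close> and \<open>prv v\<close> minus its value at \<open>upv v\<close> and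
  \<open>lef v\<close>, the four sources of a window of \<open>U\<close>. For each mutable vertex
  there is an integer weight with excess 1 there and 0 at the others (\<open>fund\<close>). This
  family serves twice: its sums along the diagonals of \<open>U\<close> solve the linear systems
  behind full rank, and twice a member is what lowers one window of \<omega>0. The plain weight
  \<open>i * j\<close> fails in windows that cross a block boundary of \<open>U\<close>, hence the
  quadratic terms of \<omega>0. Positive excess also makes the monomial with \<open>prv v\<close>
  dominate the exchange numerator; it contains the leading product of the variable at
  \<open>v\<close> once but not twice, so this variable does not divide its mutation. Pointwise
  evaluation meets an obstacle: division by zero has value 0, so a cluster variable's formula is
  meaningful only off the zeros of its intermediate denominators. Exchange relations are free of
  subtraction, so these have no zeros at positive points; a common denominator without zeros there
  (\<open>RT\<close>) supplies the open set that \<open>regular_on\<close> asks for.\<close>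

inductive_set pol :: "'v set \<Rightarrow> (('v \<Rightarrow> complex) \<Rightarrow> complex) set" for V where
  pol_const: "(\<lambda>x. c) \<in> pol V"
| pol_var: "v \<in> V \<Longrightarrow> (\<lambda>x. x v) \<in> pol V"
| pol_add: "f \<in> pol V \<Longrightarrow> g \<in> pol V \<Longrightarrow> (\<lambda>x. f x + g x) \<in> pol V"
| pol_mult: "f \<in> pol V \<Longrightarrow> g \<in> pol V \<Longrightarrow> (\<lambda>x. f x * g x) \<in> pol V"

lemma pol_mono: "f \<in> pol V \<Longrightarrow> V \<subseteq> W \<Longrightarrow> f \<in> pol W"
  by (induction rule: pol.induct) (auto intro: pol.intros)

lemma pol_uminus: "f \<in> pol V \<Longrightarrow> (\<lambda>x. - f x) \<in> pol V"
  using pol_mult[OF pol_const[of "-1"], of f V] by simp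

lemma pol_diff: "f \<in> pol V \<Longrightarrow> g \<in> pol V \<Longrightarrow> (\<lambda>x. f x - g x) \<in> pol V"
  using pol_add[of f V "\<lambda>x. - g x"] pol_uminus[of g V] by simp

lemma pol_sum: "(\<And>i. i \<in> I \<Longrightarrow> f i \<in> pol V) \<Longrightarrow> (\<lambda>x. \<Sum>i\<in>I. f i x) \<in> pol V"
  by (induction I rule: infinite_finite_induct) (auto intro: pol.intros)

lemma pol_prod: "(\<And>i. i \<in> I \<Longrightarrow> f i \<in> pol V) \<Longrightarrow> (\<lambda>x. \<Prod>i\<in>I. f i x) \<in> pol V"
  by (induction I rule: infinite_finite_induct) (auto intro: pol.intros)

lemma pol_power: "f \<in> pol V \<Longrightarrow> (\<lambda>x. f x ^ m) \<in> pol V"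
  by (induction m) (auto intro: pol.intros)

lemma pol_local: "f \<in> pol V \<Longrightarrow> (\<And>v. v \<in> V \<Longrightarrow> x v = y v) \<Longrightarrow> f x = f y"
  by (induction rule: pol.induct) auto

text \<open>Elements of \<open>pol V\<close> are functions, not formal sums. Degrees, coefficients
  and the absence of zero divisors are all obtained by restriction to polynomial curves, where
  univariate polynomials are available.\<close>

lemma pol_curve: "f \<in> pol V \<Longrightarrow> \<exists>p. \<forall>t. poly p t = f (\<lambda>v. poly (q v) t)"
proof (induction rule: pol.induct)
  case (pol_const c) show ?case by (rule exI[of _ "[:c:]"]) simp
next
  case (pol_var v) show ?case by (rule exI[of _ "q v"]) simp
next
  case (pol_add f g)
  then obtain p r where "\<forall>t. poly p t = f (\<lambda>v. poly (q v) t)" "\<forall>t. poly r t = g (\<lambda>v. poly (q v) t)" by blast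
  thus ?case by (intro exI[of _ "p + r"]) simp
next
  case (pol_mult f g)
  then obtain p r where "\<forall>t. poly p t = f (\<lambda>v. poly (q v) t)" "\<forall>t. poly r t = g (\<lambda>v. poly (q v) t)" by blast
  thus ?case by (intro exI[of _ "p * r"]) simp
qed

definition along :: "('v \<Rightarrow> complex poly) \<Rightarrow> (('v \<Rightarrow> complex) \<Rightarrow> complex) \<Rightarrow> complex poly" where
  "along q f = (SOME p. \<forall>t. poly p t = f (\<lambda>v. poly (q v) t))"

lemma poly_along: "f \<in> pol V \<Longrightarrow> poly (along q f) t = f (\<lambda>v. poly (q v) t)"
  unfolding along_def using someI_ex[OF pol_curve[of f V q]] by blast

lemma poly_ext: "(\<And>t. poly p t = poly q (t::complex)) \<Longrightarrow> p = q"
  by (simp add: poly_eq_poly_eq_iff[symmetric] fun_eq_iff)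

lemma along_eqI: "f \<in> pol V \<Longrightarrow> (\<And>t. poly p t = f (\<lambda>v. poly (q v) t)) \<Longrightarrow> along q f = p"
  by (rule poly_ext) (simp add: poly_along)

lemma along_const: "along q (\<lambda>x. c) = [:c:]"
  by (rule along_eqI[OF pol_const]) simp
lemma along_var: "along q (\<lambda>x. x v) = q v"
  by (rule along_eqI[OF pol_var, of _ UNIV]) simp_all
lemma along_add: "f \<in> pol V \<Longrightarrow> g \<in> pol V \<Longrightarrow> along q (\<lambda>x. f x + g x) = along q f + along q g"
  by (rule along_eqI[OF pol_add, of _ V]) (simp_all add: poly_along)
lemma along_mult: "f \<in> pol V \<Longrightarrow> g \<in> pol V \<Longrightarrow> along q (\<lambda>x. f x * g x) = along q f * along q g"
  by (rule along_eqI[OF pol_mult, of _ V]) (simp_all add: poly_along)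

text \<open>On the line joining a non-zero of \<open>f\<close> to a non-zero of \<open>g\<close>
  both restrictions are nonzero univariate polynomials.\<close>

lemma pol_mult_eq_0:
  assumes f: "f \<in> pol V" and g: "g \<in> pol V" and z: "\<And>x. f x * g x = 0"
  shows "f = (\<lambda>x. 0) \<or> g = (\<lambda>x. 0)"
proof (rule ccontr)
  assume "\<not> ?thesis"
  then obtain a b where a: "f a \<noteq> 0" and b: "g b \<noteq> 0" by (auto simp: fun_eq_iff)
  let ?q = "\<lambda>v. [:a v, b v - a v:]"
  have "along ?q f * along ?q g = along ?q (\<lambda>x. f x * g x)" by (rule along_mult[OF f g, symmetric])
  also have "\<dots> = 0" using along_const[of ?q 0] by (simp add: z)
  finally have "along ?q f = 0 \<or> along ?q g = 0" by simp
  moreover have "poly (along ?q f) 0 = f a" "poly (along ?q g) 1 = g b"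
    using f g by (simp_all add: poly_along)
  ultimately show False using a b by auto
qed

lemma pol_cancel:
  assumes "h \<in> pol V" "h \<noteq> (\<lambda>x. 0)" "f \<in> pol V" "g \<in> pol V" "\<And>x. h x * f x = h x * g x"
  shows "f = g"
  using pol_mult_eq_0[of h V "\<lambda>x. f x - g x"] assms by (auto simp: algebra_simps fun_eq_iff pol_diff)

text \<open>Coordinates are released one at a time: with the others fixed, a univariate polynomial
  vanishing on the infinite set \<open>I w\<close> is zero.\<close>

lemma pol_zero_on_box:
  assumes V: "finite V" and f: "f \<in> pol V" and I: "\<And>v. infinite (I v)"
    and z: "\<And>x. (\<And>v. v \<in> V \<Longrightarrow> x v \<in> I v) \<Longrightarrow> f x = 0"
  shows "f x = 0"
proof -
  have "\<forall>x. (\<forall>v\<in>V-W. x v \<in> I v) \<longrightarrow> f x = 0" if "finite W" "W \<subseteq> V" for W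
    using that
  proof (induction W)
    case empty thus ?case using z by auto
  next
    case (insert w W)
    show ?case
    proof (intro allI impI)
      fix x assume x: "\<forall>v\<in>V - insert w W. x v \<in> I v"
      let ?q = "\<lambda>v. if v = w then [:0,1:] else [:x v:]"
      have e: "(\<lambda>v. poly (?q v) t) = x(w := t)" for t by auto
      have "poly (along ?q f) t = 0" if "t \<in> I w" for t
        using insert.IH insert.prems x that by (auto simp: poly_along[OF f] e)
      hence "infinite {t. poly (along ?q f) t = 0}" using I[of w] 
        by (meson finite_subset mem_Collect_eq subsetI)
      hence "along ?q f = 0" using poly_roots_finite by blast
      hence "f (x(w := x w)) = 0" using poly_along[OF f, of ?q "x w"] by (simp add: e)
      thus "f x = 0" by simp
    qed
  qed
  from this[OF V order_refl] show ?thesis by simp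
qed

subsection \<open>Leading coefficients along a family of curves\<close>

text \<open>One notion covers two gradings. On the curves \<open>x v * t ^ w v\<close> the
  coefficients in \<open>t\<close> are the weighted homogeneous components; with \<open>t\<close> in
  a single coordinate they are the coefficients with respect to that variable.
  \<open>Qthrough\<close> prevents a nonzero function from vanishing on all curves.\<close>

locale curves =
  fixes V :: "'v set" and Q :: "('v \<Rightarrow> complex) \<Rightarrow> 'v \<Rightarrow> complex poly"
  assumes Qcoeff: "\<And>v i. v \<in> V \<Longrightarrow> (\<lambda>x. coeff (Q x v) i) \<in> pol V"
    and Qbound: "\<exists>d. \<forall>v\<in>V. \<forall>x. degree (Q x v) \<le> d"
    and Qthrough: "\<And>x. \<exists>t. \<forall>v. poly (Q x v) t = x v"
begin

definition deg :: "(('v \<Rightarrow> complex) \<Rightarrow> complex) \<Rightarrow> nat" where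
  "deg f = (LEAST D. \<forall>x. degree (along (Q x) f) \<le> D)"
definition comp :: "nat \<Rightarrow> (('v \<Rightarrow> complex) \<Rightarrow> complex) \<Rightarrow> ('v \<Rightarrow> complex) \<Rightarrow> complex" where
  "comp i f = (\<lambda>x. coeff (along (Q x) f) i)"
definition top where "top f = comp (deg f) f"

lemma comp_const: "comp i (\<lambda>x. c) = (\<lambda>x. if i = 0 then c else 0)"
  by (auto simp: comp_def along_const coeff_pCons split: nat.splits)
lemma comp_add: "f \<in> pol V \<Longrightarrow> g \<in> pol V \<Longrightarrow> comp i (\<lambda>x. f x + g x) = (\<lambda>x. comp i f x + comp i g x)"
  by (simp add: comp_def along_add)
lemma comp_mult: "f \<in> pol V \<Longrightarrow> g \<in> pol V \<Longrightarrow> comp i (\<lambda>x. f x * g x) = (\<lambda>x. \<Sum>j\<le>i. comp j f x * comp (i - j) g x)"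
  by (simp add: comp_def along_mult coeff_mult)

lemma comp_pol: "f \<in> pol V \<Longrightarrow> comp i f \<in> pol V"
proof (induction arbitrary: i rule: pol.induct)
  case (pol_const c) show ?case by (simp add: comp_const pol.pol_const)
next
  case (pol_var v) thus ?case by (simp add: comp_def along_var Qcoeff)
next
  case (pol_add f g) thus ?case by (simp add: comp_add pol.pol_add)
next
  case (pol_mult f g) thus ?case by (simp add: comp_mult pol_sum pol.pol_mult)
qed

lemma deg_bound: "f \<in> pol V \<Longrightarrow> \<exists>D. \<forall>x. degree (along (Q x) f) \<le> D"
proof (induction rule: pol.induct)
  case (pol_const c) show ?case by (rule exI[of _ 0]) (simp add: along_const)
next
  case (pol_var v) thus ?case using Qbound by (auto simp: along_var)
next
  case (pol_add f g)
  then obtain D E where "\<forall>x. degree (along (Q x) f) \<le> D" "\<forall>x. degree (along (Q x) g) \<le> E" by auto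
  hence "\<forall>x. degree (along (Q x) (\<lambda>x. f x + g x)) \<le> max D E"
    unfolding along_add[OF pol_add.hyps] by (intro allI degree_add_le) (simp_all add: le_max_iff_disj)
  thus ?case by blast
next
  case (pol_mult f g)
  then obtain D E where "\<forall>x. degree (along (Q x) f) \<le> D" "\<forall>x. degree (along (Q x) g) \<le> E" by auto
  hence "\<forall>x. degree (along (Q x) (\<lambda>x. f x * g x)) \<le> D + E"
    unfolding along_mult[OF pol_mult.hyps] by (auto intro!: order_trans[OF degree_mult_le] add_mono)
  thus ?case by blast
qed

lemma degree_le_deg: "f \<in> pol V \<Longrightarrow> degree (along (Q x) f) \<le> deg f"
  unfolding deg_def using LeastI_ex[OF deg_bound, of f] by blast

lemma comp_gt_deg: "f \<in> pol V \<Longrightarrow> deg f < i \<Longrightarrow> comp i f x = 0"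
  unfolding comp_def using degree_le_deg[of f x] by (simp add: coeff_eq_0)

lemma top_pol: "f \<in> pol V \<Longrightarrow> top f \<in> pol V"
  by (simp add: top_def comp_pol)

lemma top_nonzero:
  assumes f: "f \<in> pol V" "f \<noteq> (\<lambda>x. 0)"
  shows "top f \<noteq> (\<lambda>x. 0)"
proof (cases "deg f")
  \<comment> \<open>Minimality of \<open>deg\<close> gives no information at 0, so non-vanishing
    comes from the curve through a non-zero of \<open>f\<close>.\<close>
  case 0
  from f(2) obtain x where x: "f x \<noteq> 0" by auto
  obtain t where t: "\<forall>v. poly (Q x v) t = x v" using Qthrough by blast
  have "poly (along (Q x) f) t \<noteq> 0" using x t poly_along[OF f(1)] by simp
  moreover have "degree (along (Q x) f) = 0" using degree_le_deg[OF f(1), of x] 0 by simp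
  ultimately have "coeff (along (Q x) f) 0 \<noteq> 0" using leading_coeff_0_iff[of "along (Q x) f"] by auto
  thus ?thesis using 0 by (auto simp: top_def comp_def fun_eq_iff)
next
  case (Suc d)
  hence "\<not> (\<forall>x. degree (along (Q x) f) \<le> d)" unfolding deg_def by (intro not_less_Least) simp
  then obtain x where "degree (along (Q x) f) > d" by (auto simp: not_le)
  hence "degree (along (Q x) f) = deg f" using degree_le_deg[OF f(1), of x] Suc by simp
  hence "coeff (along (Q x) f) (deg f) \<noteq> 0" using Suc leading_coeff_0_iff[of "along (Q x) f"] by auto
  thus ?thesis by (auto simp: top_def comp_def fun_eq_iff)
qed

lemma deg_eqI:
  assumes f: "f \<in> pol V" and n: "comp D f \<noteq> (\<lambda>x. 0)" and le: "\<And>x. degree (along (Q x) f) \<le> D"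
  shows "deg f = D"
proof (rule antisym)
  show "deg f \<le> D" unfolding deg_def by (rule Least_le) (use le in blast)
  show "D \<le> deg f"
  proof (rule ccontr)
    assume "\<not> D \<le> deg f"
    hence "comp D f = (\<lambda>x. 0)" using comp_gt_deg[OF f] by (intro ext) simp
    thus False using n by simp
  qed
qed

text \<open>\<open>deg\<close> is a uniform bound that single curves may fail to reach. Additivity
  therefore rests on the absence of zero divisors, applied to the two leading coefficients as
  functions of the point.\<close>

lemma deg_top_mult:
  assumes f: "f \<in> pol V" "f \<noteq> (\<lambda>x. 0)" and g: "g \<in> pol V" "g \<noteq> (\<lambda>x. 0)"
  shows "deg (\<lambda>x. f x * g x) = deg f + deg g"
    and "top (\<lambda>x. f x * g x) = (\<lambda>x. top f x * top g x)"
proof -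
  have c: "comp (deg f + deg g) (\<lambda>x. f x * g x) = (\<lambda>x. top f x * top g x)"
  proof
    fix x
    have "comp (deg f + deg g) (\<lambda>x. f x * g x) x = coeff (along (Q x) f * along (Q x) g) (deg f + deg g)"
      by (simp add: comp_def along_mult[OF f(1) g(1)])
    also have "\<dots> = coeff (along (Q x) f) (deg f) * coeff (along (Q x) g) (deg g)"
      unfolding coeff_mult
    proof (subst sum.remove[of _ "deg f"])
      have "coeff (along (Q x) f) i * coeff (along (Q x) g) (deg f + deg g - i) = 0"
        if "i \<in> {..deg f + deg g} - {deg f}" for i
      proof (cases "i < deg f")
        case True
        hence "coeff (along (Q x) g) (deg f + deg g - i) = 0"
          using degree_le_deg[OF g(1), of x] by (intro coeff_eq_0) linarith
        thus ?thesis by simp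
      next
        case False
        hence "coeff (along (Q x) f) i = 0" using that degree_le_deg[OF f(1), of x] by (intro coeff_eq_0) auto
        thus ?thesis by simp
      qed
      thus "coeff (along (Q x) f) (deg f) * coeff (along (Q x) g) (deg f + deg g - deg f) +
        (\<Sum>i\<in>{..deg f + deg g} - {deg f}. coeff (along (Q x) f) i * coeff (along (Q x) g) (deg f + deg g - i)) =
        coeff (along (Q x) f) (deg f) * coeff (along (Q x) g) (deg g)" by (simp add: sum.neutral)
    qed auto
    finally show "comp (deg f + deg g) (\<lambda>x. f x * g x) x = top f x * top g x" by (simp add: top_def comp_def)
  qed
  have nz: "(\<lambda>x. top f x * top g x) \<noteq> (\<lambda>x. 0)"
    using pol_mult_eq_0[OF top_pol[OF f(1)] top_pol[OF g(1)]] top_nonzero[OF f] top_nonzero[OF g] by (auto simp: fun_eq_iff)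
  show d: "deg (\<lambda>x. f x * g x) = deg f + deg g"
  proof (rule deg_eqI[OF pol_mult[OF f(1) g(1)]])
    show "comp (deg f + deg g) (\<lambda>x. f x * g x) \<noteq> (\<lambda>x. 0)" using c nz by simp
    show "degree (along (Q x) (\<lambda>x. f x * g x)) \<le> deg f + deg g" for x
      unfolding along_mult[OF f(1) g(1)]
      by (intro order_trans[OF degree_mult_le] add_mono degree_le_deg f g)
  qed
  show "top (\<lambda>x. f x * g x) = (\<lambda>x. top f x * top g x)" unfolding top_def[of "\<lambda>x. f x * g x"] d c ..
qed

end

lemma curves_weight:
  assumes "finite V" shows "curves V (\<lambda>x v. monom (x v) (w v))"
proof
  show "(\<lambda>x. coeff (monom (x v) (w v)) i) \<in> pol V" if "v \<in> V" for v i
    using that by (cases "w v = i") (auto intro: pol.intros)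
  show "\<exists>d. \<forall>v\<in>V. \<forall>x. degree (monom (x v) (w v)) \<le> d"
  proof (rule exI, intro ballI allI)
    fix v x assume "v \<in> V"
    hence "w v \<le> (\<Sum>v\<in>V. w v)" using assms by (simp add: member_le_sum)
    thus "degree (monom (x v) (w v)) \<le> (\<Sum>v\<in>V. w v)" using degree_monom_le order_trans by blast
  qed
  show "\<exists>t. \<forall>v. poly (monom (x v) (w v)) t = x v" for x :: "'a \<Rightarrow> complex"
    by (rule exI[of _ 1]) (simp add: poly_monom)
qed

lemma curves_axis: "curves V (\<lambda>x v. if v = z then [:0, 1:] else [:x v:])"
proof
  show "(\<lambda>x. coeff (if v = z then [:0, 1:] else [:x v:]) i) \<in> pol V" if "v \<in> V" for v i
    using that by (cases "v = z"; cases i) (auto intro: pol.intros simp: coeff_pCons split: nat.splits)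
  show "\<exists>d. \<forall>v\<in>V. \<forall>x. degree (if v = z then [:0, 1:] else [:x v:]) \<le> d"
    by (rule exI[of _ 1]) auto
  show "\<exists>t. \<forall>v. poly (if v = z then [:0, 1:] else [:x v:]) t = x v" for x :: "'a \<Rightarrow> complex"
    by (rule exI[of _ "x z"]) auto
qed

subsection \<open>Irreducible polynomial functions are prime\<close>

definition pdvd :: "'v set \<Rightarrow> (('v \<Rightarrow> complex) \<Rightarrow> complex) \<Rightarrow> (('v \<Rightarrow> complex) \<Rightarrow> complex) \<Rightarrow> bool" where
  "pdvd V f A \<longleftrightarrow> (\<exists>C\<in>pol V. A = (\<lambda>x. f x * C x))"
definition is_const :: "('a \<Rightarrow> 'b) \<Rightarrow> bool" where
  "is_const f \<longleftrightarrow> (\<exists>c. f = (\<lambda>x. c))"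
definition irred :: "'v set \<Rightarrow> (('v \<Rightarrow> complex) \<Rightarrow> complex) \<Rightarrow> bool" where
  "irred V f \<longleftrightarrow> f \<in> pol V \<and> \<not> is_const f \<and>
    (\<forall>g\<in>pol V. \<forall>h\<in>pol V. f = (\<lambda>x. g x * h x) \<longrightarrow> is_const g \<or> is_const h)"
definition pprime :: "'v set \<Rightarrow> (('v \<Rightarrow> complex) \<Rightarrow> complex) \<Rightarrow> bool" where
  "pprime V f \<longleftrightarrow> (\<forall>A\<in>pol V. \<forall>B\<in>pol V. pdvd V f (\<lambda>x. A x * B x) \<longrightarrow> pdvd V f A \<or> pdvd V f B)"

lemma pprimeD: "pprime V f \<Longrightarrow> A \<in> pol V \<Longrightarrow> B \<in> pol V \<Longrightarrow> pdvd V f (\<lambda>x. A x * B x) \<Longrightarrow> pdvd V f A \<or> pdvd V f B"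
  by (auto simp: pprime_def)

lemma pdvdI: "C \<in> pol V \<Longrightarrow> (\<And>x. A x = f x * C x) \<Longrightarrow> pdvd V f A"
  unfolding pdvd_def by blast
lemma pdvd_0: "pdvd V f (\<lambda>x. 0)"
  by (rule pdvdI[OF pol_const[of 0]]) simp
lemma pdvd_add:
  assumes "pdvd V f A" "pdvd V f B" shows "pdvd V f (\<lambda>x. A x + B x)"
proof -
  from assms obtain C D where "C \<in> pol V" "A = (\<lambda>x. f x * C x)" "D \<in> pol V" "B = (\<lambda>x. f x * D x)"
    unfolding pdvd_def by blast
  thus ?thesis by (intro pdvdI[OF pol_add[of C V D]]) (auto simp: algebra_simps)
qed
lemma pdvd_mult:
  assumes "pdvd V f A" "B \<in> pol V" shows "pdvd V f (\<lambda>x. A x * B x)"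
proof -
  from assms obtain C where "C \<in> pol V" "A = (\<lambda>x. f x * C x)" unfolding pdvd_def by blast
  thus ?thesis using assms by (intro pdvdI[OF pol_mult[of C V B]]) auto
qed
lemma pdvd_diff:
  assumes "pdvd V f A" "pdvd V f B" shows "pdvd V f (\<lambda>x. A x - B x)"
  using pdvd_add[OF assms(1) pdvd_mult[OF assms(2) pol_const[of "-1"]]] by simp
lemma pdvd_sum:
  "(\<And>i. i \<in> I \<Longrightarrow> pdvd V f (A i)) \<Longrightarrow> pdvd V f (\<lambda>x. \<Sum>i\<in>I. A i x)"
  by (induction I rule: infinite_finite_induct) (auto intro: pdvd_0 pdvd_add)

lemma pdvd_power:
  assumes "pprime V f" "A \<in> pol V" "pdvd V f (\<lambda>x. A x ^ m)" "f \<in> pol V" "f a = 0"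
  shows "pdvd V f A"
  using assms(3)
proof (induction m)
  case 0
  then obtain C where "\<And>x. 1 = f x * C x" unfolding pdvd_def fun_eq_iff by auto
  from this[of a] assms(5) show ?case by simp
next
  case (Suc m)
  thus ?case using pprimeD[OF assms(1,2) pol_power[OF assms(2), of m]] by auto
qed

lemma pdvd_prod:
  assumes "pprime V f" "finite I" "\<And>i. i \<in> I \<Longrightarrow> A i \<in> pol V" "pdvd V f (\<lambda>x. \<Prod>i\<in>I. A i x)" "f a = 0"
  shows "\<exists>i\<in>I. pdvd V f (A i)"
  using assms(2,3,4)
proof (induction I)
  case empty
  then obtain C where "\<And>x. 1 = f x * C x" unfolding pdvd_def fun_eq_iff by auto
  from this[of a] assms(5) show ?case by simp
next
  case (insert i I)
  hence "pdvd V f (\<lambda>x. A i x * (\<Prod>i\<in>I. A i x))" by simp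
  hence "pdvd V f (A i) \<or> pdvd V f (\<lambda>x. \<Prod>i\<in>I. A i x)"
    using insert.prems by (intro pprimeD[OF assms(1)] pol_prod) auto
  thus ?case using insert by auto
qed

text \<open>With positive weights the curve through \<open>x\<close> starts at the origin for
  \<open>t = 0\<close> and reaches \<open>x\<close> for \<open>t = 1\<close>; in degree 0 the
  function is constant on it.\<close>

lemma weight_deg_0:
  assumes "finite V" "\<And>v. v \<in> V \<Longrightarrow> w v > 0" "f \<in> pol V" "curves.deg (\<lambda>x v. monom (x v) (w v)) f = 0"
  shows "is_const f"
proof -
  interpret curves V "\<lambda>x v. monom (x v) (w v)" by (rule curves_weight[OF assms(1)])
  have "f x = f (\<lambda>v. 0)" for x
  proof -
    let ?p = "along (\<lambda>v. monom (x v) (w v)) f"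
    have "degree ?p = 0" using degree_le_deg[OF assms(3), of x] assms(4) by simp
    then obtain c where c: "?p = [:c:]" by (meson degree_eq_zeroE)
    have "f x = poly ?p 1" by (simp add: poly_along[OF assms(3)] poly_monom)
    also have "\<dots> = poly ?p 0" by (simp add: c)
    also have "\<dots> = f (\<lambda>v. 0)" unfolding poly_along[OF assms(3)]
      by (rule pol_local[OF assms(3)]) (use assms(2) in \<open>auto simp: poly_monom\<close>)
    finally show ?thesis .
  qed
  thus ?thesis unfolding is_const_def by blast
qed

lemma deg_const: "curves V Q \<Longrightarrow> is_const f \<Longrightarrow> curves.deg Q f = 0"
proof -
  assume "curves V Q" "is_const f"
  then interpret curves V Q by simp
  from \<open>is_const f\<close> obtain c where "f = (\<lambda>x. c)" by (auto simp: is_const_def)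
  thus ?thesis by (simp add: deg_def along_const)
qed

text \<open>The total degree, that is all weights 1, is additive and vanishes only on constants, so
  splitting off factors terminates.\<close>

lemma irreducible_divisor:
  assumes V: "finite V" and f: "f \<in> pol V" "\<not> is_const f"
  defines "d \<equiv> curves.deg (\<lambda>x v. monom (x v) 1)"
  shows "\<exists>p g. irred V p \<and> g \<in> pol V \<and> f = (\<lambda>x. p x * g x) \<and> d g < d f"
  using f
proof (induction "d f" arbitrary: f rule: less_induct)
  case less
  interpret curves V "\<lambda>x v. monom (x v) 1" by (rule curves_weight[OF V])
  have nz: "f \<noteq> (\<lambda>x. 0)" using less.prems by (auto simp: is_const_def)
  have pos: "d h > 0" if "h \<in> pol V" "\<not> is_const h" for h
    using weight_deg_0[OF V, of "\<lambda>v. 1" h] that by (auto simp: d_def)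
  show ?case
  proof (cases "irred V f")
    case True
    have "is_const (\<lambda>x::'a \<Rightarrow> complex. 1::complex)" by (auto simp: is_const_def)
    hence "d (\<lambda>x. 1) = 0" unfolding d_def by (rule deg_const[OF curves_axioms])
    thus ?thesis using True pos[OF less.prems]
      by (intro exI[of _ f] exI[of _ "\<lambda>x. 1"]) (simp add: pol_const)
  next
    case False
    then obtain g h where gh: "g \<in> pol V" "h \<in> pol V" "f = (\<lambda>x. g x * h x)" "\<not> is_const g" "\<not> is_const h"
      using less.prems by (auto simp: irred_def)
    have gnz: "g \<noteq> (\<lambda>x. 0)" "h \<noteq> (\<lambda>x. 0)" using gh by (auto simp: is_const_def)
    have "d f = d g + d h" unfolding gh(3) d_def by (rule deg_top_mult(1)[OF gh(1) gnz(1) gh(2) gnz(2)])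
    hence "d g < d f" using pos[OF gh(2,5)] by simp
    then obtain p k where pk: "irred V p" "k \<in> pol V" "g = (\<lambda>x. p x * k x)" using less.hyps gh by blast
    have p: "p \<in> pol V" "\<not> is_const p" using pk(1) by (auto simp: irred_def)
    have kh: "(\<lambda>x. k x * h x) \<in> pol V" by (rule pol_mult[OF pk(2) gh(2)])
    have e: "f = (\<lambda>x. p x * (k x * h x))" using gh(3) pk(3) by (simp add: mult.assoc)
    have n1: "(\<lambda>x. k x * h x) \<noteq> (\<lambda>x. 0)" "p \<noteq> (\<lambda>x. 0)" using nz e by (auto simp: fun_eq_iff)
    have "d f = d p + d (\<lambda>x. k x * h x)" unfolding e d_def
      by (rule deg_top_mult(1)[OF p(1) n1(2) kh n1(1)])
    thus ?thesis using e kh pk(1) pos[OF p] by (intro exI[of _ p] exI[of _ "\<lambda>x. k x * h x"]) simp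
  qed
qed

lemma factor_induct:
  assumes V: "finite V" and c: "c \<in> pol V" "c \<noteq> (\<lambda>x. 0)"
    and const: "\<And>a. a \<noteq> 0 \<Longrightarrow> P (\<lambda>x. a)"
    and step: "\<And>p c. irred V p \<Longrightarrow> c \<in> pol V \<Longrightarrow> c \<noteq> (\<lambda>x. 0) \<Longrightarrow> P c \<Longrightarrow> P (\<lambda>x. p x * c x)"
  shows "P c"
  using c
proof (induction "curves.deg (\<lambda>x v. monom (x v) 1) c" arbitrary: c rule: less_induct)
  case less
  show ?case
  proof (cases "is_const c")
    case True
    then obtain a where "c = (\<lambda>x. a)" by (auto simp: is_const_def)
    thus ?thesis using less.prems(2) const[of a] by (cases "a = 0") simp_all
  next
    case False
    then obtain p g where pg: "irred V p" "g \<in> pol V" "c = (\<lambda>x. p x * g x)"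
      "curves.deg (\<lambda>x v. monom (x v) 1) g < curves.deg (\<lambda>x v. monom (x v) 1) c"
      using irreducible_divisor[OF V less.prems(1)] by blast
    have "g \<noteq> (\<lambda>x. 0)" using less.prems(2) pg(3) by auto
    thus ?thesis using less.hyps[OF pg(4,2)] step pg by simp
  qed
qed

text \<open>One step in the induction on the number of variables: irreducibles over
  \<open>V0\<close> are already prime, and \<open>z\<close> is adjoined. Functions in
  \<open>pol V0\<close> act as coefficients of polynomials in \<open>z\<close>.\<close>

locale axis =
  fixes V0 V :: "'v set" and z :: 'v
  assumes fin: "finite V0" and z: "z \<notin> V0" and V: "V = insert z V0"
    and prime0: "\<And>p. irred V0 p \<Longrightarrow> pprime V0 p"
begin

sublocale curves V "\<lambda>x v. if v = z then [:0, 1:] else [:x v:]"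
  by (rule curves_axis)

lemma sub: "f \<in> pol V0 \<Longrightarrow> f \<in> pol V" using V by (auto intro: pol_mono)
lemma zpow: "(\<lambda>x. x z ^ k) \<in> pol V" using V by (auto intro!: pol_power pol_var)

lemma comp_V0: "f \<in> pol V \<Longrightarrow> comp i f \<in> pol V0"
proof (induction arbitrary: i rule: pol.induct)
  case (pol_const c) show ?case by (simp add: comp_const pol.pol_const)
next
  case (pol_var v) thus ?case using V
    by (cases "v = z"; cases i) (auto simp: comp_def along_var coeff_pCons intro: pol.intros)
next
  case (pol_add f g) thus ?case by (simp add: comp_add pol.pol_add)
next
  case (pol_mult f g) thus ?case by (simp add: comp_mult pol_sum pol.pol_mult)
qed

lemma axis_point: "(\<lambda>v. poly (if v = z then [:0, 1:] else [:x v:]) t) = x(z := t)" for x :: "'v \<Rightarrow> complex"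
  by auto

lemma expand: "f \<in> pol V \<Longrightarrow> f x = (\<Sum>i\<le>deg f. comp i f x * x z ^ i)"
proof -
  assume f: "f \<in> pol V"
  let ?p = "along (\<lambda>v. if v = z then [:0, 1:] else [:x v:]) f"
  have "f x = poly ?p (x z)" by (simp add: poly_along[OF f] axis_point)
  also have "\<dots> = (\<Sum>i\<le>degree ?p. coeff ?p i * x z ^ i)" by (rule poly_altdef)
  also have "\<dots> = (\<Sum>i\<le>deg f. coeff ?p i * x z ^ i)"
    by (rule sum.mono_neutral_left) (use degree_le_deg[OF f, of x] in \<open>auto simp: coeff_eq_0\<close>)
  finally show ?thesis by (simp add: comp_def)
qed

lemma along_V0: "f \<in> pol V0 \<Longrightarrow> along (\<lambda>v. if v = z then [:0, 1:] else [:x v:]) f = [:f x:]" for x :: "'v \<Rightarrow> complex"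
proof (rule along_eqI[of _ V0])
  fix t assume f: "f \<in> pol V0"
  have "f x = f (x(z := t))" by (rule pol_local[OF f]) (use z in auto)
  thus "poly [:f x:] t = f (\<lambda>v. poly (if v = z then [:0, 1:] else [:x v:]) t)" by (simp add: axis_point)
qed

lemma comp_smult: "a \<in> pol V0 \<Longrightarrow> f \<in> pol V \<Longrightarrow> comp i (\<lambda>x. a x * f x) = (\<lambda>x. a x * comp i f x)"
  by (simp add: comp_def along_mult[OF sub] along_V0)

lemma comp_shift: "f \<in> pol V \<Longrightarrow> comp i (\<lambda>x. x z ^ k * f x) = (\<lambda>x. if i < k then 0 else comp (i - k) f x)"
proof -
  assume f: "f \<in> pol V"
  have "along (\<lambda>v. if v = z then [:0, 1:] else [:x v:]) (\<lambda>x. x z ^ k) = monom 1 k" for x :: "'v \<Rightarrow> complex"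
    by (rule along_eqI[OF zpow]) (simp add: poly_monom)
  thus ?thesis by (auto simp: comp_def along_mult[OF zpow f] coeff_monom_mult)
qed

lemma deg_0_V0: "f \<in> pol V \<Longrightarrow> deg f = 0 \<Longrightarrow> f \<in> pol V0"
proof -
  assume f: "f \<in> pol V" "deg f = 0"
  have "f = comp 0 f" using expand[OF f(1)] f(2) by (intro ext) simp
  thus ?thesis using comp_V0[OF f(1), of 0] by simp
qed

lemma V0_deg_0: "f \<in> pol V0 \<Longrightarrow> deg f = 0"
  by (simp add: deg_def along_V0)

lemma pdvd_iff_comp:
  assumes p: "p \<in> pol V0" and f: "f \<in> pol V"
  shows "pdvd V p f \<longleftrightarrow> (\<forall>i. pdvd V0 p (comp i f))"
proof
  assume "pdvd V p f"
  then obtain C where C: "C \<in> pol V" "f = (\<lambda>x. p x * C x)" by (auto simp: pdvd_def)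
  show "\<forall>i. pdvd V0 p (comp i f)"
    using comp_smult[OF p C(1)] C by (auto intro!: pdvdI[OF comp_V0[OF C(1)]])
next
  assume "\<forall>i. pdvd V0 p (comp i f)"
  hence "\<forall>i. \<exists>C. C \<in> pol V0 \<and> (\<forall>x. comp i f x = p x * C x)"
    unfolding pdvd_def fun_eq_iff by blast
  from choice[OF this] obtain C where C: "\<And>i. C i \<in> pol V0" "\<And>i x. comp i f x = p x * C i x" by blast
  show "pdvd V p f"
    by (rule pdvdI[of "\<lambda>x. \<Sum>i\<le>deg f. C i x * x z ^ i"], intro pol_sum pol_mult sub C zpow)
      (simp add: expand[OF f] C(2) sum_distrib_left mult.assoc)
qed

text \<open>Gauss's lemma: in the product, the coefficient at the sum of the first two indices not
  divisible by \<open>p\<close> is the product of these two coefficients modulo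
  \<open>p\<close>.\<close>

lemma prime_lift:
  assumes p: "p \<in> pol V0" "pprime V0 p"
  shows "pprime V p"
  unfolding pprime_def
proof (intro ballI impI, rule ccontr)
  fix A B assume A: "A \<in> pol V" and B: "B \<in> pol V" and d: "pdvd V p (\<lambda>x. A x * B x)"
    and n: "\<not> (pdvd V p A \<or> pdvd V p B)"
  define i where "i = (LEAST i. \<not> pdvd V0 p (comp i A))"
  define j where "j = (LEAST j. \<not> pdvd V0 p (comp j B))"
  have i: "\<not> pdvd V0 p (comp i A)" unfolding i_def
    by (rule LeastI_ex) (use n pdvd_iff_comp[OF p(1) A] in blast)
  have j: "\<not> pdvd V0 p (comp j B)" unfolding j_def
    by (rule LeastI_ex) (use n pdvd_iff_comp[OF p(1) B] in blast)
  have i': "pdvd V0 p (comp k A)" if "k < i" for k using not_less_Least[of k] that unfolding i_def by blast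
  have j': "pdvd V0 p (comp k B)" if "k < j" for k using not_less_Least[of k] that unfolding j_def by blast
  have "pdvd V0 p (comp (i + j) (\<lambda>x. A x * B x))"
    using pdvd_iff_comp[OF p(1) pol_mult[OF A B]] d by blast
  moreover have "pdvd V0 p (\<lambda>x. \<Sum>k\<in>{..i+j}-{i}. comp k A x * comp (i + j - k) B x)"
  proof (rule pdvd_sum)
    fix k assume k: "k \<in> {..i+j}-{i}"
    show "pdvd V0 p (\<lambda>x. comp k A x * comp (i + j - k) B x)"
    proof (cases "k < i")
      case True
      thus ?thesis by (intro pdvd_mult i' comp_V0 B)
    next
      case False
      hence "pdvd V0 p (comp (i + j - k) B)" using k by (intro j') auto
      from pdvd_mult[OF this comp_V0[OF A, of k]] show ?thesis by (simp add: mult.commute)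
    qed
  qed
  ultimately have "pdvd V0 p (\<lambda>x. comp (i + j) (\<lambda>x. A x * B x) x -
      (\<Sum>k\<in>{..i+j}-{i}. comp k A x * comp (i + j - k) B x))" by (rule pdvd_diff)
  moreover have "comp (i + j) (\<lambda>x. A x * B x) x - (\<Sum>k\<in>{..i+j}-{i}. comp k A x * comp (i + j - k) B x)
      = comp i A x * comp j B x" for x
    unfolding comp_mult[OF A B] by (subst sum.remove[of "{..i+j}" i]) auto
  ultimately have "pdvd V0 p (\<lambda>x. comp i A x * comp j B x)" by simp
  thus False using pprimeD[OF p(2) comp_V0[OF A] comp_V0[OF B]] i j by blast
qed

text \<open>A substitute for the fraction field of the coefficients: the irreducible factors of
  \<open>c\<close> stay prime after adjoining \<open>z\<close>, so each of them can be taken out of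
  \<open>q\<close> or of \<open>h\<close>.\<close>

lemma cancel_V0:
  assumes c: "c \<in> pol V0" "c \<noteq> (\<lambda>x. 0)"
    and "F \<in> pol V" "q \<in> pol V" "h \<in> pol V" "\<And>x. c x * F x = q x * h x"
  shows "\<exists>q' h' a b. q' \<in> pol V \<and> h' \<in> pol V \<and> a \<in> pol V0 \<and> b \<in> pol V0 \<and>
    (\<forall>x. F x = q' x * h' x) \<and> (\<forall>x. q x = a x * q' x) \<and> (\<forall>x. h x = b x * h' x)"
  using assms(3-)
proof (induction arbitrary: q h rule: factor_induct[OF fin c])
  case (1 c)
  show ?case
    by (rule exI[of _ "\<lambda>x. inverse c * q x"], rule exI[of _ h], rule exI[of _ "\<lambda>x. c"], rule exI[of _ "\<lambda>x. 1"])
      (use 1(1,3,4) in \<open>simp_all add: pol.intros mult.assoc 1(5)[symmetric]\<close>)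
next
  case (2 p c)
  have p: "p \<in> pol V0" "p \<noteq> (\<lambda>x. 0)" using 2(1) by (auto simp: irred_def is_const_def)
  have e: "p x * (c x * F x) = q x * h x" for x using 2(8)[of x] by (simp add: mult.assoc)
  have "pdvd V p (\<lambda>x. q x * h x)"
    by (rule pdvdI[OF pol_mult[OF sub[OF 2(2)] 2(5)]]) (simp add: e)
  hence "pdvd V p q \<or> pdvd V p h" by (intro pprimeD[OF prime_lift[OF p(1) prime0[OF 2(1)]]] 2)
  thus ?case
  proof
    assume "pdvd V p q"
    then obtain q1 where q1: "q1 \<in> pol V" "q = (\<lambda>x. p x * q1 x)" by (auto simp: pdvd_def)
    have "(\<lambda>x. c x * F x) = (\<lambda>x. q1 x * h x)"
      by (rule pol_cancel[OF sub[OF p(1)] p(2)])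
        (use e q1 2(2,5,6,7) in \<open>simp_all add: pol_mult sub mult.assoc\<close>)
    hence "\<And>x. c x * F x = q1 x * h x" by (simp add: fun_eq_iff)
    from 2(4)[OF 2(5) q1(1) 2(7) this] obtain q' h' a b where
      "q' \<in> pol V" "h' \<in> pol V" "a \<in> pol V0" "b \<in> pol V0"
      "\<forall>x. F x = q' x * h' x" "\<forall>x. q1 x = a x * q' x" "\<forall>x. h x = b x * h' x" by blast
    thus ?thesis using p(1) q1(2)
      by (intro exI[of _ q'] exI[of _ h'] exI[of _ "\<lambda>x. p x * a x"] exI[of _ b]) (simp add: pol_mult)
  next
    assume "pdvd V p h"
    then obtain q1 where q1: "q1 \<in> pol V" "h = (\<lambda>x. p x * q1 x)" by (auto simp: pdvd_def)
    have "(\<lambda>x. c x * F x) = (\<lambda>x. q x * q1 x)"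
      by (rule pol_cancel[OF sub[OF p(1)] p(2)])
        (use e q1 2(2,5,6,7) in \<open>simp_all add: pol_mult sub mult.left_commute\<close>)
    hence "\<And>x. c x * F x = q x * q1 x" by (simp add: fun_eq_iff)
    from 2(4)[OF 2(5,6) q1(1) this] obtain q' h' a b where
      "q' \<in> pol V" "h' \<in> pol V" "a \<in> pol V0" "b \<in> pol V0"
      "\<forall>x. F x = q' x * h' x" "\<forall>x. q x = a x * q' x" "\<forall>x. q1 x = b x * h' x" by blast
    thus ?thesis using p(1) q1(2)
      by (intro exI[of _ q'] exI[of _ h'] exI[of _ a] exI[of _ "\<lambda>x. p x * b x"]) (simp add: pol_mult)
  qed
qed

text \<open>An irreducible \<open>f\<close> of positive degree in \<open>z\<close> has only constant
  factors in \<open>pol V0\<close>, so all of \<open>c\<close> is absorbed by the cofactor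
  \<open>Q\<close>.\<close>

lemma irred_cancel_V0:
  assumes f: "irred V f" "deg f > 0" and c: "c \<in> pol V0" "c \<noteq> (\<lambda>x. 0)"
    and FQ: "F \<in> pol V" "Q \<in> pol V" "\<And>x. c x * F x = f x * Q x"
  shows "pdvd V f F"
proof -
  have fp: "f \<in> pol V" using f by (auto simp: irred_def)
  from cancel_V0[OF c FQ(1) fp FQ(2,3)] obtain f' Q' a b where
    *: "f' \<in> pol V" "Q' \<in> pol V" "a \<in> pol V0" "b \<in> pol V0"
      "\<And>x. F x = f' x * Q' x" "\<And>x. f x = a x * f' x" by blast
  have "is_const a \<or> is_const f'" using f(1) sub[OF *(3)] *(1,6) unfolding irred_def by blast
  moreover have "\<not> is_const f'"
  proof
    assume "is_const f'"
    then obtain k where "f' = (\<lambda>x. k)" by (auto simp: is_const_def)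
    hence "f = (\<lambda>x. a x * k)" using *(6) by auto
    hence "f \<in> pol V0" using *(3) by (auto intro: pol.intros)
    thus False using V0_deg_0 f(2) by simp
  qed
  ultimately obtain k where k: "a = (\<lambda>x. k)" by (auto simp: is_const_def)
  have "k \<noteq> 0"
  proof
    assume "k = 0"
    hence "f = (\<lambda>x. 0)" using *(6) k by auto
    thus False using f(1) by (auto simp: irred_def is_const_def)
  qed
  thus ?thesis using * k
    by (intro pdvdI[of "\<lambda>x. inverse k * Q' x"]) (auto intro: pol.intros)
qed

text \<open>Each reduction multiplies by the leading coefficient of \<open>h\<close> instead of
  dividing by it; \<open>c\<close> collects these multipliers.\<close>

lemma pseudo_division:
  assumes h: "h \<in> pol V" "h \<noteq> (\<lambda>x. 0)" and F: "F \<in> pol V"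
  shows "\<exists>c q r. c \<in> pol V0 \<and> c \<noteq> (\<lambda>x. 0) \<and> q \<in> pol V \<and> r \<in> pol V \<and>
    (\<forall>x. c x * F x = q x * h x + r x) \<and> (r = (\<lambda>x. 0) \<or> deg r < deg h)"
  using F
proof (induction "deg F" arbitrary: F rule: less_induct)
  case less
  show ?case
  proof (cases "F = (\<lambda>x. 0) \<or> deg F < deg h")
    case True
    thus ?thesis using less.prems
      by (intro exI[of _ "\<lambda>x. 1"] exI[of _ "\<lambda>x. 0"] exI[of _ F]) (auto intro: pol_const simp: fun_eq_iff)
  next
    case False
    define k where "k = deg F - deg h"
    define l where "l = top h"
    define m where "m = top F"
    have l: "l \<in> pol V0" "l \<noteq> (\<lambda>x. 0)" using comp_V0[OF h(1)] top_nonzero[OF h] by (auto simp: l_def top_def)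
    have m: "m \<in> pol V0" using comp_V0[OF less.prems] by (auto simp: m_def top_def)
    define G where "G = (\<lambda>x. l x * F x + (- 1) * (m x * (x z ^ k * h x)))"
    have zh: "(\<lambda>x. x z ^ k * h x) \<in> pol V" by (rule pol_mult[OF zpow h(1)])
    have mzh: "(\<lambda>x. m x * (x z ^ k * h x)) \<in> pol V" by (rule pol_mult[OF sub[OF m] zh])
    have G: "G \<in> pol V" unfolding G_def
      by (rule pol_add[OF pol_mult[OF sub[OF l(1)] less.prems] pol_mult[OF pol_const mzh]])
    have cG: "comp i G x = l x * comp i F x - m x * (if i < k then 0 else comp (i - k) h x)" for i x
    proof -
      have "comp i (\<lambda>x. (-1) * (m x * (x z ^ k * h x))) = (\<lambda>x. - (m x * (if i < k then 0 else comp (i - k) h x)))"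
        using comp_smult[OF pol_const[of "-1"] mzh] comp_smult[OF m zh] comp_shift[OF h(1), of _ k] by simp
      thus ?thesis unfolding G_def
        using comp_add[OF pol_mult[OF sub[OF l(1)] less.prems] pol_mult[OF pol_const mzh], of i "-1"]
          comp_smult[OF l(1) less.prems, of i] by simp
    qed
    have "comp i G x = 0" if "i \<ge> deg F" for i x
    proof (cases "i = deg F")
      case True
      thus ?thesis using False unfolding cG by (auto simp: l_def m_def top_def k_def)
    next
      case False
      hence "comp i F x = 0" "comp (i - k) h x = 0"
        using that \<open>\<not> (F = (\<lambda>x. 0) \<or> deg F < deg h)\<close> k_def
        by (auto intro!: comp_gt_deg h less.prems)
      thus ?thesis unfolding cG by simp
    qed
    hence "G = (\<lambda>x. 0) \<or> deg G < deg F" using top_nonzero[OF G] unfolding top_def by (auto simp: fun_eq_iff not_le[symmetric])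
    hence "\<exists>c q r. c \<in> pol V0 \<and> c \<noteq> (\<lambda>x. 0) \<and> q \<in> pol V \<and> r \<in> pol V \<and>
      (\<forall>x. c x * G x = q x * h x + r x) \<and> (r = (\<lambda>x. 0) \<or> deg r < deg h)"
    proof
      assume "G = (\<lambda>x. 0)"
      thus ?thesis
        by (intro exI[of _ "\<lambda>x. 1"] exI[of _ "\<lambda>x. 0"]) (auto intro: pol_const simp: fun_eq_iff)
    qed (rule less.hyps[OF _ G])
    then obtain c q r where *: "c \<in> pol V0" "c \<noteq> (\<lambda>x. 0)" "q \<in> pol V" "r \<in> pol V"
      "\<And>x. c x * G x = q x * h x + r x" "r = (\<lambda>x. 0) \<or> deg r < deg h" by blast
    have "(\<lambda>x. c x * l x) \<noteq> (\<lambda>x. 0)" using pol_mult_eq_0[OF *(1) l(1)] *(2) l(2) by (auto simp: fun_eq_iff)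
    moreover have "(\<lambda>x. c x * l x) \<in> pol V0" by (rule pol_mult[OF *(1) l(1)])
    moreover have "(\<lambda>x. q x + c x * (m x * x z ^ k)) \<in> pol V"
      by (intro pol_add pol_mult * sub m zpow)
    moreover have "c x * l x * F x = (q x + c x * (m x * x z ^ k)) * h x + r x" for x
      using *(5)[of x] by (simp add: G_def algebra_simps)
    ultimately show ?thesis using *(4,6) by blast
  qed
qed

text \<open>In positive degree this is Euclid's argument. The \<open>C\<close> with \<open>f\<close>
  dividing \<open>C * B\<close> form an ideal; a nonzero member \<open>h\<close> of least degree in
  \<open>z\<close> divides every member up to a factor from \<open>pol V0\<close>. Applied to
  \<open>f\<close> itself, irreducibility leaves two cases: \<open>h\<close> is a coefficient, and
  then \<open>f\<close> divides \<open>B\<close>, or \<open>h\<close> is \<open>f\<close> up to a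
  coefficient, and then \<open>f\<close> divides \<open>A\<close>.\<close>

lemma irred_prime_step:
  assumes f: "irred V f"
  shows "pprime V f"
proof (cases "deg f = 0")
  case True
  have fV: "f \<in> pol V" using f by (simp add: irred_def)
  hence f0: "f \<in> pol V0" using True by (rule deg_0_V0)
  have "irred V0 f" using f f0 unfolding irred_def by (auto dest: sub)
  thus ?thesis using prime0 prime_lift[OF f0] by blast
next
  case False
  hence d: "deg f > 0" by simp
  have fV: "f \<in> pol V" and fnz: "f \<noteq> (\<lambda>x. 0)" using f by (auto simp: irred_def is_const_def)
  show ?thesis unfolding pprime_def
  proof (intro ballI impI)
    fix A B assume A: "A \<in> pol V" and B: "B \<in> pol V" and AB: "pdvd V f (\<lambda>x. A x * B x)"
    define J where "J C \<longleftrightarrow> C \<in> pol V \<and> C \<noteq> (\<lambda>x. 0) \<and> pdvd V f (\<lambda>x. C x * B x)" for C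
    have Jf: "J f" unfolding J_def using fV fnz B by (auto intro: pdvdI)
    define h where "h = arg_min deg J"
    have Jh: "J h" and hmin: "\<And>C. J C \<Longrightarrow> deg h \<le> deg C"
      unfolding h_def using arg_min_nat_lemma[of J f deg] Jf by blast+
    have h: "h \<in> pol V" "h \<noteq> (\<lambda>x. 0)" "pdvd V f (\<lambda>x. h x * B x)" using Jh by (auto simp: J_def)
    have div: "\<exists>c q. c \<in> pol V0 \<and> c \<noteq> (\<lambda>x. 0) \<and> q \<in> pol V \<and> (\<forall>x. c x * F x = q x * h x)"
      if F: "F \<in> pol V" "pdvd V f (\<lambda>x. F x * B x)" for F
    proof -
      obtain c q r where *: "c \<in> pol V0" "c \<noteq> (\<lambda>x. 0)" "q \<in> pol V" "r \<in> pol V"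
        "\<And>x. c x * F x = q x * h x + r x" "r = (\<lambda>x. 0) \<or> deg r < deg h"
        using pseudo_division[OF h(1,2) F(1)] by blast
      have "pdvd V f (\<lambda>x. (F x * B x) * c x - (h x * B x) * q x)"
        by (rule pdvd_diff[OF pdvd_mult[OF F(2) sub[OF *(1)]] pdvd_mult[OF h(3) *(3)]])
      moreover have "(F x * B x) * c x - (h x * B x) * q x = r x * B x" for x
      proof -
        have "(F x * B x) * c x - (h x * B x) * q x = (c x * F x - q x * h x) * B x" by (simp add: algebra_simps)
        thus ?thesis by (simp add: *(5))
      qed
      ultimately have "pdvd V f (\<lambda>x. r x * B x)" by simp
      hence "r \<noteq> (\<lambda>x. 0) \<Longrightarrow> deg h \<le> deg r" using *(4) by (intro hmin) (simp add: J_def)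
      hence "r = (\<lambda>x. 0)" using *(6) by linarith
      hence "\<And>x. c x * F x = q x * h x" using *(5) by simp
      thus ?thesis using *(1-3) by blast
    qed
    obtain c q where cq: "c \<in> pol V0" "c \<noteq> (\<lambda>x. 0)" "q \<in> pol V" "\<And>x. c x * f x = q x * h x"
      using div[of f] Jf fV by (auto simp: J_def)
    from cancel_V0[OF cq(1,2) fV cq(3) h(1) cq(4)] obtain q' h' a b where
      *: "q' \<in> pol V" "h' \<in> pol V" "a \<in> pol V0" "b \<in> pol V0" "\<And>x. f x = q' x * h' x"
        "\<And>x. h x = b x * h' x" by blast
    have b: "b \<noteq> (\<lambda>x. 0)" using *(6) h(2) by auto
    have "is_const q' \<or> is_const h'" using f *(1,2,5) unfolding irred_def by blast
    thus "pdvd V f A \<or> pdvd V f B"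
    proof
      assume "is_const h'"
      then obtain k where k: "h' = (\<lambda>x. k)" by (auto simp: is_const_def)
      hence "h = (\<lambda>x. b x * k)" using *(6) by auto
      hence h0: "h \<in> pol V0" using *(4) by (auto intro: pol.intros)
      obtain Q where "Q \<in> pol V" "\<And>x. h x * B x = f x * Q x" using h(3) unfolding pdvd_def fun_eq_iff by blast
      hence "pdvd V f B" by (rule irred_cancel_V0[OF f d h0 h(2) B])
      thus ?thesis ..
    next
      assume "is_const q'"
      then obtain k where k: "q' = (\<lambda>x. k)" by (auto simp: is_const_def)
      have k0: "k \<noteq> 0" using *(5) k fnz by auto
      obtain c' Q where cQ: "c' \<in> pol V0" "c' \<noteq> (\<lambda>x. 0)" "Q \<in> pol V" "\<And>x. c' x * A x = Q x * h x"
        using div[OF A AB] by blast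
      have "pdvd V f A"
      proof (rule irred_cancel_V0[OF f d cQ(1,2) A])
        show "(\<lambda>x. inverse k * (Q x * b x)) \<in> pol V" by (intro pol_mult pol_const cQ sub *)
        show "c' x * A x = f x * (inverse k * (Q x * b x))" for x
          unfolding cQ(4) *(5,6) using k k0 by simp
      qed
      thus ?thesis ..
    qed
  qed
qed

end

theorem irred_pprime:
  assumes "finite V" "irred V f"
  shows "pprime V f"
  using assms
proof (induction V arbitrary: f)
  case empty
  have "is_const g" if "g \<in> pol {}" for g :: "('a \<Rightarrow> complex) \<Rightarrow> complex"
    unfolding is_const_def using pol_local[OF that] by (intro exI[of _ "g (\<lambda>v. 0)"] ext) auto
  thus ?case using empty by (auto simp: irred_def)
next
  case (insert z V0)
  interpret axis V0 "insert z V0" z by unfold_locales (use insert in auto)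
  show ?case by (rule irred_prime_step[OF insert.prems])
qed

subsection \<open>Pointwise mutation\<close>

type_synonym vx = "nat \<times> nat"

declare split_paired_All [simp del] split_paired_Ex [simp del]

definition exch :: "vx set \<Rightarrow> vx \<Rightarrow> (vx \<Rightarrow> vx \<Rightarrow> int) \<Rightarrow> (vx \<Rightarrow> 'a::field) \<Rightarrow> 'a" where
  "exch V k B y = (\<Prod>w\<in>V. if B k w > 0 then y w ^ nat (B k w) else 1)
    + (\<Prod>w\<in>V. if B k w < 0 then y w ^ nat (- B k w) else 1)"
definition mutv :: "vx set \<Rightarrow> vx \<Rightarrow> (vx \<Rightarrow> vx \<Rightarrow> int) \<Rightarrow> (vx \<Rightarrow> 'a::field) \<Rightarrow> vx \<Rightarrow> 'a" where
  "mutv V k B y = y(k := exch V k B y / y k)"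
text \<open>Only values at one point are mutated, over an arbitrary field. The same recursion thus
  serves complex matrices and the real positive points at which Laurent expansions are
  proved.\<close>

fun cv :: "vx set \<Rightarrow> (vx \<Rightarrow> vx \<Rightarrow> int) \<Rightarrow> vx list \<Rightarrow> (vx \<Rightarrow> 'a::field) \<Rightarrow> vx \<Rightarrow> 'a" where
  "cv V B [] y = y"
| "cv V B (k # ks) y = cv V (mutB k B) ks (mutv V k B y)"

lemma fold_mutate: "snd (fold (mutate V) ks (B, x)) v X = cv V B ks (\<lambda>w. x w X) v"
proof (induction ks arbitrary: B x)
  case (Cons k ks)
  have "(\<lambda>w. mutx V k B x w X) = mutv V k B (\<lambda>w. x w X)"
    by (auto simp: mutx_def mutv_def exch_def)
  moreover have "mutate V k (B, x) = (mutB k B, mutx V k B x)" by (simp add: mutate_def)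
  ultimately show ?case by (simp add: Cons.IH)
qed simp

definition skew :: "(vx \<Rightarrow> vx \<Rightarrow> int) \<Rightarrow> bool" where
  "skew B \<longleftrightarrow> (\<forall>i j. B i j = - B j i)"
text \<open>Surjectivity over the integers: every vector of degree differences on \<open>M\<close>
  is realized by an integer grading of the variables.\<close>

definition fullrank :: "vx set \<Rightarrow> vx set \<Rightarrow> (vx \<Rightarrow> vx \<Rightarrow> int) \<Rightarrow> bool" where
  "fullrank V M B \<longleftrightarrow> (\<forall>u::vx \<Rightarrow> int. \<exists>l::vx \<Rightarrow> int. \<forall>j\<in>M. (\<Sum>v\<in>V. B j v * l v) = u j)"

lemma skewD: "skew B \<Longrightarrow> B i j = - B j i" unfolding skew_def by blast
lemma skew_diag: "skew B \<Longrightarrow> B i i = 0" using skewD[of B i i] by simp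

lemma mutB_alt: "mutB k B i j = (if i = k \<or> j = k then - B i j
    else B i j + max (B i k) 0 * max (B k j) 0 - max (- B i k) 0 * max (- B k j) 0)"
proof -
  have "(\<bar>a\<bar> * b + a * \<bar>b\<bar>) div 2 = max a 0 * max b 0 - max (- a) 0 * max (- b) 0" for a b :: int
    by (cases "a \<ge> 0"; cases "b \<ge> 0") (auto simp: max_def abs_if)
  thus ?thesis by (simp add: mutB_def)
qed

lemma skew_mutB: "skew B \<Longrightarrow> skew (mutB k B)"
proof -
  assume s: "skew B"
  have "mutB k B i j = - mutB k B j i" for i j
    unfolding mutB_alt using skewD[OF s, of i j] skewD[OF s, of i k] skewD[OF s, of k j] by (simp add: mult.commute)
  thus ?thesis unfolding skew_def by blast
qed

lemma mutB_invol: "skew B \<Longrightarrow> mutB k (mutB k B) = B"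
  by (intro ext) (auto simp: mutB_alt skew_diag)

lemma mutB_uminus: "mutB k (\<lambda>i j. - B i j) = (\<lambda>i j. - mutB k B i j)"
  by (intro ext) (simp add: mutB_alt)

lemma exch_uminus: "exch V k (\<lambda>i j. - B i j) y = exch V k B y"
  unfolding exch_def by (subst add.commute, rule arg_cong2[of _ _ _ _ "(+)"]; rule prod.cong) auto

lemma mutv_uminus: "mutv V k (\<lambda>i j. - B i j) y = mutv V k B y"
  by (simp add: mutv_def exch_uminus)

lemma exch_cong:
  assumes "\<And>v. v \<in> V \<Longrightarrow> B k v = B' k v" "\<And>v. v \<in> V \<Longrightarrow> B k v \<noteq> 0 \<Longrightarrow> y v = y' v"
  shows "exch V k B y = exch V k B' y'"
  unfolding exch_def using assms by (intro arg_cong2[of _ _ _ _ "(+)"] prod.cong) auto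

lemma exch_neg:
  assumes "\<And>v. v \<in> V \<Longrightarrow> B' k v = - B k v" "\<And>v. v \<in> V \<Longrightarrow> B k v \<noteq> 0 \<Longrightarrow> y v = y' v"
  shows "exch V k B' y' = exch V k B y"
  using exch_cong[of V B' k "\<lambda>i j. - B i j" y' y] assms by (simp add: exch_uminus)

definition pos :: "(vx \<Rightarrow> real) \<Rightarrow> bool" where "pos y \<longleftrightarrow> (\<forall>v. 0 < y v)"

lemma exch_pos: "pos y \<Longrightarrow> 0 < exch V k B y"
  by (auto simp: exch_def pos_def intro!: add_pos_pos prod_pos)

lemma mutv_pos: "pos y \<Longrightarrow> pos (mutv V k B y)"
  using exch_pos[of y V k B] by (auto simp: mutv_def pos_def)

lemma mutv_invol:
  assumes s: "skew B" and y: "pos y"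
  shows "mutv V k (mutB k B) (mutv V k B y) = y"
proof -
  have "exch V k (mutB k B) (mutv V k B y) = exch V k B y"
    by (rule exch_neg) (use skew_diag[OF s] in \<open>auto simp: mutB_alt mutv_def\<close>)
  moreover have "exch V k B y > 0" "y k > 0" using exch_pos[OF y] y by (auto simp: pos_def)
  ultimately show ?thesis unfolding mutv_def[of V k "mutB k B"] by (auto simp: mutv_def fun_eq_iff)
qed

text \<open>The grading mutates with the seed: the variable at \<open>k\<close> receives the degree
  of the negative exchange monomial minus its old degree. The right-hand side chosen for the old
  matrix is the one that this change turns into \<open>u\<close>.\<close>

lemma fullrank_mutB:
  assumes V: "finite V" "k \<in> V" and k: "k \<in> M" and s: "skew B" and f: "fullrank V M B"
  shows "fullrank V M (mutB k B)"
  unfolding fullrank_def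
proof
  fix u :: "vx \<Rightarrow> int"
  have "\<exists>l. \<forall>j\<in>M. (\<Sum>v\<in>V. B j v * l v) = (if j = k then - u k else u j + max (B j k) 0 * u k)"
    by (rule f[unfolded fullrank_def, rule_format])
  then obtain l where l: "\<And>j. j \<in> M \<Longrightarrow> (\<Sum>v\<in>V. B j v * l v) = (if j = k then - u k else u j + max (B j k) 0 * u k)"
    by blast
  define S where "S = (\<Sum>v\<in>V. max (- B k v) 0 * l v)"
  define l' where "l' = l(k := S - l k)"
  have "(\<Sum>v\<in>V. mutB k B j v * l' v) = u j" if j: "j \<in> M" for j
  proof (cases "j = k")
    case True
    have "(\<Sum>v\<in>V. mutB k B k v * l' v) = (\<Sum>v\<in>V. - (B k v * l v))"
      by (rule sum.cong) (auto simp: mutB_alt l'_def skew_diag[OF s])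
    thus ?thesis using l[OF k] True by (simp add: sum_negf)
  next
    case False
    have e: "max a 0 * max b 0 - max (- a) 0 * max (- b) 0 = max a 0 * b + a * max (- b) 0" for a b :: int
      by (cases "a \<ge> 0"; cases "b \<ge> 0") (auto simp: max_def)
    have "(\<Sum>v\<in>V. mutB k B j v * l' v) = mutB k B j k * l' k + (\<Sum>v\<in>V-{k}. mutB k B j v * l' v)"
      by (rule sum.remove[OF V])
    also have "(\<Sum>v\<in>V-{k}. mutB k B j v * l' v) =
        (\<Sum>v\<in>V-{k}. B j v * l v + max (B j k) 0 * (B k v * l v) + B j k * (max (- B k v) 0 * l v))"
    proof (rule sum.cong[OF refl])
      fix v assume "v \<in> V - {k}"
      hence "mutB k B j v = B j v + (max (B j k) 0 * B k v + B j k * max (- B k v) 0)" "l' v = l v"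
        using False e[of "B j k" "B k v"] by (auto simp: mutB_alt l'_def)
      thus "mutB k B j v * l' v = B j v * l v + max (B j k) 0 * (B k v * l v) + B j k * (max (- B k v) 0 * l v)"
        by (simp add: algebra_simps)
    qed
    also have "\<dots> = (\<Sum>v\<in>V. B j v * l v + max (B j k) 0 * (B k v * l v) + B j k * (max (- B k v) 0 * l v)) - B j k * l k"
      using sum.remove[OF V, of "\<lambda>v. B j v * l v + max (B j k) 0 * (B k v * l v) + B j k * (max (- B k v) 0 * l v)"]
      by (simp add: skew_diag[OF s])
    also have "\<dots> = (\<Sum>v\<in>V. B j v * l v) + max (B j k) 0 * (\<Sum>v\<in>V. B k v * l v) + B j k * S - B j k * l k"
      by (simp add: sum.distrib sum_distrib_left S_def)
    finally show ?thesis using False l[OF k] l[OF j] by (simp add: mutB_alt l'_def algebra_simps)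
  qed
  thus "\<exists>l. \<forall>j\<in>M. (\<Sum>v\<in>V. mutB k B j v * l v) = u j" by blast
qed

subsection \<open>Laurent polynomials on the positive orthant\<close>

definition mon :: "vx set \<Rightarrow> (vx \<Rightarrow> int) \<Rightarrow> (vx \<Rightarrow> real) \<Rightarrow> real" where
  "mon V e y = (\<Prod>v\<in>V. y v powi e v)"

lemma mon_pos: "pos y \<Longrightarrow> 0 < mon V e y"
  by (auto simp: mon_def pos_def intro!: prod_pos)

lemma mon_add: "pos y \<Longrightarrow> mon V (\<lambda>v. e v + f v) y = mon V e y * mon V f y"
proof -
  assume "pos y"
  hence "y v \<noteq> 0" for v by (metis pos_def less_irrefl)
  thus ?thesis by (simp add: mon_def power_int_add prod.distrib)
qed

lemma mon_uminus: "pos y \<Longrightarrow> mon V (\<lambda>v. - e v) y * mon V e y = 1"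
  using mon_add[of y V "\<lambda>v. - e v" e] by (simp add: mon_def)

lemma mon_power: "pos y \<Longrightarrow> mon V e y ^ n = mon V (\<lambda>v. int n * e v) y"
proof (induction n)
  case 0 thus ?case by (simp add: mon_def)
next
  case (Suc n)
  have "mon V (\<lambda>v. int (Suc n) * e v) y = mon V (\<lambda>v. e v + int n * e v) y" by (simp add: algebra_simps)
  thus ?case using Suc by (simp add: mon_add)
qed

lemma mon_upd: "e i = 0 \<Longrightarrow> mon V e (y(i := t)) = mon V e y"
  unfolding mon_def by (rule prod.cong) auto

lemma mon_scale: "0 < s \<Longrightarrow> mon V e (\<lambda>v. s powi l v * y v) = s powi (\<Sum>v\<in>V. e v * l v) * mon V e y"
proof -
  assume s: "0 < s"
  have "mon V e (\<lambda>v. s powi l v * y v) = (\<Prod>v\<in>V. s powi (e v * l v)) * mon V e y"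
    by (simp add: mon_def power_int_mult_distrib prod.distrib power_int_mult[symmetric] mult.commute)
  also have "(\<Prod>v\<in>V. s powi (e v * l v)) = s powi (\<Sum>v\<in>V. e v * l v)"
    by (induction V rule: infinite_finite_induct) (use s in \<open>auto simp: power_int_add\<close>)
  finally show ?thesis .
qed

lemma mon_split: "finite V \<Longrightarrow> j \<in> V \<Longrightarrow> mon V e y = y j powi e j * mon V (e(j := 0)) y"
  unfolding mon_def by (simp add: prod.remove[of V j])

lemma exch_mon: "exch V k B y = mon V (\<lambda>v. max (B k v) 0) y + mon V (\<lambda>v. max (- B k v) 0) y"
  unfolding exch_def mon_def
  by (intro arg_cong2[of _ _ _ _ "(+)"] prod.cong) (auto simp: power_int_def max_def)

lemma exch_split:
  assumes "finite V" "j \<in> V" "B k j > 0"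
  shows "exch V k B y = y j ^ nat (B k j) * mon V (\<lambda>v. if v = j then 0 else max (B k v) 0) y
    + mon V (\<lambda>v. if v = j then 0 else max (- B k v) 0) y"
proof -
  have e1: "(\<lambda>v. max (B k v) 0)(j := 0) = (\<lambda>v. if v = j then 0 else max (B k v) 0)"
    and e2: "(\<lambda>v. max (- B k v) 0) = (\<lambda>v. if v = j then 0 else max (- B k v) 0)"
    using assms(3) by auto
  show ?thesis unfolding exch_mon e2
    using assms by (simp add: mon_split[of V j "\<lambda>v. max (B k v) 0"] e1 power_int_def)
qed

text \<open>\<open>lau_cong\<close> identifies functions that agree on the positive orthant. Values
  elsewhere, which may come from a division by zero, carry no meaning.\<close>

inductive_set lau :: "vx set \<Rightarrow> vx set \<Rightarrow> ((vx \<Rightarrow> real) \<Rightarrow> real) set" for V M where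
  lau_const: "(\<lambda>y. c) \<in> lau V M"
| lau_var: "v \<in> V \<Longrightarrow> (\<lambda>y. y v) \<in> lau V M"
| lau_inv: "v \<in> M \<Longrightarrow> (\<lambda>y. inverse (y v)) \<in> lau V M"
| lau_add: "f \<in> lau V M \<Longrightarrow> g \<in> lau V M \<Longrightarrow> (\<lambda>y. f y + g y) \<in> lau V M"
| lau_mult: "f \<in> lau V M \<Longrightarrow> g \<in> lau V M \<Longrightarrow> (\<lambda>y. f y * g y) \<in> lau V M"
| lau_cong: "f \<in> lau V M \<Longrightarrow> (\<And>y. pos y \<Longrightarrow> f y = g y) \<Longrightarrow> g \<in> lau V M"

lemma lau_diff: "f \<in> lau V M \<Longrightarrow> g \<in> lau V M \<Longrightarrow> (\<lambda>y. f y - g y) \<in> lau V M"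
  using lau_add[of f V M "\<lambda>y. (-1) * g y"] lau_mult[OF lau_const[of "-1"], of g V M] by simp
lemma lau_sum: "(\<And>i. i \<in> I \<Longrightarrow> f i \<in> lau V M) \<Longrightarrow> (\<lambda>y. \<Sum>i\<in>I. f i y) \<in> lau V M"
  by (induction I rule: infinite_finite_induct) (auto intro: lau_const lau_add)
lemma lau_prod: "(\<And>i. i \<in> I \<Longrightarrow> f i \<in> lau V M) \<Longrightarrow> (\<lambda>y. \<Prod>i\<in>I. f i y) \<in> lau V M"
  by (induction I rule: infinite_finite_induct) (auto intro: lau_const lau_mult)
lemma lau_power: "f \<in> lau V M \<Longrightarrow> (\<lambda>y. f y ^ n) \<in> lau V M"
  by (induction n) (auto intro: lau_const lau_mult)

lemma lau_mon: "mon V e \<in> lau V V"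
proof -
  have "(\<lambda>y. y v powi e v) \<in> lau V V" if "v \<in> V" for v
    by (cases "e v \<ge> 0") (use that in \<open>simp_all add: power_int_def lau_power lau_var lau_inv\<close>)
  thus ?thesis unfolding mon_def[abs_def] by (rule lau_prod)
qed

lemma lau_exch: "exch V k B \<in> lau V V"
  unfolding exch_mon[abs_def] by (intro lau_add lau_mon)

section \<open>Homogeneous components of Laurent polynomials\<close>

definition hexp :: "int \<Rightarrow> (real \<Rightarrow> real) \<Rightarrow> (int \<Rightarrow> real) \<Rightarrow> bool" where
  "hexp N \<phi> a \<longleftrightarrow> (\<forall>d. d \<notin> {-N..N} \<longrightarrow> a d = 0) \<and> (\<forall>s>0. \<phi> s = (\<Sum>d\<in>{-N..N}. a d * s powi d))"

lemma hexp_mono: "hexp N \<phi> a \<Longrightarrow> N \<le> N' \<Longrightarrow> hexp N' \<phi> a"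
  unfolding hexp_def
proof (intro conjI allI impI, goal_cases)
  case (2 s)
  hence "\<phi> s = (\<Sum>d\<in>{-N..N}. a d * s powi d)" by blast
  also have "\<dots> = (\<Sum>d\<in>{-N'..N'}. a d * s powi d)"
    by (rule sum.mono_neutral_left) (use 2 in auto)
  finally show ?case .
qed auto

lemma hexp_shift:
  assumes "hexp N \<phi> a" shows "hexp (N + \<bar>h\<bar>) (\<lambda>s. s powi h * \<phi> s) (\<lambda>d. a (d - h))"
  unfolding hexp_def
proof (intro conjI allI impI)
  fix d assume "d \<notin> {- (N + \<bar>h\<bar>)..N + \<bar>h\<bar>}"
  thus "a (d - h) = 0" using assms unfolding hexp_def by (auto simp: abs_if split: if_splits)
next
  fix s :: real assume s: "0 < s"
  have "(\<Sum>d\<in>{- (N + \<bar>h\<bar>)..N + \<bar>h\<bar>}. a (d - h) * s powi d) = (\<Sum>d\<in>{-N+h..N+h}. a (d - h) * s powi d)"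
    by (rule sum.mono_neutral_right) (use assms in \<open>auto simp: hexp_def\<close>)
  also have "\<dots> = (\<Sum>d\<in>{-N..N}. a d * s powi (d + h))"
    by (rule sum.reindex_bij_witness[of _ "\<lambda>d. d + h" "\<lambda>d. d - h"]) auto
  also have "\<dots> = s powi h * \<phi> s"
    using assms s by (simp add: hexp_def sum_distrib_left power_int_add algebra_simps)
  finally show "s powi h * \<phi> s = (\<Sum>d\<in>{- (N + \<bar>h\<bar>)..N + \<bar>h\<bar>}. a (d - h) * s powi d)" ..
qed

lemma hexp_add: "hexp N \<phi> a \<Longrightarrow> hexp N \<psi> b \<Longrightarrow> hexp N (\<lambda>s. \<phi> s + \<psi> s) (\<lambda>d. a d + b d)"
  unfolding hexp_def by (auto simp: sum.distrib algebra_simps)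
lemma hexp_cmult: "hexp N \<phi> a \<Longrightarrow> hexp N (\<lambda>s. c * \<phi> s) (\<lambda>d. c * a d)"
  unfolding hexp_def by (auto simp: sum_distrib_left algebra_simps)
lemma hexp_sum: "(\<And>i. i \<in> I \<Longrightarrow> hexp N (\<phi> i) (a i)) \<Longrightarrow> hexp N (\<lambda>s. \<Sum>i\<in>I. \<phi> i s) (\<lambda>d. \<Sum>i\<in>I. a i d)"
proof (induction I rule: infinite_finite_induct)
  case (insert x F) thus ?case using hexp_add[of N "\<phi> x" "a x"] by simp
qed (auto simp: hexp_def)
lemma hexp_cong: "hexp N \<phi> a \<Longrightarrow> (\<And>s. 0 < s \<Longrightarrow> \<phi> s = \<psi> s) \<Longrightarrow> hexp N \<psi> a"
  by (simp add: hexp_def)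

lemma hexp_0:
  assumes "hexp N (\<lambda>s. 0) a" shows "a d = 0"
proof (cases "d \<in> {-N..N}")
  case False thus ?thesis using assms by (auto simp: hexp_def)
next
  case True
  \<comment> \<open>Multiplication by the \<open>N\<close>-th power of \<open>s\<close> gives an
    ordinary polynomial that vanishes on the positive reals.\<close>
  define p where "p = (\<Sum>d\<in>{-N..N}. monom (a d) (nat (d + N)))"
  have "poly p s = 0" if s: "s > 0" for s
  proof -
    have "poly p s = (\<Sum>d\<in>{-N..N}. s powi N * (a d * s powi d))"
      unfolding p_def poly_sum poly_monom
    proof (rule sum.cong[OF refl])
      fix d assume "d \<in> {-N..N}"
      hence "s ^ nat (d + N) = s powi (N + d)" by (simp add: power_int_def add.commute)
      thus "a d * s ^ nat (d + N) = s powi N * (a d * s powi d)" using s by (simp add: power_int_add)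
    qed
    also have "\<dots> = 0" using assms s by (simp add: hexp_def sum_distrib_left[symmetric])
    finally show ?thesis .
  qed
  hence "{0<..} \<subseteq> {s. poly p s = 0}" by auto
  hence "p = 0" using poly_roots_finite[of p] infinite_Ioi[of "0::real"] finite_subset by blast
  hence "0 = coeff p (nat (d + N))" by simp
  also have "\<dots> = (\<Sum>e\<in>{-N..N}. if e = d then a e else 0)"
    unfolding p_def coeff_sum by (rule sum.cong) (use True in auto)
  also have "\<dots> = a d" using True by simp
  finally show ?thesis ..
qed

lemma hexp_unique:
  assumes "hexp N \<phi> a" "hexp N' \<phi> b" shows "a d = b d"
proof -
  have "hexp (max N N') \<phi> a" "hexp (max N N') (\<lambda>s. (-1) * \<phi> s) (\<lambda>d. (-1) * b d)"
    using hexp_mono[OF assms(1), of "max N N'"] hexp_mono[OF hexp_cmult[OF assms(2), of "-1"], of "max N N'"] by auto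
  from hexp_0[OF hexp_cong[OF hexp_add[OF this], of "\<lambda>s. 0"], of d] show ?thesis by simp
qed

lemma pos_scale: "pos y \<Longrightarrow> 0 < s \<Longrightarrow> pos (\<lambda>v. s powi l v * y v)"
  by (simp add: pos_def)

text \<open>Rescaling the variables with weights \<open>l\<close> separates the degrees: the
  coefficients of the powers of \<open>s\<close> are the homogeneous components, and they are
  Laurent polynomials in the same variables.\<close>

lemma lau_hexp:
  assumes "f \<in> lau V M"
  shows "\<exists>N c. (\<forall>d. c d \<in> lau V M) \<and> (\<forall>y. pos y \<longrightarrow> hexp N (\<lambda>s. f (\<lambda>v. s powi l v * y v)) (\<lambda>d. c d y))"
  using assms
proof (induction rule: lau.induct)
  case (lau_const c)
  show ?case
    by (rule exI[of _ 0], rule exI[of _ "\<lambda>d y. if d = 0 then c else 0"])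
      (auto simp: hexp_def intro: lau.lau_const)
next
  case (lau_var v)
  have "(\<lambda>y. if d = l v then y v else 0) \<in> lau V M" for d
    by (cases "d = l v") (use lau_var in \<open>auto intro: lau.intros\<close>)
  moreover have "hexp \<bar>l v\<bar> (\<lambda>s. s powi l v * y v) (\<lambda>d. if d = l v then y v else 0)" for y :: "vx \<Rightarrow> real"
    using hexp_shift[of 0 "\<lambda>s. y v" "\<lambda>d. if d = 0 then y v else 0" "l v"] by (simp add: hexp_def)
  ultimately show ?case
    by (intro exI[of _ "\<bar>l v\<bar>"] exI[of _ "\<lambda>d y. if d = l v then y v else 0"]) simp
next
  case (lau_inv v)
  have "(\<lambda>y. if d = - l v then inverse (y v) else 0) \<in> lau V M" for d
    by (cases "d = - l v") (use lau_inv in \<open>auto intro: lau.intros\<close>)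
  moreover have "hexp \<bar>l v\<bar> (\<lambda>s. inverse (s powi l v * y v)) (\<lambda>d. if d = - l v then inverse (y v) else 0)" for y :: "vx \<Rightarrow> real"
  proof (rule hexp_cong)
    show "hexp \<bar>l v\<bar> (\<lambda>s. s powi (- l v) * inverse (y v)) (\<lambda>d. if d = - l v then inverse (y v) else 0)"
      using hexp_shift[of 0 "\<lambda>s. inverse (y v)" "\<lambda>d. if d = 0 then inverse (y v) else 0" "- l v"]
      by (simp add: hexp_def add_eq_0_iff2)
  qed (simp add: power_int_minus)
  ultimately show ?case
    by (intro exI[of _ "\<bar>l v\<bar>"] exI[of _ "\<lambda>d y. if d = - l v then inverse (y v) else 0"]) simp
next
  case (lau_add f g)
  then obtain N1 c1 N2 c2 where *: "\<And>d. c1 d \<in> lau V M" "\<And>y. pos y \<Longrightarrow> hexp N1 (\<lambda>s. f (\<lambda>v. s powi l v * y v)) (\<lambda>d. c1 d y)"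
    "\<And>d. c2 d \<in> lau V M" "\<And>y. pos y \<Longrightarrow> hexp N2 (\<lambda>s. g (\<lambda>v. s powi l v * y v)) (\<lambda>d. c2 d y)" by blast
  show ?case
  proof (rule exI[of _ "max N1 N2"], rule exI[of _ "\<lambda>d y. c1 d y + c2 d y"], intro conjI allI impI)
    show "(\<lambda>y. c1 d y + c2 d y) \<in> lau V M" for d by (rule lau.lau_add[OF *(1) *(3)])
    fix y assume "pos y"
    thus "hexp (max N1 N2) (\<lambda>s. f (\<lambda>v. s powi l v * y v) + g (\<lambda>v. s powi l v * y v)) (\<lambda>d. c1 d y + c2 d y)"
      by (intro hexp_add hexp_mono[OF *(2)] hexp_mono[OF *(4)]) auto
  qed
next
  case (lau_mult f g)
  then obtain N1 c1 N2 c2 where *: "\<And>d. c1 d \<in> lau V M" "\<And>y. pos y \<Longrightarrow> hexp N1 (\<lambda>s. f (\<lambda>v. s powi l v * y v)) (\<lambda>d. c1 d y)"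
    "\<And>d. c2 d \<in> lau V M" "\<And>y. pos y \<Longrightarrow> hexp N2 (\<lambda>s. g (\<lambda>v. s powi l v * y v)) (\<lambda>d. c2 d y)" by blast
  show ?case
  proof (rule exI[of _ "N2 + \<bar>N1\<bar>"], rule exI[of _ "\<lambda>e y. \<Sum>d\<in>{-N1..N1}. c1 d y * c2 (e - d) y"], intro conjI allI impI)
    show "(\<lambda>y. \<Sum>d\<in>{-N1..N1}. c1 d y * c2 (e - d) y) \<in> lau V M" for e
      by (intro lau_sum lau.lau_mult *)
    fix y assume y: "pos y"
    show "hexp (N2 + \<bar>N1\<bar>) (\<lambda>s. f (\<lambda>v. s powi l v * y v) * g (\<lambda>v. s powi l v * y v))
        (\<lambda>e. \<Sum>d\<in>{-N1..N1}. c1 d y * c2 (e - d) y)"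
    proof (rule hexp_cong)
      show "hexp (N2 + \<bar>N1\<bar>) (\<lambda>s. \<Sum>d\<in>{-N1..N1}. c1 d y * (s powi d * g (\<lambda>v. s powi l v * y v)))
          (\<lambda>e. \<Sum>d\<in>{-N1..N1}. c1 d y * c2 (e - d) y)"
      proof (rule hexp_sum)
        fix d assume "d \<in> {-N1..N1}"
        hence "N2 + \<bar>d\<bar> \<le> N2 + \<bar>N1\<bar>" by auto
        thus "hexp (N2 + \<bar>N1\<bar>) (\<lambda>s. c1 d y * (s powi d * g (\<lambda>v. s powi l v * y v))) (\<lambda>e. c1 d y * c2 (e - d) y)"
          by (rule hexp_mono[OF hexp_cmult[OF hexp_shift[OF *(4)[OF y]]]])
      qed
      fix s :: real assume "0 < s"
      thus "(\<Sum>d\<in>{-N1..N1}. c1 d y * (s powi d * g (\<lambda>v. s powi l v * y v))) =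
          f (\<lambda>v. s powi l v * y v) * g (\<lambda>v. s powi l v * y v)"
        using *(2)[OF y] by (simp add: hexp_def sum_distrib_right mult.assoc)
    qed
  qed
next
  case (lau_cong f g)
  then obtain N c where "\<forall>d. c d \<in> lau V M" "\<And>y. pos y \<Longrightarrow> hexp N (\<lambda>s. f (\<lambda>v. s powi l v * y v)) (\<lambda>d. c d y)" by blast
  moreover from this(2) have "hexp N (\<lambda>s. g (\<lambda>v. s powi l v * y v)) (\<lambda>d. c d y)" if "pos y" for y
    by (rule hexp_cong) (use that lau_cong.hyps(2) pos_scale in auto)
  ultimately show ?case by (intro exI[of _ N] exI[of _ c]) simp
qed

section \<open>Divisibility and coprimality of Laurent polynomials\<close>

definition dvl :: "vx set \<Rightarrow> ((vx \<Rightarrow> real) \<Rightarrow> real) \<Rightarrow> ((vx \<Rightarrow> real) \<Rightarrow> real) \<Rightarrow> bool" where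
  "dvl V A C \<longleftrightarrow> (\<exists>E\<in>lau V V. \<forall>y. pos y \<longrightarrow> C y = A y * E y)"
text \<open>\<open>B\<close> is a non-zero-divisor modulo \<open>A\<close>. Cancellation of
  denominators uses exactly this form, so no factorization of Laurent polynomials is
  involved.\<close>

definition cop :: "vx set \<Rightarrow> ((vx \<Rightarrow> real) \<Rightarrow> real) \<Rightarrow> ((vx \<Rightarrow> real) \<Rightarrow> real) \<Rightarrow> bool" where
  "cop V A B \<longleftrightarrow> (\<forall>C\<in>lau V V. dvl V A (\<lambda>y. B y * C y) \<longrightarrow> dvl V A C)"
definition hom :: "(vx \<Rightarrow> int) \<Rightarrow> int \<Rightarrow> ((vx \<Rightarrow> real) \<Rightarrow> real) \<Rightarrow> bool" where
  "hom l h A \<longleftrightarrow> (\<forall>y s. pos y \<longrightarrow> 0 < s \<longrightarrow> A (\<lambda>v. s powi l v * y v) = s powi h * A y)"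

lemma dvlI: "E \<in> lau V V \<Longrightarrow> (\<And>y. pos y \<Longrightarrow> C y = A y * E y) \<Longrightarrow> dvl V A C"
  unfolding dvl_def by blast
lemma dvlE: "dvl V A C \<Longrightarrow> (\<And>E. E \<in> lau V V \<Longrightarrow> (\<And>y. pos y \<Longrightarrow> C y = A y * E y) \<Longrightarrow> thesis) \<Longrightarrow> thesis"
  unfolding dvl_def by blast

text \<open>Modulo \<open>A\<close> the function \<open>B\<close> is the unit \<open>W\<close>, with
  inverse \<open>W'\<close>.\<close>

lemma cop_unit:
  assumes "U \<in> lau V V" "W' \<in> lau V V" "\<And>y. pos y \<Longrightarrow> W y * W' y = 1" "\<And>y. pos y \<Longrightarrow> B y = W y + A y * U y"
  shows "cop V A B"
  unfolding cop_def
proof (intro ballI impI)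
  fix C assume C: "C \<in> lau V V" and d: "dvl V A (\<lambda>y. B y * C y)"
  from d obtain E where E: "E \<in> lau V V" "\<And>y. pos y \<Longrightarrow> B y * C y = A y * E y" by (rule dvlE) blast
  show "dvl V A C"
  proof (rule dvlI)
    show "(\<lambda>y. W' y * (E y - U y * C y)) \<in> lau V V" by (intro lau_mult lau_diff assms E C)
    fix y :: "vx \<Rightarrow> real" assume y: "pos y"
    have "A y * (W' y * (E y - U y * C y)) = W' y * (B y * C y - A y * U y * C y)" using E(2)[OF y] by (simp add: algebra_simps)
    also have "\<dots> = (W y * W' y) * C y" by (simp add: assms(4)[OF y] algebra_simps)
    finally show "C y = A y * (W' y * (E y - U y * C y))" by (simp add: assms(3)[OF y])
  qed
qed

text \<open>The lowest part \<open>U1\<close> of \<open>B\<close> is a unit and \<open>A\<close> is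
  homogeneous. Hence divisibility of the components of \<open>C\<close> propagates upwards from the
  lowest degree, each component being determined by lower ones modulo \<open>A\<close>.\<close>

lemma cop_graded_less:
  assumes A: "hom l h A" and U1: "hom l h1 U1" "U1 \<in> lau V V" and U2: "hom l h2 U2" "U2 \<in> lau V V"
    and W: "W1 \<in> lau V V" "\<And>y. pos y \<Longrightarrow> W1 y * U1 y = 1" and less: "h1 < h2"
    and B: "\<And>y. pos y \<Longrightarrow> B y = U1 y + U2 y"
  shows "cop V A B"
  unfolding cop_def
proof (intro ballI impI)
  fix C assume C: "C \<in> lau V V" and d: "dvl V A (\<lambda>y. B y * C y)"
  from d obtain E where E: "E \<in> lau V V" "\<And>y. pos y \<Longrightarrow> B y * C y = A y * E y" by (rule dvlE) blast
  obtain N c where c: "\<And>d. c d \<in> lau V V" "\<And>y. pos y \<Longrightarrow> hexp N (\<lambda>s. C (\<lambda>v. s powi l v * y v)) (\<lambda>d. c d y)"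
    using lau_hexp[OF C, of l] by blast
  obtain N' e where e: "\<And>d. e d \<in> lau V V" "\<And>y. pos y \<Longrightarrow> hexp N' (\<lambda>s. E (\<lambda>v. s powi l v * y v)) (\<lambda>d. e d y)"
    using lau_hexp[OF E(1), of l] by blast
  \<comment> \<open>The degree \<open>d\<close> component of \<open>B * C = A * E\<close>.\<close>
  have rel: "U1 y * c (d - h1) y + U2 y * c (d - h2) y = A y * e (d - h) y" if y: "pos y" for y d
  proof (rule hexp_unique[where a = "\<lambda>d. U1 y * c (d - h1) y + U2 y * c (d - h2) y" and b = "\<lambda>d. A y * e (d - h) y"])
    let ?K = "max (N + \<bar>h1\<bar>) (N + \<bar>h2\<bar>)"
    have m: "N + \<bar>h1\<bar> \<le> ?K" "N + \<bar>h2\<bar> \<le> ?K" by auto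
    show "hexp ?K (\<lambda>s. U1 y * (s powi h1 * C (\<lambda>v. s powi l v * y v)) + U2 y * (s powi h2 * C (\<lambda>v. s powi l v * y v)))
       (\<lambda>d. U1 y * c (d - h1) y + U2 y * c (d - h2) y)"
      by (rule hexp_add[OF hexp_mono[OF hexp_cmult[OF hexp_shift[OF c(2)[OF y], of h1]] m(1)]
            hexp_mono[OF hexp_cmult[OF hexp_shift[OF c(2)[OF y], of h2]] m(2)]])
    show "hexp (N' + \<bar>h\<bar>) (\<lambda>s. U1 y * (s powi h1 * C (\<lambda>v. s powi l v * y v)) + U2 y * (s powi h2 * C (\<lambda>v. s powi l v * y v)))
       (\<lambda>d. A y * e (d - h) y)"
    proof (rule hexp_cong)
      show "hexp (N' + \<bar>h\<bar>) (\<lambda>s. A y * (s powi h * E (\<lambda>v. s powi l v * y v))) (\<lambda>d. A y * e (d - h) y)"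
        by (rule hexp_cmult[OF hexp_shift[OF e(2)[OF y]]])
      fix s :: real assume s: "0 < s"
      let ?y = "\<lambda>v. s powi l v * y v"
      have "A ?y * E ?y = (U1 ?y + U2 ?y) * C ?y" using E(2)[OF pos_scale[OF y s]] B[OF pos_scale[OF y s]] by simp
      moreover have "A ?y = s powi h * A y" "U1 ?y = s powi h1 * U1 y" "U2 ?y = s powi h2 * U2 y"
        using A U1(1) U2(1) y s unfolding hom_def by blast+
      ultimately show "A y * (s powi h * E ?y) = U1 y * (s powi h1 * C ?y) + U2 y * (s powi h2 * C ?y)"
        by (simp add: algebra_simps)
    qed
  qed
  have "dvl V A (c d)" for d
  proof (induction "nat (d + N)" arbitrary: d rule: less_induct)
    case less
    show ?case
    proof (cases "d < - N")
      case True
      hence "c d y = 0" if "pos y" for y using c(2)[OF that] unfolding hexp_def by auto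
      thus ?thesis by (intro dvlI[of "\<lambda>y. 0"]) (auto intro: lau_const)
    next
      case False
      have dec: "dvl V A (c (d + h1 - h2))"
      proof (cases "d + h1 - h2 < - N")
        case True
        hence "c (d + h1 - h2) y = 0" if "pos y" for y using c(2)[OF that] unfolding hexp_def by auto
        thus ?thesis by (intro dvlI[of "\<lambda>y. 0"]) (auto intro: lau_const)
      next
        case F: False
        show ?thesis by (rule less.hyps) (use F False \<open>h1 < h2\<close> in linarith)
      qed
      then obtain F where F: "F \<in> lau V V" "\<And>y. pos y \<Longrightarrow> c (d + h1 - h2) y = A y * F y" by (rule dvlE) blast
      show ?thesis
      proof (rule dvlI)
        show "(\<lambda>y. W1 y * (e (d + h1 - h) y - U2 y * F y)) \<in> lau V V" by (intro lau_mult lau_diff W e U2 F)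
        fix y :: "vx \<Rightarrow> real" assume y: "pos y"
        have "A y * (W1 y * (e (d + h1 - h) y - U2 y * F y)) = W1 y * (A y * e (d + h1 - h) y - U2 y * c (d + h1 - h2) y)"
          using F(2)[OF y] by (simp add: algebra_simps)
        also have "A y * e (d + h1 - h) y - U2 y * c (d + h1 - h2) y = U1 y * c d y"
          using rel[OF y, of "d + h1"] by simp
        also have "W1 y * (U1 y * c d y) = (W1 y * U1 y) * c d y" by simp
        finally show "c d y = A y * (W1 y * (e (d + h1 - h) y - U2 y * F y))" using W(2)[OF y] by simp
      qed
    qed
  qed
  hence "\<forall>d. \<exists>F. F \<in> lau V V \<and> (\<forall>y. pos y \<longrightarrow> c d y = A y * F y)" unfolding dvl_def by blast
  from choice[OF this] obtain F where F: "\<And>d. F d \<in> lau V V" "\<And>d y. pos y \<Longrightarrow> c d y = A y * F d y" by blast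
  show "dvl V A C"
  proof (rule dvlI)
    show "(\<lambda>y. \<Sum>d\<in>{-N..N}. F d y) \<in> lau V V" by (intro lau_sum F)
    fix y :: "vx \<Rightarrow> real" assume y: "pos y"
    have "C y = (\<Sum>d\<in>{-N..N}. c d y)" using c(2)[OF y] unfolding hexp_def by (auto dest!: spec[of _ 1])
    thus "C y = A y * (\<Sum>d\<in>{-N..N}. F d y)" by (simp add: F(2)[OF y] sum_distrib_left)
  qed
qed

lemma cop_graded:
  assumes A: "hom l h A" and U1: "hom l h1 U1" "U1 \<in> lau V V" and U2: "hom l h2 U2" "U2 \<in> lau V V"
    and W1: "W1 \<in> lau V V" "\<And>y. pos y \<Longrightarrow> W1 y * U1 y = 1"
    and W2: "W2 \<in> lau V V" "\<And>y. pos y \<Longrightarrow> W2 y * U2 y = 1" and ne: "h1 \<noteq> h2"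
    and B: "\<And>y. pos y \<Longrightarrow> B y = U1 y + U2 y"
  shows "cop V A B"
proof (cases "h1 < h2")
  case True
  show ?thesis by (rule cop_graded_less[OF A U1 U2 W1 True B])
next
  case False
  show ?thesis by (rule cop_graded_less[OF A U2 U1 W2, of B]) (use False ne B in \<open>auto simp: add.commute\<close>)
qed

lemma cop_mult: "cop V A B1 \<Longrightarrow> cop V A B2 \<Longrightarrow> B2 \<in> lau V V \<Longrightarrow> cop V A (\<lambda>y. B1 y * B2 y)"
  unfolding cop_def
proof (intro ballI impI)
  fix C assume *: "\<forall>C\<in>lau V V. dvl V A (\<lambda>y. B1 y * C y) \<longrightarrow> dvl V A C" "\<forall>C\<in>lau V V. dvl V A (\<lambda>y. B2 y * C y) \<longrightarrow> dvl V A C"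
    "B2 \<in> lau V V" "C \<in> lau V V" "dvl V A (\<lambda>y. B1 y * B2 y * C y)"
  have "dvl V A (\<lambda>y. B1 y * (B2 y * C y))" using *(5) by (simp add: mult.assoc)
  hence "dvl V A (\<lambda>y. B2 y * C y)" by (rule *(1)[rule_format, OF lau_mult[OF *(3,4)]])
  thus "dvl V A C" using *(2,4) by blast
qed

lemma cop_power: "cop V A B \<Longrightarrow> B \<in> lau V V \<Longrightarrow> cop V A (\<lambda>y. B y ^ n)"
proof (induction n)
  case 0
  show ?case by (simp add: cop_def)
next
  case (Suc n)
  thus ?case using cop_mult[of V A B "\<lambda>y. B y ^ n"] by (simp add: lau_power)
qed

text \<open>\<open>A\<close> divides \<open>B ^ m * (f * A ^ Suc n)\<close> because
  \<open>f * B ^ m\<close> is Laurent. Coprimality drops the power of \<open>B\<close>, and one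
  power of \<open>A\<close> can be cancelled.\<close>

lemma cop_cancel:
  assumes A: "A \<in> lau V V" "\<And>y. pos y \<Longrightarrow> 0 < A y" and B: "B \<in> lau V V" "cop V A B"
    and f: "(\<lambda>y. f y * A y ^ n) \<in> lau V V" "(\<lambda>y. f y * B y ^ m) \<in> lau V V"
  shows "f \<in> lau V V"
  using f(1)
proof (induction n)
  case (Suc n)
  have "dvl V A (\<lambda>y. B y ^ m * (f y * A y ^ Suc n))"
    by (rule dvlI[of "\<lambda>y. (f y * B y ^ m) * A y ^ n"], intro lau_mult[OF f(2)] lau_power A) simp
  hence "dvl V A (\<lambda>y. f y * A y ^ Suc n)"
    by (rule cop_power[OF B(2,1), of m, unfolded cop_def, rule_format, OF Suc.prems])
  then obtain E where E: "E \<in> lau V V" "\<And>y. pos y \<Longrightarrow> f y * A y ^ Suc n = A y * E y" by (rule dvlE) blast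
  have "E y = f y * A y ^ n" if "pos y" for y
    using E(2)[OF that] A(2)[OF that] by simp
  thus ?case by (intro Suc.IH) (rule lau_cong[OF E(1)])
qed simp

text \<open>Substituted values outside \<open>S\<close> are Laurent units, so only those indexed by
  \<open>S\<close> contribute to the denominator.\<close>

lemma lau_compose:
  assumes F: "F \<in> lau V V" and V: "finite V" "S \<subseteq> V" and z: "\<And>v. v \<in> V \<Longrightarrow> z v \<in> lau V V"
    and unit: "\<And>v. v \<in> V - S \<Longrightarrow> (\<lambda>y. inverse (z v y)) \<in> lau V V"
    and zpos: "\<And>y. pos y \<Longrightarrow> pos (\<lambda>v. z v y)"
  shows "\<exists>N. (\<lambda>y. F (\<lambda>v. z v y) * (\<Prod>v\<in>S. z v y) ^ N) \<in> lau V V"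
  using F
proof (induction rule: lau.induct)
  case (lau_const c)
  show ?case by (rule exI[of _ 0]) (auto intro: lau.lau_const)
next
  case (lau_var v)
  show ?case by (rule exI[of _ 0]) (use z lau_var in simp)
next
  case (lau_inv v)
  show ?case
  proof (cases "v \<in> S")
    case True
    have fS: "finite S" using V finite_subset by blast
    have "(\<lambda>y. \<Prod>v\<in>S-{v}. z v y) \<in> lau V V" by (rule lau_prod) (use z V in auto)
    hence "(\<lambda>y. inverse (z v y) * (\<Prod>v\<in>S. z v y) ^ 1) \<in> lau V V"
    proof (rule lau_cong)
      fix y :: "vx \<Rightarrow> real" assume "pos y"
      hence "z v y > 0" using zpos by (auto simp: pos_def)
      thus "(\<Prod>v\<in>S-{v}. z v y) = inverse (z v y) * (\<Prod>v\<in>S. z v y) ^ 1"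
        using True fS by (simp add: prod.remove)
    qed
    thus ?thesis by blast
  next
    case False
    show ?thesis by (rule exI[of _ 0]) (use unit lau_inv False in simp)
  qed
next
  case (lau_add f g)
  then obtain N1 N2 where *: "(\<lambda>y. f (\<lambda>v. z v y) * (\<Prod>v\<in>S. z v y) ^ N1) \<in> lau V V"
    "(\<lambda>y. g (\<lambda>v. z v y) * (\<Prod>v\<in>S. z v y) ^ N2) \<in> lau V V" by blast
  have D: "(\<lambda>y. \<Prod>v\<in>S. z v y) \<in> lau V V" by (rule lau_prod) (use z V in auto)
  have "(\<lambda>y. (f (\<lambda>v. z v y) * (\<Prod>v\<in>S. z v y) ^ N1) * (\<Prod>v\<in>S. z v y) ^ N2
      + (g (\<lambda>v. z v y) * (\<Prod>v\<in>S. z v y) ^ N2) * (\<Prod>v\<in>S. z v y) ^ N1) \<in> lau V V"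
    by (intro lau.lau_add lau.lau_mult * lau_power D)
  thus ?case by (intro exI[of _ "N1 + N2"]) (simp add: power_add algebra_simps)
next
  case (lau_mult f g)
  then obtain N1 N2 where *: "(\<lambda>y. f (\<lambda>v. z v y) * (\<Prod>v\<in>S. z v y) ^ N1) \<in> lau V V"
    "(\<lambda>y. g (\<lambda>v. z v y) * (\<Prod>v\<in>S. z v y) ^ N2) \<in> lau V V" by blast
  have "(\<lambda>y. (f (\<lambda>v. z v y) * (\<Prod>v\<in>S. z v y) ^ N1) * (g (\<lambda>v. z v y) * (\<Prod>v\<in>S. z v y) ^ N2)) \<in> lau V V"
    by (intro lau.lau_mult *)
  thus ?case by (intro exI[of _ "N1 + N2"]) (simp add: power_add algebra_simps)
next
  case (lau_cong f g)
  then obtain N where "(\<lambda>y. f (\<lambda>v. z v y) * (\<Prod>v\<in>S. z v y) ^ N) \<in> lau V V" by blast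
  hence "(\<lambda>y. g (\<lambda>v. z v y) * (\<Prod>v\<in>S. z v y) ^ N) \<in> lau V V"
    by (rule lau.lau_cong) (use lau_cong.hyps(2) zpos in simp)
  thus ?case by blast
qed

lemma hom_mon: "hom l (\<Sum>v\<in>V. e v * l v) (mon V e)"
  unfolding hom_def by (auto simp: mon_scale)
lemma hom_add: "hom l h f \<Longrightarrow> hom l h g \<Longrightarrow> hom l h (\<lambda>y. f y + g y)"
  unfolding hom_def by (simp add: algebra_simps)
lemma hom_mult: "hom l h f \<Longrightarrow> hom l k g \<Longrightarrow> hom l (h + k) (\<lambda>y. f y * g y)"
  unfolding hom_def by (simp add: power_int_add)
lemma hom_inv: "hom l (- l v) (\<lambda>y. inverse (y v))"
  unfolding hom_def by (simp add: power_int_minus)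
subsection \<open>Three consecutive mutations at two vertices\<close>

text \<open>The seeds met when mutating at \<open>i\<close>, \<open>j\<close>, \<open>i\<close>. The
  new values \<open>a\<close>, \<open>x2\<close>, \<open>x3\<close> produced by the three steps are
  regarded as functions of the starting point.\<close>

locale rank2 =
  fixes V :: "vx set" and B :: "vx \<Rightarrow> vx \<Rightarrow> int" and i j :: vx
  assumes V: "finite V" "i \<in> V" "j \<in> V" and ij: "i \<noteq> j" and skew: "skew B"
begin

definition "y1 y = mutv V i B y"
definition "y2 y = mutv V j (mutB i B) (y1 y)"
definition "y3 y = mutv V i (mutB j (mutB i B)) (y2 y)"
definition "a y = y1 y i"
definition "x2 y = y2 y j"
definition "x3 y = y3 y i"

lemma y1: "y1 y = y(i := a y)" by (simp add: y1_def a_def mutv_def)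
lemma y2: "y2 y = y(i := a y, j := x2 y)" by (simp add: y2_def x2_def mutv_def y1)
lemma y3: "y3 y = y(i := x3 y, j := x2 y)" using ij by (simp add: y3_def x3_def mutv_def y2 fun_upd_twist)

lemma a_eq: "a y = exch V i B y / y i" by (simp add: a_def y1_def mutv_def)
lemma x2_eq: "x2 y = exch V j (mutB i B) (y(i := a y)) / y j"
  using ij by (simp add: x2_def y2_def y1 mutv_def)
lemma x3_eq: "x3 y = exch V i (mutB j (mutB i B)) (y(i := a y, j := x2 y)) / a y"
  using ij by (simp add: x3_def y3_def y2 mutv_def)

lemma pos_a: "pos y \<Longrightarrow> 0 < a y" using mutv_pos[of y V i B] by (simp add: a_def y1_def pos_def)
lemma pos_y3: "pos y \<Longrightarrow> pos (y3 y)" by (simp add: y3_def y2_def y1_def mutv_pos)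

lemma a_lau: "a \<in> lau V V"
  unfolding a_eq[abs_def] divide_inverse using V by (intro lau_mult lau_exch lau_inv)

text \<open>The two exchange monomials at \<open>i\<close> have the same degree when the grading is
  orthogonal to row \<open>i\<close>.\<close>

lemma hom_a:
  assumes "(\<Sum>v\<in>V. B i v * l v) = 0"
  shows "\<exists>h. hom l h a"
proof -
  have e: "(\<Sum>v\<in>V. max (B i v) 0 * l v) - (\<Sum>v\<in>V. max (- B i v) 0 * l v) = (\<Sum>v\<in>V. B i v * l v)"
    unfolding sum_subtractf[symmetric] by (rule sum.cong) (auto simp: max_def)
  have "hom l (\<Sum>v\<in>V. max (B i v) 0 * l v) (exch V i B)"
    unfolding exch_mon[abs_def] using hom_mon[of l "\<lambda>v. max (B i v) 0" V] hom_mon[of l "\<lambda>v. max (- B i v) 0" V] e assms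
    by (intro hom_add) auto
  from hom_mult[OF this hom_inv] show ?thesis unfolding a_eq[abs_def] divide_inverse by blast
qed

end

definition good3 :: "vx set \<Rightarrow> (vx \<Rightarrow> vx \<Rightarrow> int) \<Rightarrow> vx \<Rightarrow> vx \<Rightarrow> bool" where
  "good3 V B i j \<longleftrightarrow> rank2.x2 V B i j \<in> lau V V \<and> rank2.x3 V B i j \<in> lau V V
     \<and> cop V (rank2.a V B i) (rank2.x2 V B i j) \<and> cop V (rank2.a V B i) (rank2.x3 V B i j)"

context rank2
begin

text \<open>The two mutations commute, so \<open>x3\<close> is the old value at \<open>i\<close>, a
  unit. The grading makes \<open>a\<close> homogeneous and gives the two monomials of
  \<open>x2\<close> degrees that differ by 1.\<close>

lemma good3_zero:
  assumes b: "B i j = 0" and l: "(\<Sum>v\<in>V. B i v * l v) = 0" "(\<Sum>v\<in>V. B j v * l v) = 1"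
  shows "good3 V B i j"
proof -
  have b': "B j i = 0" using b skewD[OF skew, of j i] by simp
  have d: "B i i = 0" "B j j = 0" using skew_diag[OF skew] by auto
  have x2: "x2 y = mon V (\<lambda>v. max (B j v) 0) y * inverse (y j) + mon V (\<lambda>v. max (- B j v) 0) y * inverse (y j)" for y
  proof -
    have "exch V j (mutB i B) (y(i := a y)) = exch V j B y"
      by (rule exch_cong) (use b' ij in \<open>auto simp: mutB_alt\<close>)
    thus ?thesis unfolding x2_eq by (simp add: exch_mon[of V j B] divide_inverse distrib_right)
  qed
  have x3: "x3 y = y i" if y: "pos y" for y
  proof -
    have "exch V i (mutB j (mutB i B)) (y(i := a y, j := x2 y)) = exch V i B y"
      by (rule exch_neg) (use b d ij in \<open>auto simp: mutB_alt\<close>)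
    moreover have "exch V i B y > 0" "y i > 0" using exch_pos[OF y] y by (auto simp: pos_def)
    ultimately show ?thesis unfolding x3_eq a_eq by simp
  qed
  have U: "(\<lambda>y. mon V e y * inverse (y j)) \<in> lau V V" for e
    by (intro lau_mult lau_mon lau_inv V)
  have W: "(\<lambda>y. mon V (\<lambda>v. - e v) y * y j) \<in> lau V V" for e
    by (intro lau_mult lau_mon lau_var V)
  have UW: "(mon V (\<lambda>v. - e v) y * y j) * (mon V e y * inverse (y j)) = 1" if "pos y" for e y
    using mon_uminus[OF that, of V e] that by (simp add: pos_def less_imp_neq[symmetric] field_simps)
  obtain h where h: "hom l h a" using hom_a l by blast
  have H: "hom l ((\<Sum>v\<in>V. e v * l v) + - l j) (\<lambda>y. mon V e y * inverse (y j))" for e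
    by (rule hom_mult[OF hom_mon hom_inv])
  have e: "(\<Sum>v\<in>V. max (B j v) 0 * l v) - (\<Sum>v\<in>V. max (- B j v) 0 * l v) = (\<Sum>v\<in>V. B j v * l v)"
    unfolding sum_subtractf[symmetric] by (rule sum.cong) (auto simp: max_def)
  have "cop V a x2"
    by (rule cop_graded[OF h H U H U W UW W UW]) (use e l x2 in auto)
  moreover have "cop V a x3"
    by (rule cop_unit[of "\<lambda>y. 0" V "\<lambda>y. inverse (y i)" "\<lambda>y. y i"])
      (use V x3 in \<open>auto intro: lau_var lau_inv lau_const simp: pos_def less_imp_neq[symmetric]\<close>)
  moreover have "x2 \<in> lau V V" unfolding x2[abs_def] by (intro lau_add U)
  moreover have "x3 \<in> lau V V" by (rule lau_cong[OF lau_var[OF V(2)]]) (simp add: x3)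
  ultimately show ?thesis by (simp add: good3_def)
qed

text \<open>Here the exchange relations are explicit. Modulo \<open>a\<close>, the value
  \<open>x2\<close> is the unit \<open>r / y j\<close>. The numerator of \<open>x3\<close> turns out
  to be divisible by \<open>a\<close>; for \<open>n\<close> at least 2 the quotient is again a unit
  modulo \<open>a\<close>, and for \<open>n = 1\<close> it is a sum of two monomials told apart by
  their degree in \<open>y i\<close>.\<close>

lemma good3_pos:
  assumes b: "B i j > 0"
  shows "good3 V B i j"
proof -
  have d: "B i i = 0" "B j j = 0" and b': "B j i = - B i j" using skew_diag[OF skew] skewD[OF skew, of j i] by auto
  define n where "n = nat (B i j)"
  define B1 where "B1 = mutB i B"
  define B2 where "B2 = mutB j B1"
  define u where "u = mon V (\<lambda>v. if v = j then 0 else max (B i v) 0)"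
  define w where "w = mon V (\<lambda>v. if v = j then 0 else max (- B i v) 0)"
  define s where "s = mon V (\<lambda>v. if v = i then 0 else max (B1 j v) 0)"
  define r where "r = mon V (\<lambda>v. if v = i then 0 else max (- B1 j v) 0)"
  define p where "p = mon V (\<lambda>v. if v = j then 0 else max (B2 i v) 0)"
  define m where "m = mon V (\<lambda>v. if v = j then 0 else max (- B2 i v) 0)"
  have B1: "B1 j i = B i j" "B1 i j = - B i j" "B1 j j = 0" "\<And>v. B1 i v = - B i v"
    using b' d by (auto simp: B1_def mutB_alt ij[symmetric])
  have B2: "B2 i j = B i j" and B2': "v \<noteq> j \<Longrightarrow> B2 i v = - B i v - B i j * max (- B1 j v) 0" for v
    using B1 ij b by (auto simp: B2_def mutB_alt)
  have B2i: "B2 i i = 0" using B2'[of i] B1 d ij b by simp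
  have n: "n > 0" "int n = B i j" using b by (auto simp: n_def)
  have a: "a y = (y j ^ n * u y + w y) / y i" for y
    unfolding a_eq u_def w_def n_def by (subst exch_split[of V j B i]) (use V b in simp_all)
  have x2: "x2 y = (a y ^ n * s y + r y) / y j" for y
  proof -
    have "B1 j i > 0" using B1 b by simp
    note * = exch_split[of V i B1 j, OF V(1,2) this, of "y(i := a y)"]
    show ?thesis unfolding x2_eq B1_def[symmetric] * s_def r_def
      by (simp add: mon_upd B1 n_def)
  qed
  have x3: "x3 y = (x2 y ^ n * p y + m y) / a y" for y
  proof -
    have "B2 i j > 0" using B2 b by simp
    note * = exch_split[of V j B2 i, OF V(1,3) this, of "y(i := a y, j := x2 y)"]
    show ?thesis unfolding x3_eq B1_def[symmetric] B2_def[symmetric] * p_def m_def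
      using ij by (simp add: mon_upd B2 B2i n_def)
  qed
  \<comment> \<open>The exponents of the third exchange relation are those of the first with
    reversed signs, corrected by \<open>r\<close>. This identity turns the terms of the numerator of
    \<open>x3\<close> that are not visibly multiples of \<open>a\<close> into a multiple of
    \<open>a * y i\<close>.\<close>
  have pm: "p y * u y * r y ^ n = m y * w y" if y: "pos y" for y
  proof -
    have "p y * u y * r y ^ n = mon V (\<lambda>v. ((if v = j then 0 else max (B2 i v) 0) + (if v = j then 0 else max (B i v) 0))
        + int n * (if v = i then 0 else max (- B1 j v) 0)) y"
      unfolding p_def u_def r_def mon_add[OF y] mon_power[OF y] ..
    also have "\<dots> = mon V (\<lambda>v. (if v = j then 0 else max (- B2 i v) 0) + (if v = j then 0 else max (- B i v) 0)) y"
    proof (rule arg_cong[of _ _ "\<lambda>e. mon V e y"], rule ext)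
      fix v
      show "(if v = j then 0 else max (B2 i v) 0) + (if v = j then 0 else max (B i v) 0)
        + int n * (if v = i then 0 else max (- B1 j v) 0) = (if v = j then 0 else max (- B2 i v) 0) + (if v = j then 0 else max (- B i v) 0)"
      proof (cases "v = j \<or> v = i")
        case True thus ?thesis using B1 B2i d b ij by auto
      next
        case False
        have "max x 0 - max (- x) 0 = x" for x :: int by (auto simp: max_def)
        from this[of "B2 i v"] this[of "B i v"] B2'[of v] False show ?thesis by (simp add: n)
      qed
    qed
    also have "\<dots> = m y * w y" unfolding m_def w_def mon_add[OF y] ..
    finally show ?thesis .
  qed
  \<comment> \<open>The quotient of \<open>(a y ^ n * s y + r y) ^ n - r y ^ n\<close> by
    \<open>a y ^ n * s y\<close>, written as a geometric sum.\<close>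
  define T where "T = (\<lambda>y. \<Sum>k<n. r y ^ (n - Suc k) * (a y ^ n * s y + r y) ^ k)"
  obtain n' where n': "n = Suc n'" using n(1) by (cases n) auto
  define K where "K = (\<lambda>y. m y * inverse (u y) * inverse (r y) ^ n * inverse (y j) ^ n)"
  have mp: "0 < mon V e y" if "pos y" for e y by (rule mon_pos[OF that])
  have x3': "x3 y = K y * (r y ^ n * y i + w y * (a y ^ n' * s y * T y))" if y: "pos y" for y
  proof -
    have ps: "u y > 0" "r y > 0" "y j > 0" "a y > 0" "y i > 0"
      using mp[OF y] y pos_a[OF y] unfolding u_def r_def by (auto simp: pos_def)
    have "(a y ^ n * s y + r y) ^ n - r y ^ n = (a y ^ n * s y) * T y"
      unfolding T_def using power_diff_sumr2[of "a y ^ n * s y + r y" n "r y"] by simp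
    hence t: "(a y ^ n * s y + r y) ^ n = r y ^ n + (a y ^ n * s y) * T y" by simp
    have ay: "a y * y i = y j ^ n * u y + w y" unfolding a using ps by simp
    have "x3 y * a y * (u y * r y ^ n * y j ^ n) = (x2 y ^ n * y j ^ n) * (p y * u y * r y ^ n) + m y * u y * r y ^ n * y j ^ n"
      unfolding x3 using ps by (simp add: field_simps)
    also have "x2 y ^ n * y j ^ n = (a y ^ n * s y + r y) ^ n"
      unfolding x2 using ps by (simp add: power_divide)
    also have "(a y ^ n * s y + r y) ^ n * (p y * u y * r y ^ n) + m y * u y * r y ^ n * y j ^ n
        = m y * (w y * ((a y ^ n * s y) * T y) + r y ^ n * (y j ^ n * u y + w y))"
      unfolding t pm[OF y] by (simp add: algebra_simps)
    also have "\<dots> = a y * (m y * (r y ^ n * y i + w y * (a y ^ n' * s y * T y)))"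
      by (simp only: ay[symmetric]) (simp add: n' algebra_simps)
    finally have "x3 y * (u y * r y ^ n * y j ^ n) = m y * (r y ^ n * y i + w y * (a y ^ n' * s y * T y))"
      using ps by simp
    moreover have "K y * (u y * r y ^ n * y j ^ n) = m y"
      unfolding K_def using ps by (simp add: field_simps)
    ultimately have "x3 y * (u y * r y ^ n * y j ^ n) = (K y * (r y ^ n * y i + w y * (a y ^ n' * s y * T y))) * (u y * r y ^ n * y j ^ n)"
      by (simp add: mult.commute mult.left_commute)
    thus ?thesis using ps by simp
  qed
  have inv_mon: "(\<lambda>y. inverse (mon V e y)) \<in> lau V V" for e
  proof (rule lau_cong[OF lau_mon[of V "\<lambda>v. - e v"]])
    fix y assume "pos y"
    hence "mon V e y * mon V (\<lambda>v. - e v) y = 1" using mon_uminus[of y V e] by (simp add: mult.commute)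
    from inverse_unique[OF this] show "mon V (\<lambda>v. - e v) y = inverse (mon V e y)" ..
  qed
  have L: "u \<in> lau V V" "w \<in> lau V V" "s \<in> lau V V" "r \<in> lau V V" "m \<in> lau V V"
    "(\<lambda>y. inverse (u y)) \<in> lau V V" "(\<lambda>y. inverse (w y)) \<in> lau V V" "(\<lambda>y. inverse (r y)) \<in> lau V V"
    "(\<lambda>y. inverse (m y)) \<in> lau V V" "(\<lambda>y. inverse (s y)) \<in> lau V V"
    unfolding u_def w_def s_def r_def m_def by (auto intro: lau_mon inv_mon)
  have Y: "(\<lambda>y. y i) \<in> lau V V" "(\<lambda>y. y j) \<in> lau V V" "(\<lambda>y. inverse (y i)) \<in> lau V V" "(\<lambda>y. inverse (y j)) \<in> lau V V"
    using V by (auto intro: lau_var lau_inv lau_const)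
  have KL: "K \<in> lau V V" unfolding K_def by (intro lau_mult lau_power L Y)
  have KI: "(\<lambda>y. inverse (m y) * u y * r y ^ n * y j ^ n) \<in> lau V V" by (intro lau_mult lau_power L Y)
  have KK: "K y * (inverse (m y) * u y * r y ^ n * y j ^ n) = 1" and Kpos: "K y > 0" if y: "pos y" for y
  proof -
    have ps: "u y > 0" "r y > 0" "y j > 0" "m y > 0"
      using mp[OF y] y unfolding u_def r_def m_def by (auto simp: pos_def)
    show "K y * (inverse (m y) * u y * r y ^ n * y j ^ n) = 1" "K y > 0"
      unfolding K_def using ps by (auto simp: field_simps)
  qed
  have TL: "T \<in> lau V V" unfolding T_def by (intro lau_sum lau_mult lau_power lau_add L a_lau)
  have x2L: "x2 \<in> lau V V" unfolding x2[abs_def] divide_inverse by (intro lau_mult lau_add lau_power L Y a_lau)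
  have x3L: "x3 \<in> lau V V"
    by (rule lau_cong[of "\<lambda>y. K y * (r y ^ n * y i + w y * (a y ^ n' * s y * T y))"])
      (auto intro!: lau_mult lau_add lau_power L Y a_lau KL TL simp: x3')
  have c2: "cop V a x2"
  proof (rule cop_unit[where W = "\<lambda>y. r y * inverse (y j)" and W' = "\<lambda>y. inverse (r y) * y j" and U = "\<lambda>y. a y ^ n' * s y * inverse (y j)"])
    show "(\<lambda>y. a y ^ n' * s y * inverse (y j)) \<in> lau V V" by (intro lau_mult lau_power L Y a_lau)
    show "(\<lambda>y. inverse (r y) * y j) \<in> lau V V" by (intro lau_mult L Y)
    fix y :: "vx \<Rightarrow> real" assume y: "pos y"
    have ps: "r y > 0" "y j > 0" using mp[OF y] y unfolding r_def by (auto simp: pos_def)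
    thus "r y * inverse (y j) * (inverse (r y) * y j) = 1" by (simp add: field_simps)
    show "x2 y = r y * inverse (y j) + a y * (a y ^ n' * s y * inverse (y j))"
      unfolding x2 n' by (simp add: divide_inverse algebra_simps)
  qed
  have c3: "cop V a x3"
  proof (cases n')
    case (Suc n'')
    show ?thesis
    proof (rule cop_unit[where W = "\<lambda>y. K y * (r y ^ n * y i)" and U = "\<lambda>y. K y * (w y * (a y ^ n'' * s y * T y))"
        and W' = "\<lambda>y. (inverse (m y) * u y * r y ^ n * y j ^ n) * (inverse (r y) ^ n * inverse (y i))"])
      show "(\<lambda>y. K y * (w y * (a y ^ n'' * s y * T y))) \<in> lau V V" by (intro lau_mult lau_power L Y a_lau TL KL)
      show "(\<lambda>y. (inverse (m y) * u y * r y ^ n * y j ^ n) * (inverse (r y) ^ n * inverse (y i))) \<in> lau V V"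
        by (intro lau_mult lau_power L Y)
      fix y :: "vx \<Rightarrow> real" assume y: "pos y"
      have ps: "r y > 0" "y i > 0" using mp[OF y] y unfolding r_def by (auto simp: pos_def)
      have "K y * (r y ^ n * y i) * ((inverse (m y) * u y * r y ^ n * y j ^ n) * (inverse (r y) ^ n * inverse (y i)))
        = (K y * (inverse (m y) * u y * r y ^ n * y j ^ n)) * ((r y * inverse (r y)) ^ n * (y i * inverse (y i)))"
        by (simp only: power_mult_distrib mult_ac)
      thus "K y * (r y ^ n * y i) * ((inverse (m y) * u y * r y ^ n * y j ^ n) * (inverse (r y) ^ n * inverse (y i))) = 1"
        using KK[OF y] ps by simp
      show "x3 y = K y * (r y ^ n * y i) + a y * (K y * (w y * (a y ^ n'' * s y * T y)))"
        unfolding x3'[OF y] Suc by (simp add: algebra_simps)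
    qed
  next
    case 0
    \<comment> \<open>The degree in \<open>y i\<close>; \<open>a\<close> is homogeneous for it
      because \<open>B i i = 0\<close>.\<close>
    define l where "l = (\<lambda>v. if v = i then 1 else 0 :: int)"
    have sl: "(\<Sum>v\<in>V. e v * l v) = e i" for e using V by (simp add: l_def if_distrib cong: if_cong)
    have h0: "hom l 0 (mon V e)" if "e i = 0" for e using hom_mon[of l e V] that by (simp add: sl)
    have hi0: "hom l 0 (\<lambda>y. inverse (mon V e y))" if "e i = 0" for e using h0[of e] that by (simp add: hom_def)
    have hu: "hom l 0 u" "hom l 0 w" "hom l 0 s" "hom l 0 r" "hom l 0 m" "hom l 0 (\<lambda>y. inverse (u y))" "hom l 0 (\<lambda>y. inverse (r y))"
      unfolding u_def w_def s_def r_def m_def by (auto intro!: h0 hi0 simp: d B2i)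
    have hj: "hom l 0 (\<lambda>y. inverse (y j))" using hom_inv[of l j] ij by (simp add: l_def)
    have hy: "hom l 1 (\<lambda>y. y i)" by (simp add: hom_def l_def)
    have hK: "hom l 0 K" unfolding K_def n' 0 using hom_mult[OF hom_mult[OF hom_mult[OF hu(5,6)] hu(7)] hj] by simp
    have T1: "T y = 1" for y unfolding T_def n' 0 by simp
    obtain h where h: "hom l h a" using hom_a[of l] sl[of "B i"] d by auto
    show ?thesis
    proof (rule cop_graded[where ?U1.0 = "\<lambda>y. K y * (r y * y i)" and ?U2.0 = "\<lambda>y. K y * (w y * s y)" and ?h1.0 = 1 and ?h2.0 = 0
        and ?W1.0 = "\<lambda>y. (inverse (m y) * u y * r y ^ n * y j ^ n) * (inverse (r y) * inverse (y i))"
        and ?W2.0 = "\<lambda>y. (inverse (m y) * u y * r y ^ n * y j ^ n) * (inverse (w y) * inverse (s y))", OF h])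
      show "hom l 1 (\<lambda>y. K y * (r y * y i))" using hom_mult[OF hK hom_mult[OF hu(4) hy]] by simp
      show "hom l 0 (\<lambda>y. K y * (w y * s y))" using hom_mult[OF hK hom_mult[OF hu(2,3)]] by simp
      show "(\<lambda>y. K y * (r y * y i)) \<in> lau V V" "(\<lambda>y. K y * (w y * s y)) \<in> lau V V"
        "(\<lambda>y. (inverse (m y) * u y * r y ^ n * y j ^ n) * (inverse (r y) * inverse (y i))) \<in> lau V V"
        "(\<lambda>y. (inverse (m y) * u y * r y ^ n * y j ^ n) * (inverse (w y) * inverse (s y))) \<in> lau V V"
        by (intro lau_mult lau_power L Y KL)+
      fix y :: "vx \<Rightarrow> real" assume y: "pos y"
      have ps: "r y > 0" "w y > 0" "s y > 0" "y i > 0" using mp[OF y] y unfolding r_def w_def s_def by (auto simp: pos_def)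
      have q: "(X * (c * d)) * (K y * (e * f)) = (K y * X) * ((c * e) * (d * f))" for X c d e f by (simp add: algebra_simps)
      show "(inverse (m y) * u y * r y ^ n * y j ^ n) * (inverse (r y) * inverse (y i)) * (K y * (r y * y i)) = 1"
        unfolding q KK[OF y] using ps by simp
      show "(inverse (m y) * u y * r y ^ n * y j ^ n) * (inverse (w y) * inverse (s y)) * (K y * (w y * s y)) = 1"
        unfolding q KK[OF y] using ps by simp
      show "x3 y = K y * (r y * y i) + K y * (w y * s y)"
        unfolding x3'[OF y] T1 n' 0 by (simp add: algebra_simps)
    qed simp
  qed
  show ?thesis using x2L x3L c2 c3 by (simp add: good3_def)
qed

end

lemma rank2_uminus:
  "rank2.a V (\<lambda>i j. - B i j) i = rank2.a V B i" "rank2.x2 V (\<lambda>i j. - B i j) i j = rank2.x2 V B i j"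
  "rank2.x3 V (\<lambda>i j. - B i j) i j = rank2.x3 V B i j"
  if "rank2 V B i j" "rank2 V (\<lambda>i j. - B i j) i j"
proof -
  note d = rank2.y1_def[OF that(1)] rank2.y1_def[OF that(2)] rank2.y2_def[OF that(1)] rank2.y2_def[OF that(2)]
    rank2.y3_def[OF that(1)] rank2.y3_def[OF that(2)] mutB_uminus mutv_uminus
  show "rank2.a V (\<lambda>i j. - B i j) i = rank2.a V B i"
    by (rule ext) (simp only: rank2.a_def[OF that(1)] rank2.a_def[OF that(2)] d)
  show "rank2.x2 V (\<lambda>i j. - B i j) i j = rank2.x2 V B i j"
    by (rule ext) (simp only: rank2.x2_def[OF that(1)] rank2.x2_def[OF that(2)] d)
  show "rank2.x3 V (\<lambda>i j. - B i j) i j = rank2.x3 V B i j"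
    by (rule ext) (simp only: rank2.x3_def[OF that(1)] rank2.x3_def[OF that(2)] d)
qed

lemma good3:
  assumes V: "finite V" "i \<in> V" "j \<in> V" and M: "i \<in> M" "j \<in> M" and ij: "i \<noteq> j" and s: "skew B" and f: "fullrank V M B"
  shows "good3 V B i j"
proof -
  interpret rank2 V B i j by unfold_locales (use assms in auto)
  consider "B i j = 0" | "B i j > 0" | "B i j < 0" by linarith
  thus ?thesis
  proof cases
    case 1
    \<comment> \<open>For commuting mutations the separating grading is supplied by full
      rank.\<close>
    have "\<exists>l. \<forall>k\<in>M. (\<Sum>v\<in>V. B k v * l v) = (if k = j then 1 else 0)"
      by (rule f[unfolded fullrank_def, rule_format])
    then obtain l where "\<And>k. k \<in> M \<Longrightarrow> (\<Sum>v\<in>V. B k v * l v) = (if k = j then 1 else 0)" by blast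
    thus ?thesis using M ij by (intro good3_zero[OF 1, of l]) auto
  next
    case 2 thus ?thesis by (rule good3_pos)
  next
    case 3
    have s': "skew (\<lambda>i j. - B i j)" unfolding skew_def
    proof (intro allI)
      show "- B i j = - (- B j i)" for i j by (subst skewD[OF s, of i j]) simp
    qed
    interpret n: rank2 V "\<lambda>i j. - B i j" i j by (rule rank2.intro[OF V ij s'])
    have "good3 V (\<lambda>i j. - B i j) i j" by (rule n.good3_pos) (use 3 in simp)
    thus ?thesis unfolding good3_def rank2_uminus[OF rank2_axioms n.rank2_axioms] .
  qed
qed

subsection \<open>The Laurent phenomenon\<close>

text \<open>For a sequence \<open>i\<close>, \<open>j\<close>, \<open>rest\<close> with distinct
  \<open>i\<close> and \<open>j\<close>, the seed after \<open>i\<close> and the seed after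
  \<open>i\<close>, \<open>j\<close>, \<open>i\<close> both lead to the target by a list shorter by
  one: mutating once more at \<open>i\<close> undoes the third step. By induction the denominator is
  a power of \<open>a\<close> in one expansion and a power of \<open>x3 * x2\<close> in the other,
  up to units, and coprimality removes both.\<close>

theorem cv_laurent:
  assumes fV: "finite V" and M: "M \<subseteq> V"
    and "skew B" "fullrank V M B" "set ks \<subseteq> M" and v: "v \<in> V"
  shows "(\<lambda>y. cv V B ks y v) \<in> lau V V"
  using assms(3-5)
proof (induction "length ks" arbitrary: B ks rule: less_induct)
  case less
  show ?case
  proof (cases ks)
    case Nil
    thus ?thesis using v by (simp add: lau_var)
  next
    case (Cons i ks')
    hence i: "i \<in> M" "i \<in> V" using less.prems M by auto
    note B1 = skew_mutB[OF less.prems(1), of i] fullrank_mutB[OF fV i(2,1) less.prems(1,2)]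
    show ?thesis
    proof (cases ks')
      case Nil
      have "(\<lambda>y. if v = i then exch V i B y * inverse (y i) else y v) \<in> lau V V"
        using i v by (cases "v = i") (auto intro!: lau_var lau_mult[OF lau_exch lau_inv])
      thus ?thesis unfolding Cons Nil by (simp add: mutv_def divide_inverse fun_upd_def if_distrib cong: if_cong)
    next
      case C2: (Cons j rest)
      hence j: "j \<in> M" "j \<in> V" using less.prems Cons M by auto
      have rest: "set rest \<subseteq> M" using less.prems Cons C2 by auto
      show ?thesis
      proof (cases "i = j")
        case True
        have "(\<lambda>y. cv V B rest y v) \<in> lau V V" using less.hyps[of rest B] less.prems rest Cons C2 by simp
        thus ?thesis by (rule lau_cong) (simp add: Cons C2 True mutB_invol[OF less.prems(1)] mutv_invol[OF less.prems(1)])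
      next
        case False
        interpret rank2 V B i j by unfold_locales (use fV i j False less.prems in auto)
        define B1 where "B1 = mutB i B"
        define B2 where "B2 = mutB j B1"
        define B3 where "B3 = mutB i B2"
        have s: "skew B1" "skew B2" "skew B3" unfolding B1_def B2_def B3_def by (intro skew_mutB less.prems)+
        have fr: "fullrank V M B1" unfolding B1_def by (rule B1)
        have fr2: "fullrank V M B2" unfolding B2_def by (rule fullrank_mutB[OF fV j(2,1) s(1) fr])
        have fr3: "fullrank V M B3" unfolding B3_def by (rule fullrank_mutB[OF fV i(2,1) s(2) fr2])
        have F1: "(\<lambda>y. cv V B1 (j # rest) y v) \<in> lau V V"
          using less.hyps[of "j # rest" B1] rest j Cons C2 s fr by simp
        have F3: "(\<lambda>y. cv V B3 (i # rest) y v) \<in> lau V V"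
          using less.hyps[of "i # rest" B3] rest i Cons C2 s fr3 by simp
        define f :: "(vx \<Rightarrow> real) \<Rightarrow> real" where "f = (\<lambda>y. cv V B ks y v)"
        have f1: "f y = cv V B1 (j # rest) (y1 y) v" for y
          by (simp add: f_def Cons C2 B1_def y1_def)
        have f3: "f y = cv V B3 (i # rest) (y3 y) v" if y: "pos y" for y
        proof -
          have p2: "pos (y2 y)" unfolding y2_def y1_def by (intro mutv_pos y)
          have "cv V B3 (i # rest) (y3 y) v = cv V (mutB i (mutB i B2)) rest (mutv V i (mutB i B2) (mutv V i B2 (y2 y))) v"
            by (simp add: B3_def y3_def B2_def B1_def)
          also have "\<dots> = cv V B2 rest (y2 y) v" by (simp add: mutB_invol[OF s(2)] mutv_invol[OF s(2) p2])
          also have "\<dots> = f y" by (simp add: f_def Cons C2 B2_def B1_def y2_def y1_def)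
          finally show ?thesis ..
        qed
        have g: "x2 \<in> lau V V" "x3 \<in> lau V V" "cop V a x2" "cop V a x3"
          using good3[OF fV i(2) j(2) i(1) j(1) False less.prems(1,2)] by (auto simp: good3_def)
        have "\<exists>N. (\<lambda>y. (\<lambda>y. cv V B1 (j # rest) y v) (\<lambda>u. y1 y u) * (\<Prod>v\<in>{i}. y1 y v) ^ N) \<in> lau V V"
        proof (rule lau_compose[OF F1 fV, of "{i}" "\<lambda>u y. y1 y u"])
          show "{i} \<subseteq> V" using i by simp
          show "(\<lambda>y. y1 y u) \<in> lau V V" if "u \<in> V" for u
            using that a_lau by (cases "u = i") (auto simp: y1 intro: lau_var)
          show "(\<lambda>y. inverse (y1 y u)) \<in> lau V V" if "u \<in> V - {i}" for u
            using that by (auto simp: y1 intro: lau_inv)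
          show "pos (\<lambda>u. y1 y u)" if "pos y" for y unfolding y1_def by (rule mutv_pos[OF that])
        qed
        then obtain N where N: "(\<lambda>y. f y * a y ^ N) \<in> lau V V" by (auto simp: f1 a_def)
        have "\<exists>N. (\<lambda>y. (\<lambda>y. cv V B3 (i # rest) y v) (\<lambda>u. y3 y u) * (\<Prod>v\<in>{i, j}. y3 y v) ^ N) \<in> lau V V"
        proof (rule lau_compose[OF F3 fV, of "{i, j}" "\<lambda>u y. y3 y u"])
          show "{i, j} \<subseteq> V" using i j by simp
          show "(\<lambda>y. y3 y u) \<in> lau V V" if "u \<in> V" for u
            using that g False by (cases "u = i"; cases "u = j") (auto simp: y3 intro: lau_var)
          show "(\<lambda>y. inverse (y3 y u)) \<in> lau V V" if "u \<in> V - {i, j}" for u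
            using that by (auto simp: y3 intro: lau_var lau_inv lau_const)
          show "pos (\<lambda>u. y3 y u)" if "pos y" for y using pos_y3[OF that] .
        qed
        then obtain N' where "(\<lambda>y. cv V B3 (i # rest) (y3 y) v * (\<Prod>v\<in>{i, j}. y3 y v) ^ N') \<in> lau V V" by blast
        moreover have pr: "(\<Prod>v\<in>{i, j}. y3 y v) = x3 y * x2 y" for y using False by (simp add: y3)
        ultimately have N': "(\<lambda>y. cv V B3 (i # rest) (y3 y) v * (x3 y * x2 y) ^ N') \<in> lau V V"
          by (simp only: pr)
        have "(\<lambda>y. f y * (x3 y * x2 y) ^ N') \<in> lau V V"
          by (rule lau_cong[OF N']) (simp add: f3)
        from cop_cancel[OF a_lau pos_a lau_mult[OF g(2,1)] cop_mult[OF g(4,3,1)] N this]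
        show ?thesis by (simp add: f_def)
      qed
    qed
  qed
qed

lemma lau_specialize: "g \<in> lau V W \<Longrightarrow> (\<lambda>y. g (y(f := 1))) \<in> lau V (W - {f})"
proof (induction rule: lau.induct)
  case (lau_const c) show ?case by (rule lau.lau_const)
next
  case (lau_var v) thus ?case by (cases "v = f") (auto intro: lau.lau_const lau.lau_var)
next
  case (lau_inv v) thus ?case by (cases "v = f") (auto intro: lau.lau_const lau.lau_inv)
next
  case (lau_add g h) show ?case by (rule lau.lau_add[OF lau_add.IH])
next
  case (lau_mult g h) show ?case by (rule lau.lau_mult[OF lau_mult.IH])
next
  case (lau_cong g h)
  show ?case by (rule lau.lau_cong[OF lau_cong.IH]) (use lau_cong.hyps(2) in \<open>simp add: pos_def\<close>)
qed

text \<open>Let \<open>m\<close> be the lowest exponent that occurs. Multiplying by the power of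
  \<open>s\<close> with exponent \<open>- m\<close> isolates its coefficient in the limit; for
  negative \<open>m\<close> the same product tends to 0, because \<phi> has a finite limit.\<close>

lemma hexp_limit:
  assumes h: "hexp N \<phi> a" and lim: "(\<phi> \<longlongrightarrow> L) (at_right 0)" and d: "d < 0"
  shows "a d = 0"
proof (rule ccontr)
  assume nz: "a d \<noteq> 0"
  define D where "D = {d \<in> {-N..N}. a d \<noteq> 0}"
  have "finite D" unfolding D_def by (rule finite_subset[of _ "{-N..N}"]) auto
  hence D: "finite D" "d \<in> D" using nz h unfolding D_def hexp_def by auto
  define m where "m = Min D"
  have m: "m \<in> D" "m \<le> d" using D by (auto simp: m_def intro: Min_in)
  have mmin: "a e = 0" if "e \<in> {-N..N}" "e < m" for e
  proof (rule ccontr)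
    assume "a e \<noteq> 0"
    hence "m \<le> e" using that D unfolding m_def by (intro Min_le) (auto simp: D_def)
    thus False using that by simp
  qed
  have pw: "((\<lambda>s::real. s powi k) \<longlongrightarrow> (if k = 0 then 1 else 0)) (at_right 0)" if "k \<ge> 0" for k
  proof -
    have "((\<lambda>s::real. s ^ nat k) \<longlongrightarrow> 0 ^ nat k) (at_right 0)" by (intro tendsto_intros)
    thus ?thesis using that by (simp add: power_int_def zero_power2 power_0_left)
  qed
  have "((\<lambda>s. s powi (- m) * \<phi> s) \<longlongrightarrow> 0 * L) (at_right 0)"
    using pw[of "- m"] m d by (intro tendsto_mult lim) auto
  moreover have "((\<lambda>s. \<Sum>e\<in>{-N..N}. a e * s powi (e - m)) \<longlongrightarrow> (\<Sum>e\<in>{-N..N}. if e = m then a e else 0)) (at_right 0)"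
  proof (rule tendsto_sum)
    fix e assume e: "e \<in> {-N..N}"
    show "((\<lambda>s. a e * s powi (e - m)) \<longlongrightarrow> (if e = m then a e else 0)) (at_right 0)"
    proof (cases "e < m")
      case True thus ?thesis using mmin[OF e] by simp
    next
      case False
      from tendsto_mult[OF tendsto_const[of "a e"] pw[of "e - m"]] False show ?thesis by (cases "e = m") simp_all
    qed
  qed
  moreover have "\<forall>\<^sub>F s in at_right 0. (\<Sum>e\<in>{-N..N}. a e * s powi (e - m)) = s powi (- m) * \<phi> s"
    using eventually_at_right_less[of "0::real"]
  proof eventually_elim
    case (elim s)
    hence "\<phi> s = (\<Sum>e\<in>{-N..N}. a e * s powi e)" using h by (simp add: hexp_def)
    thus ?case using elim by (simp add: sum_distrib_left power_int_diff power_int_minus divide_inverse mult_ac)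
  qed
  ultimately have "((\<lambda>s. s powi (- m) * \<phi> s) \<longlongrightarrow> (\<Sum>e\<in>{-N..N}. if e = m then a e else 0)) (at_right 0)"
    "((\<lambda>s. s powi (- m) * \<phi> s) \<longlongrightarrow> 0) (at_right 0)"
    by (auto intro: Lim_transform_eventually)
  hence "(\<Sum>e\<in>{-N..N}. if e = m then a e else 0) = 0"
    by (rule tendsto_unique[rotated]) simp
  thus False using m(1) by (simp add: D_def)
qed

text \<open>\<open>B k f\<close> has only one sign, so at most one of the two exchange monomials can
  vanish together with \<open>y f\<close>.\<close>

lemma exch_pos_boundary:
  assumes "finite V" "\<And>v. v \<noteq> f \<Longrightarrow> 0 < y v" "0 \<le> y f"
  shows "0 < exch V k B (y :: vx \<Rightarrow> real)"
proof -
  have nn: "0 \<le> y v" for v using assms(2)[of v] assms(3) by (cases "v = f") auto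
  let ?p = "\<Prod>w\<in>V. if B k w > 0 then y w ^ nat (B k w) else 1"
  let ?q = "\<Prod>w\<in>V. if B k w < 0 then y w ^ nat (- B k w) else 1"
  have p: "0 \<le> ?p" and q: "0 \<le> ?q" using nn by (auto intro!: prod_nonneg)
  show ?thesis
  proof (cases "B k f > 0")
    case True
    have "0 < ?q"
    proof (rule prod_pos)
      show "0 < (if B k w < 0 then y w ^ nat (- B k w) else 1)" for w
        using assms(2)[of w] True by (cases "w = f") auto
    qed
    thus ?thesis using p by (simp add: exch_def)
  next
    case False
    have "0 < ?p"
    proof (rule prod_pos)
      show "0 < (if B k w > 0 then y w ^ nat (B k w) else 1)" for w
        using assms(2)[of w] False by (cases "w = f") auto
    qed
    thus ?thesis using q by (simp add: exch_def)
  qed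
qed

lemma cv_tendsto:
  fixes Y :: "real \<Rightarrow> vx \<Rightarrow> real"
  assumes "finite V" "f \<notin> set ks" "\<And>v. v \<noteq> f \<Longrightarrow> 0 < y v" "0 \<le> y f"
    and "\<And>v. ((\<lambda>s. Y s v) \<longlongrightarrow> y v) F"
  shows "((\<lambda>s. cv V B ks (Y s) v) \<longlongrightarrow> cv V B ks y v) F"
  using assms(2-)
proof (induction ks arbitrary: B Y y)
  case Nil thus ?case by simp
next
  case (Cons k ks)
  have k: "k \<noteq> f" using Cons.prems by auto
  have e: "((\<lambda>s. exch V k B (Y s)) \<longlongrightarrow> exch V k B y) F"
    unfolding exch_def
  proof (intro tendsto_add tendsto_prod)
    show "((\<lambda>s. if 0 < B k w then Y s w ^ nat (B k w) else 1) \<longlongrightarrow> (if 0 < B k w then y w ^ nat (B k w) else 1)) F" for w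
      using Cons.prems(4)[of w] by (cases "0 < B k w") (auto intro: tendsto_intros)
    show "((\<lambda>s. if B k w < 0 then Y s w ^ nat (- B k w) else 1) \<longlongrightarrow> (if B k w < 0 then y w ^ nat (- B k w) else 1)) F" for w
      using Cons.prems(4)[of w] by (cases "B k w < 0") (auto intro: tendsto_intros)
  qed
  have ep: "0 < exch V k B y" by (rule exch_pos_boundary[where f = f and y = y, OF assms(1) Cons.prems(2,3)])
  have "((\<lambda>s. cv V (mutB k B) ks (mutv V k B (Y s)) v) \<longlongrightarrow> cv V (mutB k B) ks (mutv V k B y) v) F"
  proof (rule Cons.IH)
    show "f \<notin> set ks" using Cons.prems by simp
    show "0 < mutv V k B y u" if "u \<noteq> f" for u
      using that ep Cons.prems(2)[of u] Cons.prems(2)[OF k] by (simp add: mutv_def)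
    show "0 \<le> mutv V k B y f" using k Cons.prems(3) by (simp add: mutv_def)
    show "((\<lambda>s. mutv V k B (Y s) u) \<longlongrightarrow> mutv V k B y u) F" for u
      using tendsto_divide[OF e Cons.prems(4)[of k]] Cons.prems(2)[OF k] Cons.prems(4)[of u]
      by (cases "u = k") (auto simp: mutv_def)
  qed
  thus ?case by simp
qed

text \<open>As \<open>y f\<close> tends to 0 every denominator met in the mutations keeps a positive
  limit, since \<open>f\<close> itself is never mutated. The value therefore stays bounded, and no
  negative power of \<open>y f\<close> can occur.\<close>

lemma cv_polynomial_in_frozen:
  assumes V: "finite V" and f: "f \<notin> set ks" and fV: "f \<in> V" and c: "(\<lambda>y. cv V B ks y v) \<in> lau V W"
  shows "(\<lambda>y. cv V B ks y v) \<in> lau V (W - {f})"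
proof -
  let ?l = "\<lambda>v. if v = f then 1 else 0 :: int"
  obtain N c where c: "\<And>d. c d \<in> lau V W"
    "\<And>y. pos y \<Longrightarrow> hexp N (\<lambda>s. cv V B ks (\<lambda>u. s powi ?l u * y u) v) (\<lambda>d. c d y)"
    using lau_hexp[OF c, of ?l] by blast
  \<comment> \<open>Expanding around \<open>y f = 1\<close> moves the whole dependence on
    \<open>y f\<close> into the powers of \<open>s\<close> and frees the coefficients from its
    inverse.\<close>
  define c' where "c' = (\<lambda>d y. c d (y(f := 1)))"
  have c'L: "c' d \<in> lau V (W - {f})" for d unfolding c'_def by (rule lau_specialize[OF c(1)])
  have h: "hexp N (\<lambda>s. cv V B ks (y(f := s)) v) (\<lambda>d. c' d y)" if y: "pos y" for y
  proof -
    have "pos (y(f := 1))" using y by (simp add: pos_def)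
    moreover have "(\<lambda>u. s powi ?l u * (y(f := 1)) u) = y(f := s)" for s by auto
    ultimately show ?thesis using c(2)[of "y(f := 1)"] by (simp add: c'_def)
  qed
  have z: "c' d y = 0" if y: "pos y" and d: "d < 0" for d y
  proof (rule hexp_limit[OF h[OF y] _ d])
    show "((\<lambda>s. cv V B ks (y(f := s)) v) \<longlongrightarrow> cv V B ks (y(f := 0)) v) (at_right 0)"
    proof (rule cv_tendsto[OF V f])
      show "0 < (y(f := 0)) u" if "u \<noteq> f" for u using y that by (simp add: pos_def)
      show "((\<lambda>s. (y(f := s)) u) \<longlongrightarrow> (y(f := 0)) u) (at_right 0)" for u
        by (cases "u = f") (auto intro: tendsto_ident_at)
    qed simp
  qed
  have "(\<lambda>y. \<Sum>d\<in>{0..N}. c' d y * y f ^ nat d) \<in> lau V (W - {f})"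
    by (intro lau_sum lau_mult c'L lau_power lau_var fV)
  thus ?thesis
  proof (rule lau_cong)
    fix y assume y: "pos y"
    have "cv V B ks (y(f := y f)) v = (\<Sum>d\<in>{-N..N}. c' d y * y f powi d)"
      using h[OF y, unfolded hexp_def] y[unfolded pos_def] by blast
    also have "\<dots> = (\<Sum>d\<in>{0..N}. c' d y * y f powi d)"
      by (rule sum.mono_neutral_right) (use z[OF y] in auto)
    also have "\<dots> = (\<Sum>d\<in>{0..N}. c' d y * y f ^ nat d)"
      by (rule sum.cong) (auto simp: power_int_def)
    finally show "(\<Sum>d\<in>{0..N}. c' d y * y f ^ nat d) = cv V B ks y v" by simp
  qed
qed

theorem cv_laurent_mutable:
  assumes V: "finite V" and M: "M \<subseteq> V" and B: "skew B" "fullrank V M B" and ks: "set ks \<subseteq> M" and v: "v \<in> V"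
  shows "(\<lambda>y. cv V B ks y v) \<in> lau V M"
proof -
  have "(\<lambda>y. cv V B ks y v) \<in> lau V (V - F)" if "finite F" "F \<subseteq> V - M" for F
    using that
  proof (induction F)
    case empty
    show ?case using cv_laurent[OF V M B ks v] by simp
  next
    case (insert f F)
    have "(\<lambda>y. cv V B ks y v) \<in> lau V (V - F - {f})"
      by (rule cv_polynomial_in_frozen[OF V]) (use insert ks in auto)
    moreover have "V - F - {f} = V - insert f F" by auto
    ultimately show ?case by simp
  qed
  from this[of "V - M"] V M show ?thesis by (simp add: double_diff)
qed

subsection \<open>Determinants\<close>

definition dt :: "nat \<Rightarrow> (nat \<Rightarrow> nat \<Rightarrow> complex) \<Rightarrow> complex" where
  "dt m A = det (Matrix.mat m m (\<lambda>(i, j). A i j))"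

lemma dt_0 [simp]: "dt 0 A = 1"
  unfolding dt_def by (rule det_dim_zero) simp

lemma dt_cong: "(\<And>i j. i < m \<Longrightarrow> j < m \<Longrightarrow> A i j = B i j) \<Longrightarrow> dt m A = dt m B"
  unfolding dt_def by (rule arg_cong[of _ _ det], rule eq_matI) auto

text \<open>Conjugation with the successor function matches permutations of \<open>{1..m}\<close>
  with those of \<open>{0..<m}\<close> and preserves the sign.\<close>

lemma detm_dt: "detm m A = dt m (\<lambda>i j. A (Suc i) (Suc j))"
proof -
  have b: "bij_betw Suc {0..<m} {1..m}" by (rule bij_betw_byWitness[of _ "\<lambda>i. i - 1"]) auto
  have b': "bij_betw (\<lambda>i. i - 1) {1..m} {0..<m}" by (rule bij_betw_byWitness[of _ Suc]) auto
  have "(\<Sum>p | p permutes {0..<m}. signof p * (\<Prod>i = 0..<m. A (Suc i) (Suc (p i))))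
    = (\<Sum>\<sigma> | \<sigma> permutes {1..m}. of_int (sign \<sigma>) * (\<Prod>i=1..m. A i (\<sigma> i)))"
  proof (rule sum.reindex_bij_witness[of _ "map_permutation {1..m} (\<lambda>i. i - 1)" "map_permutation {0..<m} Suc"])
    fix p assume p: "p \<in> {p. p permutes {0..<m}}"
    show "map_permutation {1..m} (\<lambda>i. i - 1) (map_permutation {0..<m} Suc p) = p"
      by (rule map_permutation_compose_inv[OF b]) (use p in auto)
    show "map_permutation {0..<m} Suc p \<in> {\<sigma>. \<sigma> permutes {1..m}}"
      using map_permutation_permutes[OF b] p by auto
    have "sign (map_permutation {0..<m} Suc p) = sign p" by (rule sign_map_permutation) (use p in auto)
    moreover have "(\<Prod>i=1..m. A i (map_permutation {0..<m} Suc p i)) = (\<Prod>i = 0..<m. A (Suc i) (Suc (p i)))"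
    proof (rule prod.reindex_bij_witness[of _ Suc "\<lambda>i. i - 1"])
      fix a assume a: "a \<in> {1..m}"
      have "map_permutation {0..<m} Suc p (Suc (a - 1)) = Suc (p (a - 1))"
        by (rule map_permutation_apply) (use a in auto)
      thus "A (Suc (a - 1)) (Suc (p (a - 1))) = A a (map_permutation {0..<m} Suc p a)" using a by simp
    qed auto
    ultimately show "of_int (sign (map_permutation {0..<m} Suc p)) * (\<Prod>i=1..m. A i (map_permutation {0..<m} Suc p i))
        = signof p * (\<Prod>i = 0..<m. A (Suc i) (Suc (p i)))"
      by simp
  next
    fix p assume p: "p \<in> {p. p permutes {1..m}}"
    show "map_permutation {0..<m} Suc (map_permutation {1..m} (\<lambda>i. i - 1) p) = p"
      by (rule map_permutation_compose_inv[OF b']) (use p in auto)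
    show "map_permutation {1..m} (\<lambda>i. i - 1) p \<in> {\<sigma>. \<sigma> permutes {0..<m}}"
      using map_permutation_permutes[OF b'] p by auto
  qed
  moreover have "dt m (\<lambda>i j. A (Suc i) (Suc j)) = (\<Sum>p | p permutes {0..<m}. signof p * (\<Prod>i = 0..<m. A (Suc i) (Suc (p i))))"
    unfolding dt_def
  proof (subst det_def'[of _ m], simp, rule sum.cong[OF refl])
    fix p assume "p \<in> {p. p permutes {0..<m}}"
    hence "\<And>i. i < m \<Longrightarrow> p i < m" using permutes_in_image by fastforce
    thus "signof p * (\<Prod>i = 0..<m. Matrix.mat m m (\<lambda>(i, j). A (Suc i) (Suc j)) $$ (i, p i)) =
        signof p * (\<Prod>i = 0..<m. A (Suc i) (Suc (p i)))"
      by (intro arg_cong2[of _ _ _ _ "(*)"] prod.cong) auto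
  qed
  ultimately show ?thesis by (simp add: detm_def)
qed

lemma dt_row_0:
  "dt (Suc n) A = (\<Sum>j<Suc n. A 0 j * ((-1) ^ j * dt n (\<lambda>a b. A (Suc a) (if b < j then b else Suc b))))"
proof -
  let ?M = "Matrix.mat (Suc n) (Suc n) (\<lambda>(i, j). A i j)"
  have "dt (Suc n) A = (\<Sum>j<Suc n. ?M $$ (0, j) * cofactor ?M 0 j)"
    unfolding dt_def by (rule laplace_expansion_row) auto
  also have "\<dots> = (\<Sum>j<Suc n. A 0 j * ((-1) ^ j * dt n (\<lambda>a b. A (Suc a) (if b < j then b else Suc b))))"
  proof (rule sum.cong[OF refl])
    fix j assume j: "j \<in> {..<Suc n}"
    have "mat_delete ?M 0 j = Matrix.mat n n (\<lambda>(a, b). A (Suc a) (if b < j then b else Suc b))"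
      unfolding mat_delete_def by (rule eq_matI) auto
    thus "?M $$ (0, j) * cofactor ?M 0 j = A 0 j * ((-1) ^ j * dt n (\<lambda>a b. A (Suc a) (if b < j then b else Suc b)))"
      using j by (simp add: cofactor_def dt_def)
  qed
  finally show ?thesis .
qed

lemma dt_col:
  assumes "j \<le> n"
  shows "dt (Suc n) A = (\<Sum>i<Suc n. A i j * ((-1) ^ (i + j) * dt n (\<lambda>a b. A (if a < i then a else Suc a) (if b < j then b else Suc b))))"
proof -
  let ?M = "Matrix.mat (Suc n) (Suc n) (\<lambda>(i, j). A i j)"
  have "dt (Suc n) A = (\<Sum>i<Suc n. ?M $$ (i, j) * cofactor ?M i j)"
    unfolding dt_def by (rule laplace_expansion_column) (use assms in auto)
  also have "\<dots> = (\<Sum>i<Suc n. A i j * ((-1) ^ (i + j) * dt n (\<lambda>a b. A (if a < i then a else Suc a) (if b < j then b else Suc b))))"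
  proof (rule sum.cong[OF refl])
    fix i assume i: "i \<in> {..<Suc n}"
    have "mat_delete ?M i j = Matrix.mat n n (\<lambda>(a, b). A (if a < i then a else Suc a) (if b < j then b else Suc b))"
      unfolding mat_delete_def by (rule eq_matI) auto
    thus "?M $$ (i, j) * cofactor ?M i j = A i j * ((-1) ^ (i + j) * dt n (\<lambda>a b. A (if a < i then a else Suc a) (if b < j then b else Suc b)))"
      using i assms by (simp add: cofactor_def dt_def)
  qed
  finally show ?thesis .
qed

lemma dt_eq_rows:
  assumes "i \<noteq> i'" "i < m" "i' < m" "\<And>j. j < m \<Longrightarrow> A i j = A i' j"
  shows "dt m A = 0"
  unfolding dt_def by (rule det_identical_rows[of _ m i i']) (use assms in \<open>auto intro!: eq_vecI\<close>)

lemma dt_eq_cols: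
  assumes "j \<noteq> j'" "j < m" "j' < m" "\<And>i. i < m \<Longrightarrow> A i j = A i j'"
  shows "dt m A = 0"
  unfolding dt_def by (rule det_identical_columns[of _ m j j']) (use assms in \<open>auto intro!: eq_vecI\<close>)

lemma dt_upper_right_zero:
  assumes "\<And>i j. i < p \<Longrightarrow> j < q \<Longrightarrow> A i (p + j) = 0"
  shows "dt (p + q) A = dt p A * dt q (\<lambda>i j. A (p + i) (p + j))"
proof -
  let ?A1 = "Matrix.mat p p (\<lambda>(i, j). A i j)" and ?A3 = "Matrix.mat q p (\<lambda>(i, j). A (p + i) j)"
    and ?A4 = "Matrix.mat q q (\<lambda>(i, j). A (p + i) (p + j))"
  have z: "A i j = 0" if "i < p" "\<not> j < p" "j < p + q" for i j
    using assms[of i "j - p"] that by simp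
  have "Matrix.mat (p + q) (p + q) (\<lambda>(i, j). A i j) = four_block_mat ?A1 (0\<^sub>m p q) ?A3 ?A4"
    by (rule eq_matI) (auto simp: z)
  thus ?thesis unfolding dt_def by (simp add: det_four_block_mat_upper_right_zero[of _ p _ q])
qed

lemma dt_lower_left_zero:
  assumes "\<And>i j. i < q \<Longrightarrow> j < p \<Longrightarrow> A (p + i) j = 0"
  shows "dt (p + q) A = dt p A * dt q (\<lambda>i j. A (p + i) (p + j))"
proof -
  let ?A1 = "Matrix.mat p p (\<lambda>(i, j). A i j)" and ?A2 = "Matrix.mat p q (\<lambda>(i, j). A i (p + j))"
    and ?A4 = "Matrix.mat q q (\<lambda>(i, j). A (p + i) (p + j))"
  have z: "A i j = 0" if "\<not> i < p" "i < p + q" "j < p" for i j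
    using assms[of "i - p" j] that by simp
  have "Matrix.mat (p + q) (p + q) (\<lambda>(i, j). A i j) = four_block_mat ?A1 ?A2 (0\<^sub>m q p) ?A4"
    by (rule eq_matI) (auto simp: z)
  thus ?thesis unfolding dt_def by (simp add: det_four_block_mat_lower_left_zero[of _ p _ q])
qed

text \<open>Expanding a determinant whose first row is a combination of its other rows gives all
  three-term relations needed; the combination is the cofactor functional of the columns \<open>2..k+1\<close>.\<close>

lemma three_term:
  fixes A :: "nat \<Rightarrow> nat \<Rightarrow> complex"
  defines "skp \<equiv> \<lambda>j. if j = 0 then 0 else Suc j"
  shows "dt (k + 2) A * dt (k + 1) (\<lambda>i j. A (Suc i) (j + 2)) + dt (k + 1) (\<lambda>i j. A (Suc i) (skp j)) * dt (k + 2) (\<lambda>i j. A i (Suc j))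
    = dt (k + 2) (\<lambda>i j. A i (skp j)) * dt (k + 1) (\<lambda>i j. A (Suc i) (Suc j))"
proof -
  define m where "m = k + 2"
  \<comment> \<open>Cofactors of the first column of a square matrix with an arbitrary first column
    and the columns 2 to \<open>k + 1\<close> of \<open>A\<close> behind it, taken from rows 1 to
    \<open>k + 1\<close>.\<close>
  define C where "C i = (-1) ^ i * dt k (\<lambda>a b. A (Suc (if a < i then a else Suc a)) (b + 2))" for i
  \<comment> \<open>Signed maximal minors of the rows 0 to \<open>k + 1\<close> of \<open>A\<close>
    in columns 0 to \<open>m\<close>; they are orthogonal to each of these rows. Pairing them with
    the combination \<open>L\<close> of rows leaves three terms, as \<open>L\<close> vanishes in all
    columns except 0, 1 and \<open>m\<close>.\<close>
  define cof where "cof j = (-1) ^ j * dt m (\<lambda>a b. A a (if b < j then b else Suc b))" for j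
  have fst_col: "dt (Suc k) (\<lambda>i j. if j = 0 then x i else A (Suc i) (Suc j)) = (\<Sum>i<Suc k. x i * C i)" for x
    by (subst dt_col[of 0]) (auto simp: C_def intro!: sum.cong)
  have last_col: "dt (Suc k) (\<lambda>i j. A (Suc i) (j + 2)) = (-1) ^ k * (\<Sum>i<Suc k. A (Suc i) m * C i)"
    unfolding sum_distrib_left
  proof (subst dt_col[of k], simp, rule sum.cong[OF refl])
    fix i assume "i \<in> {..<Suc k}"
    have "dt k (\<lambda>a b. A (Suc (if a < i then a else Suc a)) ((if b < k then b else Suc b) + 2))
      = dt k (\<lambda>a b. A (Suc (if a < i then a else Suc a)) (b + 2))" by (rule dt_cong) simp
    thus "A (Suc i) (k + 2) * ((-1) ^ (i + k) * dt k (\<lambda>a b. A (Suc (if a < i then a else Suc a)) ((if b < k then b else Suc b) + 2)))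
      = (-1) ^ k * (A (Suc i) m * C i)" by (simp add: C_def m_def power_add)
  qed
  have row: "(\<Sum>j<Suc m. A i j * cof j) = 0" if i: "i < m" for i
  proof -
    have "(\<Sum>j<Suc m. A i j * cof j) = dt (Suc m) (\<lambda>a b. if a = 0 then A i b else A (a - 1) b)"
      unfolding cof_def by (subst dt_row_0) simp
    also have "\<dots> = 0" by (rule dt_eq_rows[of 0 "Suc i"]) (use i in auto)
    finally show ?thesis .
  qed
  define L where "L j = (\<Sum>i<Suc k. A (Suc i) j * C i)" for j
  have "(\<Sum>j<Suc m. L j * cof j) = (\<Sum>i<Suc k. C i * (\<Sum>j<Suc m. A (Suc i) j * cof j))"
    unfolding L_def sum_distrib_right sum_distrib_left by (subst sum.swap) (simp add: algebra_simps)
  also have "\<dots> = 0" by (rule sum.neutral) (use row m_def in auto)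
  finally have s: "(\<Sum>j<Suc m. L j * cof j) = 0" .
  have L0: "L j = 0" if "2 \<le> j" "j < m" for j
  proof -
    have "L j = dt (Suc k) (\<lambda>a b. if b = 0 then A (Suc a) j else A (Suc a) (Suc b))" unfolding L_def fst_col ..
    also have "\<dots> = 0" by (rule dt_eq_cols[of 0 "j - 1"]) (use that m_def in auto)
    finally show ?thesis .
  qed
  have "(\<Sum>j<Suc m. L j * cof j) = (\<Sum>j\<in>{0,1,m}. L j * cof j)"
    by (rule sum.mono_neutral_right) (use L0 m_def in auto)
  also have "\<dots> = L 0 * cof 0 + L 1 * cof 1 + L m * cof m" by (simp add: m_def)
  finally have main: "L 0 * cof 0 + L 1 * cof 1 + L m * cof m = 0" using s by simp
  have e0: "L 0 = dt (k + 1) (\<lambda>i j. A (Suc i) (skp j))" unfolding L_def fst_col[symmetric] skp_def by (auto intro!: dt_cong)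
  have e1: "L 1 = dt (k + 1) (\<lambda>i j. A (Suc i) (Suc j))" unfolding L_def fst_col[symmetric] by (auto intro!: dt_cong)
  have em: "L m * (-1) ^ m = dt (k + 1) (\<lambda>i j. A (Suc i) (j + 2))"
    using last_col by (simp add: L_def m_def)
  have c0: "cof 0 = dt m (\<lambda>i j. A i (Suc j))" by (simp add: cof_def)
  have c1: "cof 1 = - dt m (\<lambda>i j. A i (skp j))" by (simp add: cof_def skp_def cong: if_cong)
  have cm: "cof m = (-1) ^ m * dt m A" unfolding cof_def by (auto intro!: dt_cong)
  have "L 0 * cof 0 + L 1 * cof 1 + (L m * (-1) ^ m) * dt m A = 0"
    using main unfolding cm by (simp only: mult.assoc)
  hence "dt (k + 1) (\<lambda>i j. A (Suc i) (skp j)) * dt m (\<lambda>i j. A i (Suc j))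
      + dt (k + 1) (\<lambda>i j. A (Suc i) (Suc j)) * (- dt m (\<lambda>i j. A i (skp j)))
      + dt (k + 1) (\<lambda>i j. A (Suc i) (j + 2)) * dt m A = 0"
    by (simp only: e0 e1 em c0 c1)
  thus ?thesis unfolding m_def[symmetric] by (simp add: algebra_simps)
qed

lemma minor_dt: "minor A r c m = dt m (\<lambda>i j. A (r + i) (c + j))"
  unfolding minor_def detm_dt by simp

text \<open>A minor on consecutive rows whose second column is passed over. The value 0 in size 0
  makes the recursion \<open>minor_skip\<close> true for \<open>m = 1\<close> as well.\<close>

definition skip :: "(nat \<Rightarrow> nat \<Rightarrow> complex) \<Rightarrow> nat \<Rightarrow> nat \<Rightarrow> nat \<Rightarrow> complex" where
  "skip A r c m = (if m = 0 then 0 else dt m (\<lambda>i j. A (r + i) (if j = 0 then c else c + j + 1)))"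

lemma minor_skip:
  assumes "m \<ge> 1"
  shows "minor A r c m * minor A (r + 1) (c + 2) (m - 1) + skip A (r + 1) c (m - 1) * minor A r (c + 1) m
    = skip A r c m * minor A (r + 1) (c + 1) (m - 1)"
proof (cases "m = 1")
  case True
  have "dt 1 B = B 0 0" for B using dt_row_0[of 0 B] by simp
  thus ?thesis using True by (simp add: minor_dt skip_def)
next
  case False
  then obtain k where m: "m = k + 2" using assms by (metis add.commute le_add_diff_inverse One_nat_def Suc_1 Suc_leI le_neq_implies_less)
  have e: "(\<lambda>i j. A (r + i) (c + (if j = 0 then 0 else Suc j))) = (\<lambda>i j. A (r + i) (if j = 0 then c else c + j + 1))" for r
    by (intro ext) auto
  have e': "c + (if j = 0 then 0 else Suc j) = (if j = 0 then c else Suc (j + c))" for j by simp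
  show ?thesis using three_term[of k "\<lambda>i j. A (r + i) (c + j)"] unfolding m e
    by (simp add: minor_dt skip_def algebra_simps e' cong: if_cong)
qed

lemma minor_0 [simp]: "minor A r c 0 = 1" by (simp add: minor_dt)
lemma skip_0 [simp]: "skip A r c 0 = 0" by (simp add: skip_def)

locale cg =
  fixes n :: nat
  assumes n2: "2 \<le> n"
begin

subsection \<open>The source of an entry of the band matrix\<close>

text \<open>\<open>l\<close> counts columns from the first block that meets the block row: offset 1
  is the zero column of \<open>calY\<close>, then come its \<open>n\<close> columns, then the
  \<open>n\<close> columns of \<open>calX\<close>, and zeros from \<open>2 * n + 2\<close>
  on.\<close>

definition srcl :: "nat \<Rightarrow> nat \<Rightarrow> nat \<times> nat" where
  "srcl a l = (if l \<le> 1 \<or> 2 * n + 1 < l then (0, 0) else if l \<le> n + 1 then (a, l - 1) else (a + 1, l - n - 1))"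

lemma Usrc_block:
  assumes a: "1 \<le> a" "a \<le> n - 1" and l: "1 \<le> l"
  shows "Usrc n (i * (n - 1) + a) (i * (n + 1) + l) = srcl a l"
proof -
  have e: "i * (n - 1) + a - 1 = (a - 1) + i * (n - 1)" using a by simp
  have "a - 1 < n - 1" using a by simp
  hence 1: "(i * (n - 1) + a - 1) div (n - 1) = i" "(i * (n - 1) + a - 1) mod (n - 1) = a - 1"
    unfolding e by simp_all
  have e: "i * (n + 1) + l - 1 = (l - 1) + i * (n + 1)" using l by simp
  have 2: "(i * (n + 1) + l - 1) div (n + 1) = i + (l - 1) div (n + 1)"
    "(i * (n + 1) + l - 1) mod (n + 1) = (l - 1) mod (n + 1)"
    unfolding e by (rule div_mult_self1, simp, rule mod_mult_self1)
  consider "l \<le> n + 1" | "n + 1 < l" "l \<le> 2 * n + 2" | "2 * n + 2 < l" by linarith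
  thus ?thesis
  proof cases
    case c: 1
    hence "(l - 1) div (n + 1) = 0" "(l - 1) mod (n + 1) = l - 1" using l by auto
    thus ?thesis unfolding Usrc_def Let_def 1 2 using c a l by (auto simp: srcl_def)
  next
    case c: 2
    hence d: "l - 1 = (l - n - 2) + 1 * (n + 1)" "l - n - 2 < n + 1" by auto
    have "(l - 1) div (n + 1) = 1" unfolding d(1) using d(2) by (subst div_mult_self1) auto
    moreover have "(l - 1) mod (n + 1) = l - n - 2" unfolding d(1) using d(2) by (subst mod_mult_self1) auto
    ultimately show ?thesis unfolding Usrc_def Let_def 1 2 using c a l by (auto simp: srcl_def)
  next
    case c: 3
    hence "2 * (n + 1) \<le> l - 1" by simp
    hence "2 \<le> (l - 1) div (n + 1)" by (simp add: less_eq_div_iff_mult_less_eq)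
    thus ?thesis unfolding Usrc_def Let_def 1 2 using c a l by (auto simp: srcl_def)
  qed
qed

lemma Usrc_left:
  assumes a: "1 \<le> a" "a \<le> n - 1" and c: "1 \<le> c" "c \<le> i * (n + 1)"
  shows "Usrc n (i * (n - 1) + a) c = (0, 0)"
proof -
  have e: "i * (n - 1) + a - 1 = (a - 1) + i * (n - 1)" using a by simp
  have "a - 1 < n - 1" using a by simp
  hence 1: "(i * (n - 1) + a - 1) div (n - 1) = i" unfolding e by simp
  have "(c - 1) div (n + 1) < i" using c by (simp add: div_less_iff_less_mult)
  thus ?thesis unfolding Usrc_def Let_def 1 by simp
qed

lemma row_block:
  assumes "1 \<le> r"
  obtains i a where "r = i * (n - 1) + a" "1 \<le> a" "a \<le> n - 1"
proof
  have n: "0 < n - 1" using n2 by simp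
  show "r = (r - 1) div (n - 1) * (n - 1) + ((r - 1) mod (n - 1) + 1)"
    using assms div_mult_mod_eq[of "r - 1" "n - 1"] by linarith
  show "1 \<le> (r - 1) mod (n - 1) + 1" by simp
  show "(r - 1) mod (n - 1) + 1 \<le> n - 1" using mod_less_divisor[OF n, of "r - 1"] by linarith
qed

lemma Umat_Usrc: "Umat n X X r c = (if Usrc n r c = (0, 0) then 0 else X (fst (Usrc n r c)) (snd (Usrc n r c)))"
  using mod_less_divisor[of "n + 1" "c - 1"]
  unfolding Umat_def Usrc_def Let_def by (auto simp: calX_def calY_def simp del: mod_less_divisor)

definition supp :: "nat \<Rightarrow> nat \<Rightarrow> bool" where
  "supp r c \<longleftrightarrow> Usrc n r c \<noteq> (0, 0)"

lemma supp_block: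
  assumes "1 \<le> a" "a \<le> n - 1" "1 \<le> c"
  shows "supp (i * (n - 1) + a) c \<longleftrightarrow> i * (n + 1) + 2 \<le> c \<and> c \<le> i * (n + 1) + 2 * n + 1"
proof (cases "c \<le> i * (n + 1)")
  case True
  thus ?thesis using Usrc_left[OF assms(1,2,3) True] by (simp add: supp_def)
next
  case False
  define l where "l = c - i * (n + 1)"
  have l: "c = i * (n + 1) + l" "1 \<le> l" using False by (auto simp: l_def)
  show ?thesis unfolding supp_def l(1) Usrc_block[OF assms(1,2) l(2)] using assms by (auto simp: srcl_def)
qed

text \<open>Sources of the upper left, upper and left neighbours in \<open>U\<close> of an entry
  with source \<open>v\<close>. Apart from plain shifts, an entry of the first matrix row has above
  it the last row of the previous \<open>calX\<close>, and an entry of the first matrix column has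
  on its left the last column of the adjacent \<open>calY\<close>.\<close>

definition prv :: "nat \<times> nat \<Rightarrow> nat \<times> nat" where
  "prv v = (case v of (i, j) \<Rightarrow> if 2 \<le> i \<and> 2 \<le> j then (i - 1, j - 1) else if i = 1 then (n, j) else (i - 2, n))"
definition upv :: "nat \<times> nat \<Rightarrow> nat \<times> nat" where
  "upv v = (case v of (i, j) \<Rightarrow> if 2 \<le> i then (i - 1, j) else (n, j + 1))"
definition lef :: "nat \<times> nat \<Rightarrow> nat \<times> nat" where
  "lef v = (case v of (i, j) \<Rightarrow> if 2 \<le> j then (i, j - 1) else (i - 1, n))"
text \<open>The value \<open>(0, 0)\<close> stands for a missing neighbour.\<close>
definition nxt :: "nat \<times> nat \<Rightarrow> nat \<times> nat" where
  "nxt v = (case v of (i, j) \<Rightarrow>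
    if 1 \<le> i \<and> 1 \<le> j \<and> i < n \<and> j < n then (i + 1, j + 1)
    else if i = n \<and> 2 \<le> j \<and> j < n then (1, j)
    else if j = n \<and> 1 \<le> i \<and> i + 2 \<le> n then (i + 2, 1) else (0, 0))"

definition mut :: "(nat \<times> nat) set" where
  "mut = verts n - {(1, 1), (1, n), (2, 1)}"

text \<open>A matrix entry occurs in \<open>U\<close> many times, in both kinds of blocks, yet as
  soon as the antidiagonal of a window is nonzero the window is determined by the source of its
  lower right entry. This converts statements about minors of \<open>U\<close> into statements about
  vertices.\<close>

lemma window:
  assumes r: "1 \<le> r" "1 \<le> c" and s: "supp r (c + 1)" "supp (r + 1) c"
  shows "supp r c" "supp (r + 1) (c + 1)" "Usrc n (r + 1) (c + 1) \<in> mut"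
    "prv (Usrc n (r + 1) (c + 1)) = Usrc n r c"
    "upv (Usrc n (r + 1) (c + 1)) = Usrc n r (c + 1)"
    "lef (Usrc n (r + 1) (c + 1)) = Usrc n (r + 1) c"
proof -
  have c1: "1 \<le> c + 1" by simp
  obtain i a where a: "r = i * (n - 1) + a" "1 \<le> a" "a \<le> n - 1" by (rule row_block[OF r(1)])
  have "supp r c \<and> supp (r + 1) (c + 1) \<and> Usrc n (r + 1) (c + 1) \<in> mut \<and>
    prv (Usrc n (r + 1) (c + 1)) = Usrc n r c \<and>
    upv (Usrc n (r + 1) (c + 1)) = Usrc n r (c + 1) \<and>
    lef (Usrc n (r + 1) (c + 1)) = Usrc n (r + 1) c"
  \<comment> \<open>For \<open>a = n - 1\<close> the second row of the window opens the next block
    row, whose blocks start \<open>n + 1\<close> columns further right.\<close>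
  proof (cases "a = n - 1")
    case False
    hence a': "1 \<le> a + 1" "a + 1 \<le> n - 1" and r1: "r + 1 = i * (n - 1) + (a + 1)" using a by auto
    have b: "i * (n + 1) + 2 \<le> c" "c + 1 \<le> i * (n + 1) + 2 * n + 1"
      using s(1)[unfolded a(1)] s(2)[unfolded r1] supp_block[OF a(2,3) c1, of i] supp_block[OF a' r(2), of i] by blast+
    define l where "l = c - i * (n + 1)"
    have l: "c = i * (n + 1) + l" "c + 1 = i * (n + 1) + (l + 1)" "2 \<le> l" "l \<le> 2 * n"
      using b unfolding l_def by linarith+
    have U: "Usrc n r c = srcl a l" "Usrc n r (c + 1) = srcl a (l + 1)"
      "Usrc n (r + 1) c = srcl (a + 1) l" "Usrc n (r + 1) (c + 1) = srcl (a + 1) (l + 1)"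
      unfolding r1 unfolding a(1) l(2) unfolding l(1)
      using Usrc_block[OF a(2,3), of l i] Usrc_block[OF a(2,3), of "l + 1" i]
        Usrc_block[OF a', of l i] Usrc_block[OF a', of "l + 1" i] l(3) by auto
    show ?thesis unfolding supp_def U srcl_def using a a' l(3,4)
      by (auto simp: prv_def upv_def lef_def mut_def verts_def)
  next
    case True
    have a': "(1::nat) \<le> 1" "1 \<le> n - 1" and r1: "r + 1 = (i + 1) * (n - 1) + 1" using a True n2 by auto
    have b: "(i + 1) * (n + 1) + 2 \<le> c" "c + 1 \<le> i * (n + 1) + 2 * n + 1"
      using s(1)[unfolded a(1)] s(2)[unfolded r1] supp_block[OF a(2,3) c1, of i] supp_block[OF a' r(2), of "i + 1"] by simp_all
    define l where "l = c - i * (n + 1)"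
    have l: "c = i * (n + 1) + l" "c + 1 = i * (n + 1) + (l + 1)" "n + 3 \<le> l" "l \<le> 2 * n"
      using b unfolding l_def by (simp_all add: algebra_simps)
    define m where "m = l - (n + 1)"
    have m: "c = (i + 1) * (n + 1) + m" "c + 1 = (i + 1) * (n + 1) + (m + 1)" "2 \<le> m" "m + 1 \<le> n" "l = m + n + 1"
      using l unfolding m_def by (simp_all add: algebra_simps)
    have U1: "Usrc n r c = srcl a l" "Usrc n r (c + 1) = srcl a (l + 1)"
      unfolding a(1) l(2) unfolding l(1)
      using Usrc_block[OF a(2,3), of l i] Usrc_block[OF a(2,3), of "l + 1" i] l(3) by auto
    have U2: "Usrc n (r + 1) c = srcl 1 m" "Usrc n (r + 1) (c + 1) = srcl 1 (m + 1)"
      unfolding r1 m(2) unfolding m(1)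
      using Usrc_block[OF a', of m "i + 1"] Usrc_block[OF a', of "m + 1" "i + 1"] m(3) by auto
    show ?thesis unfolding supp_def U1 U2 srcl_def using a a' True m(3-5) n2
      by (auto simp: prv_def upv_def lef_def mut_def verts_def)
  qed
  thus "supp r c" "supp (r + 1) (c + 1)" "Usrc n (r + 1) (c + 1) \<in> mut"
    "prv (Usrc n (r + 1) (c + 1)) = Usrc n r c"
    "upv (Usrc n (r + 1) (c + 1)) = Usrc n r (c + 1)"
    "lef (Usrc n (r + 1) (c + 1)) = Usrc n (r + 1) c" by auto
qed

lemma mut_cases [consumes 1, case_names inner top left]:
  assumes "v \<in> mut"
    "\<And>i j. v = (i, j) \<Longrightarrow> 2 \<le> i \<Longrightarrow> i \<le> n \<Longrightarrow> 2 \<le> j \<Longrightarrow> j \<le> n \<Longrightarrow> P"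
    "\<And>j. v = (1, j) \<Longrightarrow> 2 \<le> j \<Longrightarrow> j < n \<Longrightarrow> P"
    "\<And>i. v = (i, 1) \<Longrightarrow> 3 \<le> i \<Longrightarrow> i \<le> n \<Longrightarrow> P"
  shows P
proof -
  obtain i j where v: "v = (i, j)" by (cases v)
  have c: "1 \<le> i" "i \<le> n" "1 \<le> j" "j \<le> n" "(i, j) \<noteq> (1, 1)" "(i, j) \<noteq> (1, n)" "(i, j) \<noteq> (2, 1)"
    using assms(1) by (auto simp: mut_def verts_def v)
  consider "2 \<le> i" "2 \<le> j" | "i = 1" "2 \<le> j" "j < n" | "j = 1" "3 \<le> i"
  proof (cases "i = 1")
    case True
    hence "j \<noteq> 1" "j \<noteq> n" using c by auto
    thus ?thesis using that(2) True c by linarith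
  next
    case i: False
    show ?thesis
    proof (cases "j = 1")
      case True
      hence "i \<noteq> 2" using c by auto
      thus ?thesis using that(3) True c i by linarith
    next
      case False
      thus ?thesis using that(1) i c by linarith
    qed
  qed
  thus ?thesis by cases (use v c assms in auto)
qed

lemma nxt_prv: "v \<in> mut \<Longrightarrow> nxt (prv v) = v"
  by (cases rule: mut_cases) (auto simp: nxt_def prv_def)

lemma nbrs_in_verts: "v \<in> mut \<Longrightarrow> prv v \<in> verts n \<and> upv v \<in> verts n \<and> lef v \<in> verts n"
  by (cases rule: mut_cases) (auto simp: prv_def upv_def lef_def verts_def)

lemma nxt_in_verts: "v \<in> verts n \<Longrightarrow> nxt v = (0, 0) \<or> nxt v \<in> verts n"
  using n2 by (cases v) (auto simp: nxt_def verts_def)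

subsection \<open>The initial quiver\<close>

lemma arrows_pair: "arrows n (a, b) (c, d) =
     of_bool (c = a \<and> b = d + 1 \<and> 1 \<le> a \<and> a \<le> n \<and> 1 \<le> d \<and> d \<le> n - 1 \<and> (c, d) \<noteq> (1, n - 1))
   + of_bool (d = b \<and> a = c + 1 \<and> 1 \<le> c \<and> c \<le> n - 1 \<and> 1 \<le> b \<and> b \<le> n \<and> (c, d) \<noteq> (1, 1))
   + of_bool (c = a + 1 \<and> d = b + 1 \<and> 1 \<le> a \<and> a \<le> n - 1 \<and> 1 \<le> b \<and> b \<le> n - 1)
   + of_bool (a = n \<and> c = 1 \<and> b = d \<and> 2 \<le> b \<and> b \<le> n - 1)
   + of_bool (a = 1 \<and> c = n \<and> d = b + 1 \<and> 2 \<le> b \<and> b \<le> n - 1)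
   + of_bool (b = n \<and> d = 1 \<and> c = a + 2 \<and> 1 \<le> a \<and> a \<le> n - 2)
   + of_bool (b = 1 \<and> d = n \<and> a = c + 1 \<and> 2 \<le> c \<and> c \<le> n - 1)"
proof -
  have 7: "(\<exists>i. i \<in> {1..n-2} \<and> (a, b) = (i+2, 1) \<and> (c, d) = (i+1, n)) \<longleftrightarrow> (b = 1 \<and> d = n \<and> a = c + 1 \<and> 2 \<le> c \<and> c \<le> n - 1)"
    using n2 by (auto intro!: exI[of _ "c - 1"])
  show ?thesis unfolding arrows_def 7
    by (intro arg_cong2[of _ _ _ _ "(+)"] arg_cong[of _ _ of_bool]) (auto simp: Bex_def)
qed

text \<open>The seven families of arrows are three kinds of steps together with their forms at the
  border: the first and last families lead to \<open>lef\<close>, the second and fifth to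
  \<open>upv\<close>, the other three to \<open>nxt\<close>. Read at a mutable vertex, each kind has
  exactly one target or none.\<close>

lemma arrows_out:
  assumes v: "v \<in> mut" and w: "w \<noteq> (0, 0)"
  shows "arrows n v w = of_bool (w = nxt v) + of_bool (w = upv v) + of_bool (w = lef v)"
proof -
  obtain a b c d where *: "v = (a, b)" "w = (c, d)" by (cases v, cases w)
  have 1: "of_bool (c = a \<and> b = d + 1 \<and> 1 \<le> a \<and> a \<le> n \<and> 1 \<le> d \<and> d \<le> n - 1 \<and> (c, d) \<noteq> (1, n - 1))
    + of_bool (b = 1 \<and> d = n \<and> a = c + 1 \<and> 2 \<le> c \<and> c \<le> n - 1) = (of_bool (w = lef v) :: nat)"
    using v n2 unfolding * mut_def verts_def lef_def by (cases "2 \<le> b") auto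
  have 2: "of_bool (d = b \<and> a = c + 1 \<and> 1 \<le> c \<and> c \<le> n - 1 \<and> 1 \<le> b \<and> b \<le> n \<and> (c, d) \<noteq> (1, 1))
    + of_bool (a = 1 \<and> c = n \<and> d = b + 1 \<and> 2 \<le> b \<and> b \<le> n - 1) = (of_bool (w = upv v) :: nat)"
    using v n2 unfolding * mut_def verts_def upv_def by (cases "2 \<le> a") auto
  have 3: "of_bool (c = a + 1 \<and> d = b + 1 \<and> 1 \<le> a \<and> a \<le> n - 1 \<and> 1 \<le> b \<and> b \<le> n - 1)
    + of_bool (a = n \<and> c = 1 \<and> b = d \<and> 2 \<le> b \<and> b \<le> n - 1)
    + of_bool (b = n \<and> d = 1 \<and> c = a + 2 \<and> 1 \<le> a \<and> a \<le> n - 2) = (of_bool (w = nxt v) :: nat)"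
    using v w n2 unfolding * mut_def verts_def nxt_def by (cases "a < n"; cases "b < n") auto
  show ?thesis using 1 2 3 unfolding *(1,2) arrows_pair unfolding *(1,2)[symmetric] by linarith
qed

lemma arrows_in:
  assumes v: "v \<in> mut" and w: "w \<noteq> (0, 0)"
  shows "arrows n w v = of_bool (w = prv v) + of_bool (w = nxt (upv v)) + of_bool (w = nxt (lef v))"
proof -
  obtain a b c d where *: "w = (a, b)" "v = (c, d)" by (cases v, cases w)
  have 1: "of_bool (c = a \<and> b = d + 1 \<and> 1 \<le> a \<and> a \<le> n \<and> 1 \<le> d \<and> d \<le> n - 1 \<and> (c, d) \<noteq> (1, n - 1))
    + of_bool (b = 1 \<and> d = n \<and> a = c + 1 \<and> 2 \<le> c \<and> c \<le> n - 1) = (of_bool (w = nxt (upv v)) :: nat)"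
    using v w n2 unfolding * mut_def verts_def nxt_def upv_def
    by (cases "2 \<le> c"; cases "d < n"; cases "c < n") auto
  have 2: "of_bool (d = b \<and> a = c + 1 \<and> 1 \<le> c \<and> c \<le> n - 1 \<and> 1 \<le> b \<and> b \<le> n \<and> (c, d) \<noteq> (1, 1))
    + of_bool (a = 1 \<and> c = n \<and> d = b + 1 \<and> 2 \<le> b \<and> b \<le> n - 1) = (of_bool (w = nxt (lef v)) :: nat)"
    using v w n2 unfolding * mut_def verts_def nxt_def lef_def
    by (cases "2 \<le> d"; cases "c < n"; cases "2 < d") auto
  have 3: "of_bool (c = a + 1 \<and> d = b + 1 \<and> 1 \<le> a \<and> a \<le> n - 1 \<and> 1 \<le> b \<and> b \<le> n - 1)
    + of_bool (a = n \<and> c = 1 \<and> b = d \<and> 2 \<le> b \<and> b \<le> n - 1)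
    + of_bool (b = n \<and> d = 1 \<and> c = a + 2 \<and> 1 \<le> a \<and> a \<le> n - 2) = (of_bool (w = prv v) :: nat)"
    using v n2 unfolding * mut_def verts_def prv_def by (cases "2 \<le> c"; cases "2 \<le> d") auto
  show ?thesis using 1 2 3 unfolding *(1,2) arrows_pair unfolding *(1,2)[symmetric] by linarith
qed

lemma prv_nxt: "nxt u \<noteq> (0, 0) \<Longrightarrow> prv (nxt u) = u"
proof -
  obtain i j where u: "u = (i, j)" by (cases u)
  assume "nxt u \<noteq> (0, 0)"
  then consider "1 \<le> i" "1 \<le> j" "i < n" "j < n" | "i = n" "2 \<le> j" "j < n" | "j = n" "1 \<le> i" "i + 2 \<le> n"
    unfolding u nxt_def by (auto split: if_splits)
  thus ?thesis by cases (auto simp: u nxt_def prv_def)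
qed

lemma nbrs_distinct:
  assumes v: "v \<in> mut"
  shows "upv v \<noteq> lef v" "upv v \<noteq> prv v" "lef v \<noteq> prv v" "nxt v \<noteq> upv v" "nxt v \<noteq> lef v" "nxt v \<noteq> prv v"
    "nxt (upv v) \<noteq> upv v" "nxt (upv v) \<noteq> lef v" "nxt (upv v) \<noteq> prv v" "nxt (upv v) = nxt v \<Longrightarrow> nxt v = (0, 0)"
    "nxt (lef v) \<noteq> upv v" "nxt (lef v) \<noteq> lef v" "nxt (lef v) \<noteq> prv v" "nxt (lef v) = nxt v \<Longrightarrow> nxt v = (0, 0)"
    "nxt (upv v) = nxt (lef v) \<Longrightarrow> nxt (upv v) = (0, 0)"
    "v \<noteq> upv v" "v \<noteq> lef v" "v \<noteq> prv v" "v \<noteq> nxt v" "v \<noteq> nxt (upv v)" "v \<noteq> nxt (lef v)"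
proof -
  note d = prv_def upv_def lef_def nxt_def
  show "upv v \<noteq> lef v"
    using v by (cases rule: mut_cases) (auto simp: d)
  show "upv v \<noteq> prv v"
    using v by (cases rule: mut_cases) (auto simp: d)
  show "lef v \<noteq> prv v"
    using v by (cases rule: mut_cases) (auto simp: d)
  show "nxt v \<noteq> upv v"
    using v by (cases rule: mut_cases) (auto simp: d)
  show "nxt v \<noteq> lef v"
    using v by (cases rule: mut_cases) (auto simp: d)
  show "nxt v \<noteq> prv v"
    using v by (cases rule: mut_cases) (auto simp: d)
  show "nxt (upv v) \<noteq> upv v"
    using v by (cases rule: mut_cases) (auto simp: d)
  show "nxt (upv v) \<noteq> lef v"
    using v by (cases rule: mut_cases) (auto simp: d)
  show "nxt (upv v) \<noteq> prv v"
    using v by (cases rule: mut_cases) (auto simp: d)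
  show "nxt (lef v) \<noteq> upv v"
    using v by (cases rule: mut_cases) (auto simp: d)
  show "nxt (lef v) \<noteq> lef v"
    using v by (cases rule: mut_cases) (auto simp: d)
  show "nxt (lef v) \<noteq> prv v"
    using v by (cases rule: mut_cases) (auto simp: d)
  show "v \<noteq> upv v"
    using v by (cases rule: mut_cases) (auto simp: d)
  show "v \<noteq> lef v"
    using v by (cases rule: mut_cases) (auto simp: d)
  show "v \<noteq> prv v"
    using v by (cases rule: mut_cases) (auto simp: d)
  show "v \<noteq> nxt v"
    using v by (cases rule: mut_cases) (auto simp: d)
  show "v \<noteq> nxt (upv v)"
    using v by (cases rule: mut_cases) (auto simp: d)
  show "v \<noteq> nxt (lef v)"
    using v by (cases rule: mut_cases) (auto simp: d)
  show "nxt v = (0, 0)" if "nxt (upv v) = nxt v"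
    using that prv_nxt[of v] prv_nxt[of "upv v"] \<open>v \<noteq> upv v\<close> by metis
  show "nxt v = (0, 0)" if "nxt (lef v) = nxt v"
    using that prv_nxt[of v] prv_nxt[of "lef v"] \<open>v \<noteq> lef v\<close> by metis
  show "nxt (upv v) = (0, 0)" if "nxt (upv v) = nxt (lef v)"
    using that prv_nxt[of "upv v"] prv_nxt[of "lef v"] \<open>upv v \<noteq> lef v\<close> by metis
qed

end

subsection \<open>Leading forms of minors of band matrices\<close>

lemma permutes_increasing_id:
  fixes m :: nat
  assumes p: "\<sigma> permutes {1..m}" and inc: "\<And>i. 1 \<le> i \<Longrightarrow> i < m \<Longrightarrow> \<sigma> i < \<sigma> (i + 1)"
  shows "\<sigma> = id"
proof -
  have im: "\<sigma> i \<in> {1..m}" if "i \<in> {1..m}" for i using permutes_in_image[OF p] that by blast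
  have ge: "i \<le> \<sigma> i" if "1 \<le> i" "i \<le> m" for i
    using that
  proof (induction i rule: nat_induct_at_least)
    case base thus ?case using im[of 1] by simp
  next
    case (Suc i)
    have "\<sigma> i < \<sigma> (i + 1)" using Suc by (intro inc) auto
    thus ?case using Suc by simp
  qed
  have s: "(\<Sum>i\<in>{1..m}. \<sigma> i) = (\<Sum>i\<in>{1..m}. i)"
    using sum.permute[OF p, of "\<lambda>i. i"] by (simp add: comp_def)
  have "\<sigma> i = i" for i
  proof (cases "i \<in> {1..m}")
    case True
    show ?thesis
    proof (rule ccontr)
      assume "\<sigma> i \<noteq> i"
      hence "i < \<sigma> i" using ge[of i] True by auto
      hence "(\<Sum>i\<in>{1..m}. i) < (\<Sum>i\<in>{1..m}. \<sigma> i)"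
        using True ge by (intro sum_strict_mono_ex1) auto
      thus False using s by simp
    qed
  next
    case False thus ?thesis using p by (simp add: permutes_not_in)
  qed
  thus ?thesis by auto
qed

text \<open>\<open>E\<close> lists the sources of a square matrix, with \<open>(0, 0)\<close> for
  zero entries. Windows have positive excess except possibly those with lower right entry
  \<open>u0\<close>, which may have excess 0. The choice \<open>u0 = (0, 0)\<close> gives the strict
  case.\<close>

locale band =
  fixes E :: "nat \<Rightarrow> nat \<Rightarrow> nat \<times> nat" and m :: nat and w :: "nat \<times> nat \<Rightarrow> nat" and u0 :: "nat \<times> nat"
  assumes diag: "\<And>i. 1 \<le> i \<Longrightarrow> i \<le> m \<Longrightarrow> E i i \<noteq> (0, 0)"
    and stair: "\<And>i c1 c c2. 1 \<le> i \<Longrightarrow> i < m \<Longrightarrow> 1 \<le> c1 \<Longrightarrow> c1 \<le> c \<Longrightarrow> c \<le> c2 \<Longrightarrow> c2 \<le> m \<Longrightarrow>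
      E i c2 \<noteq> (0, 0) \<Longrightarrow> E (i + 1) c1 \<noteq> (0, 0) \<Longrightarrow> E i c \<noteq> (0, 0) \<and> E (i + 1) c \<noteq> (0, 0)"
    and win: "\<And>i c. 1 \<le> i \<Longrightarrow> i < m \<Longrightarrow> 1 \<le> c \<Longrightarrow> c < m \<Longrightarrow> E i (c + 1) \<noteq> (0, 0) \<Longrightarrow> E (i + 1) c \<noteq> (0, 0) \<Longrightarrow>
      w (E i (c + 1)) + w (E (i + 1) c) < w (E i c) + w (E (i + 1) (c + 1)) \<or>
      w (E i (c + 1)) + w (E (i + 1) c) = w (E i c) + w (E (i + 1) (c + 1)) \<and> E (i + 1) (c + 1) = u0"
    and inj: "\<And>i j. 1 \<le> i \<Longrightarrow> i \<le> m \<Longrightarrow> 1 \<le> j \<Longrightarrow> j \<le> m \<Longrightarrow> E i i = u0 \<Longrightarrow> E j j = u0 \<Longrightarrow> i = j"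
begin

definition wt :: "(nat \<Rightarrow> nat) \<Rightarrow> nat" where "wt \<sigma> = (\<Sum>i\<in>{1..m}. w (E i (\<sigma> i)))"
definition ok :: "(nat \<Rightarrow> nat) \<Rightarrow> bool" where "ok \<sigma> \<longleftrightarrow> \<sigma> permutes {1..m} \<and> (\<forall>i\<in>{1..m}. E i (\<sigma> i) \<noteq> (0, 0))"

text \<open>The excess of a rectangle in two adjacent rows is the sum of the excesses of its
  windows, so equality forces each of them to have excess 0.\<close>

lemma swap_row:
  assumes i: "1 \<le> i" "i < m" and c: "1 \<le> c1" "c1 \<le> c2" "c2 \<le> m" and E: "E i c2 \<noteq> (0, 0)" "E (i + 1) c1 \<noteq> (0, 0)"
  shows "w (E i c2) + w (E (i + 1) c1) \<le> w (E i c1) + w (E (i + 1) c2)"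
    and "w (E i c2) + w (E (i + 1) c1) = w (E i c1) + w (E (i + 1) c2) \<Longrightarrow> c1 \<le> c \<Longrightarrow> c < c2 \<Longrightarrow> E (i + 1) (c + 1) = u0"
proof -
  have s: "E i c \<noteq> (0, 0) \<and> E (i + 1) c \<noteq> (0, 0)" if "c1 \<le> c" "c \<le> c2" for c
    by (rule stair[of i c1 c c2]) (use i c E that in auto)
  have *: "w (E i d) + w (E (i + 1) c1) \<le> w (E i c1) + w (E (i + 1) d) \<and>
    (w (E i d) + w (E (i + 1) c1) = w (E i c1) + w (E (i + 1) d) \<longrightarrow> (\<forall>c. c1 \<le> c \<longrightarrow> c < d \<longrightarrow> E (i + 1) (c + 1) = u0))"
    if "c1 \<le> d" "d \<le> c2" for d
    using that
  proof (induction d rule: nat_induct_at_least)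
    case base thus ?case by auto
  next
    case (Suc d)
    note IH = Suc.IH[OF Suc_leD[OF Suc.prems]]
    have "w (E i (d + 1)) + w (E (i + 1) d) < w (E i d) + w (E (i + 1) (d + 1)) \<or>
      w (E i (d + 1)) + w (E (i + 1) d) = w (E i d) + w (E (i + 1) (d + 1)) \<and> E (i + 1) (d + 1) = u0"
      by (rule win) (use i c s[of d] s[of "d + 1"] Suc in auto)
    thus ?case using IH by (auto simp: less_Suc_eq)
  qed
  show "w (E i c2) + w (E (i + 1) c1) \<le> w (E i c1) + w (E (i + 1) c2)" using *[of c2] c by auto
  show "E (i + 1) (c + 1) = u0"
    if "w (E i c2) + w (E (i + 1) c1) = w (E i c1) + w (E (i + 1) c2)" "c1 \<le> c" "c < c2"
    using *[of c2] that c by auto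
qed

text \<open>Bubble sort: removing a descent in adjacent rows does not lower the weight and raises
  the sum of \<open>i * \<sigma> i\<close>, which is bounded by the cube of \<open>m\<close>. If the
  weight is unchanged, all windows of the swapped rectangle belong to \<open>u0\<close>, and since
  \<open>u0\<close> occurs at most once on the diagonal only one transposition survives.\<close>

lemma wt_le:
  assumes "ok \<sigma>"
  shows "wt \<sigma> \<le> wt id \<and> (wt \<sigma> = wt id \<longrightarrow> \<sigma> = id \<or> (\<exists>s. 1 \<le> s \<and> s < m \<and> E (s + 1) (s + 1) = u0 \<and> \<sigma> = transpose s (s + 1)))"
  using assms
proof (induction "m * (m * m) - (\<Sum>i\<in>{1..m}. i * \<sigma> i)" arbitrary: \<sigma> rule: less_induct)
  case less
  have p: "\<sigma> permutes {1..m}" and nz: "\<And>i. i \<in> {1..m} \<Longrightarrow> E i (\<sigma> i) \<noteq> (0, 0)" using less.prems by (auto simp: ok_def)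
  have im: "\<sigma> i \<in> {1..m}" if "i \<in> {1..m}" for i using permutes_in_image[OF p] that by blast
  show ?case
  proof (cases "\<sigma> = id")
    case True thus ?thesis by simp
  next
    case False
    then obtain i where i: "1 \<le> i" "i < m" "\<not> \<sigma> i < \<sigma> (i + 1)" using permutes_increasing_id[OF p] by blast
    have "\<sigma> i \<noteq> \<sigma> (i + 1)" using permutes_inj[OF p] by (simp add: inj_eq)
    hence d: "\<sigma> (i + 1) < \<sigma> i" using i by simp
    define \<tau> where "\<tau> = \<sigma> \<circ> transpose i (i + 1)"
    have t: "\<tau> i = \<sigma> (i + 1)" "\<tau> (i + 1) = \<sigma> i" "\<And>j. j \<noteq> i \<Longrightarrow> j \<noteq> i + 1 \<Longrightarrow> \<tau> j = \<sigma> j"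
      by (simp_all add: \<tau>_def transpose_def)
    have pt: "\<tau> permutes {1..m}" unfolding \<tau>_def
      by (intro permutes_compose p permutes_swap_id) (use i in auto)
    note sw = swap_row[of i "\<sigma> (i + 1)" "\<sigma> i"]
    have pre: "1 \<le> \<sigma> (i + 1)" "\<sigma> (i + 1) \<le> \<sigma> i" "\<sigma> i \<le> m" "E i (\<sigma> i) \<noteq> (0, 0)" "E (i + 1) (\<sigma> (i + 1)) \<noteq> (0, 0)"
      using im[of i] im[of "i + 1"] nz[of i] nz[of "i + 1"] i d by auto
    have st: "E i (\<sigma> (i + 1)) \<noteq> (0, 0)" "E (i + 1) (\<sigma> i) \<noteq> (0, 0)"
      using stair[of i "\<sigma> (i + 1)" "\<sigma> (i + 1)" "\<sigma> i"] stair[of i "\<sigma> (i + 1)" "\<sigma> i" "\<sigma> i"] i pre by auto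
    have ok: "ok \<tau>" unfolding ok_def
    proof (intro conjI ballI pt)
      fix j assume j: "j \<in> {1..m}"
      show "E j (\<tau> j) \<noteq> (0, 0)"
        using t st nz[OF j] by (cases "j = i"; cases "j = i + 1") auto
    qed
    have split: "(\<Sum>j\<in>{1..m}. h j (\<rho> j)) = h i (\<rho> i) + h (i + 1) (\<rho> (i + 1)) + (\<Sum>j\<in>{1..m}-{i, i+1}. h j (\<rho> j))"
      for h :: "nat \<Rightarrow> nat \<Rightarrow> nat" and \<rho>
    proof -
      have "{1..m} = insert i (insert (i + 1) ({1..m} - {i, i+1}))" using i by auto
      hence "(\<Sum>j\<in>{1..m}. h j (\<rho> j)) = (\<Sum>j\<in>insert i (insert (i + 1) ({1..m} - {i, i+1})). h j (\<rho> j))" by simp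
      thus ?thesis by (simp add: add.assoc)
    qed
    have rest: "(\<Sum>j\<in>{1..m}-{i, i+1}. h j (\<tau> j)) = (\<Sum>j\<in>{1..m}-{i, i+1}. h j (\<sigma> j))" for h :: "nat \<Rightarrow> nat \<Rightarrow> nat"
      by (rule sum.cong) (use t in auto)
    have bound: "(\<Sum>j\<in>{1..m}. j * \<rho> j) \<le> m * (m * m)" if "\<rho> permutes {1..m}" for \<rho>
    proof -
      have "(\<Sum>j\<in>{1..m}. j * \<rho> j) \<le> of_nat (card {1..m}) * (m * m)"
        using permutes_in_image[OF that] by (intro sum_bounded_above mult_mono) auto
      thus ?thesis by simp
    qed
    have "(\<Sum>j\<in>{1..m}. j * \<sigma> j) < (\<Sum>j\<in>{1..m}. j * \<tau> j)"
      using split[of "\<lambda>j c. j * c" \<sigma>] split[of "\<lambda>j c. j * c" \<tau>] rest[of "\<lambda>j c. j * c"] t d by simp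
    hence dec: "m * (m * m) - (\<Sum>j\<in>{1..m}. j * \<tau> j) < m * (m * m) - (\<Sum>j\<in>{1..m}. j * \<sigma> j)"
      using bound[OF pt] by linarith
    note IH = less.hyps[OF dec ok]
    have w: "wt \<sigma> + (w (E i (\<sigma> (i + 1))) + w (E (i + 1) (\<sigma> i))) = wt \<tau> + (w (E i (\<sigma> i)) + w (E (i + 1) (\<sigma> (i + 1))))"
      using split[of "\<lambda>j c. w (E j c)" \<sigma>] split[of "\<lambda>j c. w (E j c)" \<tau>] rest[of "\<lambda>j c. w (E j c)"] t
      unfolding wt_def by simp
    have le: "wt \<sigma> \<le> wt \<tau>" using sw(1)[OF i(1,2) pre] w by linarith
    show ?thesis
    proof (intro conjI impI)
      show "wt \<sigma> \<le> wt id" using le IH by linarith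
      assume eq: "wt \<sigma> = wt id"
      hence teq: "wt \<tau> = wt id" using le IH by linarith
      hence z: "E (i + 1) (c + 1) = u0" if "\<sigma> (i + 1) \<le> c" "c < \<sigma> i" for c
        using sw(2)[OF i(1,2) pre _ that] w eq by linarith
      from IH teq have "\<tau> = id \<or> (\<exists>s. 1 \<le> s \<and> s < m \<and> E (s + 1) (s + 1) = u0 \<and> \<tau> = transpose s (s + 1))" by blast
      \<comment> \<open>Two swaps of excess 0 cannot follow one another: for \<tau> a transposition
        at another place \<open>s\<close>, the swapped rectangle would contain the diagonal place
        \<open>i + 1\<close>, which forces \<open>i = s\<close>.\<close>
      hence "\<tau> = id"
      proof
        assume "\<exists>s. 1 \<le> s \<and> s < m \<and> E (s + 1) (s + 1) = u0 \<and> \<tau> = transpose s (s + 1)"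
        then obtain s where s: "1 \<le> s" "s < m" "E (s + 1) (s + 1) = u0" "\<tau> = transpose s (s + 1)" by blast
        have "i \<noteq> s" using s(4) t d by auto
        have "\<sigma> (i + 1) = transpose s (s + 1) i" "\<sigma> i = transpose s (s + 1) (i + 1)"
          using t(1,2) unfolding s(4) by simp_all
        hence "\<sigma> (i + 1) \<le> i" "i < \<sigma> i" using \<open>i \<noteq> s\<close> by (simp_all add: transpose_def)
        hence "E (i + 1) (i + 1) = u0" by (rule z)
        hence "i + 1 = s + 1" using s i by (intro inj) auto
        thus ?thesis using \<open>i \<noteq> s\<close> by simp
      qed
      moreover have "\<sigma> = \<tau> \<circ> transpose i (i + 1)" unfolding \<tau>_def by (simp add: comp_assoc)
      ultimately have si: "\<sigma> = transpose i (i + 1)" by simp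
      hence "E (i + 1) (i + 1) = u0" by (intro z) (auto simp: transpose_def)
      thus "\<sigma> = id \<or> (\<exists>s. 1 \<le> s \<and> s < m \<and> E (s + 1) (s + 1) = u0 \<and> \<sigma> = transpose s (s + 1))"
        using si i by blast
    qed
  qed
qed

definition mtx :: "(nat \<times> nat \<Rightarrow> complex) \<Rightarrow> nat \<Rightarrow> nat \<Rightarrow> complex" where
  "mtx x i j = (if E i j = (0, 0) then 0 else x (E i j))"
definition f :: "(nat \<times> nat \<Rightarrow> complex) \<Rightarrow> complex" where "f x = detm m (mtx x)"
definition term_of :: "(nat \<Rightarrow> nat) \<Rightarrow> (nat \<times> nat \<Rightarrow> complex) \<Rightarrow> complex" where
  "term_of \<sigma> x = of_int (sign \<sigma>) * (\<Prod>i\<in>{1..m}. x (E i (\<sigma> i)))"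

lemma finite_ok: "finite {\<sigma>. ok \<sigma>}"
  by (rule finite_subset[OF _ finite_permutations[of "{1..m}"]]) (auto simp: ok_def)

lemma f_ok: "f x = (\<Sum>\<sigma> | ok \<sigma>. term_of \<sigma> x)"
proof -
  have "f x = (\<Sum>\<sigma> | \<sigma> permutes {1..m}. of_int (sign \<sigma>) * (\<Prod>i=1..m. mtx x i (\<sigma> i)))"
    by (simp add: f_def detm_def)
  also have "\<dots> = (\<Sum>\<sigma> | ok \<sigma>. of_int (sign \<sigma>) * (\<Prod>i=1..m. mtx x i (\<sigma> i)))"
  proof (rule sum.mono_neutral_right)
    show "\<forall>\<sigma>\<in>{\<sigma>. \<sigma> permutes {1..m}} - {\<sigma>. ok \<sigma>}. of_int (sign \<sigma>) * (\<Prod>i=1..m. mtx x i (\<sigma> i)) = 0"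
    proof
      fix \<sigma> assume "\<sigma> \<in> {\<sigma>. \<sigma> permutes {1..m}} - {\<sigma>. ok \<sigma>}"
      then obtain i where "i \<in> {1..m}" "E i (\<sigma> i) = (0, 0)" by (auto simp: ok_def)
      hence "(\<Prod>i=1..m. mtx x i (\<sigma> i)) = 0" by (intro prod_zero bexI[of _ i]) (auto simp: mtx_def)
      thus "of_int (sign \<sigma>) * (\<Prod>i=1..m. mtx x i (\<sigma> i)) = 0" by simp
    qed
  qed (auto simp: finite_permutations ok_def)
  also have "\<dots> = (\<Sum>\<sigma> | ok \<sigma>. term_of \<sigma> x)"
    by (rule sum.cong) (auto simp: term_of_def ok_def mtx_def intro!: prod.cong)
  finally show ?thesis .
qed

definition lead :: "(nat \<times> nat \<Rightarrow> complex) \<Rightarrow> complex" where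
  "lead x = (\<Sum>\<sigma> | ok \<sigma> \<and> wt \<sigma> = wt id. term_of \<sigma> x)"

lemma along_f:
  assumes fV: "f \<in> pol V"
  shows "along (\<lambda>v. monom (x v) (w v)) f = (\<Sum>\<sigma> | ok \<sigma>. monom (term_of \<sigma> x) (wt \<sigma>))"
proof (rule along_eqI[OF fV])
  fix t
  have "term_of \<sigma> (\<lambda>v. x v * t ^ w v) = term_of \<sigma> x * t ^ wt \<sigma>" for \<sigma>
    by (simp add: term_of_def prod.distrib wt_def power_sum)
  thus "poly (\<Sum>\<sigma> | ok \<sigma>. monom (term_of \<sigma> x) (wt \<sigma>)) t = f (\<lambda>v. poly (monom (x v) (w v)) t)"
    by (simp add: f_ok poly_sum poly_monom)
qed

lemma
  assumes V: "finite V" and fV: "f \<in> pol V" and nz: "lead \<noteq> (\<lambda>x. 0)"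
  shows f_deg: "curves.deg (\<lambda>x v. monom (x v) (w v)) f = wt id"
    and f_top: "curves.top (\<lambda>x v. monom (x v) (w v)) f = lead"
proof -
  interpret curves V "\<lambda>x v. monom (x v) (w v)" by (rule curves_weight[OF V])
  have c: "comp (wt id) f = lead"
  proof
    fix x
    have "comp (wt id) f x = (\<Sum>\<sigma> | ok \<sigma>. if wt \<sigma> = wt id then term_of \<sigma> x else 0)"
      unfolding comp_def along_f[OF fV] coeff_sum by (intro sum.cong) auto
    also have "\<dots> = lead x" unfolding lead_def
      by (subst sum.inter_filter[symmetric, OF finite_ok]) simp
    finally show "comp (wt id) f x = lead x" .
  qed
  show d: "deg f = wt id"
  proof (rule deg_eqI[OF fV])
    show "comp (wt id) f \<noteq> (\<lambda>x. 0)" using c nz by simp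
    show "degree (along (\<lambda>v. monom (x v) (w v)) f) \<le> wt id" for x
      unfolding along_f[OF fV] by (intro degree_sum_le[OF finite_ok] order_trans[OF degree_monom_le]) (use wt_le in auto)
  qed
  show "top f = lead" unfolding top_def d c ..
qed

lemma ok_id: "ok id" using diag by (auto simp: ok_def permutes_id)

lemma lead_strict:
  assumes "\<And>i. 1 \<le> i \<Longrightarrow> i \<le> m \<Longrightarrow> E i i \<noteq> u0"
  shows "lead x = (\<Prod>i\<in>{1..m}. x (E i i))"
proof -
  have "{\<sigma>. ok \<sigma> \<and> wt \<sigma> = wt id} = {id}" using wt_le assms ok_id by force
  thus ?thesis unfolding lead_def by (simp add: term_of_def sign_id)
qed

lemma lead_swap:
  assumes s: "1 \<le> s" "s < m" "E (s + 1) (s + 1) = u0" and nz: "E s (s + 1) \<noteq> (0, 0)" "E (s + 1) s \<noteq> (0, 0)"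
    and eq: "w (E s (s + 1)) + w (E (s + 1) s) = w (E s s) + w (E (s + 1) (s + 1))"
  shows "lead x = (\<Prod>i\<in>{1..m}-{s, s+1}. x (E i i)) * (x (E s s) * x (E (s + 1) (s + 1)) - x (E s (s + 1)) * x (E (s + 1) s))"
proof -
  let ?t = "transpose s (s + 1)"
  have split: "(\<Sum>j\<in>{1..m}. h j) = h s + h (s + 1) + (\<Sum>j\<in>{1..m}-{s, s+1}. h j)" for h :: "nat \<Rightarrow> nat"
  proof -
    have "{1..m} = insert s (insert (s + 1) ({1..m} - {s, s+1}))" using s by auto
    hence "(\<Sum>j\<in>{1..m}. h j) = (\<Sum>j\<in>insert s (insert (s + 1) ({1..m} - {s, s+1})). h j)" by simp
    thus ?thesis by (simp add: add.assoc)
  qed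
  have psplit: "(\<Prod>j\<in>{1..m}. h j) = h s * h (s + 1) * (\<Prod>j\<in>{1..m}-{s, s+1}. h j)" for h :: "nat \<Rightarrow> complex"
  proof -
    have "{1..m} = insert s (insert (s + 1) ({1..m} - {s, s+1}))" using s by auto
    hence "(\<Prod>j\<in>{1..m}. h j) = (\<Prod>j\<in>insert s (insert (s + 1) ({1..m} - {s, s+1})). h j)" by simp
    thus ?thesis by (simp add: mult.assoc)
  qed
  have okt: "ok ?t" unfolding ok_def
  proof (intro conjI ballI)
    show "?t permutes {1..m}" by (rule permutes_swap_id) (use s in auto)
    fix i assume "i \<in> {1..m}"
    thus "E i (?t i) \<noteq> (0, 0)" using nz diag[of i] by (cases "i = s"; cases "i = s + 1") (auto simp: transpose_def)
  qed
  have wtt: "wt ?t = wt id"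
    unfolding wt_def split using eq by (simp add: transpose_def)
  have "{\<sigma>. ok \<sigma> \<and> wt \<sigma> = wt id} = {id, ?t}"
  proof
    show "{\<sigma>. ok \<sigma> \<and> wt \<sigma> = wt id} \<subseteq> {id, ?t}"
    proof
      fix \<sigma> assume "\<sigma> \<in> {\<sigma>. ok \<sigma> \<and> wt \<sigma> = wt id}"
      hence "\<sigma> = id \<or> (\<exists>s'. 1 \<le> s' \<and> s' < m \<and> E (s' + 1) (s' + 1) = u0 \<and> \<sigma> = transpose s' (s' + 1))" using wt_le by blast
      thus "\<sigma> \<in> {id, ?t}"
      proof
        assume "\<exists>s'. 1 \<le> s' \<and> s' < m \<and> E (s' + 1) (s' + 1) = u0 \<and> \<sigma> = transpose s' (s' + 1)"
        then obtain s' where s': "1 \<le> s'" "s' < m" "E (s' + 1) (s' + 1) = u0" "\<sigma> = transpose s' (s' + 1)" by blast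
        hence "s' + 1 = s + 1" using s by (intro inj) auto
        thus ?thesis using s' by simp
      qed simp
    qed
    show "{id, ?t} \<subseteq> {\<sigma>. ok \<sigma> \<and> wt \<sigma> = wt id}" using ok_id okt wtt by auto
  qed
  moreover have "id \<noteq> ?t" by (auto simp: fun_eq_iff transpose_def)
  ultimately have "lead x = term_of id x + term_of ?t x" unfolding lead_def by simp
  also have "term_of id x = (\<Prod>i\<in>{1..m}-{s, s+1}. x (E i i)) * (x (E s s) * x (E (s + 1) (s + 1)))"
    unfolding term_of_def psplit by (simp add: sign_id mult_ac)
  also have "term_of ?t x = - ((\<Prod>i\<in>{1..m}-{s, s+1}. x (E i i)) * (x (E s (s + 1)) * x (E (s + 1) s)))"
  proof -
    have "(\<Prod>i\<in>{1..m}-{s, s+1}. x (E i (?t i))) = (\<Prod>i\<in>{1..m}-{s, s+1}. x (E i i))"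
      by (rule prod.cong) (auto simp: transpose_def)
    thus ?thesis unfolding term_of_def psplit by (simp add: sign_swap_id mult_ac)
  qed
  finally show ?thesis by (simp add: algebra_simps)
qed

end

context cg
begin

subsection \<open>The chains of initial variables\<close>

definition XX :: "(nat \<times> nat \<Rightarrow> complex) \<Rightarrow> nat \<Rightarrow> nat \<Rightarrow> complex" where
  "XX x = (\<lambda>i j. x (i, j))"
definition U :: "(nat \<times> nat \<Rightarrow> complex) \<Rightarrow> nat \<Rightarrow> nat \<Rightarrow> complex" where
  "U x r c = (if Usrc n r c = (0, 0) then 0 else x (Usrc n r c))"

text \<open>Two spare blocks are kept above the rows used by the initial cluster: by periodicity of the
  band matrix the minors do not depend on this choice, and the relations below need the room.\<close>
definition K :: nat where "K = kk n + 2"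
definition row :: "nat \<Rightarrow> nat" where "row m = K * (n - 1) + 1 - m"
text \<open>Corner column of the trailing minors: \<open>e = 0\<close> belongs to \<open>phi\<close>
  and \<open>e = 1\<close> to \<open>psi\<close>. The value \<open>e = 2\<close> occurs for the
  neighbours above the \<open>psi\<close> corners.\<close>

definition col :: "nat \<Rightarrow> nat \<Rightarrow> nat" where "col e m = K * (n + 1) + 1 + e - m"
definition vtx :: "nat \<Rightarrow> nat \<Rightarrow> nat \<times> nat" where "vtx e m = Usrc n (row m) (col e m)"
definition G :: "nat \<Rightarrow> nat \<Rightarrow> (nat \<times> nat \<Rightarrow> complex) \<Rightarrow> complex" where
  "G e m x = minor (U x) (row m) (col e m) m"
definition th :: "nat \<Rightarrow> (nat \<times> nat \<Rightarrow> complex) \<Rightarrow> complex" where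
  "th i x = theta n i (XX x)"
definition cl :: "nat \<times> nat \<Rightarrow> (nat \<times> nat \<Rightarrow> complex) \<Rightarrow> complex" where
  "cl v x = init_cluster n v (XX x)"

lemma Umat_U: "Umat n (XX x) (XX x) = U x"
  by (intro ext) (simp add: Umat_Usrc U_def XX_def)

lemma k_facts: "n \<le> 2 * kk n" "2 * kk n \<le> n + 1" "NN n = kk n * (n - 1)"
  by (auto simp: kk_def NN_def)

lemma M_even: "even n \<Longrightarrow> MM n = kk n * (n - 1) \<and> 2 * kk n = n"
  by (auto simp: MM_def NN_def kk_def elim!: evenE)

lemma M_odd: "odd n \<Longrightarrow> MM n = (kk n - 1) * (n - 1) \<and> 2 * kk n = n + 1"
proof -
  assume o: "odd n"
  then obtain q where q: "n = 2 * q + 1" by (elim oddE)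
  thus ?thesis using n2 by (simp add: MM_def NN_def kk_def algebra_simps)
qed

section \<open>Corners of the minors in block coordinates\<close>

lemma size_split:
  assumes "1 \<le> m"
  obtains s a where "m = s * (n - 1) + (n - a)" "1 \<le> a" "a \<le> n - 1"
proof -
  \<comment> \<open>\<open>s\<close> counts the complete block rows below the block row of the
    corner; \<open>a = n - b\<close> is the row of the corner inside its own block row.\<close>
  obtain s b where b: "m = s * (n - 1) + b" "1 \<le> b" "b \<le> n - 1" by (rule row_block[OF assms])
  show ?thesis by (rule that[of s "n - b"]) (use b n2 in auto)
qed

lemma size_le:
  assumes "1 \<le> a" "a \<le> n - 1"
  shows "s * (n - 1) + (n - a) \<le> t * (n - 1) \<longleftrightarrow> s < t"
proof
  assume "s < t"
  hence "(s + 1) * (n - 1) \<le> t * (n - 1)" by (intro mult_le_mono1) simp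
  thus "s * (n - 1) + (n - a) \<le> t * (n - 1)" using assms by simp
next
  assume le: "s * (n - 1) + (n - a) \<le> t * (n - 1)"
  show "s < t"
  proof (rule ccontr)
    assume "\<not> s < t"
    hence "t * (n - 1) \<le> s * (n - 1)" by (intro mult_le_mono1) simp
    thus False using le assms n2 by linarith
  qed
qed

lemma rowcol:
  assumes "m = s * (n - 1) + (n - a)" "1 \<le> a" "a \<le> n - 1" "s < K"
  shows "row m = (K - 1 - s) * (n - 1) + a" "col e m = (K - 1 - s) * (n + 1) + (2 * s + 2 + a + e)"
proof -
  obtain d where d: "K = s + 1 + d" using assms(4) by (metis Suc_eq_plus1 Suc_leI le_Suc_ex)
  define p where "p = n - 1"
  have p: "n - 1 = p" "n + 1 = p + 2" "n = p + 1" using n2 unfolding p_def by auto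
  have a: "a \<le> p" using assms(3) p by simp
  have m: "m + a = s * p + p + 1" using assms(1) a unfolding p(1) using p(3) by linarith
  have "K * (n - 1) + 1 = d * p + (s * p + p + 1)" by (simp only: d p(1)) (simp add: algebra_simps)
  hence "row m = d * p + a" unfolding row_def m[symmetric] by simp
  thus "row m = (K - 1 - s) * (n - 1) + a" by (simp only: d p(1)) simp
  have "K * (n + 1) + 1 + e = d * (p + 2) + (s * p + p + 1) + 2 * s + 2 + e" by (simp only: d p(2)) (simp add: algebra_simps)
  hence "col e m = d * (p + 2) + a + 2 * s + 2 + e" unfolding col_def m[symmetric] by simp
  thus "col e m = (K - 1 - s) * (n + 1) + (2 * s + 2 + a + e)" by (simp only: d p(2)) simp
qed

lemma vtx_eq:
  assumes "m = s * (n - 1) + (n - a)" "1 \<le> a" "a \<le> n - 1" "s < K"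
  shows "vtx e m = srcl a (2 * s + 2 + a + e)"
  unfolding vtx_def rowcol[OF assms] by (rule Usrc_block) (use assms in auto)

definition rng :: "nat \<Rightarrow> nat \<Rightarrow> bool" where
  "rng e m \<longleftrightarrow> 1 \<le> m \<and> (e = 0 \<and> m \<le> NN n \<or> e = 1 \<and> m \<le> MM n)"

text \<open>The corner entry lies on the matrix diagonal at offset \<open>2 * s + e + 1\<close>, or
  that number minus \<open>n + 1\<close> after passing into \<open>calX\<close>. The cluster stops
  exactly before the main diagonal is hit, so the parity of \<open>n\<close> in \<open>MM\<close>
  disappears from the criterion.\<close>

lemma rng_iff:
  assumes "m = s * (n - 1) + (n - a)" "1 \<le> a" "a \<le> n - 1"
  shows "rng e m \<longleftrightarrow> e \<le> 1 \<and> 2 * s + e < n"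
proof -
  have m: "1 \<le> m" using assms n2 by simp
  have N: "m \<le> NN n \<longleftrightarrow> s < kk n" unfolding k_facts(3) assms(1) by (rule size_le[OF assms(2,3)])
  have M: "m \<le> MM n \<longleftrightarrow> 2 * s + 1 < n"
  proof (cases "even n")
    case True
    have "m \<le> MM n \<longleftrightarrow> s < kk n" using M_even[OF True] size_le[OF assms(2,3), of s "kk n"] assms(1) by simp
    thus ?thesis using M_even[OF True] True by presburger
  next
    case False
    have "m \<le> MM n \<longleftrightarrow> s < kk n - 1" using M_odd[OF False] size_le[OF assms(2,3), of s "kk n - 1"] assms(1) by simp
    thus ?thesis using M_odd[OF False] False by presburger
  qed
  have "s < kk n \<longleftrightarrow> 2 * s < n" using k_facts(1,2) by presburger
  thus ?thesis using m N M unfolding rng_def by auto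
qed

lemma rng_cases:
  assumes "rng e m"
  obtains s a where "m = s * (n - 1) + (n - a)" "1 \<le> a" "a \<le> n - 1" "e \<le> 1" "2 * s + e < n" "s < K"
proof -
  have "1 \<le> m" using assms by (simp add: rng_def)
  then obtain s a where sa: "m = s * (n - 1) + (n - a)" "1 \<le> a" "a \<le> n - 1" by (rule size_split)
  have "e \<le> 1" "2 * s + e < n" using assms rng_iff[OF sa] by auto
  moreover have "s < K" using calculation k_facts(1) unfolding K_def by linarith
  ultimately show ?thesis using that sa by blast
qed

lemma vtx_pair:
  assumes "m = s * (n - 1) + (n - a)" "1 \<le> a" "a \<le> n - 1" "s < K" "2 * s + e \<le> n"
  shows "vtx e m = (if a + 2 * s + e + 1 \<le> n then (a, a + 2 * s + e + 1) else (a + 1, a + 2 * s + e + 1 - n))"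
  unfolding vtx_eq[OF assms(1-4)] srcl_def using assms n2 by auto

text \<open>The offset of the corner from the main diagonal determines \<open>2 * s + e\<close>, and
  its parity is \<open>e\<close>.\<close>

lemma vtx_inj:
  assumes "rng e m" "rng e' m'" "vtx e m = vtx e' m'"
  shows "e = e' \<and> m = m'"
proof -
  obtain s a where sa: "m = s * (n - 1) + (n - a)" "1 \<le> a" "a \<le> n - 1" "e \<le> 1" "2 * s + e < n" "s < K"
    using assms(1) by (rule rng_cases)
  obtain s' a' where sa': "m' = s' * (n - 1) + (n - a')" "1 \<le> a'" "a' \<le> n - 1" "e' \<le> 1" "2 * s' + e' < n" "s' < K"
    using assms(2) by (rule rng_cases)
  have "2 * s + e \<le> n" "2 * s' + e' \<le> n" using sa sa' by auto
  hence "a = a' \<and> 2 * s + e = 2 * s' + e'"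
    using assms(3) vtx_pair[OF sa(1-3,6), of e] vtx_pair[OF sa'(1-3,6), of e'] sa(2-5) sa'(2-5)
    by (auto split: if_splits)
  moreover from this sa(4) sa'(4) have "s = s'" "e = e'" by presburger+
  ultimately show ?thesis using sa(1) sa'(1) by simp
qed

lemma vtx_offdiag: "rng e m \<Longrightarrow> fst (vtx e m) \<noteq> snd (vtx e m)"
  by (erule rng_cases) (subst (1 2) vtx_pair, auto)

lemma vtx_verts: "rng e m \<Longrightarrow> vtx e m \<in> verts n"
  by (erule rng_cases) (subst vtx_pair, auto simp: verts_def)

lemma cover:
  assumes "v \<in> verts n"
  obtains t where "1 \<le> t" "t \<le> n" "v = (t, t)" | e m where "rng e m" "v = vtx e m"
proof -
  obtain i j where v: "v = (i, j)" by (cases v)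
  have ij: "1 \<le> i" "i \<le> n" "1 \<le> j" "j \<le> n" using assms by (auto simp: v verts_def)
  consider "i = j" | "i < j" | "j < i" by linarith
  thus ?thesis
  proof cases
    case 1 thus ?thesis using that(1)[of i] ij v by simp
  next
    case 2
    \<comment> \<open>\<open>D\<close> is the value \<open>2 * s + e\<close> belonging to the offset
      \<open>j - i\<close>; below the main diagonal the corner lies in \<open>calX\<close>, whence
      the row \<open>i - 1\<close> and the shift by \<open>n\<close> in the other case.\<close>
    define D where "D = j - i - 1"
    define m where "m = (D div 2) * (n - 1) + (n - i)"
    have D: "2 * (D div 2) + D mod 2 = D" "D mod 2 \<le> 1" by auto
    have i: "1 \<le> i" "i \<le> n - 1" using 2 ij by auto
    have r: "rng (D mod 2) m" using rng_iff[OF m_def i] D 2 ij unfolding D_def by auto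
    have "D div 2 < K" using 2 ij k_facts(1) unfolding D_def K_def by linarith
    hence "vtx (D mod 2) m = (i, j)"
      using vtx_pair[OF m_def i, of "D mod 2"] D 2 ij unfolding D_def by auto
    thus ?thesis using that(2)[OF r] v by simp
  next
    case 3
    define D where "D = n + j - i"
    define m where "m = (D div 2) * (n - 1) + (n - (i - 1))"
    have D: "2 * (D div 2) + D mod 2 = D" "D mod 2 \<le> 1" by auto
    have i: "1 \<le> i - 1" "i - 1 \<le> n - 1" using 3 ij by auto
    have Dn: "D < n" "1 \<le> D" using 3 ij unfolding D_def by auto
    have r: "rng (D mod 2) m" using rng_iff[OF m_def i] D Dn by auto
    have "D div 2 < K" using Dn k_facts(1) unfolding K_def by linarith
    hence "vtx (D mod 2) m = (if (i - 1) + 2 * (D div 2) + D mod 2 + 1 \<le> n then (i - 1, (i - 1) + 2 * (D div 2) + D mod 2 + 1)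
      else (i - 1 + 1, (i - 1) + 2 * (D div 2) + D mod 2 + 1 - n))"
      using D Dn by (intro vtx_pair[OF m_def i]) auto
    also have "(i - 1) + 2 * (D div 2) + D mod 2 + 1 = n + j" using D(1) 3 ij unfolding D_def by linarith
    finally have "vtx (D mod 2) m = (i, j)" using 3 ij by simp
    thus ?thesis using that(2)[OF r] v by simp
  qed
qed

lemma Usrc_shift:
  assumes "1 \<le> r" "1 \<le> c"
  shows "Usrc n (r + j * (n - 1)) (c + j * (n + 1)) = Usrc n r c"
proof -
  obtain i a where a: "r = i * (n - 1) + a" "1 \<le> a" "a \<le> n - 1" by (rule row_block[OF assms(1)])
  have r: "r + j * (n - 1) = (i + j) * (n - 1) + a" unfolding a(1) add_mult_distrib by simp
  show ?thesis
  proof (cases "c \<le> i * (n + 1)")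
    case True
    have "Usrc n r c = (0, 0)" unfolding a(1) by (rule Usrc_left[OF a(2,3) assms(2) True])
    moreover have "Usrc n (r + j * (n - 1)) (c + j * (n + 1)) = (0, 0)"
      unfolding r by (rule Usrc_left[OF a(2,3)]) (use assms True in \<open>auto simp: algebra_simps\<close>)
    ultimately show ?thesis by simp
  next
    case False
    define l where "l = c - i * (n + 1)"
    have l: "c = i * (n + 1) + l" "1 \<le> l" using False by (auto simp: l_def)
    have c: "c + j * (n + 1) = (i + j) * (n + 1) + l" using l by (simp add: algebra_simps)
    show ?thesis unfolding r c Usrc_block[OF a(2,3) l(2)] unfolding a(1) l(1) Usrc_block[OF a(2,3) l(2)] ..
  qed
qed

lemma minor_shift:
  assumes "1 \<le> r" "1 \<le> c"
  shows "minor (U x) (r + j * (n - 1)) (c + j * (n + 1)) m = minor (U x) r c m"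
  unfolding minor_dt
proof (rule dt_cong)
  fix i i' assume "i < m" "i' < m"
  have "Usrc n (r + i + j * (n - 1)) (c + i' + j * (n + 1)) = Usrc n (r + i) (c + i')"
    by (rule Usrc_shift) (use assms in auto)
  thus "U x (r + j * (n - 1) + i) (c + j * (n + 1) + i') = U x (r + i) (c + i')"
    by (simp add: U_def algebra_simps)
qed

lemma skip_shift:
  assumes "1 \<le> r" "1 \<le> c"
  shows "skip (U x) (r + j * (n - 1)) (c + j * (n + 1)) m = skip (U x) r c m"
proof (cases "m = 0")
  case False
  have "dt m (\<lambda>i i'. U x (r + j * (n - 1) + i) (if i' = 0 then c + j * (n + 1) else c + j * (n + 1) + i' + 1))
    = dt m (\<lambda>i i'. U x (r + i) (if i' = 0 then c else c + i' + 1))"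
  proof (rule dt_cong)
    fix i i' assume "i < m" "i' < m"
    define d where "d = (if i' = 0 then c else c + i' + 1)"
    have "Usrc n (r + i + j * (n - 1)) (d + j * (n + 1)) = Usrc n (r + i) d"
      by (rule Usrc_shift) (use assms d_def in auto)
    hence "U x (r + j * (n - 1) + i) (d + j * (n + 1)) = U x (r + i) d"
      by (simp add: U_def algebra_simps)
    moreover have "(if i' = 0 then c + j * (n + 1) else c + j * (n + 1) + i' + 1) = d + j * (n + 1)"
      unfolding d_def by simp
    ultimately show "U x (r + j * (n - 1) + i) (if i' = 0 then c + j * (n + 1) else c + j * (n + 1) + i' + 1)
        = U x (r + i) (if i' = 0 then c else c + i' + 1)" unfolding d_def by simp
  qed
  thus ?thesis unfolding skip_def by (simp only: False if_False)
qed simp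

lemma N_le:
  assumes "p \<le> NN n"
  shows "row p = (NN n - p + 1) + 2 * (n - 1)" "col e p = (kk n * (n + 1) - p + 1 + e) + 2 * (n + 1)"
proof -
  have "kk n * (n - 1) \<le> kk n * (n + 1)" by (intro mult_le_mono2) simp
  hence p: "p \<le> kk n * (n + 1)" using assms k_facts(3) by linarith
  have "K * (n - 1) = NN n + 2 * (n - 1)" unfolding K_def k_facts(3) add_mult_distrib ..
  thus "row p = (NN n - p + 1) + 2 * (n - 1)" unfolding row_def using assms by linarith
  have "K * (n + 1) = kk n * (n + 1) + 2 * (n + 1)" unfolding K_def add_mult_distrib ..
  thus "col e p = (kk n * (n + 1) - p + 1 + e) + 2 * (n + 1)" unfolding col_def using p by linarith
qed

lemma M_le_N: "MM n \<le> NN n"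
  using M_even M_odd k_facts(3) by (cases "even n") auto

lemma pos_phi_vtx: "p \<le> NN n \<Longrightarrow> pos_phi n p = vtx 0 p"
  unfolding pos_phi_def vtx_def N_le by (subst Usrc_shift) simp_all
lemma pos_psi_vtx: "q \<le> MM n \<Longrightarrow> pos_psi n q = vtx 1 q"
  unfolding pos_psi_def vtx_def N_le[OF order_trans[OF _ M_le_N]] by (subst Usrc_shift) simp_all
lemma phi_G: "p \<le> NN n \<Longrightarrow> phi n p (XX x) (XX x) = G 0 p x"
  unfolding phi_def G_def Umat_U N_le by (subst minor_shift) simp_all
lemma psi_G: "q \<le> MM n \<Longrightarrow> psi n q (XX x) (XX x) = G 1 q x"
  unfolding psi_def G_def Umat_U N_le[OF order_trans[OF _ M_le_N]] by (subst minor_shift) simp_all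

lemma cl_vtx: assumes "rng e m" shows "cl (vtx e m) x = G e m x"
proof -
  have nt: "\<not> (\<exists>i\<in>{1..n}. pos_theta n i = vtx e m)"
  proof
    assume "\<exists>i\<in>{1..n}. pos_theta n i = vtx e m"
    then obtain i where "pos_theta n i = vtx e m" by blast
    hence "fst (vtx e m) = snd (vtx e m)" by (metis pos_theta_def fst_conv snd_conv)
    thus False using vtx_offdiag[OF assms] by simp
  qed
  have ph: "p = m" "e = 0" if "p \<in> {1..NN n}" "pos_phi n p = vtx e m" for p
    using vtx_inj[of 0 p e m] that assms pos_phi_vtx[of p] by (auto simp: rng_def)
  have ps: "q = m" "e = 1" if "q \<in> {1..MM n}" "pos_psi n q = vtx e m" for q
    using vtx_inj[of 1 q e m] that assms pos_psi_vtx[of q] by (auto simp: rng_def)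
  consider "e = 0" "1 \<le> m" "m \<le> NN n" | "e = 1" "1 \<le> m" "m \<le> MM n" using assms by (auto simp: rng_def)
  thus ?thesis
  proof cases
    case 1
    have ex: "\<exists>p\<in>{1..NN n}. pos_phi n p = vtx e m" using 1 pos_phi_vtx[of m] by (intro bexI[of _ m]) auto
    have "(SOME p. p \<in> {1..NN n} \<and> pos_phi n p = vtx e m) = m"
      by (rule some_equality) (use ph 1 pos_phi_vtx[of m] in auto)
    thus ?thesis unfolding cl_def init_cluster_def using nt ex phi_G[OF 1(3)] 1(1) by simp
  next
    case 2
    have nph: "\<not> (\<exists>p\<in>{1..NN n}. pos_phi n p = vtx e m)" using ph(2) 2(1) by (metis zero_neq_one)
    have ex: "\<exists>p\<in>{1..MM n}. pos_psi n p = vtx e m" using 2 pos_psi_vtx[of m] by (intro bexI[of _ m]) auto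
    have "(SOME p. p \<in> {1..MM n} \<and> pos_psi n p = vtx e m) = m"
      by (rule some_equality) (use ps 2 pos_psi_vtx[of m] in auto)
    thus ?thesis unfolding cl_def init_cluster_def using nt nph ex psi_G[OF 2(3)] 2(1) by simp
  qed
qed

lemma cl_diag: assumes "1 \<le> t" "t \<le> n" shows "cl (t, t) x = th (n - t + 1) x"
proof -
  have ex: "\<exists>i\<in>{1..n}. pos_theta n i = (t, t)"
    by (rule bexI[of _ "n - t + 1"]) (use assms in \<open>auto simp: pos_theta_def\<close>)
  have "(SOME i. i \<in> {1..n} \<and> pos_theta n i = (t, t)) = n - t + 1"
    by (rule some_equality) (use assms in \<open>auto simp: pos_theta_def\<close>)
  thus ?thesis unfolding cl_def init_cluster_def th_def using ex by simp
qed

text \<open>The largest \<open>phi\<close> and \<open>psi\<close> have their corners at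
  \<open>(1, n)\<close> and \<open>(2, 1)\<close>, in an order that depends on the parity of
  \<open>n\<close>.\<close>

lemma frozen_eq: "frozen n = {(1, 1), (1, n), (2, 1)}"
proof -
  have N: "NN n = (kk n - 1) * (n - 1) + (n - 1)" using k_facts n2 by (cases "kk n") auto
  have 1: "pos_theta n n = (1, 1)" using n2 by (simp add: pos_theta_def)
  have N1: "1 \<le> NN n" using N n2 by simp
  have b1: "1 \<le> (1::nat)" "1 \<le> n - 1" using n2 by auto
  show ?thesis
  proof (cases "even n")
    case True
    note M = M_even[OF True]
    have s: "2 * (kk n - 1) + 2 = n" using M n2 by linarith
    have "vtx 0 (NN n) = (1, n)" "vtx 1 (NN n) = (2, 1)"
      using vtx_pair[OF N b1, of 0] vtx_pair[OF N b1, of 1] s n2 unfolding K_def by auto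
    moreover have "MM n = NN n" using M k_facts by simp
    ultimately show ?thesis unfolding frozen_def 1
      using N1 pos_phi_vtx[of "NN n"] pos_psi_vtx[of "NN n"] by auto
  next
    case False
    note M = M_odd[OF False]
    have n3: "3 \<le> n" using n2 False by presburger
    have k2: "2 \<le> kk n" using M n3 by linarith
    have M': "MM n = (kk n - 2) * (n - 1) + (n - 1)" 
    proof -
      have "kk n - 1 = (kk n - 2) + 1" using k2 by simp
      hence "MM n = ((kk n - 2) + 1) * (n - 1)" using M by simp
      thus ?thesis unfolding add_mult_distrib by simp
    qed
    have s: "2 * (kk n - 1) + 1 = n" "2 * (kk n - 2) + 3 = n" using M n3 k2 by linarith+
    have "vtx 0 (NN n) = (2, 1)" "vtx 1 (MM n) = (1, n)"
      using vtx_pair[OF N b1, of 0] vtx_pair[OF M' b1, of 1] s n3 unfolding K_def by auto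
    moreover have "1 \<le> MM n" using M' n2 by simp
    ultimately show ?thesis unfolding frozen_def 1
      using N1 pos_phi_vtx[of "NN n"] pos_psi_vtx[of "MM n"] by auto
  qed
qed

lemma mutable_eq: "mutable n = mut"
  by (simp add: mutable_def mut_def frozen_eq)

lemma chain_nbrs:
  assumes "rng e m" "rng e (m + 1)"
  shows "vtx e m \<in> mut" "prv (vtx e m) = vtx e (m + 1)" "upv (vtx e m) = vtx (e + 1) (m + 1)"
    "lef (vtx e m) = Usrc n (row m) (col e m - 1)" "nxt (vtx e (m + 1)) = vtx e m"
proof -
  obtain s a where sa: "m = s * (n - 1) + (n - a)" "1 \<le> a" "a \<le> n - 1" "e \<le> 1" "2 * s + e < n" "s < K"
    using assms(1) by (rule rng_cases)
  obtain s' a' where sa': "m + 1 = s' * (n - 1) + (n - a')" "1 \<le> a'" "a' \<le> n - 1" "e \<le> 1" "2 * s' + e < n" "s' < K"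
    using assms(2) by (rule rng_cases)
  note rc = rowcol[OF sa(1-3,6)] and rc' = rowcol[OF sa'(1-3,6)]
  have r: "1 \<le> row (m + 1)" "1 \<le> col e (m + 1)" using rc'(1) rc'(2)[of e] sa'(2) by auto
  have R: "row (m + 1) + 1 = row m" "col e (m + 1) + 1 = col e m" using r unfolding row_def col_def by auto
  have s1: "supp (row m) (col e (m + 1))"
  proof -
    have "col e (m + 1) = (K - 1 - s) * (n + 1) + (2 * s + 1 + a + e)" using R(2) rc(2)[of e] by simp
    thus ?thesis unfolding rc(1) using supp_block[OF sa(2,3), of "col e (m + 1)" "K - 1 - s"] r sa by auto
  qed
  have s2: "supp (row (m + 1)) (col e (m + 1) + 1)"
    unfolding rc' using supp_block[OF sa'(2,3), of "(K - 1 - s') * (n + 1) + (2 * s' + 2 + a' + e) + 1" "K - 1 - s'"] sa' by auto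
  note w = window[OF r s2 s1[folded R(1)], unfolded R]
  show "vtx e m \<in> mut" "prv (vtx e m) = vtx e (m + 1)" using w by (auto simp: vtx_def)
  thus "nxt (vtx e (m + 1)) = vtx e m" using nxt_prv by metis
  have "col e m = col (e + 1) (m + 1)" unfolding col_def by simp
  thus "upv (vtx e m) = vtx (e + 1) (m + 1)" using w by (simp add: vtx_def)
  show "lef (vtx e m) = Usrc n (row m) (col e m - 1)" using w R(2) by (simp add: vtx_def R(2)[symmetric])
qed

lemma nxt_vtx_1: "rng e 1 \<Longrightarrow> nxt (vtx e 1) = (0, 0)"
proof -
  assume r: "rng e 1"
  have e: "(1::nat) = 0 * (n - 1) + (n - (n - 1))" "1 \<le> n - 1" "n - 1 \<le> n - 1" using n2 by auto
  have "vtx e 1 = (if n - 1 + 2 * 0 + e + 1 \<le> n then (n - 1, n - 1 + 2 * 0 + e + 1) else (n - 1 + 1, n - 1 + 2 * 0 + e + 1 - n))"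
    by (rule vtx_pair[OF e]) (use r n2 in \<open>auto simp: K_def rng_def\<close>)
  hence "vtx e 1 = (n - 1, n) \<or> vtx e 1 = (n, 1)" using r n2 by (auto simp: rng_def)
  thus ?thesis using n2 by (auto simp: nxt_def)
qed

lemma nxt_vtx: "rng e m \<Longrightarrow> nxt (vtx e m) = (if m = 1 then (0, 0) else vtx e (m - 1))"
proof (cases "m = 1")
  case False
  assume r: "rng e m"
  hence "rng e (m - 1)" "rng e (m - 1 + 1)" using False by (auto simp: rng_def)
  thus ?thesis using chain_nbrs(5)[of e "m - 1"] False r by (simp add: rng_def)
qed (use nxt_vtx_1 in simp)

lemma lef_vtx_1: "rng 1 m \<Longrightarrow> rng 1 (m + 1) \<Longrightarrow> lef (vtx 1 m) = vtx 0 m"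
  using chain_nbrs(4)[of 1 m] by (simp add: vtx_def col_def)

text \<open>The source to the left of a \<open>phi\<close> corner reappears in \<open>U\<close> one
  block row lower as a \<open>psi\<close> corner, which is \<open>n - 1\<close> smaller in size. In
  the last block row there is no such place, and the source is diagonal.\<close>

lemma lef_vtx_0:
  assumes "rng 0 m" "rng 0 (m + 1)"
  shows "lef (vtx 0 m) = (if n \<le> m then vtx 1 (m - n + 1) else (n - m, n - m))" "n \<le> m \<Longrightarrow> rng 1 (m - n + 1)"
proof -
  obtain s a where sa: "m = s * (n - 1) + (n - a)" "1 \<le> a" "a \<le> n - 1" "2 * s + 0 < n" "s < K"
    using assms(1) by (rule rng_cases) auto
  have "lef (vtx 0 m) = Usrc n (row m) (col 0 m - 1)" by (rule chain_nbrs[OF assms])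
  also have "\<dots> = srcl a (2 * s + 1 + a)"
    unfolding rowcol[OF sa(1-3,5)] using Usrc_block[OF sa(2,3), of "2 * s + 1 + a" "K - 1 - s"] sa by simp
  finally have l: "lef (vtx 0 m) = srcl a (2 * s + 1 + a)" .
  have nm: "n \<le> m \<longleftrightarrow> 1 \<le> s" using size_le[OF sa(2,3), of s 1] sa by auto
  have "lef (vtx 0 m) = (if n \<le> m then vtx 1 (m - n + 1) else (n - m, n - m)) \<and> (n \<le> m \<longrightarrow> rng 1 (m - n + 1))"
  proof (cases "n \<le> m")
    case True
    then obtain s' where s': "s = s' + 1" using nm by (metis le_add_diff_inverse2)
    have "m = s' * (n - 1) + (n - 1) + (n - a)" unfolding sa(1) s' add_mult_distrib by simp
    hence m': "m - n + 1 = s' * (n - 1) + (n - a)" using True n2 by linarith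
    have "vtx 1 (m - n + 1) = srcl a (2 * s' + 2 + a + 1)" by (rule vtx_eq[OF m' sa(2,3)]) (use s' sa in simp)
    moreover have "rng 1 (m - n + 1)" using rng_iff[OF m' sa(2,3)] s' sa by simp
    ultimately show ?thesis using l True s' by simp
  next
    case False
    hence "s = 0" using nm by simp
    thus ?thesis using l False sa n2 by (auto simp: srcl_def)
  qed
  thus "lef (vtx 0 m) = (if n \<le> m then vtx 1 (m - n + 1) else (n - m, n - m))" "n \<le> m \<Longrightarrow> rng 1 (m - n + 1)" by auto
qed

text \<open>\<open>es\<close> and \<open>ms\<close> locate the solution of
  \<open>2 * s + e = n\<close>, where a chain prolonged beyond the cluster would have its corners on
  the main diagonal.\<close>

definition es :: nat where "es = n mod 2"
definition ms :: nat where "ms = (n div 2) * (n - 1)"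

lemma vtx_critical:
  assumes "m = s * (n - 1) + (n - a)" "1 \<le> a" "a \<le> n - 1" "e \<le> 1" "2 * s + e = n"
  shows "vtx e m = (a + 1, a + 1)" "e = es" "m = ms + (n - a)"
proof -
  have "s < K" using assms k_facts(1) unfolding K_def by linarith
  thus "vtx e m = (a + 1, a + 1)" using vtx_pair[OF assms(1-3), of e] assms by auto
  have "s = n div 2" "e = n mod 2" using assms(4,5) by presburger+
  thus "e = es" "m = ms + (n - a)" using assms(1) by (auto simp: es_def ms_def)
qed

lemma rng_ms: "rng es ms"
proof -
  define s where "s = n div 2 - 1"
  have s: "n div 2 = s + 1" using n2 unfolding s_def by linarith
  have "ms = s * (n - 1) + (n - 1)" using s by (simp add: ms_def)
  moreover have "2 * s + es < n" using s unfolding es_def by presburger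
  ultimately show ?thesis using rng_iff[of ms s 1 es] n2 by (simp add: es_def)
qed

lemma upv_vtx_0:
  assumes "rng 0 m" "rng 0 (m + 1)"
  shows "rng 1 (m + 1) \<and> upv (vtx 0 m) = vtx 1 (m + 1) \<or>
    (\<exists>a. 1 \<le> a \<and> a \<le> n - 1 \<and> es = 1 \<and> m + 1 = ms + (n - a) \<and> upv (vtx 0 m) = (a + 1, a + 1))"
proof -
  have u: "upv (vtx 0 m) = vtx 1 (m + 1)" using chain_nbrs(3)[OF assms] by simp
  obtain s a where sa: "m + 1 = s * (n - 1) + (n - a)" "1 \<le> a" "a \<le> n - 1" "2 * s + 0 < n" "s < K"
    using assms(2) by (rule rng_cases) auto
  show ?thesis
  proof (cases "2 * s + 1 < n")
    case True
    thus ?thesis using u rng_iff[OF sa(1-3), of 1] by simp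
  next
    case False
    hence "2 * s + 1 = n" using sa by simp
    note c = vtx_critical[OF sa(1-3) order_refl this]
    show ?thesis by (intro disjI2 exI[of _ a] conjI) (use u c(1) c(2)[symmetric] c(3) sa(2,3) in simp_all)
  qed
qed

lemma upv_vtx_1:
  assumes "rng 1 m" "rng 1 (m + 1)"
  shows "rng 0 (m + n) \<and> upv (vtx 1 m) = vtx 0 (m + n) \<or>
    (\<exists>a. 1 \<le> a \<and> a \<le> n - 1 \<and> es = 0 \<and> m + n = ms + (n - a) \<and> upv (vtx 1 m) = (a + 1, a + 1))"
proof -
  have u: "upv (vtx 1 m) = vtx 2 (m + 1)" using chain_nbrs(3)[OF assms] by (simp add: numeral_2_eq_2)
  obtain s a where sa: "m + 1 = s * (n - 1) + (n - a)" "1 \<le> a" "a \<le> n - 1" "2 * s + 1 < n" "s < K"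
    using assms(2) by (rule rng_cases) auto
  \<comment> \<open>Two columns further right in block \<open>s\<close> has the same source as
    \<open>e = 0\<close> in block \<open>s + 1\<close>.\<close>
  have m': "m + n = (s + 1) * (n - 1) + (n - a)" using sa n2 by simp
  have "s + 1 < K" using sa k_facts(1) unfolding K_def by linarith
  hence "vtx 0 (m + n) = srcl a (2 * (s + 1) + 2 + a + 0)" by (rule vtx_eq[OF m' sa(2,3)])
  moreover have "vtx 2 (m + 1) = srcl a (2 * s + 2 + a + 2)" by (rule vtx_eq[OF sa(1-3,5)])
  ultimately have u': "upv (vtx 1 m) = vtx 0 (m + n)" using u by simp
  show ?thesis
  proof (cases "2 * (s + 1) + 0 < n")
    case True
    thus ?thesis using u' rng_iff[OF m' sa(2,3), of 0] by simp
  next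
    case False
    hence "2 * (s + 1) + 0 = n" using sa by simp
    note c = vtx_critical[OF m' sa(2,3) _ this]
    show ?thesis by (intro disjI2 exI[of _ a] conjI) (use u' c(1) c(2)[symmetric] c(3) sa(2,3) in simp_all)
  qed
qed

text \<open>The chain through the subdiagonal vertices \<open>(t, t - 1)\<close>.\<close>
definition ec :: nat where "ec = (n + 1) mod 2"
definition mc :: "nat \<Rightarrow> nat" where "mc i = ((n - 1) div 2) * (n - 1) + i"

lemma vtx_mc:
  assumes "1 \<le> i" "i \<le> n - 1"
  shows "rng ec (mc i)" "vtx ec (mc i) = (n - i + 1, n - i)"
proof -
  have m: "mc i = ((n - 1) div 2) * (n - 1) + (n - (n - i))" "1 \<le> n - i" "n - i \<le> n - 1"
    using assms by (auto simp: mc_def)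
  have d: "2 * ((n - 1) div 2) + ec + 1 = n" "ec \<le> 1" using n2 unfolding ec_def by presburger+
  show "rng ec (mc i)" using rng_iff[OF m, of ec] d by simp
  have "(n - 1) div 2 < K" using d k_facts(1) unfolding K_def by linarith
  moreover have "n - i + 2 * ((n - 1) div 2) + ec + 1 = (n - i) + n" using d by simp
  note e = this
  have "vtx ec (mc i) = (if n - i + 2 * ((n - 1) div 2) + ec + 1 \<le> n then (n - i, n - i + 2 * ((n - 1) div 2) + ec + 1)
      else (n - i + 1, n - i + 2 * ((n - 1) div 2) + ec + 1 - n))"
    by (rule vtx_pair[OF m]) (use calculation d in auto)
  thus "vtx ec (mc i) = (n - i + 1, n - i)" unfolding e using m(2) by simp
qed

lemma vtx_superdiag:
  assumes "1 \<le> i" "i \<le> n - 1"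
  shows "rng 0 i" "vtx 0 i = (n - i, n - i + 1)"
proof -
  have m: "i = 0 * (n - 1) + (n - (n - i))" "1 \<le> n - i" "n - i \<le> n - 1"
    using assms by auto
  show "rng 0 i" using rng_iff[OF m, of 0] n2 by simp
  show "vtx 0 i = (n - i, n - i + 1)" using vtx_pair[OF m, of 0] assms by (auto simp: K_def)
qed

lemma diag_nbrs:
  assumes "1 \<le> i" "i \<le> n - 1"
  defines "t \<equiv> n - i + 1"
  shows "(t, t) \<in> mut" "prv (t, t) = (t - 1, t - 1)" "upv (t, t) = vtx 0 i" "lef (t, t) = vtx ec (mc i)"
    "nxt (t, t) = (if i = 1 then (0, 0) else (t + 1, t + 1))"
  using assms(1,2) vtx_mc[OF assms(1,2)] vtx_superdiag[OF assms(1,2)] n2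
  by (auto simp: t_def mut_def verts_def prv_def upv_def lef_def nxt_def)

lemma mut_chain:
  assumes "v \<in> mut"
  obtains i where "1 \<le> i" "i \<le> n - 1" "v = (n - i + 1, n - i + 1)" | e m where "rng e m" "rng e (m + 1)" "v = vtx e m"
proof -
  have v: "v \<in> verts n" "v \<notin> frozen n" using assms by (auto simp: mut_def frozen_eq)
  from v(1) show ?thesis
  proof (cases rule: cover)
    case (1 t)
    hence "t \<noteq> 1" using v frozen_eq by auto
    thus ?thesis using that(1)[of "n - t + 1"] 1 by auto
  next
    case (2 e m)
    have "rng e (m + 1)"
    proof (rule ccontr)
      assume "\<not> rng e (m + 1)"
      hence "e = 0 \<and> m = NN n \<or> e = 1 \<and> m = MM n" using 2 by (auto simp: rng_def)
      hence "v \<in> frozen n" using 2 pos_phi_vtx[of "NN n"] pos_psi_vtx[of "MM n"]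
        unfolding frozen_def rng_def by auto
      thus False using v by simp
    qed
    thus ?thesis using that(2) 2 by blast
  qed
qed

end

lemma detm_pol:
  assumes "\<And>i j. i \<in> {1..m} \<Longrightarrow> j \<in> {1..m} \<Longrightarrow> (\<lambda>x. A x i j) \<in> pol V"
  shows "(\<lambda>x. detm m (A x)) \<in> pol V"
  unfolding detm_def
proof (rule pol_sum, rule pol_mult[OF pol_const], rule pol_prod)
  fix \<sigma> i assume s: "\<sigma> \<in> {\<sigma>. \<sigma> permutes {1..m}}" and i: "i \<in> {1..m}"
  have "\<sigma> i \<in> {1..m}" using s permutes_in_image[of \<sigma> "{1..m}" i] i by simp
  thus "(\<lambda>x. A x i (\<sigma> i)) \<in> pol V" by (rule assms[OF i])
qed

lemma dt_pol:
  assumes "\<And>i j. i < m \<Longrightarrow> j < m \<Longrightarrow> (\<lambda>x. A x i j) \<in> pol V"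
  shows "(\<lambda>x. dt m (A x)) \<in> pol V"
proof -
  have "(\<lambda>x. detm m (\<lambda>i j. A x (i - 1) (j - 1))) \<in> pol V"
    by (rule detm_pol) (use assms in auto)
  thus ?thesis by (simp add: detm_dt)
qed

lemma minor_pol:
  assumes "\<And>i j. r \<le> i \<Longrightarrow> i < r + m \<Longrightarrow> c \<le> j \<Longrightarrow> j < c + m \<Longrightarrow> (\<lambda>x. A x i j) \<in> pol V"
  shows "(\<lambda>x. minor (A x) r c m) \<in> pol V"
  unfolding minor_dt by (rule dt_pol) (use assms in auto)

lemma skip_pol:
  assumes "\<And>i j. r \<le> i \<Longrightarrow> i < r + m \<Longrightarrow> c \<le> j \<Longrightarrow> j \<le> c + m \<Longrightarrow> (\<lambda>x. A x i j) \<in> pol V"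
  shows "(\<lambda>x. skip (A x) r c m) \<in> pol V"
proof (cases "m = 0")
  case False
  have "(\<lambda>x. dt m (\<lambda>i j. A x (r + i) (if j = 0 then c else c + j + 1))) \<in> pol V"
    by (rule dt_pol) (use assms in auto)
  thus ?thesis using False by (simp add: skip_def)
qed (simp add: pol_const)

lemma dt_zero_col: "0 < m \<Longrightarrow> (\<And>i. i < m \<Longrightarrow> A i 0 = 0) \<Longrightarrow> dt m A = 0"
  by (cases m) (simp_all add: dt_col[of 0])

lemma dt_last_unit:
  assumes "\<And>i. i < p \<Longrightarrow> A i p = 0" "A p p = 1"
  shows "dt (p + 1) A = dt p A"
proof -
  have "dt 1 (\<lambda>i j. A (p + i) (p + j)) = 1" using dt_row_0[of 0 "\<lambda>i j. A (p + i) (p + j)"] assms by simp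
  thus ?thesis using dt_upper_right_zero[of p 1 A] assms by simp
qed

context cg
begin

subsection \<open>Weights on the matrix entries\<close>

text \<open>The term \<open>2 * i * j\<close> has mixed second difference 2 in ordinary windows, but
  \<open>2 - 2 * n\<close> in windows that wrap around the border. The squares are invisible in
  ordinary windows and contribute the missing \<open>2 * n\<close> in the others.\<close>

definition \<omega>0 :: "nat \<times> nat \<Rightarrow> int" where
  "\<omega>0 v = 2 * int (fst v) * int (snd v) + int n * int (fst v) ^ 2 - int n * int (snd v) ^ 2"
definition \<mu> :: "(nat \<times> nat \<Rightarrow> int) \<Rightarrow> nat \<times> nat \<Rightarrow> int" where
  "\<mu> \<omega> v = \<omega> v + \<omega> (prv v) - \<omega> (upv v) - \<omega> (lef v)"

lemma \<mu>_\<omega>0: assumes "v \<in> mut" shows "\<mu> \<omega>0 v = 2"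
  using assms
proof (cases rule: mut_cases)
  case (inner i j)
  have "prv v = (i - 1, j - 1)" "upv v = (i - 1, j)" "lef v = (i, j - 1)"
    using inner by (auto simp: prv_def upv_def lef_def)
  moreover have "int (i - 1) = int i - 1" "int (j - 1) = int j - 1" using inner by auto
  ultimately show ?thesis unfolding inner(1) \<mu>_def \<omega>0_def by (simp add: power2_eq_square algebra_simps)
next
  case (top j)
  have "prv v = (n, j)" "upv v = (n, j + 1)" "lef v = (1, j - 1)"
    using top by (auto simp: prv_def upv_def lef_def)
  moreover have "int (j - 1) = int j - 1" using top by auto
  ultimately show ?thesis unfolding top(1) \<mu>_def \<omega>0_def by (simp add: power2_eq_square algebra_simps)
next
  case (left i)
  have "prv v = (i - 2, n)" "upv v = (i - 1, 1)" "lef v = (i - 1, n)"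
    using left by (auto simp: prv_def upv_def lef_def)
  moreover have "int (i - 1) = int i - 1" "int (i - 2) = int i - 2" using left by auto
  ultimately show ?thesis unfolding left(1) \<mu>_def \<omega>0_def by (simp add: power2_eq_square algebra_simps)
qed

lemma stair:
  assumes "1 \<le> r" "1 \<le> c1" "c1 \<le> c" "c \<le> c2" "supp r c2" "supp (r + 1) c1"
  shows "supp r c \<and> supp (r + 1) c"
proof -
  obtain i a where a: "r = i * (n - 1) + a" "1 \<le> a" "a \<le> n - 1" by (rule row_block[OF assms(1)])
  have c: "1 \<le> c" "1 \<le> c2" using assms by auto
  note s = supp_block[OF a(2,3), of _ i]
  show ?thesis
  proof (cases "a = n - 1")
    case False
    hence a': "1 \<le> a + 1" "a + 1 \<le> n - 1" and r1: "r + 1 = i * (n - 1) + (a + 1)" using a by auto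
    show ?thesis using assms s[OF c(1)] s[OF c(2)] supp_block[OF a' c(1), of i] supp_block[OF a' assms(2), of i]
      unfolding r1 unfolding a(1) by linarith
  next
    case True
    have a': "(1::nat) \<le> 1" "1 \<le> n - 1" and r1: "r + 1 = (i + 1) * (n - 1) + 1" using a True n2 by auto
    have "(i + 1) * (n + 1) = i * (n + 1) + n + 1" by (simp add: algebra_simps)
    thus ?thesis using assms s[OF c(1)] s[OF c(2)] supp_block[OF a' c(1), of "i + 1"] supp_block[OF a' assms(2), of "i + 1"]
      unfolding r1 unfolding a(1) by linarith
  qed
qed

text \<open>Only the diagonal has to be checked to lie in the support; the staircase shape of
  \<open>U\<close> and \<open>window\<close> give the rest.\<close>

lemma band_U:
  assumes rc: "1 \<le> r" "1 \<le> c" and d: "\<And>i. i < m \<Longrightarrow> supp (r + i) (c + i)"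
    and w: "\<And>v. v \<in> mut \<Longrightarrow> w (upv v) + w (lef v) < w v + w (prv v) \<or> w (upv v) + w (lef v) = w v + w (prv v) \<and> v = u0"
    and inj: "\<And>i j. i < m \<Longrightarrow> j < m \<Longrightarrow> Usrc n (r + i) (c + i) = u0 \<Longrightarrow> Usrc n (r + j) (c + j) = u0 \<Longrightarrow> i = j"
  shows "band (\<lambda>i j. Usrc n (r + i - 1) (c + j - 1)) m w u0"
proof
  show "Usrc n (r + i - 1) (c + i - 1) \<noteq> (0, 0)" if "1 \<le> i" "i \<le> m" for i
    using d[of "i - 1"] that by (simp add: supp_def)
  show "Usrc n (r + i - 1) (c + c' - 1) \<noteq> (0, 0) \<and> Usrc n (r + (i + 1) - 1) (c + c' - 1) \<noteq> (0, 0)"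
    if "1 \<le> i" "i < m" "1 \<le> c1" "c1 \<le> c'" "c' \<le> c2" "c2 \<le> m"
      "Usrc n (r + i - 1) (c + c2 - 1) \<noteq> (0, 0)" "Usrc n (r + (i + 1) - 1) (c + c1 - 1) \<noteq> (0, 0)" for i c1 c' c2
    using stair[of "r + i - 1" "c + c1 - 1" "c + c' - 1" "c + c2 - 1"] that rc by (simp add: supp_def)
  show "w (Usrc n (r + i - 1) (c + (c' + 1) - 1)) + w (Usrc n (r + (i + 1) - 1) (c + c' - 1))
      < w (Usrc n (r + i - 1) (c + c' - 1)) + w (Usrc n (r + (i + 1) - 1) (c + (c' + 1) - 1)) \<or>
    w (Usrc n (r + i - 1) (c + (c' + 1) - 1)) + w (Usrc n (r + (i + 1) - 1) (c + c' - 1))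
      = w (Usrc n (r + i - 1) (c + c' - 1)) + w (Usrc n (r + (i + 1) - 1) (c + (c' + 1) - 1)) \<and>
    Usrc n (r + (i + 1) - 1) (c + (c' + 1) - 1) = u0"
    if "1 \<le> i" "i < m" "1 \<le> c'" "c' < m"
      "Usrc n (r + i - 1) (c + (c' + 1) - 1) \<noteq> (0, 0)" "Usrc n (r + (i + 1) - 1) (c + c' - 1) \<noteq> (0, 0)" for i c'
  proof -
    have e: "r + i - 1 + 1 = r + (i + 1) - 1" "c + c' - 1 + 1 = c + (c' + 1) - 1" using that by auto
    note W = window[of "r + i - 1" "c + c' - 1", unfolded e supp_def]
    have "1 \<le> r + i - 1" "1 \<le> c + c' - 1" using rc that by auto
    note W = W[OF this that(5,6)]
    show ?thesis using w[OF W(3)] unfolding W(4-6) by linarith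
  qed
  show "i = j" if "1 \<le> i" "i \<le> m" "1 \<le> j" "j \<le> m" "Usrc n (r + i - 1) (c + i - 1) = u0" "Usrc n (r + j - 1) (c + j - 1) = u0" for i j
  proof -
    have "r + i - 1 = r + (i - 1)" "c + i - 1 = c + (i - 1)" "r + j - 1 = r + (j - 1)" "c + j - 1 = c + (j - 1)"
      using that by auto
    hence "i - 1 = j - 1" using that inj[of "i - 1" "j - 1"] by (simp only:)
    thus ?thesis using that by simp
  qed
qed

text \<open>Adding a constant makes the weights positive naturals. It does not change any excess,
  since a window has two entries of either sign.\<close>

definition nw :: "(nat \<times> nat \<Rightarrow> int) \<Rightarrow> nat \<times> nat \<Rightarrow> nat" where
  "nw \<omega> v = nat (\<omega> v + (\<Sum>u\<in>verts n. \<bar>\<omega> u\<bar>) + 1)"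

lemma finite_verts: "finite (verts n)" by (simp add: verts_def)

lemma nw: "v \<in> verts n \<Longrightarrow> int (nw \<omega> v) = \<omega> v + (\<Sum>u\<in>verts n. \<bar>\<omega> u\<bar>) + 1 \<and> 0 < nw \<omega> v"
proof -
  assume "v \<in> verts n"
  hence "\<bar>\<omega> v\<bar> \<le> (\<Sum>u\<in>verts n. \<bar>\<omega> u\<bar>)" by (intro member_le_sum finite_verts) auto
  thus ?thesis by (auto simp: nw_def)
qed

lemma nw_window:
  assumes "v \<in> mut"
  shows "int (nw \<omega> v) + int (nw \<omega> (prv v)) - int (nw \<omega> (upv v)) - int (nw \<omega> (lef v)) = \<mu> \<omega> v"
  using nw[of v \<omega>] nw[of "prv v" \<omega>] nw[of "upv v" \<omega>] nw[of "lef v" \<omega>] nbrs_in_verts[OF assms] assms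
  by (simp add: \<mu>_def mut_def)

lemma minor_U_band: "minor (U x) r c m = band.f (\<lambda>i j. Usrc n (r + i - 1) (c + j - 1)) m x"
  if "band (\<lambda>i j. Usrc n (r + i - 1) (c + j - 1)) m w u0"
proof -
  interpret band "\<lambda>i j. Usrc n (r + i - 1) (c + j - 1)" m w u0 by (rule that)
  show ?thesis unfolding f_def minor_def mtx_def U_def ..
qed

lemma Usrc_verts: "1 \<le> r \<Longrightarrow> 1 \<le> c \<Longrightarrow> supp r c \<Longrightarrow> Usrc n r c \<in> verts n"
proof -
  assume rc: "1 \<le> r" "1 \<le> c" and s: "supp r c"
  obtain i a where a: "r = i * (n - 1) + a" "1 \<le> a" "a \<le> n - 1" by (rule row_block[OF rc(1)])
  define l where "l = c - i * (n + 1)"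
  have l: "c = i * (n + 1) + l" "2 \<le> l" "l \<le> 2 * n + 1"
    using s supp_block[OF a(2,3) rc(2), of i] unfolding a(1) l_def by auto
  have "Usrc n r c = srcl a l" unfolding a(1) l(1) by (rule Usrc_block[OF a(2,3)]) (use l in simp)
  thus ?thesis using l a by (auto simp: srcl_def verts_def)
qed

lemma U_pol: "1 \<le> r \<Longrightarrow> 1 \<le> c \<Longrightarrow> (\<lambda>x. U x r c) \<in> pol (verts n)"
  using Usrc_verts[of r c] by (cases "supp r c") (simp_all add: U_def supp_def pol_const pol_var)

lemma minor_U_pol: "1 \<le> r \<Longrightarrow> 1 \<le> c \<Longrightarrow> (\<lambda>x. minor (U x) r c m) \<in> pol (verts n)"
  by (rule minor_pol, rule U_pol) simp_all
lemma skip_U_pol: "1 \<le> r \<Longrightarrow> 1 \<le> c \<Longrightarrow> (\<lambda>x. skip (U x) r c m) \<in> pol (verts n)"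
  by (rule skip_pol, rule U_pol) simp_all
lemma minor_XX_pol: "1 \<le> r \<Longrightarrow> 1 \<le> c \<Longrightarrow> r + m \<le> n + 1 \<Longrightarrow> c + m \<le> n + 1 \<Longrightarrow> (\<lambda>x. minor (XX x) r c m) \<in> pol (verts n)"
  by (rule minor_pol) (unfold XX_def, rule pol_var, simp add: verts_def)
lemma skip_XX_pol: "1 \<le> r \<Longrightarrow> 1 \<le> c \<Longrightarrow> r + m \<le> n + 1 \<Longrightarrow> c + m \<le> n \<Longrightarrow> (\<lambda>x. skip (XX x) r c m) \<in> pol (verts n)"
  by (rule skip_pol) (unfold XX_def, rule pol_var, simp add: verts_def)

text \<open>All windows have excess 2, so the diagonal product is the whole leading form. This
  justifies the cancellation of common minors in the relations below.\<close>

lemma minor_U_nonzero: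
  assumes rc: "1 \<le> r" "1 \<le> c" and d: "\<And>i. i < m \<Longrightarrow> supp (r + i) (c + i)"
  shows "(\<lambda>x. minor (U x) r c m) \<noteq> (\<lambda>x. 0)"
proof
  assume z: "(\<lambda>x. minor (U x) r c m) = (\<lambda>x. 0)"
  have b: "band (\<lambda>i j. Usrc n (r + i - 1) (c + j - 1)) m (nw \<omega>0) (0, 0)"
  proof (rule band_U[OF rc d])
    show "nw \<omega>0 (upv v) + nw \<omega>0 (lef v) < nw \<omega>0 v + nw \<omega>0 (prv v) \<or>
      nw \<omega>0 (upv v) + nw \<omega>0 (lef v) = nw \<omega>0 v + nw \<omega>0 (prv v) \<and> v = (0, 0)" if "v \<in> mut" for v
      using nw_window[OF that, of \<omega>0] \<mu>_\<omega>0[OF that] by linarith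
  qed (use d in \<open>auto simp: supp_def\<close>)
  interpret band "\<lambda>i j. Usrc n (r + i - 1) (c + j - 1)" m "nw \<omega>0" "(0, 0)" by (rule b)
  have "f = (\<lambda>x. minor (U x) r c m)" using minor_U_band[OF b] by auto
  hence fz: "f = (\<lambda>x. 0)" using z by simp
  have le: "lead x = (\<Prod>i\<in>{1..m}. x (Usrc n (r + i - 1) (c + i - 1)))" for x
    by (rule lead_strict) (use d[of "_ - 1"] diag in auto)
  have nz: "lead \<noteq> (\<lambda>x. 0)"
  proof
    assume "lead = (\<lambda>x. 0)"
    hence "lead (\<lambda>v. 1) = 0" by simp
    thus False unfolding le by simp
  qed
  have fp: "f \<in> pol (verts n)" unfolding fz by (rule pol_const)
  interpret C: curves "verts n" "\<lambda>x v. monom (x v) (nw \<omega>0 v)" by (rule curves_weight[OF finite_verts])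
  have "C.top f = lead" by (rule f_top[OF finite_verts fp nz])
  moreover have "C.top f = (\<lambda>x. 0)" unfolding fz C.top_def C.comp_const by auto
  ultimately show False using nz by simp
qed

subsection \<open>Triangular minors\<close>

lemma U_block:
  assumes "1 \<le> a" "a \<le> n - 1" "1 \<le> l"
  shows "U x (i * (n - 1) + a) (i * (n + 1) + l) =
    (if l \<le> 1 \<or> 2 * n + 1 < l then 0 else if l \<le> n + 1 then x (a, l - 1) else x (a + 1, l - n - 1))"
  unfolding U_def Usrc_block[OF assms] srcl_def using assms by auto

lemma U_zero: "1 \<le> a \<Longrightarrow> a \<le> n - 1 \<Longrightarrow> 1 \<le> c \<Longrightarrow> c \<le> i * (n + 1) + 1 \<Longrightarrow> U x (i * (n - 1) + a) c = 0"
  using supp_block[of a c i] by (simp add: U_def supp_def)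

definition sg :: "(nat \<times> nat \<Rightarrow> complex) \<Rightarrow> complex" where "sg x = minor (XX x) 1 1 (n - 1)"

text \<open>When the last \<open>n - 1\<close> rows form a block row and their square part starts at
  the first column of \<open>calY\<close> after the zero column, everything to its left vanishes,
  and \<open>sg\<close> splits off.\<close>

lemma minor_bottom_block:
  assumes "r + p = b * (n - 1) + 1" "c + p = b * (n + 1) + 2" "1 \<le> c"
  shows "minor (U x) r c (p + (n - 1)) = minor (U x) r c p * sg x"
  unfolding minor_dt sg_def
proof (subst dt_lower_left_zero)
  fix i j assume ij: "i < n - 1" "j < p"
  have "r + (p + i) = b * (n - 1) + (i + 1)" using assms by simp
  thus "U x (r + (p + i)) (c + j) = 0" using ij assms by (simp only:) (rule U_zero, auto)
next
  have "dt (n - 1) (\<lambda>i j. U x (r + (p + i)) (c + (p + j))) = dt (n - 1) (\<lambda>i j. XX x (1 + i) (1 + j))"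
  proof (rule dt_cong)
    fix i j assume ij: "i < n - 1" "j < n - 1"
    have "r + (p + i) = b * (n - 1) + (i + 1)" "c + (p + j) = b * (n + 1) + (j + 2)" using assms by auto
    thus "U x (r + (p + i)) (c + (p + j)) = XX x (1 + i) (1 + j)"
      using ij U_block[of "i + 1" "j + 2" x b] by (simp only:) (simp add: XX_def)
  qed
  thus "dt p (\<lambda>i j. U x (r + i) (c + j)) * dt (n - 1) (\<lambda>i j. U x (r + (p + i)) (c + (p + j)))
    = dt p (\<lambda>i j. U x (r + i) (c + j)) * dt (n - 1) (\<lambda>i j. XX x (1 + i) (1 + j))" by simp
qed

lemma skip_bottom_block:
  assumes "r + p = b * (n - 1) + 1" "c + p = b * (n + 1) + 1" "1 \<le> c"
  shows "skip (U x) r c (p + (n - 1)) = skip (U x) r c p * sg x"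
proof (cases "p = 0")
  case True
  have "dt (n - 1) (\<lambda>i j. U x (r + i) (if j = 0 then c else c + j + 1)) = 0"
  proof (rule dt_zero_col)
    fix i assume i: "i < n - 1"
    have "r + i = b * (n - 1) + (i + 1)" using assms True by simp
    thus "U x (r + i) (if (0::nat) = 0 then c else c + 0 + 1) = 0" using i assms True
      by (simp only:) (simp, rule U_zero[of "i + 1", simplified], auto)
  qed (use n2 in auto)
  thus ?thesis using True n2 by (simp add: skip_def)
next
  case False
  let ?A = "\<lambda>i j. U x (r + i) (if j = 0 then c else c + j + 1)"
  have "dt (p + (n - 1)) ?A = dt p ?A * dt (n - 1) (\<lambda>i j. ?A (p + i) (p + j))"
  proof (rule dt_lower_left_zero)
    fix i j assume ij: "i < n - 1" "j < p"
    have "r + (p + i) = b * (n - 1) + (i + 1)" using assms by simp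
    moreover have "(if j = 0 then c else c + j + 1) \<le> b * (n + 1) + 1" "1 \<le> (if j = 0 then c else c + j + 1)" using ij assms by auto
    ultimately show "U x (r + (p + i)) (if j = 0 then c else c + j + 1) = 0" using ij
      by (simp only:) (rule U_zero, auto)
  qed
  moreover have "dt (n - 1) (\<lambda>i j. ?A (p + i) (p + j)) = sg x" unfolding sg_def minor_dt
  proof (rule dt_cong)
    fix i j assume ij: "i < n - 1" "j < n - 1"
    have "r + (p + i) = b * (n - 1) + (i + 1)" "(if p + j = 0 then c else c + (p + j) + 1) = b * (n + 1) + (j + 2)"
      using assms False by auto
    thus "U x (r + (p + i)) (if p + j = 0 then c else c + (p + j) + 1) = XX x (1 + i) (1 + j)"
      using ij U_block[of "i + 1" "j + 2" x b] by (simp only:) (simp add: XX_def)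
  qed
  ultimately show ?thesis using False n2 by (simp add: skip_def)
qed

text \<open>The first \<open>n - r\<close> rows complete a block row and the minor meets the
  trailing square of its \<open>calX\<close>. To the right there are zeros, so a trailing minor of
  the matrix itself splits off.\<close>

lemma minor_top_block:
  assumes "1 \<le> r" "r \<le> n"
  shows "minor (U x) (i * (n - 1) + r) (i * (n + 1) + (n + r + 2)) ((n - r) + q)
    = th (n - r) x * minor (U x) (i * (n - 1) + n) (i * (n + 1) + (2 * n + 2)) q"
proof -
  let ?A = "\<lambda>a b. U x (i * (n - 1) + r + a) (i * (n + 1) + (n + r + 2) + b)"
  have "dt ((n - r) + q) ?A = dt (n - r) ?A * dt q (\<lambda>a b. ?A ((n - r) + a) ((n - r) + b))"
  proof (rule dt_upper_right_zero)
    fix a b assume ab: "a < n - r" "b < q"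
    have "i * (n - 1) + r + a = i * (n - 1) + (r + a)" "i * (n + 1) + (n + r + 2) + (n - r + b) = i * (n + 1) + (2 * n + 2 + b)"
      using assms by auto
    thus "?A a (n - r + b) = 0" using U_block[of "r + a" "2 * n + 2 + b" x i] ab assms by (simp only:) simp
  qed
  moreover have "dt (n - r) ?A = th (n - r) x" unfolding th_def theta_def minor_dt
  proof (rule dt_cong)
    fix a b assume ab: "a < n - r" "b < n - r"
    have "i * (n - 1) + r + a = i * (n - 1) + (r + a)" "i * (n + 1) + (n + r + 2) + b = i * (n + 1) + (n + r + 2 + b)" by auto
    thus "?A a b = XX x (n - (n - r) + 1 + a) (n - (n - r) + 1 + b)"
      using U_block[of "r + a" "n + r + 2 + b" x i] ab assms by (simp only:) (simp add: XX_def)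
  qed
  moreover have "(\<lambda>a b. ?A ((n - r) + a) ((n - r) + b)) = (\<lambda>a b. U x (i * (n - 1) + n + a) (i * (n + 1) + (2 * n + 2) + b))"
    using assms by (intro ext arg_cong2[of _ _ _ _ "U x"]) auto
  ultimately show ?thesis unfolding minor_dt by simp
qed

text \<open>The trailing minor \<open>th j\<close> with its first column replaced by the column on
  its left.\<close>

definition lam :: "nat \<Rightarrow> (nat \<times> nat \<Rightarrow> complex) \<Rightarrow> complex" where
  "lam j x = skip (XX x) (n - j + 1) (n - j) j"

lemma skip_top_block:
  assumes "1 \<le> r" "r \<le> n - 1"
  shows "skip (U x) (i * (n - 1) + r) (i * (n + 1) + (n + r + 1)) ((n - r) + q)
    = lam (n - r) x * minor (U x) (i * (n - 1) + n) (i * (n + 1) + (2 * n + 2)) q"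
proof -
  let ?c = "\<lambda>b. if b = 0 then i * (n + 1) + (n + r + 1) else i * (n + 1) + (n + r + 1) + b + 1"
  let ?A = "\<lambda>a b. U x (i * (n - 1) + r + a) (?c b)"
  have p: "0 < n - r" using assms by simp
  have "dt ((n - r) + q) ?A = dt (n - r) ?A * dt q (\<lambda>a b. ?A ((n - r) + a) ((n - r) + b))"
  proof (rule dt_upper_right_zero)
    fix a b assume ab: "a < n - r" "b < q"
    have "i * (n - 1) + r + a = i * (n - 1) + (r + a)" "?c (n - r + b) = i * (n + 1) + (2 * n + 2 + b)"
      using assms by auto
    thus "?A a (n - r + b) = 0" using U_block[of "r + a" "2 * n + 2 + b" x i] ab assms by (simp only:) simp
  qed
  moreover have "dt (n - r) ?A = lam (n - r) x"
  proof -
    have "dt (n - r) ?A = dt (n - r) (\<lambda>a b. XX x (n - (n - r) + 1 + a) (if b = 0 then n - (n - r) else n - (n - r) + b + 1))"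
    proof (rule dt_cong)
      fix a b assume ab: "a < n - r" "b < n - r"
      define d where "d = (if b = 0 then 0 else b + 1)"
      have e: "i * (n - 1) + r + a = i * (n - 1) + (r + a)" "?c b = i * (n + 1) + (n + r + 1 + d)"
        "(if b = 0 then n - (n - r) else n - (n - r) + b + 1) = r + d" using assms by (auto simp: d_def)
      have "r + a \<le> n - 1" "n + r + 1 + d \<le> 2 * n + 1" using ab assms by (auto simp: d_def)
      thus "?A a b = XX x (n - (n - r) + 1 + a) (if b = 0 then n - (n - r) else n - (n - r) + b + 1)"
        unfolding e using U_block[of "r + a" "n + r + 1 + d" x i] assms by (simp add: XX_def)
    qed
    also have "\<dots> = lam (n - r) x" using p unfolding lam_def skip_def by simp
    finally show ?thesis .
  qed
  moreover have "(\<lambda>a b. ?A ((n - r) + a) ((n - r) + b)) = (\<lambda>a b. U x (i * (n - 1) + n + a) (i * (n + 1) + (2 * n + 2) + b))"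
    using assms by (intro ext arg_cong2[of _ _ _ _ "U x"]) auto
  moreover have "(n - r + q = 0) = False" using p by simp
  ultimately show ?thesis unfolding minor_dt skip_def by (simp only: if_False)
qed

text \<open>The minor \<open>G e m\<close> with its first column replaced by the column on its left.
  These functions are the common factors eliminated between two three-term relations.\<close>

definition gam :: "nat \<Rightarrow> nat \<Rightarrow> (nat \<times> nat \<Rightarrow> complex) \<Rightarrow> complex" where
  "gam e m x = skip (U x) (row m) (col e m - 1) m"

text \<open>Past the end of the cluster the chain minors are no new functions: a trailing minor of
  the matrix splits off and the cofactor \<open>G es ms\<close> does not depend on
  \<open>j\<close>.\<close>

lemma critical:
  assumes "j \<le> n - 1"
  shows "G es (ms + j) x = th j x * G es ms x" "1 \<le> j \<Longrightarrow> gam es (ms + j) x = lam j x * G es ms x"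
proof -
  have K: "n div 2 < K" using k_facts(1) unfolding K_def by linarith
  have d: "2 * (n div 2) + es = n" unfolding es_def by simp
  define b where "b = K - 1 - n div 2"
  have rc: "row (ms + i) = b * (n - 1) + (n - i) \<and> col es (ms + i) = b * (n + 1) + (n + (n - i) + 2)" if "i \<le> n - 1" for i
  proof (cases "i = 0")
    case False
    have "ms + i = (n div 2) * (n - 1) + (n - (n - i))" "1 \<le> n - i" "n - i \<le> n - 1" using False that by (auto simp: ms_def)
    from rowcol[OF this K] show ?thesis using d by (simp add: b_def)
  next
    case True
    define s where "s = n div 2 - 1"
    have s: "n div 2 = s + 1" using n2 unfolding s_def by linarith
    have "ms + 0 = s * (n - 1) + (n - 1)" "1 \<le> (1::nat)" "1 \<le> n - 1" "s < K" using s K n2 by (auto simp: ms_def)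
    note * = rowcol[OF this]
    have b: "K - 1 - s = b + 1" using s K by (simp add: b_def)
    have "2 * s + 2 + es = n" using d s by simp
    hence "col es (ms + 0) = b * (n + 1) + (n + n + 2)" unfolding * b add_mult_distrib by simp
    moreover have "row (ms + 0) = b * (n - 1) + n" unfolding * b add_mult_distrib using n2 by simp
    ultimately show ?thesis using True by simp
  qed
  have r0: "row ms = b * (n - 1) + n" "col es ms = b * (n + 1) + (2 * n + 2)" using rc[of 0] by auto
  have nj: "n - (n - j) = j" using assms by simp
  show "G es (ms + j) x = th j x * G es ms x"
    unfolding G_def r0 using rc[OF assms] minor_top_block[of "n - j" x b ms, unfolded nj] assms n2
    by (simp add: add.commute)
  show "gam es (ms + j) x = lam j x * G es ms x" if "1 \<le> j"
  proof -
    have "col es (ms + j) - 1 = b * (n + 1) + (n + (n - j) + 1)" using rc[OF assms] by simp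
    thus ?thesis unfolding gam_def G_def r0 using rc[OF assms] skip_top_block[of "n - j" x b ms, unfolded nj] that assms
      by (simp add: add.commute)
  qed
qed

end

context cg
begin

subsection \<open>Exchange relations\<close>

lemma n_le_K: "n \<le> 2 * K - 4" "2 \<le> K" using k_facts(1) by (auto simp: K_def)

lemma row_step: "1 \<le> m \<Longrightarrow> m \<le> K * (n - 1) \<Longrightarrow> row m + 1 = row (m - 1)" by (simp add: row_def)
lemma le_Kn: "m \<le> K * (n - 1) \<Longrightarrow> m \<le> K * (n + 1)"
  by (erule order_trans) (rule mult_le_mono2, simp)
lemma col_step: "1 \<le> m \<Longrightarrow> m \<le> K * (n - 1) \<Longrightarrow> col e m + 1 = col e (m - 1)"
  using le_Kn[of m] by (simp add: col_def)
lemma col_e: "m \<le> K * (n - 1) \<Longrightarrow> col e m + 1 = col (e + 1) m"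
  using le_Kn[of m] by (simp add: col_def)

lemma G_pol: "m \<le> K * (n - 1) \<Longrightarrow> (\<lambda>x. G e m x) \<in> pol (verts n)"
  unfolding G_def using le_Kn[of m] by (intro minor_U_pol) (auto simp: row_def col_def)
lemma gam_pol: "m \<le> K * (n - 1) \<Longrightarrow> (\<lambda>x. gam e m x) \<in> pol (verts n)"
  if "1 \<le> e \<or> 1 \<le> m"
proof (cases "m = 0")
  case False
  assume m: "m \<le> K * (n - 1)"
  have "K * (n - 1) < K * (n + 1)" by (rule mult_less_mono2) (use n_le_K in auto)
  hence "1 \<le> col e m - 1" using m unfolding col_def by linarith
  thus ?thesis unfolding gam_def using m by (intro skip_U_pol) (auto simp: row_def)
qed (simp add: gam_def pol_const)
lemma th_pol: "i \<le> n \<Longrightarrow> (\<lambda>x. th i x) \<in> pol (verts n)"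
  unfolding th_def theta_def by (rule minor_XX_pol) auto
lemma lam_pol: "i \<le> n - 1 \<Longrightarrow> (\<lambda>x. lam i x) \<in> pol (verts n)"
  unfolding lam_def by (rule skip_XX_pol) (use n2 in auto)

lemma th_0 [simp]: "th 0 x = 1" by (simp add: th_def theta_def)
lemma G_0 [simp]: "G e 0 x = 1" by (simp add: G_def)

lemma rng_le: "rng e m \<Longrightarrow> m + n \<le> K * (n - 1) \<and> 1 \<le> m"
proof -
  assume "rng e m"
  hence "m \<le> NN n" "1 \<le> m" using M_le_N by (auto simp: rng_def)
  moreover have "K * (n - 1) = NN n + 2 * (n - 1)" unfolding K_def k_facts(3) add_mult_distrib ..
  ultimately show ?thesis using n2 by linarith
qed

lemma G_nonzero:
  assumes "m \<le> S * (n - 1)" "2 * S + e \<le> n + 2" "S \<le> K"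
  shows "(\<lambda>x. G e m x) \<noteq> (\<lambda>x. 0)"
proof -
  have mK: "m \<le> K * (n - 1)" using assms(1) mult_le_mono1[OF assms(3), of "n - 1"] by (rule order_trans)
  show ?thesis unfolding G_def
  proof (rule minor_U_nonzero)
    fix i assume i: "i < m"
    have m': "1 \<le> m - i" "m - i \<le> S * (n - 1)" using i assms(1) by auto
    obtain s a where sa: "m - i = s * (n - 1) + (n - a)" "1 \<le> a" "a \<le> n - 1" by (rule size_split[OF m'(1)])
    have s: "s < S" using m'(2) size_le[OF sa(2,3)] unfolding sa(1) by simp
    hence sK: "s < K" using assms(3) by simp
    have "row m + i = row (m - i)" "col e m + i = col e (m - i)"
      using i mK le_Kn[OF mK] by (auto simp: row_def col_def)
    moreover have "supp (row (m - i)) (col e (m - i))"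
      unfolding rowcol[OF sa sK] by (subst supp_block[OF sa(2,3)]) (use s assms(2) sa(2,3) in auto)
    ultimately show "supp (row m + i) (col e m + i)" by simp
  qed (use mK le_Kn[OF mK] in \<open>auto simp: row_def col_def\<close>)
qed

lemma sg_pol: "(\<lambda>x. sg x) \<in> pol (verts n)"
  unfolding sg_def by (rule minor_XX_pol) auto

lemma sg_nonzero: "(\<lambda>x. sg x) \<noteq> (\<lambda>x. 0)"
proof
  assume "(\<lambda>x. sg x) = (\<lambda>x. 0)"
  hence z: "sg (\<lambda>v. if fst v = snd v then 1 else 0) = 0" by meson
  have "minor (XX (\<lambda>v. if fst v = snd v then 1 else 0)) 1 1 (n - 1) = det (1\<^sub>m (n - 1))"
    unfolding minor_dt dt_def by (rule arg_cong[of _ _ det], rule eq_matI) (auto simp: XX_def)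
  thus False using z unfolding sg_def by simp
qed

lemma rel_R0:
  assumes "m + 1 \<le> K * (n - 1)"
  shows "G 0 (m + 1) x * G 1 m x + gam 0 m x * G 1 (m + 1) x = gam 1 (m + 1) x * G 0 m x"
proof -
  have r: "row (m + 1) + 1 = row m" using row_step[of "m + 1"] assms by simp
  have c: "col 0 (m + 1) + 2 = col 1 m" "col 0 (m + 1) = col 0 m - 1" "col 0 (m + 1) + 1 = col 0 m"
      "col 1 (m + 1) = col 0 (m + 1) + 1" "col 1 (m + 1) - 1 = col 0 (m + 1)"
    using col_step[of "m + 1" 0] col_e[of "m + 1" 0] col_e[of m 0] assms by simp_all
  have "minor (U x) (row (m + 1)) (col 0 (m + 1)) (m + 1) * minor (U x) (row (m + 1) + 1) (col 0 (m + 1) + 2) (m + 1 - 1)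
      + skip (U x) (row (m + 1) + 1) (col 0 (m + 1)) (m + 1 - 1) * minor (U x) (row (m + 1)) (col 0 (m + 1) + 1) (m + 1)
    = skip (U x) (row (m + 1)) (col 0 (m + 1)) (m + 1) * minor (U x) (row (m + 1) + 1) (col 0 (m + 1) + 1) (m + 1 - 1)"
    by (rule minor_skip) simp
  moreover have "gam 0 m x = skip (U x) (row (m + 1) + 1) (col 0 (m + 1)) (m + 1 - 1)"
    unfolding gam_def c(2)[symmetric] r by simp
  moreover have "gam 1 (m + 1) x = skip (U x) (row (m + 1)) (col 0 (m + 1)) (m + 1)" unfolding gam_def c(5) ..
  moreover have "G 1 (m + 1) x = minor (U x) (row (m + 1)) (col 0 (m + 1) + 1) (m + 1)" unfolding G_def c(4) ..
  moreover have "G 1 m x = minor (U x) (row (m + 1) + 1) (col 0 (m + 1) + 2) (m + 1 - 1)" unfolding G_def c(1) r by simp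
  moreover have "G 0 m x = minor (U x) (row (m + 1) + 1) (col 0 (m + 1) + 1) (m + 1 - 1)" unfolding G_def c(3) r by simp
  moreover have "G 0 (m + 1) x = minor (U x) (row (m + 1)) (col 0 (m + 1)) (m + 1)" unfolding G_def ..
  ultimately show ?thesis by (simp only:)
qed

text \<open>The three-term relation with corner one column to the left of \<open>phi\<close> of size
  \<open>m\<close>. In each product one factor ends with a complete bottom block; \<open>sg\<close>
  cancels, and by periodicity the remaining parts are \<open>psi\<close> minors.\<close>

lemma rel_big:
  assumes "n \<le> m" "m \<le> K * (n - 1)"
  shows "G 1 (m - n + 1) x * G 0 (m - 1) x + gam 1 (m - n) x * G 0 m x = gam 0 m x * G 1 (m - n) x"
proof -
  define B where "B = K - 1"
  have K: "K = B + 1" using n_le_K by (simp add: B_def)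
  have Kn: "K * (n - 1) = B * (n - 1) + (n - 1)" "K * (n + 1) = B * (n + 1) + (n + 1)" unfolding K by simp_all
  have lt: "m \<le> K * (n + 1)" "m < K * (n + 1)" using le_Kn[OF assms(2)] assms(2) n_le_K
      mult_le_mono2[of "n - 1" "n + 1" K] Kn n2 mult_le_mono2[of "n - 1" "n + 1" B] by linarith+
  note d = row_def col_def
  define R where "R = row m" define C where "C = col 0 m - 1"
  have R1: "1 \<le> R" "1 \<le> C" using assms lt by (auto simp: R_def C_def d)
  have n1: "(n - 1) + (m - n) = m - 1" "m - n + 1 + (n - 1) = m" "m - n + (n - 1) = m - 1" using assms n2 by auto
  have e: "row (m - 1) = R + 1" "col 0 m = C + 1" "col 0 (m - 1) = C + 2" "R = row m" "C = col 0 m - 1"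
    "row (m - n + 1) = R + 1 * (n - 1)" "col 1 (m - n + 1) = C + 1 * (n + 1)"
    "row (m - n) = R + 1 + 1 * (n - 1)" "col 1 (m - n) = C + 1 + 1 * (n + 1)" "col 1 (m - n) - 1 = C + 1 * (n + 1)"
  proof -
    obtain d where d: "m = n + d" using assms(1) le_Suc_ex by blast
    define P where "P = K * (n - 1)"
    define Q where "Q = K * (n + 1)"
    obtain p q where p: "P = n + d + p" and q: "Q = n + d + 1 + q"
      using assms(2) lt(2) unfolding d P_def[symmetric] Q_def[symmetric]
      by (metis le_Suc_ex less_eq_Suc_le add_Suc_right add_Suc Suc_eq_plus1)
    note D = R_def C_def row_def col_def P_def[symmetric] Q_def[symmetric] p q d
    show "row (m - 1) = R + 1" "col 0 m = C + 1" "col 0 (m - 1) = C + 2" "R = row m" "C = col 0 m - 1"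
      "row (m - n + 1) = R + 1 * (n - 1)" "col 1 (m - n + 1) = C + 1 * (n + 1)"
      "row (m - n) = R + 1 + 1 * (n - 1)" "col 1 (m - n) = C + 1 + 1 * (n + 1)" "col 1 (m - n) - 1 = C + 1 * (n + 1)"
      unfolding D using n2 by simp_all
  qed
  have b: "R + (m - n + 1) = B * (n - 1) + 1" "C + (m - n + 1) = B * (n + 1) + 2"
    "R + 1 + (m - n) = B * (n - 1) + 1" "C + 1 + (m - n) = B * (n + 1) + 2" "C + (m - n) = B * (n + 1) + 1"
  proof -
    define P where "P = B * (n - 1)"
    define Q where "Q = B * (n + 1)"
    have "m \<le> P + (n - 1)" "m < Q + (n + 1)" using assms(2) lt(2) unfolding Kn P_def Q_def by auto
    thus "R + (m - n + 1) = B * (n - 1) + 1" "C + (m - n + 1) = B * (n + 1) + 2"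
      "R + 1 + (m - n) = B * (n - 1) + 1" "C + 1 + (m - n) = B * (n + 1) + 2" "C + (m - n) = B * (n + 1) + 1"
      unfolding R_def C_def d Kn P_def[symmetric] Q_def[symmetric] using assms(1) n2 by auto
  qed
  have main: "sg y * (G 1 (m - n + 1) y * G 0 (m - 1) y + gam 1 (m - n) y * G 0 m y) = sg y * (gam 0 m y * G 1 (m - n) y)" for y
  proof -
    have "minor (U y) R C m * minor (U y) (R + 1) (C + 2) (m - 1) + skip (U y) (R + 1) C (m - 1) * minor (U y) R (C + 1) m
      = skip (U y) R C m * minor (U y) (R + 1) (C + 1) (m - 1)"
      by (rule minor_skip) (use assms n2 in simp)
    moreover have "minor (U y) R C m = G 1 (m - n + 1) y * sg y"
      using minor_bottom_block[OF b(1,2) R1(2), of y] unfolding n1(2) G_def e(6,7) minor_shift[OF R1] .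
    moreover have "minor (U y) (R + 1) (C + 2) (m - 1) = G 0 (m - 1) y" unfolding G_def e(1,3) ..
    moreover have "skip (U y) (R + 1) C (m - 1) = gam 1 (m - n) y * sg y"
      using skip_bottom_block[OF b(3,5) R1(2), of y] R1 unfolding n1(3) gam_def e(8,10) by (subst skip_shift) auto
    moreover have "minor (U y) R (C + 1) m = G 0 m y" unfolding G_def e(2) R_def ..
    moreover have "skip (U y) R C m = gam 0 m y" unfolding gam_def R_def C_def ..
    moreover have "minor (U y) (R + 1) (C + 1) (m - 1) = G 1 (m - n) y * sg y"
      using minor_bottom_block[OF b(3,4), of y] R1 unfolding n1(3) G_def e(8,9) by (subst minor_shift) auto
    ultimately show ?thesis by (simp add: algebra_simps)
  qed
  have le: "m - n + 1 \<le> K * (n - 1)" "m - 1 \<le> K * (n - 1)" "m - n \<le> K * (n - 1)" using assms n2 by linarith+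
  have "(\<lambda>y. G 1 (m - n + 1) y * G 0 (m - 1) y + gam 1 (m - n) y * G 0 m y) = (\<lambda>y. gam 0 m y * G 1 (m - n) y)"
    by (rule pol_cancel[OF sg_pol sg_nonzero _ _ main])
      (rule pol_add pol_mult G_pol gam_pol assms(2) le | use assms n2 in simp)+
  thus ?thesis by meson
qed

text \<open>In these sizes the rows stay inside the last block row and the columns inside its
  \<open>calY\<close>, so the minors are minors of the matrix.\<close>

lemma G_small:
  assumes "m \<le> n - 1"
  shows "G 0 m x = minor (XX x) (n - m) (n - m + 1) m" "gam 0 m x = skip (XX x) (n - m) (n - m) m"
proof -
  define B where "B = K - 1"
  have K: "K = B + 1" using n_le_K by (simp add: B_def)
  have rc: "row m = B * (n - 1) + (n - m)" "col 0 m = B * (n + 1) + (n + 2 - m)" "col 0 m - 1 = B * (n + 1) + (n + 1 - m)"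
    using assms n2 unfolding row_def col_def K by simp_all
  show "G 0 m x = minor (XX x) (n - m) (n - m + 1) m" unfolding G_def rc minor_dt
  proof (rule dt_cong)
    fix i j assume ij: "i < m" "j < m"
    have "B * (n - 1) + (n - m) + i = B * (n - 1) + (n - m + i)" "B * (n + 1) + (n + 2 - m) + j = B * (n + 1) + (n + 2 - m + j)" by auto
    moreover have "n + 2 - m + j - 1 = n - m + 1 + j" "n + 2 - m + j \<le> n + 1" "\<not> n + 2 - m + j \<le> 1" "\<not> 2 * n + 1 < n + 2 - m + j"
      "1 \<le> n - m + i" "n - m + i \<le> n - 1" "1 \<le> n + 2 - m + j" using ij assms n2 by auto
    ultimately show "U x (B * (n - 1) + (n - m) + i) (B * (n + 1) + (n + 2 - m) + j) = XX x (n - m + i) (n - m + 1 + j)"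
      using U_block[of "n - m + i" "n + 2 - m + j" x B] unfolding XX_def by (simp only: if_False if_True simp_thms)
  qed
  show "gam 0 m x = skip (XX x) (n - m) (n - m) m"
  proof (cases "m = 0")
    case False
    have "dt m (\<lambda>i j. U x (B * (n - 1) + (n - m) + i) (if j = 0 then B * (n + 1) + (n + 1 - m) else B * (n + 1) + (n + 1 - m) + j + 1))
      = dt m (\<lambda>i j. XX x (n - m + i) (if j = 0 then n - m else n - m + j + 1))"
    proof (rule dt_cong)
      fix i j assume ij: "i < m" "j < m"
      define d where "d = (if j = 0 then 0 else j + 1)"
      have e: "B * (n - 1) + (n - m) + i = B * (n - 1) + (n - m + i)"
        "(if j = 0 then B * (n + 1) + (n + 1 - m) else B * (n + 1) + (n + 1 - m) + j + 1) = B * (n + 1) + (n + 1 - m + d)"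
        "(if j = 0 then n - m else n - m + j + 1) = n - m + d" by (auto simp: d_def)
      have d: "d \<le> m" using ij by (simp add: d_def)
      have "n + 1 - m + d - 1 = n - m + d" "n + 1 - m + d \<le> n + 1" "\<not> n + 1 - m + d \<le> 1" "\<not> 2 * n + 1 < n + 1 - m + d"
        "1 \<le> n - m + i" "n - m + i \<le> n - 1" "1 \<le> n + 1 - m + d" using ij assms n2 d by auto
      thus "U x (B * (n - 1) + (n - m) + i) (if j = 0 then B * (n + 1) + (n + 1 - m) else B * (n + 1) + (n + 1 - m) + j + 1)
        = XX x (n - m + i) (if j = 0 then n - m else n - m + j + 1)"
        unfolding e XX_def using U_block[of "n - m + i" "n + 1 - m + d" x B] by (simp only: if_False if_True simp_thms)
    qed
    thus ?thesis using False unfolding gam_def rc(3) unfolding rc(1) skip_def by simp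
  qed (simp add: gam_def)
qed

text \<open>Bordering \<open>X\<close> with the unit column \<open>e\<^sub>n\<close> makes this relation an instance of the three-term relation.\<close>
lemma rel_small:
  assumes "1 \<le> m" "m \<le> n - 1"
  shows "th (m + 1) x * G 0 (m - 1) x + lam m x * G 0 m x = gam 0 m x * th m x"
proof -
  define A where "A = (\<lambda>i j. if j = n + 1 then if i = n then 1 else 0 else XX x i j)"
  have un: "minor A (n - p) (n - p + 1) (p + 1) = minor (XX x) (n - p) (n - p + 1) p" if "p \<le> n - 1" for p
    unfolding minor_dt
  proof (subst dt_last_unit)
    show "dt p (\<lambda>i j. A (n - p + i) (n - p + 1 + j)) = dt p (\<lambda>i j. XX x (n - p + i) (n - p + 1 + j))"
      by (rule dt_cong) (use that in \<open>auto simp: A_def\<close>)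
  qed (use that n2 in \<open>auto simp: A_def\<close>)
  have us: "skip A (n - m) (n - m) (m + 1) = skip (XX x) (n - m) (n - m) m"
  proof -
    have "dt (m + 1) (\<lambda>i j. A (n - m + i) (if j = 0 then n - m else n - m + j + 1))
      = dt m (\<lambda>i j. A (n - m + i) (if j = 0 then n - m else n - m + j + 1))"
      by (rule dt_last_unit) (use assms n2 in \<open>auto simp: A_def\<close>)
    also have "\<dots> = dt m (\<lambda>i j. XX x (n - m + i) (if j = 0 then n - m else n - m + j + 1))"
      by (rule dt_cong) (use assms in \<open>auto simp: A_def\<close>)
    finally show ?thesis using assms unfolding skip_def by simp
  qed
  have ua: "minor A r c p = minor (XX x) r c p" if "c + p \<le> n + 1" for r c p
    unfolding minor_dt by (rule dt_cong) (use that in \<open>auto simp: A_def\<close>)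
  have ub: "skip A r c p = skip (XX x) r c p" if "c + p \<le> n" for r c p
  proof (cases "p = 0")
    case False
    have "dt p (\<lambda>i j. A (r + i) (if j = 0 then c else c + j + 1)) = dt p (\<lambda>i j. XX x (r + i) (if j = 0 then c else c + j + 1))"
      by (rule dt_cong) (use that in \<open>auto simp: A_def\<close>)
    thus ?thesis using False by (simp add: skip_def)
  qed simp
  have m1: "n - (m - 1) = n - m + 1" "m - 1 \<le> n - 1" "m - 1 + 1 = m" "n - (m + 1) + 1 = n - m" using assms n2 by auto
  have "minor A (n - m) (n - m) (m + 1) * minor A (n - m + 1) (n - m + 2) (m + 1 - 1)
      + skip A (n - m + 1) (n - m) (m + 1 - 1) * minor A (n - m) (n - m + 1) (m + 1)
    = skip A (n - m) (n - m) (m + 1) * minor A (n - m + 1) (n - m + 1) (m + 1 - 1)"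
    by (rule minor_skip) simp
  moreover have "minor A (n - m) (n - m) (m + 1) = th (m + 1) x"
    unfolding th_def theta_def m1(4) by (rule ua) (use assms in simp)
  moreover have "minor A (n - m + 1) (n - m + 2) (m + 1 - 1) = G 0 (m - 1) x"
    using un[OF m1(2)] unfolding G_small(1)[OF m1(2)] m1 by simp
  moreover have "skip A (n - m + 1) (n - m) (m + 1 - 1) = lam m x" unfolding lam_def using ub assms by simp
  moreover have "minor A (n - m) (n - m + 1) (m + 1) = G 0 m x" using un[OF assms(2)] G_small(1)[OF assms(2)] by simp
  moreover have "skip A (n - m) (n - m) (m + 1) = gam 0 m x" using us G_small(2)[OF assms(2)] by simp
  moreover have "minor A (n - m + 1) (n - m + 1) (m + 1 - 1) = th m x" unfolding th_def theta_def using ua assms by simp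
  ultimately show ?thesis by simp
qed

text \<open>The three-term relation at the subdiagonal corner. Three of its minors, one in each
  product, split off a trailing block and share the cofactor \<tau>, which cancels. The coefficient
  \<open>l\<close> only has to be a polynomial.\<close>

lemma rel_theta:
  assumes "1 \<le> i" "i \<le> n - 1"
  shows "\<exists>l\<in>pol (verts n). \<forall>x. G ec (mc i) x * th (i - 1) x + l x * th i x = lam i x * G ec (mc i - 1) x"
proof -
  define h where "h = (n - 1) div 2"
  define q where "q = h * (n - 1)"
  define b where "b = K - 1 - h"
  have h: "2 * h + ec + 1 = n" "ec \<le> 1" using n2 unfolding ec_def h_def by presburger+
  have hK: "h < K" using h k_facts(1) unfolding K_def by linarith
  have m: "mc i = h * (n - 1) + (n - (n - i))" "1 \<le> n - i" "n - i \<le> n - 1" and mq: "mc i = i + q"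
    using assms by (auto simp: mc_def h_def q_def)
  define r where "r = n - i"
  have rc: "row (mc i) = b * (n - 1) + r" "col ec (mc i) = b * (n + 1) + (n + r + 1)"
    using rowcol[OF m hK] h by (auto simp: b_def r_def)
  have r: "1 \<le> r" "r \<le> n" "r \<le> n - 1" "1 \<le> r + 1" "r + 1 \<le> n" "n - r = i" "n - (r + 1) = i - 1" "i - 1 + q = mc i - 1"
    using assms by (auto simp: r_def mq)
  have mK: "mc i \<le> K * (n - 1)" "1 \<le> mc i" "mc i - 1 \<le> K * (n - 1)" using rng_le[OF vtx_mc(1)[OF assms]] by auto
  have r1: "row (mc i - 1) = row (mc i) + 1" "col ec (mc i - 1) = col ec (mc i) + 1" using row_step col_step mK by auto
  define \<tau> where "\<tau> = (\<lambda>x. minor (U x) (b * (n - 1) + n) (b * (n + 1) + (2 * n + 2)) q)"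
  \<comment> \<open>As a chain minor with \<open>e\<close> raised by 1 the cofactor is covered by
    \<open>G_nonzero\<close>.\<close>
  have \<tau>: "\<tau> = (\<lambda>x. G (ec + 1) q x)"
  proof -
    obtain d where d: "K = h + 1 + d" using hK by (metis Suc_eq_plus1 Suc_leI le_Suc_ex)
    have "row q = b * (n - 1) + n" "col (ec + 1) q = b * (n + 1) + (2 * n + 2)"
    proof -
      have bd: "b = d" by (simp add: b_def d)
      have nn: "n - 1 = p \<Longrightarrow> n = p + 1 \<and> n + 1 = p + 2" for p using n2 by auto
      define p where "p = n - 1"
      have p: "n - 1 = p" "n = p + 1" "n + 1 = p + 2" using nn by (auto simp: p_def)
      have "row q = K * p + 1 - h * p" unfolding row_def q_def p(1) ..
      also have "K * p = h * p + p + d * p" unfolding d by (simp add: algebra_simps)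
      finally show "row q = b * (n - 1) + n" unfolding bd p(1) using p(2) by simp
      have "K * (p + 2) = h * p + 2 * h + (p + 2) + d * (p + 2)" unfolding d by (simp add: algebra_simps)
      thus "col (ec + 1) q = b * (n + 1) + (2 * n + 2)" unfolding bd col_def q_def p(1,3) using h p by simp
    qed
    thus ?thesis by (simp add: \<tau>_def G_def)
  qed
  have \<tau>0: "\<tau> \<noteq> (\<lambda>x. 0)" unfolding \<tau> by (rule G_nonzero[of _ h]) (use h hK in \<open>auto simp: q_def\<close>)
  have qK: "q \<le> K * (n - 1)" using mK(1) mq by simp
  have \<tau>p: "\<tau> \<in> pol (verts n)" unfolding \<tau> by (rule G_pol[OF qK])
  define l where "l = (\<lambda>x. skip (U x) (row (mc i) + 1) (col ec (mc i)) (mc i - 1))"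
  have lp: "l \<in> pol (verts n)" unfolding l_def by (rule skip_U_pol) (auto simp: rc)
  have main: "\<tau> x * (G ec (mc i) x * th (i - 1) x + l x * th i x) = \<tau> x * (lam i x * G ec (mc i - 1) x)" for x
  proof -
    have "minor (U x) (row (mc i)) (col ec (mc i)) (mc i) * minor (U x) (row (mc i) + 1) (col ec (mc i) + 2) (mc i - 1)
       + skip (U x) (row (mc i) + 1) (col ec (mc i)) (mc i - 1) * minor (U x) (row (mc i)) (col ec (mc i) + 1) (mc i)
     = skip (U x) (row (mc i)) (col ec (mc i)) (mc i) * minor (U x) (row (mc i) + 1) (col ec (mc i) + 1) (mc i - 1)"
      by (rule minor_skip[OF mK(2)])
    moreover have "minor (U x) (row (mc i) + 1) (col ec (mc i) + 2) (mc i - 1) = th (i - 1) x * \<tau> x"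
    proof -
      have "row (mc i) + 1 = b * (n - 1) + (r + 1)" "col ec (mc i) + 2 = b * (n + 1) + (n + (r + 1) + 2)" using rc by auto
      thus ?thesis using minor_top_block[OF r(4,5), of x b q] unfolding \<tau>_def r(7,8) by (simp only:)
    qed
    moreover have "minor (U x) (row (mc i)) (col ec (mc i) + 1) (mc i) = th i x * \<tau> x"
    proof -
      have "col ec (mc i) + 1 = b * (n + 1) + (n + r + 2)" using rc by auto
      thus ?thesis using minor_top_block[OF r(1,2), of x b q] unfolding \<tau>_def r(6) mq[symmetric] rc(1) by (simp only:)
    qed
    moreover have "skip (U x) (row (mc i)) (col ec (mc i)) (mc i) = lam i x * \<tau> x"
      using skip_top_block[OF r(1,3), of x b q] unfolding \<tau>_def r(6) mq[symmetric] rc .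
    moreover have "minor (U x) (row (mc i) + 1) (col ec (mc i) + 1) (mc i - 1) = G ec (mc i - 1) x"
      unfolding G_def r1 ..
    ultimately show ?thesis unfolding l_def G_def by (simp add: algebra_simps)
  qed
  have "i \<le> n" "i - 1 \<le> n" using assms by auto
  note P = G_pol[OF mK(1)] G_pol[OF mK(3)] th_pol[OF this(1)] th_pol[OF this(2)] lam_pol[OF assms(2)] lp
  have "(\<lambda>x. G ec (mc i) x * th (i - 1) x + l x * th i x) = (\<lambda>x. lam i x * G ec (mc i - 1) x)"
    by (rule pol_cancel[OF \<tau>p \<tau>0 _ _ main]) (rule pol_add pol_mult P)+
  thus ?thesis using lp by meson
qed

text \<open>A missing neighbour contributes the factor 1, in accordance with minors of size
  0.\<close>

definition cx :: "nat \<times> nat \<Rightarrow> (nat \<times> nat \<Rightarrow> complex) \<Rightarrow> complex" where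
  "cx w x = (if w = (0, 0) then 1 else cl w x)"

lemma cl_pol: "v \<in> verts n \<Longrightarrow> (\<lambda>x. cl v x) \<in> pol (verts n)"
proof (erule cover)
  fix t assume "1 \<le> t" "t \<le> n" "v = (t, t)"
  thus ?thesis using th_pol[of "n - t + 1"] cl_diag[of t] by simp
next
  fix e m assume em: "rng e m" "v = vtx e m"
  have "m \<le> K * (n - 1)" using rng_le[OF em(1)] by simp
  thus ?thesis using G_pol[of m e] cl_vtx[OF em(1)] em(2) by simp
qed

lemma cx_vtx: "rng e m \<Longrightarrow> cx (vtx e m) x = G e m x"
  using vtx_verts[of e m] cl_vtx[of e m x] by (auto simp: cx_def verts_def)
lemma cx_nxt_vtx: "rng e m \<Longrightarrow> cx (nxt (vtx e m)) x = G e (m - 1) x"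
proof (cases "m = 1")
  case False
  assume r: "rng e m"
  hence "rng e (m - 1)" using False by (auto simp: rng_def)
  thus ?thesis using cx_vtx nxt_vtx[OF r] False by simp
next
  case True
  assume "rng e m"
  thus ?thesis using nxt_vtx True by (simp add: cx_def)
qed
lemma cx_diag: "1 \<le> i \<Longrightarrow> i \<le> n \<Longrightarrow> cx (n - i + 1, n - i + 1) x = th i x"
  using cl_diag[of "n - i + 1" x] by (simp add: cx_def)
lemma cx_nxt_diag: "1 \<le> i \<Longrightarrow> i \<le> n \<Longrightarrow> cx (nxt (n - i + 1, n - i + 1)) x = th (i - 1) x"
proof (cases "i = 1")
  case True thus ?thesis using n2 by (simp add: cx_def nxt_def)
next
  case False
  assume i: "1 \<le> i" "i \<le> n"
  hence "nxt (n - i + 1, n - i + 1) = (n - (i - 1) + 1, n - (i - 1) + 1)" using False n2 by (auto simp: nxt_def)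
  thus ?thesis using cx_diag[of "i - 1" x] False i by simp
qed

text \<open>The two three-term relations through \<open>v\<close>, one with its lower left and one with its upper right
  neighbours, share the factor \<open>\<gamma>\<close>; eliminating it gives the numerator of the exchange relation at \<open>v\<close>.\<close>
lemma exchange_aux:
  assumes "f \<in> pol V" "dn \<in> pol V" "up \<in> pol V" "lr \<in> pol V" "rr \<in> pol V"
    and L: "\<And>x. lf x * nx x + lr x * f x = \<gamma> x * dn x"
    and R: "\<And>x. pr x * rt x + \<gamma> x * up x = rr x * f x"
  shows "\<exists>q\<in>pol V. \<forall>x. f x * q x = nx x * up x * lf x + pr x * rt x * dn x"
proof (rule bexI[of _ "\<lambda>x. dn x * rr x - up x * lr x"], intro allI)
  fix x
  have e: "lr x * f x = \<gamma> x * dn x - lf x * nx x" "rr x * f x = pr x * rt x + \<gamma> x * up x"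
    using L[of x] R[of x] by (simp_all add: algebra_simps)
  have "f x * (dn x * rr x - up x * lr x) = dn x * (rr x * f x) - up x * (lr x * f x)" by (simp add: algebra_simps)
  also have "\<dots> = nx x * up x * lf x + pr x * rt x * dn x" unfolding e by (simp add: algebra_simps)
  finally show "f x * (dn x * rr x - up x * lr x) = nx x * up x * lf x + pr x * rt x * dn x" .
qed (intro pol_diff pol_mult assms)

lemma cancel_T:
  assumes "f \<in> pol (verts n)" "g \<in> pol (verts n)" "\<And>x. G es ms x * f x = G es ms x * g x"
  shows "f = g"
proof -
  have "ms \<le> K * (n - 1)" using rng_le[OF rng_ms] by simp
  note Tp = G_pol[OF this, of es]
  have "n div 2 \<le> K" "2 * (n div 2) + es = n" using k_facts(1) unfolding K_def es_def by auto
  hence "(\<lambda>x. G es ms x) \<noteq> (\<lambda>x. 0)" by (intro G_nonzero[of _ "n div 2"]) (auto simp: ms_def)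
  from pol_cancel[OF Tp this assms] show ?thesis .
qed

lemma nxt_verts: "w \<in> verts n \<Longrightarrow> (\<lambda>x. cx (nxt w) x) \<in> pol (verts n)"
proof (cases "nxt w = (0, 0)")
  case True thus ?thesis by (simp add: cx_def pol_const)
next
  case False
  assume "w \<in> verts n"
  hence "nxt w \<in> verts n" using nxt_in_verts False by blast
  thus ?thesis using False cl_pol by (simp add: cx_def)
qed

lemma cx_pol: "w \<in> verts n \<Longrightarrow> (\<lambda>x. cx w x) \<in> pol (verts n)"
  using cl_pol by (cases "w = (0, 0)") (simp_all add: cx_def pol_const)

text \<open>The shared factor is \<open>lam i\<close> at a diagonal vertex and
  \<open>gam e m\<close> on the other chains. Where the upper neighbour falls on the main diagonal,
  \<open>critical\<close> rewrites the upper relation and the common minor \<open>G es ms\<close> is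
  cancelled.\<close>

theorem exchange:
  assumes v: "v \<in> mut"
  shows "\<exists>q\<in>pol (verts n). \<forall>x. cl v x * q x =
    cx (nxt v) x * cx (upv v) x * cx (lef v) x + cx (prv v) x * cx (nxt (upv v)) x * cx (nxt (lef v)) x"
proof -
  have vv: "v \<in> verts n" using v by (simp add: mut_def)
  note nb = nbrs_in_verts[OF v]
  have P: "(\<lambda>x. cl v x) \<in> pol (verts n)" "(\<lambda>x. cx (nxt (lef v)) x) \<in> pol (verts n)" "(\<lambda>x. cx (upv v) x) \<in> pol (verts n)"
    using cl_pol vv nxt_verts cx_pol nb by auto
  have "\<exists>\<gamma>. \<exists>lr\<in>pol (verts n). \<exists>rr\<in>pol (verts n). \<forall>x.
     cx (lef v) x * cx (nxt v) x + lr x * cl v x = \<gamma> x * cx (nxt (lef v)) x \<and>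
     cx (prv v) x * cx (nxt (upv v)) x + \<gamma> x * cx (upv v) x = rr x * cl v x"
    using v
  proof (cases rule: mut_chain)
    case (1 i)
    note nb = diag_nbrs[OF 1(1,2)]
    have i: "1 \<le> i + 1" "i + 1 \<le> n" "i \<le> n" "n - (i + 1) + 1 = n - i" "n - i + 1 - 1 = n - i" using 1 by auto
    obtain l where l: "l \<in> pol (verts n)" "\<And>x. G ec (mc i) x * th (i - 1) x + l x * th i x = lam i x * G ec (mc i - 1) x"
      using rel_theta[OF 1(1,2)] by blast
    have g: "(\<lambda>x. gam 0 i x) \<in> pol (verts n)" by (rule gam_pol) (use 1 rng_le[OF vtx_superdiag(1)[OF 1(1,2)]] in auto)
    have e: "cl v x = th i x" "cx (lef v) x = G ec (mc i) x" "cx (nxt v) x = th (i - 1) x" "cx (nxt (lef v)) x = G ec (mc i - 1) x"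
      "cx (prv v) x = th (i + 1) x" "cx (upv v) x = G 0 i x" "cx (nxt (upv v)) x = G 0 (i - 1) x" for x
      using cx_diag[OF 1(1) i(3), of x] cx_diag[OF i(1,2), of x] cx_nxt_diag[OF 1(1) i(3), of x]
        cx_vtx[OF vtx_mc(1)[OF 1(1,2)], of x] cx_nxt_vtx[OF vtx_mc(1)[OF 1(1,2)], of x]
        cx_vtx[OF vtx_superdiag(1)[OF 1(1,2)], of x] cx_nxt_vtx[OF vtx_superdiag(1)[OF 1(1,2)], of x]
      unfolding 1(3) nb(2-4) i(4,5) by (simp_all add: cx_def)
    show ?thesis
      by (rule exI[of _ "\<lambda>x. lam i x"], rule bexI[OF _ l(1)], rule bexI[OF _ g], intro allI conjI)
        (simp_all only: e l(2) rel_small[OF 1(1,2)])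
  next
    case (2 e m)
    note cn = chain_nbrs[OF 2(1,2)]
    have m1: "1 \<le> m" using 2(1) by (simp add: rng_def)
    have mK: "m + n \<le> K * (n - 1)" "m + 1 \<le> K * (n - 1)" "m \<le> K * (n - 1)" using rng_le[OF 2(1)] rng_le[OF 2(2)] by auto
    have e1: "cl v x = G e m x" "cx (nxt v) x = G e (m - 1) x" "cx (prv v) x = G e (m + 1) x" for x
      using cl_vtx[OF 2(1)] cx_nxt_vtx[OF 2(1)] cx_vtx[OF 2(2)] cn(2) 2(3) by auto
    have "e = 0 \<or> e = 1" using 2(1) by (auto simp: rng_def)
    thus ?thesis
    proof
      assume e0: "e = 0"
      note r0 = 2(1)[unfolded e0] note r1 = 2(2)[unfolded e0]
      have l: "\<exists>lr\<in>pol (verts n). \<forall>x. cx (lef v) x * cx (nxt v) x + lr x * cl v x = gam 0 m x * cx (nxt (lef v)) x"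
      proof (cases "n \<le> m")
        case True
        have rl: "rng 1 (m - n + 1)" using lef_vtx_0(2)[OF r0 r1 True] .
        have "lef v = vtx 1 (m - n + 1)" using lef_vtx_0(1)[OF r0 r1] True 2(3) e0 by simp
        hence "cx (lef v) x = G 1 (m - n + 1) x" "cx (nxt (lef v)) x = G 1 (m - n) x" for x
          using cx_vtx[OF rl, of x] cx_nxt_vtx[OF rl, of x] by simp_all
        moreover have "(\<lambda>x. gam 1 (m - n) x) \<in> pol (verts n)" by (rule gam_pol) (use mK in auto)
        ultimately show ?thesis using rel_big[OF True mK(3)] e1 e0
          by (intro bexI[of _ "\<lambda>x. gam 1 (m - n) x"]) simp_all
      next
        case False
        hence m: "m \<le> n - 1" "m + 1 \<le> n" "1 \<le> m + 1" "n - (m + 1) + 1 = n - m" by auto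
        have "lef v = (n - m, n - m)" using lef_vtx_0(1)[OF r0 r1] False 2(3) e0 by simp
        hence "cx (lef v) x = th (m + 1) x" "cx (nxt (lef v)) x = th m x" for x
          using cx_diag[OF m(3,2), of x] cx_nxt_diag[OF m(3,2), of x] unfolding m(4) by simp_all
        moreover have "(\<lambda>x. lam m x) \<in> pol (verts n)" by (rule lam_pol[OF m(1)])
        ultimately show ?thesis using rel_small[OF m1 m(1)] e1 e0
          by (intro bexI[of _ "\<lambda>x. lam m x"]) simp_all
      qed
      have r: "\<exists>rr\<in>pol (verts n). \<forall>x. cx (prv v) x * cx (nxt (upv v)) x + gam 0 m x * cx (upv v) x = rr x * cl v x"
        using upv_vtx_0[OF r0 r1]
      proof (elim disjE exE conjE)
        assume ru: "rng 1 (m + 1)" "upv (vtx 0 m) = vtx 1 (m + 1)"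
        hence "cx (upv v) x = G 1 (m + 1) x" "cx (nxt (upv v)) x = G 1 m x" for x
          using cx_vtx[OF ru(1), of x] cx_nxt_vtx[OF ru(1), of x] 2(3) e0 by simp_all
        moreover have "(\<lambda>x. gam 1 (m + 1) x) \<in> pol (verts n)" by (rule gam_pol) (use mK in auto)
        ultimately show ?thesis using rel_R0[OF mK(2)] e1 e0
          by (intro bexI[of _ "\<lambda>x. gam 1 (m + 1) x"]) simp_all
      next
        fix a assume a: "1 \<le> a" "a \<le> n - 1" "es = 1" "m + 1 = ms + (n - a)" "upv (vtx 0 m) = (a + 1, a + 1)"
        define j where "j = n - a"
        have j: "1 \<le> j" "j \<le> n - 1" "j \<le> n" "j - 1 \<le> n - 1" "n - j + 1 = a + 1" "m + 1 = ms + j" "m = ms + (j - 1)"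
          using a by (auto simp: j_def)
        have u: "cx (upv v) x = th j x" "cx (nxt (upv v)) x = th (j - 1) x" for x
          using cx_diag[OF j(1,3), of x] cx_nxt_diag[OF j(1,3), of x] a(5) 2(3) e0 unfolding j(5) by simp_all
        have c: "G 1 (m + 1) x = th j x * G es ms x" "gam 1 (m + 1) x = lam j x * G es ms x" "G 1 m x = th (j - 1) x * G es ms x" for x
          using critical(1)[OF j(2), of x] critical(2)[OF j(2,1), of x] critical(1)[OF j(4), of x]
          unfolding j(6,7)[symmetric] a(3) by simp_all
        have jn: "j - 1 \<le> n" using j by simp
        have "(\<lambda>x. G 0 (m + 1) x * th (j - 1) x + gam 0 m x * th j x) = (\<lambda>x. lam j x * G 0 m x)"
        proof (rule cancel_T)
          show "G es ms y * (G 0 (m + 1) y * th (j - 1) y + gam 0 m y * th j y) = G es ms y * (lam j y * G 0 m y)" for y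
            using rel_R0[OF mK(2), of y] unfolding c by (simp add: algebra_simps)
        qed (rule pol_add pol_mult G_pol gam_pol th_pol lam_pol mK j jn | use m1 in simp)+
        thus ?thesis using u e1 e0 lam_pol[OF j(2)] unfolding fun_eq_iff
          by (intro bexI[of _ "\<lambda>x. lam j x"]) simp_all
      qed
      show ?thesis using l r by blast
    next
      assume e0: "e = 1"
      note r0 = 2(1)[unfolded e0] note r1 = 2(2)[unfolded e0]
      have l: "\<exists>lr\<in>pol (verts n). \<forall>x. cx (lef v) x * cx (nxt v) x + lr x * cl v x = gam 1 m x * cx (nxt (lef v)) x"
      proof -
        have rl: "rng 0 m" using r0 M_le_N by (auto simp: rng_def)
        have "lef v = vtx 0 m" using lef_vtx_1[OF r0 r1] 2(3) e0 by simp
        hence "cx (lef v) x = G 0 m x" "cx (nxt (lef v)) x = G 0 (m - 1) x" for x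
          using cx_vtx[OF rl, of x] cx_nxt_vtx[OF rl, of x] by simp_all
        moreover have "(\<lambda>x. gam 0 (m - 1) x) \<in> pol (verts n)"
        proof (cases "m = 1")
          case True thus ?thesis by (simp add: gam_def pol_const)
        next
          case False
          show ?thesis by (rule gam_pol) (use mK m1 False in auto)
        qed
        ultimately show ?thesis using rel_R0[of "m - 1"] m1 mK e1 e0
          by (intro bexI[of _ "\<lambda>x. gam 0 (m - 1) x"]) simp_all
      qed
      have big: "G 1 (m + 1) x * G 0 (m + n - 1) x + gam 1 m x * G 0 (m + n) x = gam 0 (m + n) x * G 1 m x" for x
        using rel_big[of "m + n" x] mK by simp
      have r: "\<exists>rr\<in>pol (verts n). \<forall>x. cx (prv v) x * cx (nxt (upv v)) x + gam 1 m x * cx (upv v) x = rr x * cl v x"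
        using upv_vtx_1[OF r0 r1]
      proof (elim disjE exE conjE)
        assume ru: "rng 0 (m + n)" "upv (vtx 1 m) = vtx 0 (m + n)"
        hence "cx (upv v) x = G 0 (m + n) x" "cx (nxt (upv v)) x = G 0 (m + n - 1) x" for x
          using cx_vtx[OF ru(1), of x] cx_nxt_vtx[OF ru(1), of x] 2(3) e0 by simp_all
        moreover have "(\<lambda>x. gam 0 (m + n) x) \<in> pol (verts n)" by (rule gam_pol) (use mK m1 in auto)
        ultimately show ?thesis using big e1 e0
          by (intro bexI[of _ "\<lambda>x. gam 0 (m + n) x"]) simp_all
      next
        fix a assume a: "1 \<le> a" "a \<le> n - 1" "es = 0" "m + n = ms + (n - a)" "upv (vtx 1 m) = (a + 1, a + 1)"
        define j where "j = n - a"
        have j: "1 \<le> j" "j \<le> n - 1" "j \<le> n" "j - 1 \<le> n - 1" "n - j + 1 = a + 1" "m + n = ms + j" "m + n - 1 = ms + (j - 1)"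
          using a by (auto simp: j_def)
        have u: "cx (upv v) x = th j x" "cx (nxt (upv v)) x = th (j - 1) x" for x
          using cx_diag[OF j(1,3), of x] cx_nxt_diag[OF j(1,3), of x] a(5) 2(3) e0 unfolding j(5) by simp_all
        have c: "G 0 (m + n) x = th j x * G es ms x" "gam 0 (m + n) x = lam j x * G es ms x" "G 0 (m + n - 1) x = th (j - 1) x * G es ms x" for x
          using critical(1)[OF j(2), of x] critical(2)[OF j(2,1), of x] critical(1)[OF j(4), of x]
          unfolding j(6,7)[symmetric] a(3) by simp_all
        have jn: "j - 1 \<le> n" using j by simp
        have "(\<lambda>x. G 1 (m + 1) x * th (j - 1) x + gam 1 m x * th j x) = (\<lambda>x. lam j x * G 1 m x)"
        proof (rule cancel_T)
          show "G es ms y * (G 1 (m + 1) y * th (j - 1) y + gam 1 m y * th j y) = G es ms y * (lam j y * G 1 m y)" for y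
            using big[of y] unfolding c by (simp add: algebra_simps)
        qed (rule pol_add pol_mult G_pol gam_pol th_pol lam_pol mK j jn | use m1 in simp)+
        thus ?thesis using u e1 e0 lam_pol[OF j(2)] unfolding fun_eq_iff
          by (intro bexI[of _ "\<lambda>x. lam j x"]) simp_all
      qed
      show ?thesis using l r by blast
    qed
  qed
  then obtain \<gamma> lr rr where "lr \<in> pol (verts n)" "rr \<in> pol (verts n)"
    "\<And>x. cx (lef v) x * cx (nxt v) x + lr x * cl v x = \<gamma> x * cx (nxt (lef v)) x"
    "\<And>x. cx (prv v) x * cx (nxt (upv v)) x + \<gamma> x * cx (upv v) x = rr x * cl v x" by blast
  from exchange_aux[OF P(1,2,3) this] show ?thesis .
qed

end

text \<open>A fundamental solution of the excess operator. In the first case the quadrant indicator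
  has mixed second difference 1 at \<open>(i, j)\<close> and 0 elsewhere; the ramps depend on one
  coordinate only, hence do not affect ordinary windows, and compensate the indicator in windows
  that wrap around. For vertices in the first row or column a single ramp suffices.\<close>

definition fund_int :: "int \<Rightarrow> int \<Rightarrow> int \<Rightarrow> int \<Rightarrow> int" where
  "fund_int i j a b = (if 2 \<le> i \<and> 2 \<le> j then of_bool (i \<le> a \<and> j \<le> b) + max 0 (a - i) - max 0 (b - j + 1)
    else if j = 1 then max 0 (a - i + 1) else - max 0 (b - j))"

lemma fund_int_inner: "fund_int i j a b + fund_int i j (a - 1) (b - 1) - fund_int i j (a - 1) b - fund_int i j a (b - 1) = of_bool (a = i \<and> b = j)"
  if "2 \<le> a" "2 \<le> b" "2 \<le> i \<and> 2 \<le> j \<or> i = 1 \<or> j = 1"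
  using that unfolding fund_int_def by (cases "2 \<le> i \<and> 2 \<le> j"; cases "j = 1"; simp; auto)
lemma fund_int_top: "fund_int i j 1 b + fund_int i j n b - fund_int i j n (b + 1) - fund_int i j 1 (b - 1) = of_bool (1 = i \<and> b = j)"
  if "2 \<le> b" "b < n" "2 \<le> i \<and> i \<le> n \<and> 2 \<le> j \<and> j \<le> n \<or> i = 1 \<and> 2 \<le> j \<and> j < n \<or> 3 \<le> i \<and> i \<le> n \<and> j = 1"
  using that unfolding fund_int_def max_def of_bool_def by (smt (verit))
lemma fund_int_left: "fund_int i j a 1 + fund_int i j (a - 2) n - fund_int i j (a - 1) 1 - fund_int i j (a - 1) n = of_bool (a = i \<and> 1 = j)"
  if "3 \<le> a" "a \<le> n" "2 \<le> i \<and> i \<le> n \<and> 2 \<le> j \<and> j \<le> n \<or> i = 1 \<and> 2 \<le> j \<and> j < n \<or> 3 \<le> i \<and> i \<le> n \<and> j = 1"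
proof -
  note i = that
  consider "2 \<le> i" "2 \<le> j" "j \<le> n" | "i = 1" "2 \<le> j" "j < n" | "3 \<le> i" "j = 1" using i(3) by blast
  thus ?thesis
  proof cases
    case 1
    thus ?thesis using i(1,2) by (cases "a < i"; cases "a = i"; cases "a = i + 1") (simp_all add: fund_int_def max_def)
  next
    case 2
    thus ?thesis by (simp add: fund_int_def)
  next
    case 3
    thus ?thesis using i(1,2) by (cases "a < i"; cases "a = i"; cases "a = i + 1") (simp_all add: fund_int_def max_def)
  qed
qed

context cg
begin

subsection \<open>The exchange matrix\<close>

lemma skew_B0: "skew (B0 n)" by (simp add: skew_def B0_def)

lemma B0_mut:
  assumes "v \<in> mut" "w \<noteq> (0, 0)"
  shows "B0 n v w = of_bool (w = nxt v) + of_bool (w = upv v) + of_bool (w = lef v)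
    - of_bool (w = prv v) - of_bool (w = nxt (upv v)) - of_bool (w = nxt (lef v))"
  unfolding B0_def arrows_out[OF assms] arrows_in[OF assms] by simp

lemma sum_of_bool:
  assumes "\<not> (a \<and> b)" "\<not> (a \<and> c)" "\<not> (b \<and> c)" "\<not> (d \<and> e)" "\<not> (d \<and> f)" "\<not> (e \<and> f)"
    "a \<or> b \<or> c \<Longrightarrow> \<not> d \<and> \<not> e \<and> \<not> f"
  shows "of_bool a + of_bool b + of_bool c - of_bool d - of_bool e - of_bool f
    = (if a \<or> b \<or> c then 1 else if d \<or> e \<or> f then -1 else 0 :: int)"
proof (cases "a \<or> b \<or> c")
  case True
  thus ?thesis using assms by (cases a; cases b; cases c) simp_all
next
  case False
  thus ?thesis using assms by (cases d; cases e; cases f) simp_all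
qed

definition ext :: "(nat \<times> nat \<Rightarrow> 'a::one) \<Rightarrow> nat \<times> nat \<Rightarrow> 'a" where
  "ext y w = (if w = (0, 0) then 1 else y w)"

lemma verts_nz: "w \<in> verts n \<Longrightarrow> w \<noteq> (0, 0)" by (auto simp: verts_def)

lemma prod_three:
  fixes y :: "nat \<times> nat \<Rightarrow> 'a::comm_monoid_mult"
  assumes "\<And>w. w \<in> verts n \<Longrightarrow> g w = (if w = a then y w else 1) * (if w = b then y w else 1) * (if w = c then y w else 1)"
    and "\<And>w. w \<in> {a, b, c} \<Longrightarrow> w = (0, 0) \<or> w \<in> verts n"
  shows "(\<Prod>w\<in>verts n. g w) = ext y a * ext y b * ext y c"
proof -
  have e: "(if w \<in> verts n then y w else 1) = ext y w" if "w \<in> {a, b, c}" for w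
    using assms(2)[OF that] verts_nz[of w] by (auto simp: ext_def)
  have "(\<Prod>w\<in>verts n. g w) = (\<Prod>w\<in>verts n. (if w = a then y w else 1) * (if w = b then y w else 1) * (if w = c then y w else 1))"
    by (rule prod.cong[OF refl assms(1)])
  also have "\<dots> = ext y a * ext y b * ext y c"
    unfolding prod.distrib prod.delta[OF finite_verts] by (simp add: e)
  finally show ?thesis .
qed

text \<open>The six neighbours that exist are distinct, so no arrows cancel or add up, and all
  nonzero entries of the row are 1 or -1.\<close>

lemma exch_B0:
  fixes y :: "nat \<times> nat \<Rightarrow> 'a::field"
  assumes v: "v \<in> mut"
  shows "exch (verts n) v (B0 n) y = ext y (nxt v) * ext y (upv v) * ext y (lef v)
    + ext y (prv v) * ext y (nxt (upv v)) * ext y (nxt (lef v))"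
proof -
  have vv: "v \<in> verts n" using v by (simp add: mut_def)
  note D = nbrs_distinct[OF v] note nv = nbrs_in_verts[OF v]
  have in1: "w = (0, 0) \<or> w \<in> verts n" if "w \<in> {nxt v, upv v, lef v}" for w using that nv nxt_in_verts[OF vv] by auto
  have in2: "w = (0, 0) \<or> w \<in> verts n" if "w \<in> {prv v, nxt (upv v), nxt (lef v)}" for w
    using that nv nxt_in_verts[of "upv v"] nxt_in_verts[of "lef v"] by auto
  have B: "B0 n v w = (if w \<in> {nxt v, upv v, lef v} then 1 else if w \<in> {prv v, nxt (upv v), nxt (lef v)} then -1 else 0)
    \<and> (w = nxt v \<longrightarrow> w \<noteq> upv v \<and> w \<noteq> lef v) \<and> (w = upv v \<longrightarrow> w \<noteq> lef v)
    \<and> (w = prv v \<longrightarrow> w \<noteq> nxt (upv v) \<and> w \<noteq> nxt (lef v)) \<and> (w = nxt (upv v) \<longrightarrow> w \<noteq> nxt (lef v))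
    \<and> (w \<in> {nxt v, upv v, lef v} \<longrightarrow> w \<notin> {prv v, nxt (upv v), nxt (lef v)})" if "w \<in> verts n" for w
  proof -
    have nz: "w \<noteq> (0, 0)" by (rule verts_nz[OF that])
    have d: "(w = nxt v \<longrightarrow> w \<noteq> upv v \<and> w \<noteq> lef v) \<and> (w = upv v \<longrightarrow> w \<noteq> lef v)
      \<and> (w = prv v \<longrightarrow> w \<noteq> nxt (upv v) \<and> w \<noteq> nxt (lef v)) \<and> (w = nxt (upv v) \<longrightarrow> w \<noteq> nxt (lef v))
      \<and> (w \<in> {nxt v, upv v, lef v} \<longrightarrow> w \<notin> {prv v, nxt (upv v), nxt (lef v)})"
    proof (intro conjI impI)
      assume "w = nxt v" thus "w \<noteq> upv v" "w \<noteq> lef v" using D(4,5) by simp_all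
    next
      assume "w = upv v" thus "w \<noteq> lef v" using D(1) by simp
    next
      assume "w = prv v" thus "w \<noteq> nxt (upv v)" "w \<noteq> nxt (lef v)" using D(9,13) by metis+
    next
      assume "w = nxt (upv v)" thus "w \<noteq> nxt (lef v)" using D(15) nz by metis
    next
      assume "w \<in> {nxt v, upv v, lef v}"
      then consider "w = nxt v" | "w = upv v" | "w = lef v" by blast
      thus "w \<notin> {prv v, nxt (upv v), nxt (lef v)}"
      proof cases
        case 1
        have "w \<noteq> nxt (upv v)" "w \<noteq> nxt (lef v)" "w \<noteq> prv v" using 1 D(6,10,14) nz by metis+
        thus ?thesis by simp
      next
        case 2
        have "w \<noteq> nxt (upv v)" "w \<noteq> nxt (lef v)" "w \<noteq> prv v" using 2 D(2,7,11) by metis+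
        thus ?thesis by simp
      next
        case 3
        have "w \<noteq> nxt (upv v)" "w \<noteq> nxt (lef v)" "w \<noteq> prv v" using 3 D(3,8,12) by metis+
        thus ?thesis by simp
      qed
    qed
    have "B0 n v w = (if w \<in> {nxt v, upv v, lef v} then 1 else if w \<in> {prv v, nxt (upv v), nxt (lef v)} then -1 else 0)"
      unfolding B0_mut[OF v nz] insert_iff empty_iff simp_thms by (rule sum_of_bool) (use d in blast)+
    thus ?thesis using d by blast
  qed
  have "(\<Prod>w\<in>verts n. if B0 n v w > 0 then y w ^ nat (B0 n v w) else 1) = ext y (nxt v) * ext y (upv v) * ext y (lef v)"
  proof (rule prod_three[OF _ in1])
    fix w assume "w \<in> verts n"
    from B[OF this] show "(if B0 n v w > 0 then y w ^ nat (B0 n v w) else 1) =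
      (if w = nxt v then y w else 1) * (if w = upv v then y w else 1) * (if w = lef v then y w else 1)"
      by (cases "w = nxt v"; cases "w = upv v"; cases "w = lef v") auto
  qed
  moreover have "(\<Prod>w\<in>verts n. if B0 n v w < 0 then y w ^ nat (- B0 n v w) else 1) = ext y (prv v) * ext y (nxt (upv v)) * ext y (nxt (lef v))"
  proof (rule prod_three[OF _ in2])
    fix w assume "w \<in> verts n"
    from B[OF this] show "(if B0 n v w < 0 then y w ^ nat (- B0 n v w) else 1) =
      (if w = prv v then y w else 1) * (if w = nxt (upv v) then y w else 1) * (if w = nxt (lef v) then y w else 1)"
      by (cases "w = prv v"; cases "w = nxt (upv v)"; cases "w = nxt (lef v)") auto
  qed
  ultimately show ?thesis unfolding exch_def by simp
qed

definition fund :: "nat \<times> nat \<Rightarrow> nat \<times> nat \<Rightarrow> int" where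
  "fund v0 v = fund_int (int (fst v0)) (int (snd v0)) (int (fst v)) (int (snd v))"

lemma nbrs_eq:
  "2 \<le> i \<Longrightarrow> 2 \<le> j \<Longrightarrow> prv (i, j) = (i - 1, j - 1) \<and> upv (i, j) = (i - 1, j) \<and> lef (i, j) = (i, j - 1)"
  "2 \<le> j \<Longrightarrow> prv (1, j) = (n, j) \<and> upv (1, j) = (n, j + 1) \<and> lef (1, j) = (1, j - 1)"
  "3 \<le> i \<Longrightarrow> prv (i, 1) = (i - 2, n) \<and> upv (i, 1) = (i - 1, 1) \<and> lef (i, 1) = (i - 1, n)"
  by (auto simp: prv_def upv_def lef_def)

lemma \<mu>_fund:
  assumes "v0 \<in> mut" "v \<in> mut"
  shows "\<mu> (fund v0) v = of_bool (v = v0)"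
proof -
  obtain i0 j0 where v0: "v0 = (i0, j0)" by (cases v0)
  from assms(1) v0 have c: "2 \<le> i0 \<and> i0 \<le> n \<and> 2 \<le> j0 \<and> j0 \<le> n \<or> i0 = 1 \<and> 2 \<le> j0 \<and> j0 < n \<or> 3 \<le> i0 \<and> i0 \<le> n \<and> j0 = 1"
    by (cases rule: mut_cases) auto
  have c': "2 \<le> int i0 \<and> int i0 \<le> int n \<and> 2 \<le> int j0 \<and> int j0 \<le> int n \<or> int i0 = 1 \<and> 2 \<le> int j0 \<and> int j0 < int n
      \<or> 3 \<le> int i0 \<and> int i0 \<le> int n \<and> int j0 = 1" using c by auto
  show ?thesis using assms(2)
  proof (cases rule: mut_cases)
    case (inner i j)
    have e: "int (i - 1) = int i - 1" "int (j - 1) = int j - 1" using inner by auto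
    show ?thesis using fund_int_inner[of "int i" "int j" "int i0" "int j0"] nbrs_eq(1)[OF inner(2,4)] inner(2,4) c'
      unfolding inner(1) v0 \<mu>_def fund_def by (auto simp: e)
  next
    case (top j)
    have e: "int (j - 1) = int j - 1" using top by auto
    show ?thesis using fund_int_top[OF _ _ c', of "int j"] nbrs_eq(2)[OF top(2)] top(2,3)
      unfolding top(1) v0 \<mu>_def fund_def by (auto simp: e add.commute)
  next
    case (left i)
    have e: "int (i - 1) = int i - 1" "int (i - 2) = int i - 2" using left by auto
    show ?thesis using fund_int_left[OF _ _ c', of "int i"] nbrs_eq(3)[OF left(2)] left(2,3)
      unfolding left(1) v0 \<mu>_def fund_def by (auto simp: e)
  qed
qed

section \<open>Summation along the diagonals and full rank\<close>

definition clen :: nat where "clen = K * (n - 1) + n"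

lemma nxt_funpow_0: "(nxt ^^ k) (0, 0) = (0, 0)"
  by (induction k) (auto simp: nxt_def)

lemma nxt_funpow_clen: "v \<in> verts n \<Longrightarrow> (nxt ^^ clen) v = (0, 0)"
proof -
  have vt: "(nxt ^^ m) (vtx e m) = (0, 0)" if "rng e m" for e m
    using that
  proof (induction m)
    case (Suc m)
    show ?case
    proof (cases "m = 0")
      case False
      hence "rng e m" using Suc by (auto simp: rng_def)
      thus ?thesis using Suc nxt_vtx[OF Suc.prems] False by (simp add: funpow_swap1)
    next
      case True thus ?thesis using nxt_vtx[OF Suc.prems] by simp
    qed
  qed (simp add: rng_def)
  have dg: "(nxt ^^ i) (n + 1 - i, n + 1 - i) = (0, 0)" if "1 \<le> i" "i \<le> n" for i
    using that
  proof (induction i)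
    case (Suc i)
    have e: "(nxt ^^ Suc i) (n + 1 - Suc i, n + 1 - Suc i) = (nxt ^^ i) (nxt (n - i, n - i))"
      by (simp add: funpow_swap1)
    show ?case
    proof (cases "i = 0")
      case True thus ?thesis using n2 by (simp add: nxt_def)
    next
      case False
      hence "nxt (n - i, n - i) = (n + 1 - i, n + 1 - i)" using Suc by (auto simp: nxt_def)
      thus ?thesis unfolding e using Suc False by simp
    qed
  qed simp
  have ext: "(nxt ^^ clen) v = (0, 0)" if "(nxt ^^ i) v = (0, 0)" "i \<le> clen" for i v
  proof -
    have "clen = (clen - i) + i" using that by simp
    hence "(nxt ^^ clen) v = (nxt ^^ (clen - i)) ((nxt ^^ i) v)" by (metis funpow_add comp_apply)
    thus ?thesis using that nxt_funpow_0 by simp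
  qed
  assume "v \<in> verts n"
  thus ?thesis
  proof (cases rule: cover)
    case (1 t)
    have "(nxt ^^ (n + 1 - t)) v = (0, 0)" using dg[of "n + 1 - t"] 1 by simp
    moreover have "n + 1 - t \<le> clen" using 1 unfolding clen_def by linarith
    ultimately show ?thesis by (rule ext)
  next
    case (2 e m)
    have "(nxt ^^ m) v = (0, 0)" using vt 2 by simp
    moreover have "m \<le> clen" using rng_le[OF 2(1)] by (simp add: clen_def)
    ultimately show ?thesis by (rule ext)
  qed
qed

text \<open>A potential on the chains: its drop from a vertex to the next one is \<omega>. The
  length \<open>clen\<close> exceeds every chain, and \<open>(0, 0)\<close> is absorbing.\<close>

definition csum :: "(nat \<times> nat \<Rightarrow> int) \<Rightarrow> nat \<times> nat \<Rightarrow> int" where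
  "csum \<omega> v = (\<Sum>k<clen. if (nxt ^^ k) v = (0, 0) then 0 else \<omega> ((nxt ^^ k) v))"

lemma csum_0: "csum \<omega> (0, 0) = 0" by (simp add: csum_def nxt_funpow_0)

lemma csum_step: assumes "v \<in> verts n" shows "csum \<omega> v = \<omega> v + csum \<omega> (nxt v)"
proof -
  let ?h = "\<lambda>k. if (nxt ^^ k) v = (0, 0) then 0 else \<omega> ((nxt ^^ k) v)"
  have "(nxt ^^ k) (nxt v) = (nxt ^^ Suc k) v" for k by (simp add: funpow_swap1)
  hence "csum \<omega> (nxt v) = (\<Sum>k<clen. ?h (Suc k))" unfolding csum_def by (simp only:)
  moreover have "(\<Sum>k<Suc clen. ?h k) = ?h 0 + (\<Sum>k<clen. ?h (Suc k))" by (rule sum.lessThan_Suc_shift)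
  moreover have "(\<Sum>k<Suc clen. ?h k) = csum \<omega> v" using nxt_funpow_clen[OF assms] by (simp add: csum_def)
  ultimately show ?thesis using verts_nz[OF assms] by simp
qed

text \<open>The six neighbours pair off along the chains: \<open>upv v\<close> and
  \<open>lef v\<close> with their successors, \<open>prv v\<close> with \<open>nxt v\<close> through
  \<open>v\<close>. The drops of the potential add up to the negative excess.\<close>

lemma B0_csum:
  assumes v: "v \<in> mut"
  shows "(\<Sum>w\<in>verts n. B0 n v w * csum \<omega> w) = - \<mu> \<omega> v"
proof -
  have vv: "v \<in> verts n" using v by (simp add: mut_def)
  have nv: "prv v \<in> verts n" "upv v \<in> verts n" "lef v \<in> verts n" using nbrs_in_verts[OF v] by auto
  have d: "(\<Sum>w\<in>verts n. of_bool (w = u) * csum \<omega> w) = csum \<omega> u" if "u = (0, 0) \<or> u \<in> verts n" for u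
  proof -
    have "(\<Sum>w\<in>verts n. of_bool (w = u) * csum \<omega> w) = (\<Sum>w\<in>verts n. if w = u then csum \<omega> w else 0)"
      by (rule sum.cong) auto
    also have "\<dots> = (if u \<in> verts n then csum \<omega> u else 0)" by (simp add: sum.delta finite_verts)
    finally show ?thesis using that csum_0 by auto
  qed
  have "(\<Sum>w\<in>verts n. B0 n v w * csum \<omega> w) = (\<Sum>w\<in>verts n. of_bool (w = nxt v) * csum \<omega> w + of_bool (w = upv v) * csum \<omega> w + of_bool (w = lef v) * csum \<omega> w
    - of_bool (w = prv v) * csum \<omega> w - of_bool (w = nxt (upv v)) * csum \<omega> w - of_bool (w = nxt (lef v)) * csum \<omega> w)"
    by (rule sum.cong[OF refl]) (simp only: B0_mut[OF v verts_nz] ring_distribs)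
  also have "\<dots> = csum \<omega> (nxt v) + csum \<omega> (upv v) + csum \<omega> (lef v) - csum \<omega> (prv v) - csum \<omega> (nxt (upv v)) - csum \<omega> (nxt (lef v))"
    unfolding sum_subtractf sum.distrib
    unfolding d[OF nxt_in_verts[OF vv]] d[OF disjI2[OF nv(2)]] d[OF disjI2[OF nv(3)]] d[OF disjI2[OF nv(1)]]
      d[OF nxt_in_verts[OF nv(2)]] d[OF nxt_in_verts[OF nv(3)]] ..
  also have "\<dots> = - \<mu> \<omega> v"
    using csum_step[OF vv, of \<omega>] csum_step[of "upv v" \<omega>] csum_step[of "lef v" \<omega>] csum_step[of "prv v" \<omega>, unfolded nxt_prv[OF v]] nv
    unfolding \<mu>_def by linarith
  finally show ?thesis .
qed

lemma finite_mut: "finite mut" using finite_verts by (simp add: mut_def)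

lemma fullrank_B0: "fullrank (verts n) mut (B0 n)"
  unfolding fullrank_def
proof
  fix u :: "nat \<times> nat \<Rightarrow> int"
  \<comment> \<open>The combination of fundamental solutions with excess \<open>- u v\<close> at
    every mutable \<open>v\<close>; its potential solves the system.\<close>
  define \<omega> where "\<omega> = (\<lambda>v. \<Sum>v0\<in>mut. - u v0 * fund v0 v)"
  have "\<mu> \<omega> v = - u v" if "v \<in> mut" for v
  proof -
    have "\<mu> \<omega> v = (\<Sum>v0\<in>mut. - u v0 * \<mu> (fund v0) v)"
      unfolding \<mu>_def \<omega>_def sum.distrib[symmetric] sum_subtractf[symmetric] by (rule sum.cong[OF refl]) (simp add: algebra_simps)
    also have "\<dots> = (\<Sum>v0\<in>mut. if v = v0 then - u v0 else 0)" by (rule sum.cong[OF refl]) (simp add: \<mu>_fund[OF _ that])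
    also have "\<dots> = - u v" using that finite_mut by (simp add: sum.delta')
    finally show ?thesis .
  qed
  thus "\<exists>l. \<forall>j\<in>mut. (\<Sum>v\<in>verts n. B0 n j v * l v) = u j" using B0_csum by (intro exI[of _ "csum \<omega>"]) simp
qed

end

subsection \<open>Irreducibility from leading forms\<close>

text \<open>Both operators select monomials by a weight, so they belong to a common bigrading; for
  functions this is proved by structural induction.\<close>

lemma comp_weight_commute:
  fixes w w' :: "'v \<Rightarrow> nat"
  assumes V: "finite V" and f: "f \<in> pol V"
  defines "C \<equiv> curves.comp (\<lambda>x v. monom (x v) (w v))" and "C' \<equiv> curves.comp (\<lambda>x v. monom (x v) (w' v))"
  shows "C i (C' j f) = C' j (C i f)"
proof -
  interpret A: curves V "\<lambda>x v. monom (x v) (w v)" by (rule curves_weight[OF V])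
  interpret B: curves V "\<lambda>x v. monom (x v) (w' v)" by (rule curves_weight[OF V])
  from f show ?thesis unfolding C_def C'_def
  proof (induction arbitrary: i j rule: pol.induct)
    case (pol_const c)
    show ?case unfolding A.comp_const B.comp_const by (auto simp: A.comp_const B.comp_const fun_eq_iff)
  next
    case (pol_var v)
    have a: "A.comp i (\<lambda>x. x v) = (\<lambda>x. if i = w v then x v else 0)" for i
      by (auto simp: A.comp_def along_var fun_eq_iff)
    have b: "B.comp i (\<lambda>x. x v) = (\<lambda>x. if i = w' v then x v else 0)" for i
      by (auto simp: B.comp_def along_var fun_eq_iff)
    show ?case unfolding a b
      by (cases "i = w v"; cases "j = w' v") (simp_all add: a b A.comp_const B.comp_const)
  next
    case (pol_add f g)
    note fh = pol_add.hyps(1) and gh = pol_add.hyps(2)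
    show ?case unfolding A.comp_add[OF fh gh] B.comp_add[OF fh gh] A.comp_add[OF B.comp_pol[OF fh] B.comp_pol[OF gh]]
      B.comp_add[OF A.comp_pol[OF fh] A.comp_pol[OF gh]] pol_add.IH ..
  next
    case (pol_mult f g)
    have sA: "A.comp i (\<lambda>x. \<Sum>k\<in>S. F k x) = (\<lambda>x. \<Sum>k\<in>S. A.comp i (F k) x)" if "finite S" "\<And>k. F k \<in> pol V" for S :: "nat set" and F i
      using that(1)
    proof (induction S)
      case (insert k S)
      thus ?case using A.comp_add[OF that(2)[of k] pol_sum[of S F V, OF that(2)], of i] by simp
    qed (simp add: A.comp_const)
    have sB: "B.comp i (\<lambda>x. \<Sum>k\<in>S. F k x) = (\<lambda>x. \<Sum>k\<in>S. B.comp i (F k) x)" if "finite S" "\<And>k. F k \<in> pol V" for S :: "nat set" and F i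
      using that(1)
    proof (induction S)
      case (insert k S)
      thus ?case using B.comp_add[OF that(2)[of k] pol_sum[of S F V, OF that(2)], of i] by simp
    qed (simp add: B.comp_const)
    note fh = pol_mult.hyps(1) and gh = pol_mult.hyps(2)
    have "A.comp i (B.comp j (\<lambda>x. f x * g x)) = (\<lambda>x. \<Sum>k\<le>j. A.comp i (\<lambda>x. B.comp k f x * B.comp (j - k) g x) x)"
      unfolding B.comp_mult[OF pol_mult.hyps]
      by (rule sA[OF finite_atMost pol.pol_mult[OF B.comp_pol[OF fh] B.comp_pol[OF gh]]])
    also have "\<dots> = (\<lambda>x. \<Sum>k\<le>j. \<Sum>l\<le>i. A.comp l (B.comp k f) x * A.comp (i - l) (B.comp (j - k) g) x)"
      unfolding A.comp_mult[OF B.comp_pol[OF fh] B.comp_pol[OF gh]] ..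
    also have "\<dots> = (\<lambda>x. \<Sum>l\<le>i. \<Sum>k\<le>j. B.comp k (A.comp l f) x * B.comp (j - k) (A.comp (i - l) g) x)"
      unfolding pol_mult.IH by (rule ext, rule sum.swap)
    also have "\<dots> = (\<lambda>x. \<Sum>l\<le>i. B.comp j (\<lambda>x. A.comp l f x * A.comp (i - l) g x) x)"
      unfolding B.comp_mult[OF A.comp_pol[OF fh] A.comp_pol[OF gh]] ..
    also have "\<dots> = B.comp j (A.comp i (\<lambda>x. f x * g x))"
      unfolding A.comp_mult[OF pol_mult.hyps]
      by (rule sB[OF finite_atMost pol.pol_mult[OF A.comp_pol[OF fh] A.comp_pol[OF gh]], symmetric])
    finally show ?case .
  qed
qed

lemma pol_monomial: "(\<And>i. i \<in> I \<Longrightarrow> d i \<in> V) \<Longrightarrow> (\<lambda>x. c * (\<Prod>i\<in>I. x (d i))) \<in> pol V"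
  by (rule pol_mult[OF pol_const pol_prod]) (rule pol_var)

lemma comp_monomial:
  assumes "finite V" "\<And>i. i \<in> I \<Longrightarrow> d i \<in> V"
  shows "curves.comp (\<lambda>x v. monom (x v) (w v)) k (\<lambda>x. c * (\<Prod>i\<in>I. x (d i)))
    = (if k = (\<Sum>i\<in>I. w (d i)) then (\<lambda>x. c * (\<Prod>i\<in>I. x (d i))) else (\<lambda>x. 0))"
proof -
  interpret A: curves V "\<lambda>x v. monom (x v) (w v)" by (rule curves_weight[OF assms(1)])
  have "along (\<lambda>v. monom (x v) (w v)) (\<lambda>x. c * (\<Prod>i\<in>I. x (d i))) = monom (c * (\<Prod>i\<in>I. x (d i))) (\<Sum>i\<in>I. w (d i))" for x
    by (rule along_eqI[OF pol_monomial[OF assms(2)]]) (simp_all add: poly_monom prod.distrib power_sum)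
  thus ?thesis by (auto simp: A.comp_def fun_eq_iff)
qed

lemma pol_upd: "f \<in> pol V \<Longrightarrow> (\<lambda>x. f (x(z := c))) \<in> pol V"
proof (induction rule: pol.induct)
  case (pol_var v) thus ?case by (cases "v = z") (simp_all add: pol.pol_const pol.pol_var)
next
  case (pol_const c) show ?case by (rule pol.pol_const)
next
  case (pol_add f g) show ?case by (rule pol.pol_add[OF pol_add.IH])
next
  case (pol_mult f g) show ?case by (rule pol.pol_mult[OF pol_mult.IH])
qed

lemma pol_split_var:
  assumes z: "z \<in> V"
  shows "f \<in> pol V \<Longrightarrow> \<exists>C\<in>pol V. \<forall>x. f x = f (x(z := 0)) + x z * C x"
proof (induction rule: pol.induct)
  case (pol_const c) show ?case by (rule bexI[of _ "\<lambda>x. 0"]) (simp_all add: pol.pol_const)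
next
  case (pol_var v)
  show ?case
    by (cases "v = z"; rule bexI[of _ "\<lambda>x. if v = z then 1 else 0"]) (simp_all add: pol.pol_const)
next
  case (pol_add f g)
  then obtain C D where CD: "C \<in> pol V" "\<And>x. f x = f (x(z := 0)) + x z * C x" "D \<in> pol V" "\<And>x. g x = g (x(z := 0)) + x z * D x"
    by blast
  have "f x + g x = f (x(z := 0)) + g (x(z := 0)) + x z * (C x + D x)" for x
    using CD(2)[of x] CD(4)[of x] by (simp add: algebra_simps)
  thus ?case by (intro bexI[of _ "\<lambda>x. C x + D x", OF _ pol.pol_add[OF CD(1,3)]] allI)
next
  case (pol_mult f g)
  then obtain C D where CD: "C \<in> pol V" "\<And>x. f x = f (x(z := 0)) + x z * C x" "D \<in> pol V" "\<And>x. g x = g (x(z := 0)) + x z * D x"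
    by blast
  show ?case
  proof (intro bexI[of _ "\<lambda>x. f (x(z := 0)) * D x + C x * g (x(z := 0)) + x z * (C x * D x)"] allI)
    fix x
    have "f x * g x = (f (x(z := 0)) + x z * C x) * (g (x(z := 0)) + x z * D x)" using CD(2,4)[of x] by simp
    thus "f x * g x = f (x(z := 0)) * g (x(z := 0)) + x z * (f (x(z := 0)) * D x + C x * g (x(z := 0)) + x z * (C x * D x))"
      by (simp add: algebra_simps)
    show "(\<lambda>x. f (x(z := 0)) * D x + C x * g (x(z := 0)) + x z * (C x * D x)) \<in> pol V"
      by (rule pol.pol_add[OF pol.pol_add[OF pol.pol_mult[OF pol_upd[OF pol_mult.hyps(1)] CD(3)]
        pol.pol_mult[OF CD(1) pol_upd[OF pol_mult.hyps(2)]]] pol.pol_mult[OF pol.pol_var[OF z] pol.pol_mult[OF CD(1,3)]]])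
  qed
qed

lemma pol_var_factor:
  assumes "z \<in> V" "f \<in> pol V" "\<And>x. f (x(z := 0)) = 0"
  shows "\<exists>C\<in>pol V. f = (\<lambda>x. x z * C x)"
proof -
  obtain C where C: "C \<in> pol V" "\<And>x. f x = f (x(z := 0)) + x z * C x" using pol_split_var[OF assms(1,2)] by blast
  have "f = (\<lambda>x. x z * C x)" by (rule ext) (subst C(2), subst assms(3), simp)
  thus ?thesis using C(1) by blast
qed

text \<open>Setting one variable to 0 kills the product, hence one factor, which is therefore
  divisible by that variable; the variables are distributed one after the other.\<close>

lemma monomial_factor:
  assumes V: "finite V" and I: "finite I" and d: "\<And>i. i \<in> I \<Longrightarrow> d i \<in> V"
  shows "f \<in> pol V \<Longrightarrow> g \<in> pol V \<Longrightarrow> c \<noteq> 0 \<Longrightarrow> (\<And>x. f x * g x = c * (\<Prod>i\<in>I. x (d i))) \<Longrightarrow>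
    \<exists>S a b. S \<subseteq> I \<and> a \<noteq> 0 \<and> b \<noteq> 0 \<and> f = (\<lambda>x. a * (\<Prod>i\<in>S. x (d i))) \<and> g = (\<lambda>x. b * (\<Prod>i\<in>I-S. x (d i)))"
  using I d
proof (induction I arbitrary: f g rule: finite_induct)
  case empty
  hence e: "(\<lambda>x. f x * g x) = (\<lambda>x. c)" by auto
  interpret A: curves V "\<lambda>x v. monom (x v) 1" by (rule curves_weight[OF V])
  have "f x * g x \<noteq> 0" for x using fun_cong[OF e, of x] \<open>c \<noteq> 0\<close> by simp
  hence nz: "f \<noteq> (\<lambda>x. 0)" "g \<noteq> (\<lambda>x. 0)" by auto
  have "A.deg f + A.deg g = A.deg (\<lambda>x. c)" using A.deg_top_mult(1)[OF empty(1) nz(1) empty(2) nz(2)] e by simp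
  also have "\<dots> = 0" by (rule deg_const[OF curves_weight[OF V]]) (auto simp: is_const_def)
  finally have "is_const f" "is_const g"
    using weight_deg_0[OF V, of "\<lambda>v. 1" f] weight_deg_0[OF V, of "\<lambda>v. 1" g] empty(1,2) by simp_all
  then obtain a b where ab: "f = (\<lambda>x. a)" "g = (\<lambda>x. b)" by (auto simp: is_const_def)
  thus ?case using nz by (intro exI[of _ "{}"] exI[of _ a] exI[of _ b]) auto
next
  case (insert i I)
  have dV: "d i \<in> V" using insert.prems by simp
  let ?P = "\<lambda>I x. \<Prod>i\<in>I. x (d i)"
  have xz: "(\<lambda>x. x (d i)) \<in> pol V" "(\<lambda>x::'a \<Rightarrow> complex. x (d i)) \<noteq> (\<lambda>x. 0)"
    using dV by (auto intro: pol.pol_var simp: fun_eq_iff intro!: exI[of _ "\<lambda>v. 1"])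
  have "f (x(d i := 0)) * g (x(d i := 0)) = 0" for x
  proof -
    have "(\<Prod>j\<in>insert i I. (x(d i := 0)) (d j)) = 0" by (rule prod_zero) (use insert.hyps in auto)
    thus ?thesis unfolding insert.prems(4) by simp
  qed
  hence or: "(\<lambda>x. f (x(d i := 0))) = (\<lambda>x. 0) \<or> (\<lambda>x. g (x(d i := 0))) = (\<lambda>x. 0)"
    by (rule pol_mult_eq_0[OF pol_upd[OF insert.prems(1)] pol_upd[OF insert.prems(2)]])
  have step: "\<exists>S a b. S \<subseteq> insert i I \<and> a \<noteq> 0 \<and> b \<noteq> 0 \<and> i \<in> S \<and> f = (\<lambda>x. a * ?P S x) \<and> g = (\<lambda>x. b * ?P (insert i I - S) x)"
    if fg: "f \<in> pol V" "g \<in> pol V" "\<And>x. f x * g x = c * ?P (insert i I) x" and z: "(\<lambda>x. f (x(d i := 0))) = (\<lambda>x. 0)" for f g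
  proof -
    obtain C where C: "C \<in> pol V" "f = (\<lambda>x. x (d i) * C x)" using pol_var_factor[OF dV fg(1)] z unfolding fun_eq_iff by blast
    have "(\<lambda>x. C x * g x) = (\<lambda>x. c * ?P I x)"
    proof (rule pol_cancel[OF xz, of "\<lambda>x. C x * g x" "\<lambda>x. c * ?P I x"])
      show "(\<lambda>x. c * ?P I x) \<in> pol V" by (rule pol_monomial) (use insert.prems in auto)
      show "x (d i) * (C x * g x) = x (d i) * (c * ?P I x)" for x
        using fg(3)[of x] insert.hyps unfolding C(2) by (simp add: algebra_simps)
    qed (rule pol.pol_mult[OF C(1) fg(2)])
    hence "\<And>x. C x * g x = c * ?P I x" by meson
    from insert.IH[OF C(1) fg(2) insert.prems(3) this insert.prems(5)] obtain S a b where
      S: "S \<subseteq> I" "a \<noteq> 0" "b \<noteq> 0" "C = (\<lambda>x. a * ?P S x)" "g = (\<lambda>x. b * ?P (I - S) x)" by blast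
    have fS: "finite S" "i \<notin> S" using S(1) insert.hyps finite_subset by auto
    have "f = (\<lambda>x. a * ?P (insert i S) x)" unfolding C(2) S(4) using fS by (simp add: ac_simps)
    moreover have "insert i I - insert i S = I - S" using insert.hyps by auto
    ultimately show ?thesis using S by (intro exI[of _ "insert i S"] exI[of _ a] exI[of _ b] conjI) auto
  qed
  from or show ?case
  proof
    assume "(\<lambda>x. f (x(d i := 0))) = (\<lambda>x. 0)"
    from step[OF insert.prems(1,2,4) this] show ?thesis by blast
  next
    assume z: "(\<lambda>x. g (x(d i := 0))) = (\<lambda>x. 0)"
    have "\<And>x. g x * f x = c * ?P (insert i I) x" using insert.prems(4) by (simp add: mult.commute)
    from step[OF insert.prems(2,1) this z] obtain S a b where
      S: "S \<subseteq> insert i I" "a \<noteq> 0" "b \<noteq> 0" "g = (\<lambda>x. a * ?P S x)" "f = (\<lambda>x. b * ?P (insert i I - S) x)" by blast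
    have "insert i I - (insert i I - S) = S" using S(1) by auto
    thus ?thesis using S by (intro exI[of _ "insert i I - S"] exI[of _ b] exI[of _ a]) auto
  qed
qed

text \<open>Degrees in \<open>z\<close> add: when the product is at most linear in \<open>z\<close>
  and \<open>a\<close> involves \<open>z\<close>, nothing is left for \<open>b\<close>.\<close>

lemma pol_drop_var:
  assumes V: "finite V" and z: "z \<in> V" and ab: "a \<in> pol V" "b \<in> pol V" "a \<notin> pol (V - {z})" "b \<noteq> (\<lambda>x. 0)"
    and le: "\<And>x. degree (along (\<lambda>v. if v = z then [:0, 1:] else [:x v:]) (\<lambda>x. a x * b x)) \<le> 1"
  shows "b \<in> pol (V - {z})"
proof -
  interpret axis "V - {z}" V z
    by unfold_locales (use V z irred_pprime[of "V - {z}"] in auto)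
  have a0: "a \<noteq> (\<lambda>x. 0)" using ab(3) pol_const[of 0] by metis
  have "deg a \<noteq> 0" using deg_0_V0[OF ab(1)] ab(3) by blast
  moreover have "deg (\<lambda>x. a x * b x) \<le> 1" unfolding deg_def by (rule Least_le) (use le in blast)
  ultimately have "deg b = 0" using deg_top_mult(1)[OF ab(1) a0 ab(2,4)] by simp
  thus ?thesis using deg_0_V0[OF ab(2)] by blast
qed

text \<open>For \<open>w0\<close> the leading forms of two factors divide the diagonal indices
  between them, \<open>S\<close> and its complement. For each \<open>s\<close> another weight has a
  leading form linear in \<open>d s\<close> and \<open>d (s + 1)\<close> that is not a product of
  parts separating these variables, so \<open>s\<close> and \<open>s + 1\<close> stay together. Thus
  one factor has a constant leading form and is constant.\<close>

lemma irred_by_tops: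
  fixes w0 :: "'v \<Rightarrow> nat" and d :: "nat \<Rightarrow> 'v"
  defines "C w \<equiv> curves.comp (\<lambda>x v. monom (x v) (w v :: nat))"
    and "D w \<equiv> curves.deg (\<lambda>x v. monom (x v) (w v :: nat))"
    and "T w \<equiv> curves.top (\<lambda>x v. monom (x v) (w v :: nat))"
  assumes V: "finite V" and f: "f \<in> pol V" and w0: "\<And>v. v \<in> V \<Longrightarrow> 0 < w0 v"
    and d: "inj_on d {1..m}" "\<And>i. i \<in> {1..m} \<Longrightarrow> d i \<in> V" and m: "1 \<le> m"
    and t0: "T w0 f = (\<lambda>x. \<Prod>i\<in>{1..m}. x (d i))"
    and ts: "\<And>s. 1 \<le> s \<Longrightarrow> s < m \<Longrightarrow> \<exists>w p r. D w f = (\<Sum>i\<in>{1..m}. w (d i)) \<and>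
      T w f = (\<lambda>x. (\<Prod>i\<in>{1..m}-{s, s+1}. x (d i)) * (x (d s) * x (d (s + 1)) - x p * x r)) \<and>
      p \<in> V \<and> r \<in> V \<and> p \<notin> {d s, d (s + 1)} \<and> r \<notin> {d s, d (s + 1)}"
  shows "irred V f"
proof -
  let ?P = "\<lambda>S x. \<Prod>i\<in>S. x (d i) :: complex"
  have cw: "curves V (\<lambda>x v. monom (x v) (w v))" for w :: "'v \<Rightarrow> nat" by (rule curves_weight[OF V])
  interpret A: curves V "\<lambda>x v. monom (x v) (w0 v)" by (rule cw)
  have P1: "?P S (\<lambda>v. 1) = 1" for S by simp
  have P0: "?P S (\<lambda>v. 0) = 0" if "S \<noteq> {}" "S \<subseteq> {1..m}" for S
    using that finite_subset[OF that(2)] by (simp add: card_gt_0_iff)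
  have fc: "\<not> is_const f"
  proof
    assume c: "is_const f"
    have "A.deg f = 0" by (rule deg_const[OF cw c])
    moreover obtain k where "f = (\<lambda>x. k)" using c by (auto simp: is_const_def)
    ultimately have "T w0 f = (\<lambda>x. k)" unfolding T_def A.top_def by (simp add: A.comp_const)
    hence "?P {1..m} (\<lambda>v. 1) = k" "?P {1..m} (\<lambda>v. 0) = k" unfolding t0 by meson+
    thus False using P1 P0[of "{1..m}"] m by simp
  qed
  have main: "is_const g \<or> is_const h"
    if g: "g \<in> pol V" and h: "h \<in> pol V" and gh: "f = (\<lambda>x. g x * h x)" for g h
  proof -
    have nz: "g \<noteq> (\<lambda>x. 0)" "h \<noteq> (\<lambda>x. 0)" using gh fc by (auto simp: is_const_def)
    have "(\<lambda>x. A.top g x * A.top h x) = (\<lambda>x. ?P {1..m} x)"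
      using A.deg_top_mult(2)[OF g nz(1) h nz(2)] t0 gh unfolding T_def by simp
    hence "\<And>x. A.top g x * A.top h x = 1 * ?P {1..m} x" by (simp add: fun_eq_iff)
    from monomial_factor[OF V _ d(2) A.top_pol[OF g] A.top_pol[OF h] one_neq_zero this]
    obtain S a b where S: "S \<subseteq> {1..m}" "a \<noteq> 0" "b \<noteq> 0" "A.top g = (\<lambda>x. a * ?P S x)" "A.top h = (\<lambda>x. b * ?P ({1..m} - S) x)"
      by blast
    have link: "s \<in> S \<longleftrightarrow> s + 1 \<in> S" if s: "1 \<le> s" "s < m" for s
    proof -
      obtain w p r where w: "D w f = (\<Sum>i\<in>{1..m}. w (d i))"
        "T w f = (\<lambda>x. (\<Prod>i\<in>{1..m}-{s, s+1}. x (d i)) * (x (d s) * x (d (s + 1)) - x p * x r))"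
        "p \<in> V" "r \<in> V" "p \<notin> {d s, d (s + 1)}" "r \<notin> {d s, d (s + 1)}" using ts[OF s] by blast
      interpret B: curves V "\<lambda>x v. monom (x v) (w v)" by (rule cw)
      have Dw: "B.deg g + B.deg h = (\<Sum>i\<in>{1..m}. w (d i))"
        using B.deg_top_mult(1)[OF g nz(1) h nz(2)] w(1) gh unfolding D_def by simp
      have Tw: "B.top g x * B.top h x = ?P ({1..m}-{s, s+1}) x * (x (d s) * x (d (s + 1)) - x p * x r)" for x
        using B.deg_top_mult(2)[OF g nz(1) h nz(2)] w(2) gh unfolding T_def by (simp add: fun_eq_iff)
      have le: "B.comp j (A.top q) = (\<lambda>x. 0)" if "q \<in> pol V" "B.deg q < j" for q j
      proof -
        have "B.comp j (A.top q) = A.comp (A.deg q) (B.comp j q)"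
          unfolding A.top_def by (rule comp_weight_commute[OF V that(1), symmetric])
        also have "B.comp j q = (\<lambda>x. 0)" using B.comp_gt_deg[OF that] by auto
        finally show ?thesis by (simp add: A.comp_const)
      qed
      have mg: "A.top g \<in> pol V" "A.top h \<in> pol V" by (intro A.top_pol g h)+
      have SI: "\<And>i. i \<in> S \<Longrightarrow> d i \<in> V" "\<And>i. i \<in> {1..m} - S \<Longrightarrow> d i \<in> V" using S(1) d(2) by auto
      have cg: "B.comp k (A.top g) = (if k = (\<Sum>i\<in>S. w (d i)) then A.top g else (\<lambda>x. 0))" for k
        unfolding S(4) by (rule comp_monomial[OF V SI(1)])
      have ch: "B.comp k (A.top h) = (if k = (\<Sum>i\<in>{1..m}-S. w (d i)) then A.top h else (\<lambda>x. 0))" for k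
        unfolding S(5) by (rule comp_monomial[OF V SI(2)])
      have tn: "A.top g \<noteq> (\<lambda>x. 0)" "A.top h \<noteq> (\<lambda>x. 0)" by (intro A.top_nonzero g h nz)+
      have "(\<Sum>i\<in>S. w (d i)) \<le> B.deg g" using le[OF g, of "\<Sum>i\<in>S. w (d i)"] cg[of "\<Sum>i\<in>S. w (d i)"] tn(1) by (cases "B.deg g < (\<Sum>i\<in>S. w (d i))") simp_all
      moreover have "(\<Sum>i\<in>{1..m}-S. w (d i)) \<le> B.deg h" using le[OF h, of "\<Sum>i\<in>{1..m}-S. w (d i)"] ch[of "\<Sum>i\<in>{1..m}-S. w (d i)"] tn(2) by (cases "B.deg h < (\<Sum>i\<in>{1..m}-S. w (d i))") simp_all
      moreover have "(\<Sum>i\<in>S. w (d i)) + (\<Sum>i\<in>{1..m}-S. w (d i)) = (\<Sum>i\<in>{1..m}. w (d i))"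
        using sum.subset_diff[OF S(1) finite_atLeastAtMost, of "\<lambda>i. w (d i)"] by simp
      \<comment> \<open>The weight of each leading monomial is at most the degree of its factor, and
        the totals agree, so both bounds are attained.\<close>
      ultimately have dg: "(\<Sum>i\<in>S. w (d i)) = B.deg g" "(\<Sum>i\<in>{1..m}-S. w (d i)) = B.deg h" using Dw by linarith+
      have kg: "A.comp (A.deg g) (B.top g) = A.top g"
        using cg[of "B.deg g"] dg(1) unfolding B.top_def A.top_def using comp_weight_commute[OF V g, of w0 "A.deg g" w "B.deg g"] by simp
      have kh: "A.comp (A.deg h) (B.top h) = A.top h"
        using ch[of "B.deg h"] dg(2) unfolding B.top_def A.top_def using comp_weight_commute[OF V h, of w0 "A.deg h" w "B.deg h"] by simp
      have bt: "B.top g \<in> pol V" "B.top h \<in> pol V" "B.top g \<noteq> (\<lambda>x. 0)" "B.top h \<noteq> (\<lambda>x. 0)"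
        by (intro B.top_pol B.top_nonzero g h nz)+
      have dd: "d s \<noteq> d (s + 1)" "\<And>i. i \<in> {1..m}-{s, s+1} \<Longrightarrow> d i \<noteq> d s \<and> d i \<noteq> d (s + 1)" "d s \<in> V" "d (s + 1) \<in> V"
        using d s by (auto simp: inj_on_eq_iff)
      \<comment> \<open>Each of the two variables occurs in the leading form only to the first
        power, because the diagonal entries are distinct and \<open>p\<close>, \<open>r\<close>
        differ from them.\<close>
      have deg1: "degree (along (\<lambda>v. if v = z then [:0, 1:] else [:x v:]) (\<lambda>x. B.top g x * B.top h x)) \<le> 1"
        if z: "z = d s \<or> z = d (s + 1)" for z x
      proof -
        let ?y = "if z = d s then x (d (s + 1)) else x (d s)"
        have eq: "along (\<lambda>v. if v = z then [:0, 1:] else [:x v:]) (\<lambda>x. B.top g x * B.top h x)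
          = [:- (?P ({1..m}-{s, s+1}) x * (x p * x r)), ?P ({1..m}-{s, s+1}) x * ?y:]"
        proof (rule along_eqI[OF pol_mult[OF bt(1,2)]])
          fix t
          have e: "(\<lambda>v. poly (if v = z then [:0, 1:] else [:x v:]) t) = x(z := t)" by auto
          have "?P ({1..m}-{s, s+1}) (x(z := t)) = ?P ({1..m}-{s, s+1}) x"
            by (rule prod.cong[OF refl]) (use dd z in auto)
          thus "poly [:- (?P ({1..m}-{s, s+1}) x * (x p * x r)), ?P ({1..m}-{s, s+1}) x * ?y:] t
            = B.top g (\<lambda>v. poly (if v = z then [:0, 1:] else [:x v:]) t) * B.top h (\<lambda>v. poly (if v = z then [:0, 1:] else [:x v:]) t)"
            unfolding e Tw using w(5,6) dd(1) z by (auto simp: algebra_simps)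
        qed
        show ?thesis unfolding eq by simp
      qed
      have dep: "B.top q \<notin> pol (V - {d i})"
        if q: "A.comp (A.deg q) (B.top q) = (\<lambda>x. c * ?P R x)" "c \<noteq> 0" "R \<subseteq> {1..m}" "i \<in> R" for q c R i
      proof
        assume "B.top q \<in> pol (V - {d i})"
        hence "A.comp (A.deg q) (B.top q) \<in> pol (V - {d i})"
          by (intro curves.comp_pol[OF curves_weight]) (use V in auto)
        hence "(\<lambda>x. c * ?P R x) \<in> pol (V - {d i})" unfolding q(1) .
        hence "c * ?P R (\<lambda>v. 1) = c * ?P R (\<lambda>v. if v = d i then 0 else 1)"
          by (rule pol_local[of "\<lambda>x. c * ?P R x" "V - {d i}"]) auto
        moreover have "?P R (\<lambda>v. if v = d i then 0 else 1) = 0"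
          using q(3,4) finite_subset[OF q(3)] by (intro prod_zero) auto
        ultimately show False using q(2) by simp
      qed
      have contra: False
        if s0: "(s0 = s \<and> s1 = s + 1) \<or> (s0 = s + 1 \<and> s1 = s)" and "s0 \<in> S" "s1 \<notin> S" for s0 s1
      proof -
        have s1: "s1 \<in> {1..m} - S" using that s by auto
        have SS: "{1..m} - S \<subseteq> {1..m}" by blast
        note ng = dep[OF kg[unfolded S(4)] S(2,1) \<open>s0 \<in> S\<close>] and nh = dep[OF kh[unfolded S(5)] S(3) SS s1]
        have v01: "d s0 \<in> V" "d s1 \<in> V" using dd s0 by auto
        have H: "B.top h \<in> pol (V - {d s0})"
          by (rule pol_drop_var[OF V v01(1) bt(1,2) ng bt(4) deg1]) (use s0 in auto)
        have "(\<lambda>x. B.top h x * B.top g x) = (\<lambda>x. B.top g x * B.top h x)" by (simp add: mult.commute)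
        hence G: "B.top g \<in> pol (V - {d s1})"
          by (intro pol_drop_var[OF V v01(2) bt(2,1) nh bt(3)]) (use s0 deg1 in auto)
        \<comment> \<open>With all other variables equal to 1 the separated factors would satisfy
          \<open>g u * h t = u * t - 1\<close>. The value at \<open>(1, 1)\<close> makes
          \<open>g 1\<close> or \<open>h 1\<close> vanish, against the value -1 at
          \<open>(1, 0)\<close> and \<open>(0, 1)\<close>.\<close>
        let ?X = "\<lambda>u t v. if v = d s0 then u else if v = d s1 then t else 1 :: complex"
        have ne: "d s0 \<noteq> d s1" using s0 dd(1) by auto
        have ge: "B.top g (?X u t) = B.top g (?X u t')" for u t t'
          by (rule pol_local[OF G]) auto
        have he: "B.top h (?X u t) = B.top h (?X u' t)" for u u' t
          by (rule pol_local[OF H]) auto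
        have val: "B.top g (?X u t) * B.top h (?X u t) = u * t - 1" for u t
        proof -
          have "?P ({1..m}-{s, s+1}) (?X u t) = 1"
            by (rule prod.neutral) (use dd(2) s0 in auto)
          moreover have "?X u t p = 1" "?X u t r = 1" using w(5,6) s0 by auto
          moreover have "?X u t (d s) * ?X u t (d (s + 1)) = u * t" using s0 ne by (auto simp: mult.commute)
          ultimately show ?thesis unfolding Tw by simp
        qed
        have "B.top g (?X 1 0) * B.top h (?X 0 1) = 0" using val[of 1 1] ge[of 1 1 0] he[of 1 1 0] by simp
        hence "B.top g (?X 1 0) = 0 \<or> B.top h (?X 0 1) = 0" by simp
        thus False using val[of 1 0] val[of 0 1] by auto
      qed
      show ?thesis using contra[of s "s + 1"] contra[of "s + 1" s] by blast
    qed
    have all: "i \<in> S \<longleftrightarrow> 1 \<in> S" if "1 \<le> i" "i \<le> m" for i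
      using that
    proof (induction i rule: nat_induct_at_least)
      case (Suc i) thus ?case using link[of i] by simp
    qed simp
    have const: "is_const q" if q: "q \<in> pol V" "A.top q = (\<lambda>x. c)" "q \<noteq> (\<lambda>x. 0)" for q c
    proof -
      have "A.top q \<noteq> (\<lambda>x. 0)" by (rule A.top_nonzero[OF q(1,3)])
      hence c: "c \<noteq> 0" using q(2) by auto
      have "along (\<lambda>v. monom ((\<lambda>v. 0) v) (w0 v)) q = [:q (\<lambda>v. 0):]" by (rule along_eqI[OF q(1)]) simp
      hence "coeff [:q (\<lambda>v. 0):] (A.deg q) = c" using fun_cong[OF q(2), of "\<lambda>v. 0"] unfolding A.top_def A.comp_def by simp
      hence "A.deg q = 0" using c by (cases "A.deg q") auto
      thus ?thesis using weight_deg_0[where w = w0, OF V w0 q(1)] by blast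
    qed
    show ?thesis
    proof (cases "1 \<in> S")
      case True
      hence "{1..m} - S = {}" using all by auto
      hence "A.top h = (\<lambda>x. b)" unfolding S(5) by (simp only: prod.empty mult_1_right)
      thus ?thesis using const[OF h _ nz(2)] by blast
    next
      case False
      hence "S = {}" using all S(1) by force
      hence "A.top g = (\<lambda>x. a)" unfolding S(4) by (simp only: prod.empty mult_1_right)
      thus ?thesis using const[OF g _ nz(1)] by blast
    qed
  qed
  show ?thesis unfolding irred_def using f fc main by blast
qed

context curves
begin

lemma deg_top_add:
  assumes f: "f \<in> pol V" and g: "g \<in> pol V" "g \<noteq> (\<lambda>x. 0)" and lt: "deg f < deg g"
  shows "top (\<lambda>x. f x + g x) = top g" "deg (\<lambda>x. f x + g x) = deg g"
proof -
  have c: "comp (deg g) (\<lambda>x. f x + g x) = top g"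
    unfolding comp_add[OF f g(1)] top_def using comp_gt_deg[OF f lt] by simp
  show d: "deg (\<lambda>x. f x + g x) = deg g"
  proof (rule deg_eqI[OF pol_add[OF f g(1)]])
    show "comp (deg g) (\<lambda>x. f x + g x) \<noteq> (\<lambda>x. 0)" using c top_nonzero[OF g] by simp
    show "degree (along (Q x) (\<lambda>x. f x + g x)) \<le> deg g" for x
      unfolding along_add[OF f g(1)]
      by (rule degree_add_le) (use degree_le_deg[OF f, of x] degree_le_deg[OF g(1), of x] lt in auto)
  qed
  show "top (\<lambda>x. f x + g x) = top g" using c d unfolding top_def by simp
qed

end

context cg
begin

subsection \<open>The initial variables are pairwise non-associated primes\<close>

definition Sch :: "nat \<times> nat \<Rightarrow> (nat \<times> nat) set" where "Sch v = {u \<in> verts n. \<exists>k. u = (nxt ^^ k) v}"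
definition cm :: "nat \<times> nat \<Rightarrow> (nat \<times> nat \<Rightarrow> complex) \<Rightarrow> complex" where "cm v x = (\<Prod>u\<in>Sch v. x u)"
abbreviation W :: "nat \<times> nat \<Rightarrow> nat" where "W \<equiv> nw \<omega>0"
definition DW :: "nat \<times> nat \<Rightarrow> nat" where "DW v = (\<Sum>u\<in>Sch v. W u)"
abbreviation tW where "tW \<equiv> curves.top (\<lambda>x v. monom (x v) (W v))"
abbreviation dW where "dW \<equiv> curves.deg (\<lambda>x v. monom (x v) (W v))"

lemma finite_Sch: "finite (Sch v)" using finite_verts by (simp add: Sch_def)

lemma nxt_no_cycle: assumes "v \<in> verts n" "(nxt ^^ Suc k) v = v" shows False
proof -
  have "(nxt ^^ (Suc k * j)) v = v" for j
  proof (induction j)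
    case (Suc j)
    have "(nxt ^^ (Suc k * Suc j)) v = (nxt ^^ Suc k) ((nxt ^^ (Suc k * j)) v)"
      using funpow_add[of "Suc k" "Suc k * j" nxt] by (simp add: algebra_simps)
    thus ?case using Suc assms(2) by simp
  qed simp
  hence "(nxt ^^ (Suc k * clen)) v = v" .
  moreover have "Suc k * clen = k * clen + clen" by simp
  ultimately have "(nxt ^^ (k * clen)) ((nxt ^^ clen) v) = v" by (metis funpow_add comp_apply)
  thus False using nxt_funpow_clen[OF assms(1)] nxt_funpow_0 verts_nz[OF assms(1)] by simp
qed

lemma Sch_0: "Sch (0, 0) = {}" using verts_nz by (auto simp: Sch_def nxt_funpow_0)

lemma Sch_self: "v \<in> verts n \<Longrightarrow> v \<in> Sch v" by (auto simp: Sch_def intro: exI[of _ 0])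

lemma Sch_step:
  assumes v: "v \<in> verts n"
  shows "Sch v = insert v (Sch (nxt v))" "v \<notin> Sch (nxt v)"
proof -
  have s: "(nxt ^^ k) (nxt v) = (nxt ^^ Suc k) v" for k by (simp add: funpow_swap1)
  show "v \<notin> Sch (nxt v)"
  proof
    assume "v \<in> Sch (nxt v)"
    then obtain k where k: "v = (nxt ^^ Suc k) v" unfolding Sch_def s by blast
    show False by (rule nxt_no_cycle[OF v k[symmetric]])
  qed
  show "Sch v = insert v (Sch (nxt v))"
  proof (rule subset_antisym; rule subsetI)
    fix u assume "u \<in> Sch v"
    then obtain k where k: "u \<in> verts n" "u = (nxt ^^ k) v" by (auto simp: Sch_def)
    show "u \<in> insert v (Sch (nxt v))"
    proof (cases k)
      case (Suc j)
      hence "u = (nxt ^^ j) (nxt v)" using k s by simp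
      thus ?thesis using k(1) unfolding Sch_def by blast
    qed (use k in simp)
  next
    fix u assume "u \<in> insert v (Sch (nxt v))"
    thus "u \<in> Sch v" using Sch_self[OF v] unfolding Sch_def s by blast
  qed
qed

lemma cm_step: "v \<in> verts n \<Longrightarrow> cm v x = x v * cm (nxt v) x"
  using Sch_step[of v] finite_Sch by (simp add: cm_def)
lemma DW_step: "v \<in> verts n \<Longrightarrow> DW v = W v + DW (nxt v)"
  using Sch_step[of v] finite_Sch by (simp add: DW_def)

lemma Sch_asym: "v \<in> verts n \<Longrightarrow> v \<in> Sch w \<Longrightarrow> w \<in> Sch v \<Longrightarrow> v = w"
proof (rule ccontr)
  assume v: "v \<in> verts n" "v \<in> Sch w" "w \<in> Sch v" and ne: "v \<noteq> w"
  then obtain a b where ab: "v = (nxt ^^ a) w" "w = (nxt ^^ b) v" by (auto simp: Sch_def)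
  hence "(nxt ^^ (a + b)) v = v" by (simp add: funpow_add)
  moreover obtain k where "a + b = Suc k" using ab ne by (cases "a + b") auto
  ultimately show False using nxt_no_cycle[OF v(1), of k] by simp
qed

lemma chain_image:
  fixes m :: nat
  assumes E: "\<And>i. 1 \<le> i \<Longrightarrow> i \<le> m \<Longrightarrow> d i \<in> verts n" "\<And>s. 1 \<le> s \<Longrightarrow> s < m \<Longrightarrow> d (s + 1) = nxt (d s)" "nxt (d m) = (0, 0)"
    and m: "1 \<le> m"
  shows "d ` {1..m} = Sch (d 1)" "inj_on d {1..m}"
proof -
  have "d ` {m - k..m} = Sch (d (m - k)) \<and> inj_on d {m - k..m}" if "k < m" for k
    using that
  proof (induction k)
    case 0
    have "Sch (d m) = {d m}" using Sch_step[OF E(1)[OF m order_refl]] E(3) Sch_0 by simp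
    thus ?case by simp
  next
    case (Suc k)
    define j where "j = m - Suc k"
    have j: "1 \<le> j" "j < m" "m - k = j + 1" using Suc.prems by (auto simp: j_def)
    have IH: "d ` {j + 1..m} = Sch (nxt (d j))" "inj_on d {j + 1..m}" using Suc j E(2)[OF j(1,2)] by auto
    have i: "{j..m} = insert j {j + 1..m}" using j by auto
    have v: "d j \<in> verts n" using E(1) j by simp
    have "d ` {j..m} = Sch (d j)" unfolding i using IH(1) Sch_step(1)[OF v] by simp
    moreover have "inj_on d {j..m}" unfolding i using IH Sch_step(2)[OF v] by (simp add: inj_on_insert)
    ultimately show ?case unfolding j_def by simp
  qed
  from this[of "m - 1"] m show "d ` {1..m} = Sch (d 1)" "inj_on d {1..m}" by auto
qed

text \<open>A common description of all initial variables, trailing minors included: a band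
  determinant whose diagonal runs through the chain of \<open>v\<close>. The last clause leaves the
  weight open, since different weights are applied to the same determinant.\<close>

lemma cl_band:
  assumes v: "v \<in> verts n"
  obtains E m where "1 \<le> m" "E 1 1 = v" "\<And>i. 1 \<le> i \<Longrightarrow> i \<le> m \<Longrightarrow> E i i \<in> verts n" "nxt (E m m) = (0, 0)"
    "\<And>s. 1 \<le> s \<Longrightarrow> s < m \<Longrightarrow> E (s + 1) (s + 1) \<in> mut \<and> prv (E (s + 1) (s + 1)) = E s s \<and>
      upv (E (s + 1) (s + 1)) = E s (s + 1) \<and> lef (E (s + 1) (s + 1)) = E (s + 1) s"
    "\<And>x. cl v x = detm m (\<lambda>i j. if E i j = (0, 0) then 0 else x (E i j))"
    "\<And>w u0. (\<And>v. v \<in> mut \<Longrightarrow> w (upv v) + w (lef v) < w v + w (prv v) \<or> w (upv v) + w (lef v) = w v + w (prv v) \<and> v = u0) \<Longrightarrow>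
      (\<And>i j. 1 \<le> i \<Longrightarrow> i \<le> m \<Longrightarrow> 1 \<le> j \<Longrightarrow> j \<le> m \<Longrightarrow> E i i = u0 \<Longrightarrow> E j j = u0 \<Longrightarrow> i = j) \<Longrightarrow> band E m w u0"
  using v
proof (cases rule: cover)
  case (2 e m)
  let ?E = "\<lambda>i j. Usrc n (row m + i - 1) (col e m + j - 1)"
  have m: "m + n \<le> K * (n - 1)" "1 \<le> m" using rng_le[OF 2(1)] by auto
  have mc: "m \<le> K * (n + 1)" using le_Kn[of m] m by simp
  have rc: "row (m - s) = row m + s" "col e' (m - s) = col e m + s + e' - e" if "s \<le> m" "e \<le> e'" for s e'
    using that m mc by (auto simp: row_def col_def)
  have rc1: "1 \<le> row m" "1 \<le> col e m" using m mc by (auto simp: row_def col_def)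
  have r: "rng e (m - s)" if "s < m" for s using 2(1) that by (auto simp: rng_def)
  have d: "Usrc n (row m + s) (col e m + s) = vtx e (m - s)" if "s < m" for s
    using rc[of s e] that by (simp add: vtx_def)
  have dE: "?E i i = vtx e (m - (i - 1)) \<and> ?E i i \<in> verts n" if "1 \<le> i" "i \<le> m" for i
    using d[of "i - 1"] vtx_verts[OF r[of "i - 1"]] that by simp
  show ?thesis
  proof (rule that[of m ?E])
    show "1 \<le> m" by (rule m(2))
    show "?E 1 1 = v" using d[of 0] m 2(2) by simp
    show "?E i i \<in> verts n" if "1 \<le> i" "i \<le> m" for i by (rule conjunct2[OF dE[OF that]])
    show "nxt (?E m m) = (0, 0)" using dE[OF m(2) order_refl] m nxt_vtx_1[of e] r[of "m - 1"] by simp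
    show "?E (s + 1) (s + 1) \<in> mut \<and> prv (?E (s + 1) (s + 1)) = ?E s s \<and>
      upv (?E (s + 1) (s + 1)) = ?E s (s + 1) \<and> lef (?E (s + 1) (s + 1)) = ?E (s + 1) s" if s: "1 \<le> s" "s < m" for s
    proof -
      have s': "m - s + 1 = m - (s - 1)" "s - 1 < m" using s by auto
      have rr: "rng e (m - s)" "rng e (m - s + 1)" using r[of s] r[of "s - 1"] s s' by auto
      note C = chain_nbrs[OF rr]
      have e: "?E (s + 1) (s + 1) = vtx e (m - s)" using d[of s] s by simp
      have e2: "?E s s = vtx e (m - s + 1)" using dE[of s] s s' by simp
      have e3: "?E s (s + 1) = vtx (e + 1) (m - s + 1)"
        using rc[of "s - 1" "e + 1"] s s' by (simp add: vtx_def)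
      have e4: "?E (s + 1) s = Usrc n (row (m - s)) (col e (m - s) - 1)" using rc[of s e] s by simp
      show ?thesis unfolding e e2 e3 e4 using C by simp
    qed
    show "cl v x = detm m (\<lambda>i j. if ?E i j = (0, 0) then 0 else x (?E i j))" for x
      using cl_vtx[OF 2(1), of x] unfolding 2(2) G_def minor_def U_def .
    show "band ?E m w u0"
      if w: "\<And>v. v \<in> mut \<Longrightarrow> w (upv v) + w (lef v) < w v + w (prv v) \<or> w (upv v) + w (lef v) = w v + w (prv v) \<and> v = u0"
        and inj: "\<And>i j. 1 \<le> i \<Longrightarrow> i \<le> m \<Longrightarrow> 1 \<le> j \<Longrightarrow> j \<le> m \<Longrightarrow> ?E i i = u0 \<Longrightarrow> ?E j j = u0 \<Longrightarrow> i = j" for w u0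
    proof (rule band_U[OF rc1 _ w])
      show "supp (row m + i) (col e m + i)" if "i < m" for i
        unfolding supp_def d[OF that] using verts_nz vtx_verts[OF r[OF that]] by blast
      show "i = j" if "i < m" "j < m" "Usrc n (row m + i) (col e m + i) = u0" "Usrc n (row m + j) (col e m + j) = u0" for i j
        using inj[of "i + 1" "j + 1"] that by simp
    qed
  qed
next
  case (1 t)
  let ?E = "\<lambda>i j. (t - 1 + i, t - 1 + j)" and ?m = "n - t + 1"
  show ?thesis
  proof (rule that[of ?m ?E])
    show "1 \<le> ?m" by simp
    show "?E 1 1 = v" using 1 by simp
    show "?E i i \<in> verts n" if "1 \<le> i" "i \<le> ?m" for i using that 1 by (auto simp: verts_def)
    show "nxt (?E ?m ?m) = (0, 0)" using 1 n2 by (simp add: nxt_def)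
    show "?E (s + 1) (s + 1) \<in> mut \<and> prv (?E (s + 1) (s + 1)) = ?E s s \<and>
      upv (?E (s + 1) (s + 1)) = ?E s (s + 1) \<and> lef (?E (s + 1) (s + 1)) = ?E (s + 1) s" if s: "1 \<le> s" "s < ?m" for s
      using s 1 by (auto simp: mut_def verts_def prv_def upv_def lef_def)
    show "cl v x = detm ?m (\<lambda>i j. if ?E i j = (0, 0) then 0 else x (?E i j))" for x
    proof -
      have e: "n - ?m + 1 = t" using 1 by simp
      have "cl v x = detm ?m (\<lambda>i j. x (t + i - 1, t + j - 1))"
        using cl_diag[OF 1(1,2), of x] unfolding 1(3) th_def theta_def minor_def XX_def e .
      also have "\<dots> = detm ?m (\<lambda>i j. if ?E i j = (0, 0) then 0 else x (?E i j))"
        unfolding detm_dt by (rule dt_cong) (use 1 in simp)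
      finally show ?thesis .
    qed
    show "band ?E ?m w u0"
      if w: "\<And>v. v \<in> mut \<Longrightarrow> w (upv v) + w (lef v) < w v + w (prv v) \<or> w (upv v) + w (lef v) = w v + w (prv v) \<and> v = u0"
        and inj: "\<And>i j. 1 \<le> i \<Longrightarrow> i \<le> ?m \<Longrightarrow> 1 \<le> j \<Longrightarrow> j \<le> ?m \<Longrightarrow> ?E i i = u0 \<Longrightarrow> ?E j j = u0 \<Longrightarrow> i = j" for w u0
    proof
      show "w (?E i (c + 1)) + w (?E (i + 1) c) < w (?E i c) + w (?E (i + 1) (c + 1)) \<or>
        w (?E i (c + 1)) + w (?E (i + 1) c) = w (?E i c) + w (?E (i + 1) (c + 1)) \<and> ?E (i + 1) (c + 1) = u0"
        if ic: "1 \<le> i" "i < ?m" "1 \<le> c" "c < ?m" for i c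
      proof -
        have "?E (i + 1) (c + 1) \<in> mut" using ic 1 by (auto simp: mut_def verts_def)
        moreover have "prv (?E (i + 1) (c + 1)) = ?E i c" "upv (?E (i + 1) (c + 1)) = ?E i (c + 1)" "lef (?E (i + 1) (c + 1)) = ?E (i + 1) c"
          using ic 1 by (auto simp: prv_def upv_def lef_def)
        ultimately show ?thesis using w[of "?E (i + 1) (c + 1)"] by auto
      qed
      show "i = j" if "1 \<le> i" "i \<le> ?m" "1 \<le> j" "j \<le> ?m" "?E i i = u0" "?E j j = u0" for i j
        using inj[of i j] that by blast
    qed auto
  qed
qed

lemma cl_leading:
  assumes v: "v \<in> verts n"
  shows "irred (verts n) (cl v)" "tW (cl v) = cm v" "dW (cl v) = DW v"
proof -
  obtain E m where m: "1 \<le> m" and E1: "E 1 1 = v" and Ev: "\<And>i. 1 \<le> i \<Longrightarrow> i \<le> m \<Longrightarrow> E i i \<in> verts n" and Em: "nxt (E m m) = (0, 0)"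
    and En: "\<And>s. 1 \<le> s \<Longrightarrow> s < m \<Longrightarrow> E (s + 1) (s + 1) \<in> mut \<and> prv (E (s + 1) (s + 1)) = E s s \<and>
      upv (E (s + 1) (s + 1)) = E s (s + 1) \<and> lef (E (s + 1) (s + 1)) = E (s + 1) s"
    and Ef: "\<And>x. cl v x = detm m (\<lambda>i j. if E i j = (0, 0) then 0 else x (E i j))"
    and Eb: "\<And>w u0. (\<And>v. v \<in> mut \<Longrightarrow> w (upv v) + w (lef v) < w v + w (prv v) \<or> w (upv v) + w (lef v) = w v + w (prv v) \<and> v = u0) \<Longrightarrow>
      (\<And>i j. 1 \<le> i \<Longrightarrow> i \<le> m \<Longrightarrow> 1 \<le> j \<Longrightarrow> j \<le> m \<Longrightarrow> E i i = u0 \<Longrightarrow> E j j = u0 \<Longrightarrow> i = j) \<Longrightarrow> band E m w u0"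
    by (rule cl_band[OF v]) blast
  let ?d = "\<lambda>i. E i i"
  have st: "E (s + 1) (s + 1) = nxt (E s s)" if "1 \<le> s" "s < m" for s
    using nxt_prv[of "E (s + 1) (s + 1)"] En[OF that] by auto
  note im = chain_image[of m ?d, OF Ev st Em m]
  have ij: "i = j" if "1 \<le> i" "i \<le> m" "1 \<le> j" "j \<le> m" "E i i = u" "E j j = u" for i j u
    by (rule inj_onD[OF im(2)]) (use that in simp_all)
  have nz: "E i i \<noteq> (0, 0)" if "1 \<le> i" "i \<le> m" for i using Ev[OF that] verts_nz by blast
  have clp: "cl v \<in> pol (verts n)" using cl_pol[OF v] by simp
  have wnd: "nw \<omega> (upv u) + nw \<omega> (lef u) < nw \<omega> u + nw \<omega> (prv u) \<longleftrightarrow> 0 < \<mu> \<omega> u"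
    "nw \<omega> (upv u) + nw \<omega> (lef u) = nw \<omega> u + nw \<omega> (prv u) \<longleftrightarrow> 0 = \<mu> \<omega> u" if "u \<in> mut" for u \<omega>
    using nw_window[OF that, of \<omega>] by linarith+
  have b0: "band E m W (0, 0)" by (rule Eb) (use wnd[of _ \<omega>0] \<mu>_\<omega>0 ij in auto)
  interpret S: band E m W "(0, 0)" by (rule b0)
  have fS: "S.f = cl v" using Ef unfolding S.f_def S.mtx_def by auto
  have lS: "S.lead = (\<lambda>x. \<Prod>i\<in>{1..m}. x (E i i))" by (rule ext, rule S.lead_strict) (use nz in auto)
  have "S.lead (\<lambda>v. 1) \<noteq> 0" unfolding lS by simp
  hence lz: "S.lead \<noteq> (\<lambda>x. 0)" by auto
  have t0: "tW (cl v) = (\<lambda>x. \<Prod>i\<in>{1..m}. x (E i i))"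
    using S.f_top[OF finite_verts _ lz] clp unfolding fS lS by blast
  have d0: "dW (cl v) = (\<Sum>i\<in>{1..m}. W (E i i))"
    using S.f_deg[OF finite_verts _ lz] clp unfolding fS S.wt_def by simp
  have Sv: "Sch v = ?d ` {1..m}" using im(1) E1 by simp
  show "tW (cl v) = cm v" unfolding t0 by (rule ext) (simp only: cm_def Sv prod.reindex[OF im(2)] comp_def)
  show "dW (cl v) = DW v" unfolding d0 by (simp only: DW_def Sv sum.reindex[OF im(2)] comp_def)
  show "irred (verts n) (cl v)"
  proof (rule irred_by_tops[OF finite_verts clp _ im(2) _ m t0])
    show "0 < W u" if "u \<in> verts n" for u using nw[OF that] by simp
    show "E i i \<in> verts n" if "i \<in> {1..m}" for i using Ev that by simp
    show "\<exists>w p r. curves.deg (\<lambda>x v. monom (x v) (w v)) (cl v) = (\<Sum>i\<in>{1..m}. w (E i i)) \<and>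
      curves.top (\<lambda>x v. monom (x v) (w v)) (cl v) =
        (\<lambda>x. (\<Prod>i\<in>{1..m}-{s, s+1}. x (E i i)) * (x (E s s) * x (E (s + 1) (s + 1)) - x p * x r)) \<and>
      p \<in> verts n \<and> r \<in> verts n \<and> p \<notin> {E s s, E (s + 1) (s + 1)} \<and> r \<notin> {E s s, E (s + 1) (s + 1)}"
      if s: "1 \<le> s" "s < m" for s
    proof -
      define u0 where "u0 = E (s + 1) (s + 1)"
      have u0: "u0 \<in> mut" "prv u0 = E s s" "upv u0 = E s (s + 1)" "lef u0 = E (s + 1) s" using En[OF s] by (auto simp: u0_def)
      \<comment> \<open>Subtracting twice the fundamental solution lowers the excess at
        \<open>u0\<close> from 2 to 0 and keeps it at 2 elsewhere.\<close>
      define \<omega> where "\<omega> = (\<lambda>v. \<omega>0 v - 2 * fund u0 v)"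
      have mu: "\<mu> \<omega> u = 2 - 2 * of_bool (u = u0)" if "u \<in> mut" for u
      proof -
        have "\<mu> \<omega> u = \<mu> \<omega>0 u - 2 * \<mu> (fund u0) u" by (simp add: \<mu>_def \<omega>_def)
        thus ?thesis using \<mu>_\<omega>0[OF that] \<mu>_fund[OF u0(1) that] by simp
      qed
      have "band E m (nw \<omega>) u0"
      proof (rule Eb)
        fix u assume u: "u \<in> mut"
        show "nw \<omega> (upv u) + nw \<omega> (lef u) < nw \<omega> u + nw \<omega> (prv u) \<or>
          nw \<omega> (upv u) + nw \<omega> (lef u) = nw \<omega> u + nw \<omega> (prv u) \<and> u = u0"
          using wnd[OF u, of \<omega>] mu[OF u] by (cases "u = u0") auto
      qed (use ij in blast)
      then interpret T: band E m "nw \<omega>" u0 .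
      have fT: "T.f = cl v" using Ef unfolding T.f_def T.mtx_def by auto
      have pr: "E s (s + 1) \<in> verts n" "E (s + 1) s \<in> verts n" using nbrs_in_verts[OF u0(1)] u0 by auto
      have ne: "E s (s + 1) \<noteq> E s s" "E s (s + 1) \<noteq> u0" "E (s + 1) s \<noteq> E s s" "E (s + 1) s \<noteq> u0" "E s s \<noteq> u0"
        using nbrs_distinct(2,3,16,17,18)[OF u0(1)] unfolding u0(2-4) by metis+
      have eqw: "nw \<omega> (E s (s + 1)) + nw \<omega> (E (s + 1) s) = nw \<omega> (E s s) + nw \<omega> (E (s + 1) (s + 1))"
      proof -
        have "nw \<omega> (upv u0) + nw \<omega> (lef u0) = nw \<omega> u0 + nw \<omega> (prv u0)"
          using wnd(2)[OF u0(1), of \<omega>] mu[OF u0(1)] by simp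
        thus ?thesis unfolding u0(2-4) unfolding u0_def by (simp add: add.commute)
      qed
      have lT: "T.lead = (\<lambda>x. (\<Prod>i\<in>{1..m}-{s, s+1}. x (E i i)) * (x (E s s) * x (E (s + 1) (s + 1)) - x (E s (s + 1)) * x (E (s + 1) s)))"
        by (rule ext, rule T.lead_swap[OF s u0_def[symmetric] _ _ eqw]) (use pr verts_nz in auto)
      have "T.lead (\<lambda>v. if v = E s s then 0 else 1) = -1"
      proof -
        have "(\<Prod>i\<in>{1..m}-{s, s+1}. (if E i i = E s s then 0 else 1 :: complex)) = 1"
          by (rule prod.neutral) (use ij[of _ s "E s s"] s in auto)
        thus ?thesis unfolding lT using ne by simp
      qed
      hence lz: "T.lead \<noteq> (\<lambda>x. 0)" by auto
      have "curves.top (\<lambda>x v. monom (x v) (nw \<omega> v)) (cl v) = T.lead"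
        using T.f_top[OF finite_verts _ lz] clp unfolding fT by blast
      moreover have "curves.deg (\<lambda>x v. monom (x v) (nw \<omega> v)) (cl v) = (\<Sum>i\<in>{1..m}. nw \<omega> (E i i))"
        using T.f_deg[OF finite_verts _ lz] clp unfolding fT T.wt_def by simp
      ultimately show ?thesis unfolding lT using pr ne unfolding u0_def
        by (intro exI[of _ "nw \<omega>"] exI[of _ "E s (s + 1)"] exI[of _ "E (s + 1) s"]) auto
    qed
  qed
qed

interpretation CW: curves "verts n" "\<lambda>x v. monom (x v) (W v)" by (rule curves_weight[OF finite_verts])

lemma cl_prime: "v \<in> verts n \<Longrightarrow> pprime (verts n) (cl v)"
  by (rule irred_pprime[OF finite_verts cl_leading(1)])

lemma cl_nonzero: "v \<in> verts n \<Longrightarrow> cl v \<noteq> (\<lambda>x. 0)"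
  using cl_leading(1)[of v] by (auto simp: irred_def is_const_def)

lemma cl_pol': "v \<in> verts n \<Longrightarrow> cl v \<in> pol (verts n)"
  using cl_leading(1)[of v] by (auto simp: irred_def)

lemma cm_zero: "u \<in> Sch v \<Longrightarrow> cm v (\<lambda>w. if w = u then 0 else 1) = 0"
  unfolding cm_def by (rule prod_zero[OF finite_Sch]) auto
lemma cm_one: "u \<notin> Sch v \<Longrightarrow> cm v (\<lambda>w. if w = u then 0 else 1) = 1"
  unfolding cm_def by (rule prod.neutral) auto

text \<open>A divisor among irreducibles differs by a constant, so the leading monomials would be
  proportional. Each of the two chains would then contain the start of the other, and chains have no
  cycles.\<close>

lemma cl_not_dvd_cl:
  assumes v: "v \<in> verts n" "w \<in> verts n" "v \<noteq> w"
  shows "\<not> pdvd (verts n) (cl v) (cl w)"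
proof
  assume "pdvd (verts n) (cl v) (cl w)"
  then obtain C where C: "C \<in> pol (verts n)" "cl w = (\<lambda>x. cl v x * C x)" by (auto simp: pdvd_def)
  have "is_const C" using cl_leading(1)[OF v(2)] cl_leading(1)[OF v(1)] C unfolding irred_def by blast
  then obtain c where c: "C = (\<lambda>x. c)" by (auto simp: is_const_def)
  have C0: "C \<noteq> (\<lambda>x. 0)" using cl_nonzero[OF v(2)] C(2) by auto
  have "tW (cl w) = (\<lambda>x. tW (cl v) x * tW C x)"
    unfolding C(2) by (rule CW.deg_top_mult(2)[OF cl_pol'[OF v(1)] cl_nonzero[OF v(1)] C(1) C0])
  moreover have "tW C = (\<lambda>x. if CW.deg C = 0 then c else 0)" unfolding CW.top_def c CW.comp_const ..
  ultimately have "cm w = (\<lambda>x. cm v x * (if CW.deg C = 0 then c else 0))"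
    unfolding cl_leading(2)[OF v(1)] cl_leading(2)[OF v(2)] by simp
  then obtain c' where c': "\<And>x. cm w x = cm v x * c'" by meson
  have "cm w (\<lambda>u. 1) = 1" by (simp add: cm_def)
  hence c'0: "c' \<noteq> 0" using c'[of "\<lambda>u. 1"] by auto
  have "v \<in> Sch w" using c'[of "\<lambda>u. if u = v then 0 else 1"] cm_zero[OF Sch_self[OF v(1)]] cm_one[of v w] by fastforce
  moreover have "w \<in> Sch v" using c'[of "\<lambda>u. if u = w then 0 else 1"] cm_zero[OF Sch_self[OF v(2)]] cm_one[of w v] c'0 by fastforce
  ultimately show False using Sch_asym v by blast
qed

text \<open>The kind of chain a vertex lies on: 0 for \<open>phi\<close>, 1 for \<open>psi\<close>,
  2 for \<open>theta\<close>.\<close>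

definition ck :: "nat \<times> nat \<Rightarrow> nat \<Rightarrow> bool" where
  "ck v k \<longleftrightarrow> k = 2 \<and> fst v = snd v \<or> k \<le> 1 \<and> (\<exists>m. rng k m \<and> v = vtx k m)"

lemma ck_unique: "ck v k \<Longrightarrow> ck v k' \<Longrightarrow> k = k'"
  using vtx_inj vtx_offdiag unfolding ck_def by metis

lemma ck_nxt: "v \<in> verts n \<Longrightarrow> ck v k \<Longrightarrow> nxt v \<noteq> (0, 0) \<Longrightarrow> ck (nxt v) k"
proof -
  assume v: "v \<in> verts n" "ck v k" "nxt v \<noteq> (0, 0)"
  from v(2) consider "k = 2" "fst v = snd v" | m where "k \<le> 1" "rng k m" "v = vtx k m" by (auto simp: ck_def)
  thus ?thesis
  proof cases
    case 1
    thus ?thesis using v(3) by (cases v) (auto simp: ck_def nxt_def split: if_splits)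
  next
    case 2
    hence "m \<noteq> 1" using v(3) nxt_vtx[OF 2(2)] by auto
    hence "nxt v = vtx k (m - 1)" "rng k (m - 1)" using nxt_vtx[OF 2(2)] 2 by (auto simp: rng_def)
    thus ?thesis using 2(1) by (auto simp: ck_def)
  qed
qed

lemma ck_Sch: "w \<in> verts n \<Longrightarrow> ck w k \<Longrightarrow> u \<in> Sch w \<Longrightarrow> ck u k"
proof -
  assume w: "w \<in> verts n" "ck w k" and u: "u \<in> Sch w"
  have "(nxt ^^ j) w = (0, 0) \<or> (nxt ^^ j) w \<in> verts n \<and> ck ((nxt ^^ j) w) k" for j
  proof (induction j)
    case (Suc j)
    thus ?case using nxt_in_verts[of "(nxt ^^ j) w"] ck_nxt[of "(nxt ^^ j) w" k] nxt_funpow_0[of 1] by auto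
  qed (use w in simp)
  thus ?thesis using u verts_nz unfolding Sch_def by blast
qed

text \<open>The neighbours above and to the left lie on chains of other kinds, so the chains
  starting there never pass through \<open>v\<close>.\<close>

lemma ck_nbrs:
  assumes v: "v \<in> mut"
  obtains k k1 k2 where "ck v k" "ck (upv v) k1" "ck (lef v) k2" "k \<noteq> k1" "k \<noteq> k2"
  using v
proof (cases rule: mut_chain)
  case (1 i)
  note d = diag_nbrs[OF 1(1,2)]
  show ?thesis
  proof (rule that[of 2 0 ec])
    show "ck v 2" using 1 by (simp add: ck_def)
    show "ck (upv v) 0" using d(3) 1(3) vtx_superdiag(1)[OF 1(1,2)] by (auto simp: ck_def)
    show "ck (lef v) ec" using d(4) 1(3) vtx_mc(1)[OF 1(1,2)] by (auto simp: ck_def ec_def)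
    show "(2::nat) \<noteq> ec" by (simp add: ec_def)
  qed simp
next
  case (2 e m)
  have ck: "ck v e" using 2 by (auto simp: ck_def rng_def)
  have "e = 0 \<or> e = 1" using 2(1) by (auto simp: rng_def)
  thus ?thesis
  proof
    assume e: "e = 0"
    note r = 2(1,2)[unfolded e]
    have "ck (upv v) 1 \<or> ck (upv v) 2" using upv_vtx_0[OF r] 2(3) e by (auto simp: ck_def)
    moreover have "ck (lef v) 1 \<or> ck (lef v) 2" using lef_vtx_0[OF r] 2(3) e by (auto simp: ck_def)
    ultimately show ?thesis using that ck e by (metis zero_neq_one zero_neq_numeral)
  next
    assume e: "e = 1"
    note r = 2(1,2)[unfolded e]
    have "ck (upv v) 0 \<or> ck (upv v) 2" using upv_vtx_1[OF r] 2(3) e by (auto simp: ck_def)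
    moreover have "rng 0 m" using r M_le_N by (auto simp: rng_def)
    hence "ck (lef v) 0" using lef_vtx_1[OF r] 2(3) e by (auto simp: ck_def)
    ultimately show ?thesis using that ck e by (metis zero_neq_one one_eq_numeral_iff semiring_norm(85))
  qed
qed

lemma cx_leading:
  assumes "w = (0, 0) \<or> w \<in> verts n"
  shows "cx w \<in> pol (verts n)" "cx w \<noteq> (\<lambda>x. 0)" "tW (cx w) = cm w" "dW (cx w) = DW w"
proof -
  have "cx w \<in> pol (verts n) \<and> cx w \<noteq> (\<lambda>x. 0) \<and> tW (cx w) = cm w \<and> dW (cx w) = DW w"
  proof (cases "w = (0, 0)")
    case True
    have e: "cx w = (\<lambda>x. 1)" using True by (auto simp: cx_def)
    have d: "CW.deg (\<lambda>x. 1) = 0" by (rule deg_const[OF CW.curves_axioms]) (auto simp: is_const_def)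
    have "CW.top (\<lambda>x. 1) = (\<lambda>x. 1)" unfolding CW.top_def d CW.comp_const by simp
    thus ?thesis unfolding e using d True by (auto simp: cm_def DW_def Sch_0 pol_const fun_eq_iff)
  next
    case False
    hence w: "w \<in> verts n" using assms by simp
    have e: "cx w = cl w" by (rule ext) (simp add: cx_def False)
    show ?thesis unfolding e by (intro conjI cl_pol'[OF w] cl_nonzero[OF w] cl_leading(2,3)[OF w])
  qed
  thus "cx w \<in> pol (verts n)" "cx w \<noteq> (\<lambda>x. 0)" "tW (cx w) = cm w" "dW (cx w) = DW w" by auto
qed

lemma cx_prod3:
  assumes "a = (0, 0) \<or> a \<in> verts n" "b = (0, 0) \<or> b \<in> verts n" "c = (0, 0) \<or> c \<in> verts n"
  defines "M \<equiv> \<lambda>x. cx a x * cx b x * cx c x"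
  shows "M \<in> pol (verts n)" "M \<noteq> (\<lambda>x. 0)" "dW M = DW a + DW b + DW c" "tW M = (\<lambda>x. cm a x * cm b x * cm c x)"
proof -
  note A = cx_leading[OF assms(1)] and B = cx_leading[OF assms(2)] and C = cx_leading[OF assms(3)]
  have ab: "(\<lambda>x. cx a x * cx b x) \<in> pol (verts n)" by (rule pol_mult[OF A(1) B(1)])
  have ab0: "(\<lambda>x. cx a x * cx b x) \<noteq> (\<lambda>x. 0)"
    using pol_mult_eq_0[OF A(1) B(1)] A(2) B(2) by meson
  show "M \<in> pol (verts n)" unfolding M_def by (rule pol_mult[OF ab C(1)])
  show "M \<noteq> (\<lambda>x. 0)" unfolding M_def using pol_mult_eq_0[OF ab C(1)] ab0 C(2) by meson
  show "dW M = DW a + DW b + DW c" "tW M = (\<lambda>x. cm a x * cm b x * cm c x)"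
    unfolding M_def CW.deg_top_mult[OF ab ab0 C(1,2)] CW.deg_top_mult[OF A(1,2) B(1,2)] A(3,4) B(3,4) C(3,4) by simp_all
qed

text \<open>Otherwise the square of \<open>cl v\<close> divides the exchange numerator, whose
  leading form is that of the monomial with \<open>prv v\<close>, because the weights of the two
  monomials differ by the excess at \<open>v\<close>. This leading form is \<open>cm v\<close> times
  the variable at \<open>prv v\<close> and two chains of other kinds; the second copy of
  \<open>cm v\<close> would need the variable at \<open>v\<close> to divide the remaining
  product.\<close>

lemma cl_not_dvd_exchange:
  assumes v: "v \<in> mut" and q: "q \<in> pol (verts n)"
    and eq: "\<And>x. cl v x * q x = cx (nxt v) x * cx (upv v) x * cx (lef v) x + cx (prv v) x * cx (nxt (upv v)) x * cx (nxt (lef v)) x"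
  shows "\<not> pdvd (verts n) (cl v) q"
proof
  assume "pdvd (verts n) (cl v) q"
  then obtain C where C: "C \<in> pol (verts n)" "q = (\<lambda>x. cl v x * C x)" by (auto simp: pdvd_def)
  have vv: "v \<in> verts n" using v by (simp add: mut_def)
  have nv: "prv v \<in> verts n" "upv v \<in> verts n" "lef v \<in> verts n" using nbrs_in_verts[OF v] by auto
  define Mo where "Mo = (\<lambda>x. cx (nxt v) x * cx (upv v) x * cx (lef v) x)"
  define Mi where "Mi = (\<lambda>x. cx (prv v) x * cx (nxt (upv v)) x * cx (nxt (lef v)) x)"
  note o = cx_prod3[OF nxt_in_verts[OF vv] disjI2[OF nv(2)] disjI2[OF nv(3)], folded Mo_def]
  note i = cx_prod3[OF disjI2[OF nv(1)] nxt_in_verts[OF nv(2)] nxt_in_verts[OF nv(3)], folded Mi_def]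
  have "int (W v) + int (W (prv v)) - int (W (upv v)) - int (W (lef v)) = 2"
    using nw_window[OF v, of \<omega>0] \<mu>_\<omega>0[OF v] by simp
  hence lt: "dW Mo < dW Mi"
    unfolding o(3) i(3) using DW_step[OF nv(1)] DW_step[OF nv(2)] DW_step[OF nv(3)] DW_step[OF vv] nxt_prv[OF v] by simp
  have s: "(\<lambda>x. Mo x + Mi x) = (\<lambda>x. cl v x * (cl v x * C x))"
    using eq unfolding C(2) Mo_def Mi_def by auto
  note top = CW.deg_top_add(1)[OF o(1) i(1,2) lt, unfolded s i(4)]
  have C0: "C \<noteq> (\<lambda>x. 0)"
  proof
    assume "C = (\<lambda>x. 0)"
    hence "(\<lambda>x. Mo x + Mi x) = (\<lambda>x. 0)" unfolding s by simp
    hence "CW.top (\<lambda>x. 0) = CW.top Mi" using CW.deg_top_add(1)[OF o(1) i(1,2) lt] by simp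
    thus False using CW.top_nonzero[OF i(1,2)] unfolding CW.top_def by (simp add: CW.comp_const)
  qed
  have p: "(\<lambda>x. cl v x * C x) \<in> pol (verts n)" by (rule pol_mult[OF cl_pol'[OF vv] C(1)])
  have p0: "(\<lambda>x. cl v x * C x) \<noteq> (\<lambda>x. 0)" using pol_mult_eq_0[OF cl_pol'[OF vv] C(1)] cl_nonzero[OF vv] C0 by meson
  have "tW (\<lambda>x. cl v x * (cl v x * C x)) = (\<lambda>x. cm v x * (cm v x * tW C x))"
    unfolding CW.deg_top_mult(2)[OF cl_pol'[OF vv] cl_nonzero[OF vv] p p0]
      CW.deg_top_mult(2)[OF cl_pol'[OF vv] cl_nonzero[OF vv] C(1) C0] cl_leading(2)[OF vv] ..
  hence "(\<lambda>x. cm v x * (cm v x * tW C x)) = (\<lambda>x. cm (prv v) x * cm (nxt (upv v)) x * cm (nxt (lef v)) x)"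
    using top by simp
  hence e: "cm v x * (cm v x * tW C x) = cm v x * (x (prv v) * cm (nxt (upv v)) x * cm (nxt (lef v)) x)" for x
    using cm_step[OF nv(1), of x] nxt_prv[OF v] by (simp add: fun_eq_iff algebra_simps)
  have cmp: "cm w \<in> pol (verts n)" for w
  proof -
    have "(\<lambda>x. \<Prod>u\<in>Sch w. x u) \<in> pol (verts n)" by (rule pol_prod, rule pol_var) (simp add: Sch_def)
    moreover have "cm w = (\<lambda>x. \<Prod>u\<in>Sch w. x u)" by (rule ext) (simp add: cm_def)
    ultimately show ?thesis by simp
  qed
  have cm0: "cm v \<noteq> (\<lambda>x. 0)"
  proof
    assume "cm v = (\<lambda>x. 0)"
    hence "cm v (\<lambda>u. 1) = 0" by simp
    thus False by (simp add: cm_def)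
  qed
  have "(\<lambda>x. cm v x * tW C x) = (\<lambda>x. x (prv v) * cm (nxt (upv v)) x * cm (nxt (lef v)) x)"
    by (rule pol_cancel[OF cmp cm0 _ _ e]) (rule pol_mult cmp CW.top_pol C pol_var nv)+
  hence "cm v x * tW C x = x (prv v) * cm (nxt (upv v)) x * cm (nxt (lef v)) x" for x by meson
  from this[of "\<lambda>u. if u = v then 0 else 1"] cm_zero[OF Sch_self[OF vv]]
  have z: "(if prv v = v then 0 else 1) * cm (nxt (upv v)) (\<lambda>u. if u = v then 0 else 1) * cm (nxt (lef v)) (\<lambda>u. if u = v then 0 else 1) = (0::complex)"
    by simp
  obtain k k1 k2 where k: "ck v k" "ck (upv v) k1" "ck (lef v) k2" "k \<noteq> k1" "k \<noteq> k2" by (rule ck_nbrs[OF v])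
  have "v \<notin> Sch (nxt (upv v))" using ck_Sch[OF nv(2) k(2)] ck_unique k Sch_step(1)[OF nv(2)] by blast
  moreover have "v \<notin> Sch (nxt (lef v))" using ck_Sch[OF nv(3) k(3)] ck_unique k Sch_step(1)[OF nv(3)] by blast
  ultimately show False using z cm_one nbrs_distinct(18)[OF v] by simp
qed

end

section \<open>Cancellation of prime powers and evaluation at positive points\<close>

lemma pdvd_power_cancel:
  assumes p: "pprime V p" "p \<in> pol V" "p \<noteq> (\<lambda>x. 0)" and B: "B \<in> pol V" "\<not> pdvd V p B"
  shows "A \<in> pol V \<Longrightarrow> pdvd V (\<lambda>x. p x ^ N) (\<lambda>x. A x * B x) \<Longrightarrow> pdvd V (\<lambda>x. p x ^ N) A"
proof (induction N arbitrary: A)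
  case 0 thus ?case by (intro pdvdI[of A]) auto
next
  case (Suc N)
  then obtain C where C: "C \<in> pol V" "(\<lambda>x. A x * B x) = (\<lambda>x. p x ^ Suc N * C x)" unfolding pdvd_def by blast
  have pN: "(\<lambda>x. p x ^ N) \<in> pol V" by (rule pol_power[OF p(2)])
  have e: "A x * B x = p x * (p x ^ N * C x)" for x using fun_cong[OF C(2), of x] by simp
  have "pdvd V p (\<lambda>x. A x * B x)" by (rule pdvdI[OF pol_mult[OF pN C(1)] e])
  hence "pdvd V p A" using pprimeD[OF p(1) Suc.prems(1) B(1)] B(2) by blast
  then obtain A' where A': "A' \<in> pol V" "A = (\<lambda>x. p x * A' x)" unfolding pdvd_def by blast
  have "(\<lambda>x. A' x * B x) = (\<lambda>x. p x ^ N * C x)"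
  proof (rule pol_cancel[OF p(2,3) pol_mult[OF A'(1) B(1)] pol_mult[OF pN C(1)]])
    show "p x * (A' x * B x) = p x * (p x ^ N * C x)" for x using e[of x] unfolding A'(2) by (simp add: mult.assoc)
  qed
  hence "pdvd V (\<lambda>x. p x ^ N) (\<lambda>x. A' x * B x)" using C(1) unfolding pdvd_def by blast
  from Suc.IH[OF A'(1) this] obtain D where D: "D \<in> pol V" "A' = (\<lambda>x. p x ^ N * D x)" unfolding pdvd_def by blast
  show ?case by (rule pdvdI[OF D(1)]) (simp add: A'(2) D(2))
qed

lemma cv_local:
  "(\<And>w. w \<in> V \<Longrightarrow> y w = y' w) \<Longrightarrow> set ks \<subseteq> V \<Longrightarrow> v \<in> V \<Longrightarrow> cv V B ks y v = cv V B ks y' v"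
proof (induction ks arbitrary: B y y')
  case (Cons k ks)
  have e: "exch V k B y = exch V k B y'" by (rule exch_cong) (use Cons.prems in auto)
  have "mutv V k B y w = mutv V k B y' w" if "w \<in> V" for w
    using Cons.prems that e by (simp add: mutv_def)
  from Cons.IH[OF this] Cons.prems show ?case by simp
qed simp

lemma exch_of_real: "exch V k B (\<lambda>w. of_real (y w)) = (of_real (exch V k B y) :: complex)"
  unfolding exch_def of_real_add of_real_prod by (intro arg_cong2[of _ _ _ _ "(+)"] prod.cong) auto

lemma cv_of_real: "cv V B ks (\<lambda>w. of_real (y w)) v = (of_real (cv V B ks y v) :: complex)"
proof (induction ks arbitrary: B y)
  case (Cons k ks)
  have "mutv V k B (\<lambda>w. of_real (y w)) = (\<lambda>w. of_real (mutv V k B y w) :: complex)"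
    by (rule ext) (simp add: mutv_def exch_of_real)
  thus ?case by (simp add: Cons.IH)
qed simp

text \<open>A vertex that is never mutated and carries the value 1 may be deleted. This links the
  seeds on \<open>SL n\<close> with those on \<open>Mat n\<close>.\<close>

lemma cv_restrict:
  assumes V: "finite V"
  shows "y f = 1 \<Longrightarrow> f \<notin> set ks \<Longrightarrow> cv (V - {f}) B ks y v = cv V B ks y v"
proof (induction ks arbitrary: B y)
  case (Cons k ks)
  have "(\<Prod>w\<in>V - {f}. if P w then y w ^ e w else 1) = (\<Prod>w\<in>V. if P w then y w ^ e w else 1)" for P e
    by (rule prod.mono_neutral_left[OF V]) (use Cons.prems in auto)
  hence "exch (V - {f}) k B y = exch V k B y" unfolding exch_def by simp
  hence e: "mutv (V - {f}) k B y = mutv V k B y" by (simp add: mutv_def)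
  have "mutv V k B y f = 1" using Cons.prems by (simp add: mutv_def)
  from Cons.IH[where y = "mutv V k B y", OF this] show ?case using Cons.prems e by simp
qed simp

definition pr :: "complex \<Rightarrow> bool" where "pr z \<longleftrightarrow> (\<exists>r>0. z = of_real r)"

lemma pr_1: "pr 1" unfolding pr_def by (rule exI[of _ 1]) simp
lemma pr_add: "pr a \<Longrightarrow> pr b \<Longrightarrow> pr (a + b)" unfolding pr_def by (metis add_pos_pos of_real_add)
lemma pr_mult: "pr a \<Longrightarrow> pr b \<Longrightarrow> pr (a * b)" unfolding pr_def by (metis mult_pos_pos of_real_mult)
lemma pr_divide: "pr a \<Longrightarrow> pr b \<Longrightarrow> pr (a / b)" unfolding pr_def by (metis divide_pos_pos of_real_divide)
lemma pr_power: "pr a \<Longrightarrow> pr (a ^ k)" unfolding pr_def by (metis zero_less_power of_real_power)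
lemma pr_prod: "(\<And>i. i \<in> I \<Longrightarrow> pr (f i)) \<Longrightarrow> pr (\<Prod>i\<in>I. f i)"
  by (induction I rule: infinite_finite_induct) (simp_all add: pr_1 pr_mult)
lemma pr_nz: "pr a \<Longrightarrow> a \<noteq> 0" by (auto simp: pr_def)
lemma pr_Re: "pr a \<Longrightarrow> of_real (Re a) = a \<and> 0 < Re a" by (auto simp: pr_def)

lemma exch_pr: "(\<And>w. w \<in> V \<Longrightarrow> pr (y w)) \<Longrightarrow> pr (exch V k B y)"
  unfolding exch_def by (intro pr_add pr_prod) (simp_all add: pr_1 pr_power)

lemma Re_poly_eventually_pos:
  fixes p :: "complex poly"
  assumes d: "degree p \<le> d" and c: "0 < Re (coeff p d)"
  shows "\<forall>\<^sub>F t in at_top. 0 < Re (poly p (of_real t))"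
proof -
  define q where "q = map_poly Re p"
  have cq: "coeff q i = Re (coeff p i)" for i by (simp add: q_def coeff_map_poly)
  have dq: "degree q = d"
  proof (rule antisym)
    show "degree q \<le> d" by (rule degree_le) (use d in \<open>auto simp: cq coeff_eq_0\<close>)
    show "d \<le> degree q" by (rule le_degree) (use c cq in auto)
  qed
  have e: "Re (poly p (of_real t)) = poly q t" for t
  proof -
    have "poly p (of_real t) = (\<Sum>i\<le>d. coeff p i * of_real t ^ i)"
      unfolding poly_altdef using d by (intro sum.mono_neutral_left) (auto simp: coeff_eq_0)
    hence "Re (poly p (of_real t)) = (\<Sum>i\<le>d. Re (coeff p i) * t ^ i)"
      by (simp flip: of_real_power)
    thus ?thesis unfolding poly_altdef dq cq .
  qed
  have lc: "lead_coeff q > 0" using c by (simp add: dq cq)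
  then obtain b where "\<forall>t\<ge>b. poly q t \<ge> lead_coeff q" using poly_pinfty_gt_lc by blast
  hence "\<forall>t\<ge>b. 0 < Re (poly p (of_real t))" unfolding e using lc by force
  thus ?thesis unfolding eventually_at_top_linorder by blast
qed

context cg
begin

subsection \<open>Positive points\<close>

definition PP :: "(nat \<times> nat \<Rightarrow> complex) set" where "PP = {x. \<forall>v\<in>verts n. pr (cl v x)}"

lemma PP_D: "x \<in> PP \<Longrightarrow> v \<in> verts n \<Longrightarrow> pr (cl v x)" by (simp add: PP_def)

lemma detm_scale: "detm m (\<lambda>i j. s * A i j) = s ^ m * detm m A"
  unfolding detm_def by (simp add: prod.distrib sum_distrib_left mult.left_commute)

lemma cl_homogeneous:
  assumes "v \<in> verts n"
  obtains m where "1 \<le> m" "\<And>s x. cl v (\<lambda>u. s * x u) = s ^ m * cl v x"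
proof -
  obtain E m where m: "1 \<le> m" and Ef: "\<And>x. cl v x = detm m (\<lambda>i j. if E i j = (0, 0) then 0 else x (E i j))"
    by (rule cl_band[OF assms]) blast
  have "cl v (\<lambda>u. s * x u) = s ^ m * cl v x" for s x
  proof -
    have "(\<lambda>i j. if E i j = (0, 0) then 0 else s * x (E i j)) = (\<lambda>i j. s * (if E i j = (0, 0) then 0 else x (E i j)))"
      by (intro ext) simp
    thus ?thesis unfolding Ef by (simp only: detm_scale)
  qed
  thus ?thesis using that m by blast
qed

lemma cl_real:
  assumes "v \<in> verts n" "\<And>u. x u \<in> \<real>"
  shows "cl v x \<in> \<real>"
proof -
  obtain E m where Ef: "\<And>x. cl v x = detm m (\<lambda>i j. if E i j = (0, 0) then 0 else x (E i j))"
    by (rule cl_band[OF assms(1)]) blast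
  show ?thesis unfolding Ef detm_def
    by (intro sum_in_Reals Reals_mult prod_in_Reals) (simp_all add: assms(2))
qed

text \<open>Along \<open>t \<mapsto> (y v * t ^ W v)\<close> with \<open>y > 0\<close> every initial variable has a positive leading coefficient.\<close>
lemma PP_dense:
  assumes H: "H \<in> pol (verts n)" "H \<noteq> (\<lambda>x. 0)"
  shows "\<exists>x\<in>PP. H x \<noteq> 0"
proof -
  interpret CW: curves "verts n" "\<lambda>x v. monom (x v) (W v)" by (rule curves_weight[OF finite_verts])
  have T: "tW H \<in> pol (verts n)" "tW H \<noteq> (\<lambda>x. 0)" using CW.top_pol[OF H(1)] CW.top_nonzero[OF H] by auto
  have inf: "infinite (complex_of_real ` {0<..})"
  proof
    assume "finite (complex_of_real ` {0<..})"
    hence "finite {0::real<..}" by (rule finite_imageD) (auto simp: inj_on_def)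
    thus False using infinite_Ioi by blast
  qed
  \<comment> \<open>A nonzero polynomial cannot vanish on a product of infinite sets; hence the
    curve can start at a positive point where the leading form of \<open>H\<close> is
    nonzero.\<close>
  obtain z where z: "\<And>v. v \<in> verts n \<Longrightarrow> z v \<in> complex_of_real ` {0<..}" "tW H z \<noteq> 0"
  proof (rule ccontr)
    assume a: "\<not> thesis"
    have "tW H x = 0" for x
    proof (rule pol_zero_on_box[OF finite_verts T(1) inf])
      show "tW H x = 0" if "\<And>v. v \<in> verts n \<Longrightarrow> x v \<in> complex_of_real ` {0<..}" for x
        using a that \<open>\<And>z. (\<And>v. v \<in> verts n \<Longrightarrow> z v \<in> complex_of_real ` {0<..}) \<Longrightarrow> tW H z \<noteq> 0 \<Longrightarrow> thesis\<close> by blast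
    qed
    thus False using T(2) by auto
  qed
  define y where "y = (\<lambda>v. if v \<in> verts n then z v else 1)"
  have y: "pr (y v)" for v using z(1)[of v] pr_1 by (auto simp: y_def pr_def)
  have "tW H y = tW H z" by (rule pol_local[OF T(1)]) (simp add: y_def)
  hence Hy: "tW H y \<noteq> 0" using z(2) by simp
  define X where "X = (\<lambda>t v. poly (monom (y v) (W v)) (complex_of_real t))"
  have Xr: "X t u \<in> \<real>" for t u
    using pr_Re[OF y[of u]] unfolding X_def poly_monom by (metis Reals_mult Reals_of_real Reals_power)
  have ev: "\<forall>\<^sub>F t in at_top. 0 < Re (cl v (X t))" if v: "v \<in> verts n" for v
  proof -
    let ?p = "along (\<lambda>u. monom (y u) (W u)) (cl v)"
    have "degree ?p \<le> DW v" using CW.degree_le_deg[OF cl_pol'[OF v], of y] cl_leading(3)[OF v] by simp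
    moreover have "coeff ?p (DW v) = cm v y"
      using fun_cong[OF cl_leading(2)[OF v], of y] cl_leading(3)[OF v] unfolding CW.top_def CW.comp_def by simp
    moreover have "pr (cm v y)" unfolding cm_def by (rule pr_prod) (rule y)
    ultimately have "\<forall>\<^sub>F t in at_top. 0 < Re (poly ?p (of_real t))"
      using pr_Re[of "cm v y"] by (intro Re_poly_eventually_pos[of _ "DW v"]) auto
    thus ?thesis unfolding poly_along[OF cl_pol'[OF v]] X_def .
  qed
  hence ev1: "\<forall>\<^sub>F t in at_top. \<forall>v\<in>verts n. 0 < Re (cl v (X t))"
    by (intro eventually_ball_finite finite_verts ballI) auto
  have ev2: "\<forall>\<^sub>F t in at_top. H (X t) \<noteq> 0"
  proof -
    let ?p = "along (\<lambda>u. monom (y u) (W u)) H"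
    have "coeff ?p (dW H) \<noteq> 0" using Hy unfolding CW.top_def CW.comp_def .
    hence "?p \<noteq> 0" by auto
    hence "finite {c. poly ?p c = 0}" by (rule poly_roots_finite)
    hence f: "finite (Re ` {c. poly ?p c = 0})" by (rule finite_imageI)
    have "\<forall>\<^sub>F t in at_top. Max (insert 0 (Re ` {c. poly ?p c = 0})) < t" by (rule eventually_gt_at_top)
    thus ?thesis
    proof (rule eventually_mono)
      fix t assume t: "Max (insert 0 (Re ` {c. poly ?p c = 0})) < t"
      show "H (X t) \<noteq> 0"
      proof
        assume "H (X t) = 0"
        hence "poly ?p (of_real t) = 0" unfolding poly_along[OF H(1)] X_def .
        hence "t \<in> Re ` {c. poly ?p c = 0}" by (intro image_eqI[of _ _ "of_real t"]) auto
        hence "t \<le> Max (insert 0 (Re ` {c. poly ?p c = 0}))" using f by (intro Max_ge) auto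
        thus False using t by simp
      qed
    qed
  qed
  obtain t where t: "\<And>v. v \<in> verts n \<Longrightarrow> 0 < Re (cl v (X t))" "H (X t) \<noteq> 0"
    using eventually_happens'[OF _ eventually_conj[OF ev1 ev2]] by (auto simp: trivial_limit_at_top_linorder)
  have "X t \<in> PP" unfolding PP_def
  proof (intro CollectI ballI)
    fix v assume v: "v \<in> verts n"
    obtain r where r: "cl v (X t) = of_real r" using cl_real[OF v, of "X t", OF Xr] by (auto elim: Reals_cases)
    thus "pr (cl v (X t))" using t(1)[OF v] by (auto simp: pr_def)
  qed
  thus ?thesis using t(2) by blast
qed

lemma PP_eqI:
  assumes "f \<in> pol (verts n)" "g \<in> pol (verts n)" "\<And>x. x \<in> PP \<Longrightarrow> f x = g x"
  shows "f = g"
proof (rule ccontr)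
  assume ne: "f \<noteq> g"
  have "(\<lambda>x. f x - g x) \<noteq> (\<lambda>x. 0)"
  proof
    assume "(\<lambda>x. f x - g x) = (\<lambda>x. 0)"
    hence "f x = g x" for x using fun_cong[of "\<lambda>x. f x - g x" "\<lambda>x. 0" x] by simp
    thus False using ne by blast
  qed
  then obtain x where "x \<in> PP" "f x - g x \<noteq> 0" using PP_dense[OF pol_diff[OF assms(1,2)]] by blast
  thus False using assms(3) by simp
qed

text \<open>The value 1 outside the vertices makes \<open>pos\<close>, which speaks about all
  indices, available.\<close>

definition yv :: "(nat \<times> nat \<Rightarrow> complex) \<Rightarrow> nat \<times> nat \<Rightarrow> real" where
  "yv x w = (if w \<in> verts n then Re (cl w x) else 1)"

lemma yv: "x \<in> PP \<Longrightarrow> pos (yv x)" "x \<in> PP \<Longrightarrow> w \<in> verts n \<Longrightarrow> of_real (yv x w) = cl w x"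
  using PP_D pr_Re by (auto simp: pos_def yv_def)

subsection \<open>Laurent expansions in an initial or adjacent cluster\<close>

text \<open>Carries a Laurent expansion from the positive orthant to matrices. \<open>Z\<close>
  consists of polynomials with the cluster \<open>y\<close> as values; it is the initial cluster in
  one use and an adjacent one in the other.\<close>

lemma clear_denominators:
  assumes Z: "\<And>w. w \<in> verts n \<Longrightarrow> Z w \<in> pol (verts n)"
    and y: "\<And>x. x \<in> PP \<Longrightarrow> pos (y x)" "\<And>x w. x \<in> PP \<Longrightarrow> w \<in> verts n \<Longrightarrow> of_real (y x w) = Z w x"
  shows "F \<in> lau (verts n) mut \<Longrightarrow>
    \<exists>N. \<exists>P\<in>pol (verts n). \<forall>x\<in>PP. of_real (F (y x)) * (\<Prod>w\<in>mut. Z w x) ^ N = P x"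
proof (induction rule: lau.induct)
  case (lau_const c)
  show ?case by (rule exI[of _ 0], rule bexI[OF _ pol_const[of "of_real c"]]) simp
next
  case (lau_var v)
  show ?case by (rule exI[of _ 0], rule bexI[OF _ Z[OF lau_var]]) (simp add: y(2) lau_var)
next
  case (lau_inv v)
  have mv: "mut \<subseteq> verts n" by (auto simp: mut_def)
  have P: "(\<lambda>x. \<Prod>w\<in>mut - {v}. Z w x) \<in> pol (verts n)" by (rule pol_prod, rule Z) (use mv in auto)
  show ?case
  proof (rule exI[of _ 1], rule bexI[OF _ P], rule ballI)
    fix x assume x: "x \<in> PP"
    have "y x v \<noteq> 0" using y(1)[OF x] by (metis pos_def less_irrefl)
    moreover have "of_real (y x v) = Z v x" using y(2)[OF x] lau_inv mv by blast
    ultimately have "of_real (inverse (y x v)) * Z v x = 1"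
      by (metis of_real_1 of_real_mult left_inverse)
    thus "of_real (inverse (y x v)) * (\<Prod>w\<in>mut. Z w x) ^ 1 = (\<Prod>w\<in>mut - {v}. Z w x)"
      unfolding prod.remove[OF finite_mut lau_inv] power_one_right mult.assoc[symmetric] by simp
  qed
next
  case (lau_add f g)
  then obtain N P N' P' where P: "P \<in> pol (verts n)" "\<And>x. x \<in> PP \<Longrightarrow> of_real (f (y x)) * (\<Prod>w\<in>mut. Z w x) ^ N = P x"
    and P': "P' \<in> pol (verts n)" "\<And>x. x \<in> PP \<Longrightarrow> of_real (g (y x)) * (\<Prod>w\<in>mut. Z w x) ^ N' = P' x" by blast
  define D where "D = (\<lambda>x. \<Prod>w\<in>mut. Z w x)"
  have D: "D \<in> pol (verts n)" unfolding D_def by (rule pol_prod, rule Z) (auto simp: mut_def)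
  have "(\<lambda>x. P x * D x ^ N' + P' x * D x ^ N) \<in> pol (verts n)"
    by (rule pol_add[OF pol_mult[OF P(1) pol_power[OF D]] pol_mult[OF P'(1) pol_power[OF D]]])
  thus ?case
  proof (intro exI[of _ "N + N'"], rule bexI[rotated], intro ballI)
    fix x assume x: "x \<in> PP"
    show "of_real (f (y x) + g (y x)) * (\<Prod>w\<in>mut. Z w x) ^ (N + N') = P x * D x ^ N' + P' x * D x ^ N"
      unfolding P(2)[OF x, symmetric] P'(2)[OF x, symmetric] D_def[symmetric] by (simp add: algebra_simps power_add D_def)
  qed
next
  case (lau_mult f g)
  then obtain N P N' P' where P: "P \<in> pol (verts n)" "\<And>x. x \<in> PP \<Longrightarrow> of_real (f (y x)) * (\<Prod>w\<in>mut. Z w x) ^ N = P x"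
    and P': "P' \<in> pol (verts n)" "\<And>x. x \<in> PP \<Longrightarrow> of_real (g (y x)) * (\<Prod>w\<in>mut. Z w x) ^ N' = P' x" by blast
  show ?case
  proof (rule exI[of _ "N + N'"], rule bexI[OF _ pol_mult[OF P(1) P'(1)]], rule ballI)
    fix x assume x: "x \<in> PP"
    show "of_real (f (y x) * g (y x)) * (\<Prod>w\<in>mut. Z w x) ^ (N + N') = P x * P' x"
      unfolding P(2)[OF x, symmetric] P'(2)[OF x, symmetric] by (simp add: algebra_simps power_add)
  qed
next
  case (lau_cong f g)
  thus ?case using y(1) by (simp cong: ball_cong_simp)
qed

lemma exch_yv:
  assumes x: "x \<in> PP" and u: "u \<in> mut"
    and q: "\<And>x. cl u x * q x = cx (nxt u) x * cx (upv u) x * cx (lef u) x + cx (prv u) x * cx (nxt (upv u)) x * cx (nxt (lef u)) x"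
  shows "of_real (exch (verts n) u (B0 n) (yv x) / yv x u) = q x"
proof -
  have uv: "u \<in> verts n" using u by (simp add: mut_def)
  have nu: "prv u \<in> verts n" "upv u \<in> verts n" "lef u \<in> verts n" using nbrs_in_verts[OF u] by auto
  have e: "ext (\<lambda>w. complex_of_real (yv x w)) w = cx w x" if "w = (0, 0) \<or> w \<in> verts n" for w
    using that yv(2)[OF x, of w] by (auto simp: ext_def cx_def)
  have "complex_of_real (exch (verts n) u (B0 n) (yv x)) = exch (verts n) u (B0 n) (\<lambda>w. complex_of_real (yv x w))"
    by (rule exch_of_real[symmetric])
  also have "\<dots> = cl u x * q x"
    unfolding exch_B0[OF u] q
    using e[OF nxt_in_verts[OF uv]] e[OF nxt_in_verts[OF nu(2)]] e[OF nxt_in_verts[OF nu(3)]] e[of "prv u"] e[of "upv u"] e[of "lef u"] nu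
    by simp
  finally show ?thesis using yv(2)[OF x uv] pr_nz[OF PP_D[OF x uv]] by simp
qed

lemma cl_dvd_coprime:
  assumes u: "u \<in> mut" and q: "q \<in> pol (verts n)" "\<not> pdvd (verts n) (cl u) q"
  shows "\<not> pdvd (verts n) (cl u) (\<lambda>x. (q x * (\<Prod>w\<in>mut - {u}. cl w x)) ^ N)"
proof
  assume d: "pdvd (verts n) (cl u) (\<lambda>x. (q x * (\<Prod>w\<in>mut - {u}. cl w x)) ^ N)"
  have uv: "u \<in> verts n" using u by (simp add: mut_def)
  have wv: "w \<in> verts n" if "w \<in> mut - {u}" for w using that by (simp add: mut_def)
  obtain m where m: "1 \<le> m" "\<And>s x. cl u (\<lambda>v. s * x v) = s ^ m * cl u x" by (rule cl_homogeneous[OF uv]) blast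
  have "(0::complex) ^ m = 0" using m(1) by (simp add: power_0_left)
  hence z: "cl u (\<lambda>v. 0) = 0" using m(2)[of 0 "\<lambda>v. 0"] by (simp only: mult_zero_left)
  have E: "(\<lambda>x. \<Prod>w\<in>mut - {u}. cl w x) \<in> pol (verts n)" by (rule pol_prod, rule cl_pol', rule wv)
  have "pdvd (verts n) (cl u) (\<lambda>x. q x * (\<Prod>w\<in>mut - {u}. cl w x))"
    by (rule pdvd_power[OF cl_prime[OF uv] pol_mult[OF q(1) E] d cl_pol'[OF uv] z])
  hence "pdvd (verts n) (cl u) (\<lambda>x. \<Prod>w\<in>mut - {u}. cl w x)"
    using pprimeD[OF cl_prime[OF uv] q(1) E] q(2) by blast
  hence "\<exists>w\<in>mut - {u}. pdvd (verts n) (cl u) (cl w)"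
    by (intro pdvd_prod[OF cl_prime[OF uv] _ _ _ z]) (use finite_mut cl_pol'[OF wv] in auto)
  thus False using cl_not_dvd_cl[OF uv wv] by blast
qed

lemma cv_polynomial_on_PP:
  assumes ks: "set ks \<subseteq> mut" and v: "v \<in> verts n"
  shows "\<exists>P\<in>pol (verts n). \<forall>x\<in>PP. of_real (cv (verts n) (B0 n) ks (yv x) v) = P x"
proof -
  let ?V = "verts n"
  define c where "c = (\<lambda>x. complex_of_real (cv ?V (B0 n) ks (yv x) v))"
  have mv: "mut \<subseteq> ?V" by (auto simp: mut_def)
  have base: "\<exists>N. \<exists>P\<in>pol ?V. \<forall>x\<in>PP. c x * (\<Prod>w\<in>mut. cl w x) ^ N = P x"
    unfolding c_def
    by (rule clear_denominators[where Z = cl and y = yv, OF cl_pol' yv cv_laurent_mutable[OF finite_verts mv skew_B0 fullrank_B0 ks v]])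
  have nbr: "\<exists>N. \<exists>P\<in>pol ?V. \<exists>q\<in>pol ?V. (\<forall>x\<in>PP. c x * (q x * (\<Prod>w\<in>mut - {u}. cl w x)) ^ N = P x) \<and> \<not> pdvd ?V (cl u) q"
    if u: "u \<in> mut" for u
  proof -
    have uv: "u \<in> ?V" using u mv by blast
    obtain q where q: "q \<in> pol ?V" "\<And>x. cl u x * q x =
      cx (nxt u) x * cx (upv u) x * cx (lef u) x + cx (prv u) x * cx (nxt (upv u)) x * cx (nxt (lef u)) x"
      using exchange[OF u] by blast
    define Z where "Z = (\<lambda>w. if w = u then q else cl w)"
    define y where "y = (\<lambda>x. mutv ?V u (B0 n) (yv x))"
    \<comment> \<open>Mutating at \<open>u\<close> first returns from the adjacent seed to the
      initial one, so the same variable expands in the adjacent cluster.\<close>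
    have L: "(\<lambda>y. cv ?V (mutB u (B0 n)) (u # ks) y v) \<in> lau ?V mut"
      by (rule cv_laurent_mutable[OF finite_verts mv skew_mutB[OF skew_B0] fullrank_mutB[OF finite_verts uv u skew_B0 fullrank_B0] _ v])
        (use u ks in simp)
    have Zp: "Z w \<in> pol ?V" if "w \<in> ?V" for w using that q(1) cl_pol' by (simp add: Z_def)
    have y1: "pos (y x)" if "x \<in> PP" for x unfolding y_def by (rule mutv_pos[OF yv(1)[OF that]])
    have y2: "of_real (y x w) = Z w x" if "x \<in> PP" "w \<in> ?V" for x w
      using exch_yv[OF that(1) u q(2)] yv(2)[OF that] by (cases "w = u") (simp_all add: y_def Z_def mutv_def)
    obtain N P where P: "P \<in> pol ?V"
      "\<And>x. x \<in> PP \<Longrightarrow> of_real (cv ?V (mutB u (B0 n)) (u # ks) (y x) v) * (\<Prod>w\<in>mut. Z w x) ^ N = P x"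
      using clear_denominators[where Z = Z and y = y, OF Zp y1 y2 L] by blast
    have cy: "complex_of_real (cv ?V (mutB u (B0 n)) (u # ks) (y x) v) = c x" if "x \<in> PP" for x
      using mutv_invol[OF skew_B0 yv(1)[OF that], of ?V u] by (simp add: c_def y_def mutB_invol[OF skew_B0])
    have pz: "(\<Prod>w\<in>mut. Z w x) = q x * (\<Prod>w\<in>mut - {u}. cl w x)" for x
    proof -
      have "(\<Prod>w\<in>mut - {u}. Z w x) = (\<Prod>w\<in>mut - {u}. cl w x)" by (rule prod.cong) (auto simp: Z_def)
      thus ?thesis using prod.remove[OF finite_mut u, of "\<lambda>w. Z w x"] by (simp add: Z_def)
    qed
    have "\<forall>x\<in>PP. c x * (q x * (\<Prod>w\<in>mut - {u}. cl w x)) ^ N = P x"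
    proof
      fix x assume x: "x \<in> PP"
      show "c x * (q x * (\<Prod>w\<in>mut - {u}. cl w x)) ^ N = P x" using P(2)[OF x] unfolding cy[OF x] pz .
    qed
    moreover have "\<not> pdvd ?V (cl u) q" by (rule cl_not_dvd_exchange[OF u q])
    ultimately show ?thesis using P(1) q(1) by blast
  qed
  \<comment> \<open>The initial variables leave the denominator one at a time; \<open>S\<close>
    collects those already removed.\<close>
  have red: "\<exists>N. \<exists>P\<in>pol ?V. \<forall>x\<in>PP. c x * (\<Prod>w\<in>mut - S. cl w x) ^ N = P x" if "finite S" "S \<subseteq> mut" for S
    using that
  proof (induction S rule: finite_induct)
    case empty thus ?case using base by simp
  next
    case (insert u S)
    have u: "u \<in> mut" and uv: "u \<in> ?V" using insert.prems mv by auto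
    obtain N P where P: "P \<in> pol ?V" "\<And>x. x \<in> PP \<Longrightarrow> c x * (\<Prod>w\<in>mut - S. cl w x) ^ N = P x" using insert by blast
    obtain N' P' q where P': "P' \<in> pol ?V" "q \<in> pol ?V" "\<And>x. x \<in> PP \<Longrightarrow> c x * (q x * (\<Prod>w\<in>mut - {u}. cl w x)) ^ N' = P' x"
      "\<not> pdvd ?V (cl u) q" using nbr[OF u] by blast
    define E where "E = (\<lambda>x. \<Prod>w\<in>mut - insert u S. cl w x)"
    define R where "R = (\<lambda>x. (q x * (\<Prod>w\<in>mut - {u}. cl w x)) ^ N')"
    have clp: "(\<lambda>x. \<Prod>w\<in>A. cl w x) \<in> pol ?V" if "A \<subseteq> mut" for A
      by (rule pol_prod, rule cl_pol') (use that mv in auto)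
    have E: "E \<in> pol ?V" unfolding E_def by (rule clp) auto
    have R: "R \<in> pol ?V" unfolding R_def by (rule pol_power[OF pol_mult[OF P'(2) clp]]) auto
    have split: "(\<Prod>w\<in>mut - S. cl w x) = cl u x * E x" for x
    proof -
      have "u \<in> mut - S" "mut - S - {u} = mut - insert u S" using u insert.hyps by auto
      thus ?thesis unfolding E_def using prod.remove[of "mut - S" u "\<lambda>w. cl w x"] finite_mut by simp
    qed
    \<comment> \<open>Cross-multiplied expansions. Since the variable at \<open>u\<close> does not
      divide \<open>R\<close>, its power must divide \<open>P\<close>.\<close>
    have eqn: "(\<lambda>x. P x * R x) = (\<lambda>x. cl u x ^ N * (P' x * E x ^ N))"
    proof (rule PP_eqI[OF pol_mult[OF P(1) R] pol_mult[OF pol_power[OF cl_pol'[OF uv]] pol_mult[OF P'(1) pol_power[OF E]]]])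
      fix x assume x: "x \<in> PP"
      show "P x * R x = cl u x ^ N * (P' x * E x ^ N)"
        unfolding P(2)[OF x, symmetric] P'(3)[OF x, symmetric] split R_def by (simp add: power_mult_distrib algebra_simps)
    qed
    have "pdvd ?V (\<lambda>x. cl u x ^ N) (\<lambda>x. P x * R x)"
      unfolding eqn by (rule pdvdI[OF pol_mult[OF P'(1) pol_power[OF E]] refl])
    moreover have "\<not> pdvd ?V (cl u) R" unfolding R_def by (rule cl_dvd_coprime[OF u P'(2,4)])
    ultimately have "pdvd ?V (\<lambda>x. cl u x ^ N) P"
      using pdvd_power_cancel[OF cl_prime[OF uv] cl_pol'[OF uv] cl_nonzero[OF uv] R _ P(1)] by blast
    then obtain P1 where P1: "P1 \<in> pol ?V" "P = (\<lambda>x. cl u x ^ N * P1 x)" unfolding pdvd_def by blast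
    have "\<forall>x\<in>PP. c x * E x ^ N = P1 x"
    proof
      fix x assume x: "x \<in> PP"
      have "cl u x ^ N * (c x * E x ^ N) = cl u x ^ N * P1 x"
        using P(2)[OF x] unfolding split P1(2) by (simp add: power_mult_distrib algebra_simps)
      thus "c x * E x ^ N = P1 x" using pr_nz[OF PP_D[OF x uv]] by simp
    qed
    thus ?case using P1(1) unfolding E_def by blast
  qed
  from red[OF finite_mut order_refl] show ?thesis unfolding c_def by simp
qed

subsection \<open>Regularity\<close>

text \<open>A rational function whose denominator has no zeros on \<open>PP\<close>. The equation is
  required wherever \<open>H\<close> is nonzero, at non-positive complex points too, because
  \<open>regular_on\<close> compares values on an open set of the whole variety.\<close>

definition RT :: "((nat \<times> nat \<Rightarrow> complex) \<Rightarrow> complex) \<Rightarrow> bool" where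
  "RT Y \<longleftrightarrow> (\<exists>P\<in>pol (verts n). \<exists>H\<in>pol (verts n). (\<forall>x\<in>PP. H x \<noteq> 0) \<and> (\<forall>x. H x \<noteq> 0 \<longrightarrow> Y x * H x = P x))"

lemma RT_pol: "Y \<in> pol (verts n) \<Longrightarrow> RT Y"
  unfolding RT_def by (rule bexI[of _ Y], rule bexI[OF _ pol_const[of 1]]) auto

lemma RT_add: assumes "RT Y" "RT Z" shows "RT (\<lambda>x. Y x + Z x)"
proof -
  from assms obtain P H P' H' where 1: "P \<in> pol (verts n)" "H \<in> pol (verts n)" "\<forall>x\<in>PP. H x \<noteq> 0" "\<And>x. H x \<noteq> 0 \<Longrightarrow> Y x * H x = P x"
    and 2: "P' \<in> pol (verts n)" "H' \<in> pol (verts n)" "\<forall>x\<in>PP. H' x \<noteq> 0" "\<And>x. H' x \<noteq> 0 \<Longrightarrow> Z x * H' x = P' x"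
    unfolding RT_def by blast
  show ?thesis unfolding RT_def
  proof (rule bexI[of _ "\<lambda>x. P x * H' x + P' x * H x"], rule bexI[of _ "\<lambda>x. H x * H' x"], intro conjI ballI allI impI)
    fix x assume "H x * H' x \<noteq> 0"
    hence e: "Y x * H x = P x" "Z x * H' x = P' x" using 1(4) 2(4) by auto
    show "(Y x + Z x) * (H x * H' x) = P x * H' x + P' x * H x" unfolding e[symmetric] by (simp add: algebra_simps)
  qed (use 1(3) 2(3) in \<open>auto intro: pol_add[OF pol_mult[OF 1(1) 2(2)] pol_mult[OF 2(1) 1(2)]] pol_mult[OF 1(2) 2(2)]\<close>)
qed

lemma RT_mult: assumes "RT Y" "RT Z" shows "RT (\<lambda>x. Y x * Z x)"
proof -
  from assms obtain P H P' H' where 1: "P \<in> pol (verts n)" "H \<in> pol (verts n)" "\<forall>x\<in>PP. H x \<noteq> 0" "\<And>x. H x \<noteq> 0 \<Longrightarrow> Y x * H x = P x"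
    and 2: "P' \<in> pol (verts n)" "H' \<in> pol (verts n)" "\<forall>x\<in>PP. H' x \<noteq> 0" "\<And>x. H' x \<noteq> 0 \<Longrightarrow> Z x * H' x = P' x"
    unfolding RT_def by blast
  show ?thesis unfolding RT_def
  proof (rule bexI[of _ "\<lambda>x. P x * P' x"], rule bexI[of _ "\<lambda>x. H x * H' x"], intro conjI ballI allI impI)
    fix x assume "H x * H' x \<noteq> 0"
    hence e: "Y x * H x = P x" "Z x * H' x = P' x" using 1(4) 2(4) by auto
    show "(Y x * Z x) * (H x * H' x) = P x * P' x" unfolding e[symmetric] by (simp add: algebra_simps)
  qed (use 1(3) 2(3) in \<open>auto intro: pol_mult[OF 1(1) 2(1)] pol_mult[OF 1(2) 2(2)]\<close>)
qed

lemma RT_inverse: assumes "RT Y" "\<And>x. x \<in> PP \<Longrightarrow> Y x \<noteq> 0" shows "RT (\<lambda>x. inverse (Y x))"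
proof -
  from assms(1) obtain P H where 1: "P \<in> pol (verts n)" "H \<in> pol (verts n)" "\<forall>x\<in>PP. H x \<noteq> 0" "\<And>x. H x \<noteq> 0 \<Longrightarrow> Y x * H x = P x"
    unfolding RT_def by blast
  show ?thesis unfolding RT_def
  \<comment> \<open>The factor \<open>P\<close> in the new denominator excludes the zeros of
    \<open>Y\<close>, where \<open>inverse\<close> takes the value 0 by convention.\<close>
  proof (rule bexI[of _ "\<lambda>x. H x * H x"], rule bexI[of _ "\<lambda>x. H x * P x"], intro conjI ballI allI impI)
    fix x assume a: "H x * P x \<noteq> 0"
    hence e: "Y x * H x = P x" using 1(4) by auto
    hence "Y x \<noteq> 0" using a by auto
    thus "inverse (Y x) * (H x * P x) = H x * H x" unfolding e[symmetric] by (simp add: field_simps)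
  next
    fix x assume x: "x \<in> PP"
    have "P x = Y x * H x" using 1(3,4) x by auto
    thus "H x * P x \<noteq> 0" using 1(3) x assms(2)[OF x] by auto
  qed (rule pol_mult[OF 1(2) 1(1)] pol_mult[OF 1(2) 1(2)])+
qed

lemma RT_power: "RT Y \<Longrightarrow> RT (\<lambda>x. Y x ^ k)"
proof (induction k)
  case 0 show ?case using RT_pol[OF pol_const[of 1]] by simp
next
  case (Suc k) thus ?case using RT_mult[of Y "\<lambda>x. Y x ^ k"] by simp
qed

lemma RT_prod: "finite I \<Longrightarrow> (\<And>i. i \<in> I \<Longrightarrow> RT (f i)) \<Longrightarrow> RT (\<lambda>x. \<Prod>i\<in>I. f i x)"
proof (induction I rule: finite_induct)
  case empty show ?case using RT_pol[OF pol_const[of 1]] by simp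
next
  case (insert i I)
  thus ?case using RT_mult[of "f i" "\<lambda>x. \<Prod>i\<in>I. f i x"] by simp
qed

lemma RT_exch:
  assumes "\<And>w. w \<in> verts n \<Longrightarrow> RT (\<lambda>x. y x w)"
  shows "RT (\<lambda>x. exch (verts n) k B (y x))"
proof -
  have "RT (\<lambda>x. \<Prod>w\<in>verts n. if Q w then y x w ^ e w else 1)" for Q e
  proof (rule RT_prod[OF finite_verts])
    fix w assume "w \<in> verts n"
    thus "RT (\<lambda>x. if Q w then y x w ^ e w else 1)"
      using RT_power[OF assms, of w "e w"] RT_pol[OF pol_const[of 1]] by (cases "Q w") simp_all
  qed
  from RT_add[OF this this] show ?thesis unfolding exch_def .
qed

lemma RT_cv:
  "(\<And>w. w \<in> verts n \<Longrightarrow> RT (\<lambda>x. y x w)) \<Longrightarrow> (\<And>x w. x \<in> PP \<Longrightarrow> w \<in> verts n \<Longrightarrow> pr (y x w)) \<Longrightarrow>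
    set ks \<subseteq> verts n \<Longrightarrow> v \<in> verts n \<Longrightarrow> RT (\<lambda>x. cv (verts n) B ks (y x) v)"
proof (induction ks arbitrary: B y)
  case (Cons k ks)
  have k: "k \<in> verts n" "set ks \<subseteq> verts n" using Cons.prems(3) by auto
  have "RT (\<lambda>x. exch (verts n) k B (y x) * inverse (y x k))"
    using Cons.prems(2) pr_nz k(1) by (intro RT_mult RT_exch RT_inverse Cons.prems(1)) auto
  hence r: "RT (\<lambda>x. mutv (verts n) k B (y x) w)" if "w \<in> verts n" for w
    using Cons.prems(1)[OF that] by (cases "w = k") (simp_all add: mutv_def divide_inverse)
  have p: "pr (mutv (verts n) k B (y x) w)" if "x \<in> PP" "w \<in> verts n" for x w
  proof (cases "w = k")
    case True
    have "pr (exch (verts n) k B (y x))" by (rule exch_pr) (rule Cons.prems(2)[OF that(1)])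
    from pr_divide[OF this Cons.prems(2)[OF that(1) k(1)]] show ?thesis using True by (simp add: mutv_def)
  next
    case False
    thus ?thesis using Cons.prems(2)[OF that] by (simp add: mutv_def)
  qed
  show ?case using Cons.IH[of "\<lambda>x. mutv (verts n) k B (y x)", OF r p k(2) Cons.prems(4)] by simp
qed simp

text \<open>The starfish argument yields the polynomial \<open>Q\<close> only at positive points.
  The fraction provided by \<open>RT_cv\<close> has the same values there, and density of
  \<open>PP\<close> extends the equality to all points where \<open>H\<close> is nonzero.\<close>

lemma cv_regular:
  assumes ks: "set ks \<subseteq> mut" and v: "v \<in> verts n"
  shows "\<exists>Q\<in>pol (verts n). \<exists>H\<in>pol (verts n). (\<forall>x\<in>PP. H x \<noteq> 0) \<and>
    (\<forall>x. H x \<noteq> 0 \<longrightarrow> cv (verts n) (B0 n) ks (\<lambda>w. cl w x) v = Q x)"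
proof -
  have ksv: "set ks \<subseteq> verts n" using ks by (auto simp: mut_def)
  obtain Q where Q: "Q \<in> pol (verts n)" "\<And>x. x \<in> PP \<Longrightarrow> of_real (cv (verts n) (B0 n) ks (yv x) v) = Q x"
    using cv_polynomial_on_PP[OF assms] by blast
  have c: "cv (verts n) (B0 n) ks (\<lambda>w. cl w x) v = Q x" if x: "x \<in> PP" for x
    unfolding Q(2)[OF x, symmetric] cv_of_real[symmetric]
    by (rule cv_local[OF _ ksv v]) (simp add: yv(2)[OF x])
  have "RT (\<lambda>x. cv (verts n) (B0 n) ks (\<lambda>w. cl w x) v)"
    by (rule RT_cv[OF RT_pol[OF cl_pol] PP_D ksv v])
  then obtain P H where H: "P \<in> pol (verts n)" "H \<in> pol (verts n)" "\<forall>x\<in>PP. H x \<noteq> 0"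
    "\<And>x. H x \<noteq> 0 \<Longrightarrow> cv (verts n) (B0 n) ks (\<lambda>w. cl w x) v * H x = P x" unfolding RT_def by blast
  have "(\<lambda>x. Q x * H x) = P"
    by (rule PP_eqI[OF pol_mult[OF Q(1) H(2)] H(1)]) (use H(3,4) c in metis)
  hence "cv (verts n) (B0 n) ks (\<lambda>w. cl w x) v = Q x" if "H x \<noteq> 0" for x
    using H(4)[OF that] that by (metis mult_right_cancel)
  thus ?thesis using Q(1) H(2,3) by blast
qed

lemma pol_polyfun: "f \<in> pol (verts n) \<Longrightarrow> (\<lambda>X. f (\<lambda>(i, j). X i j)) \<in> polyfun n"
proof (induction rule: pol.induct)
  case (pol_const c) show ?case by (rule pf_const)
next
  case (pol_var v)
  thus ?case using pf_coord[of "fst v" n "snd v"] by (cases v) (simp add: verts_def)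
next
  case (pol_add f g) thus ?case using pf_add by blast
next
  case (pol_mult f g) thus ?case using pf_mult by blast
qed

lemma init_cl: "init_cluster n w X = cl w (\<lambda>(i, j). X i j)"
  by (simp add: cl_def XX_def)

lemma cl_11: "cl (1, 1) (\<lambda>(i, j). X i j) = detm n X"
  using cl_diag[of 1 "\<lambda>(i, j). X i j"] n2 by (simp add: th_def theta_def XX_def minor_def)

definition mat_of :: "(nat \<times> nat \<Rightarrow> complex) \<Rightarrow> nat \<Rightarrow> nat \<Rightarrow> complex" where
  "mat_of x = (\<lambda>i j. if (i, j) \<in> verts n then x (i, j) else 0)"

lemma mat_of: "mat_of x \<in> Mat n" "f \<in> pol (verts n) \<Longrightarrow> f (\<lambda>(i, j). mat_of x i j) = f x"
proof -
  show "mat_of x \<in> Mat n" by (auto simp: Mat_def mat_of_def verts_def)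
  show "f (\<lambda>(i, j). mat_of x i j) = f x" if "f \<in> pol (verts n)"
    by (rule pol_local[OF that]) (auto simp: mat_of_def)
qed

lemma PP_nonempty: obtains x where "x \<in> PP"
  using PP_dense[OF pol_const[of 1]] by (metis one_neq_zero)

text \<open>The initial variables are homogeneous, so scaling by a positive real preserves
  positivity, and a suitable root normalizes the determinant.\<close>

lemma PP_det_1: obtains x where "x \<in> PP" "cl (1, 1) x = 1"
proof -
  obtain x where x: "x \<in> PP" by (rule PP_nonempty)
  have v: "(1, 1) \<in> verts n" using n2 by (simp add: verts_def)
  obtain r where r: "0 < r" "cl (1, 1) x = of_real r" using PP_D[OF x v] by (auto simp: pr_def)
  obtain m where m: "1 \<le> m" "\<And>s x. cl (1, 1) (\<lambda>u. s * x u) = s ^ m * cl (1, 1) x" by (rule cl_homogeneous[OF v]) blast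
  define s where "s = root m (1 / r)"
  have s: "0 < s" "s ^ m = 1 / r" using r m(1) by (auto simp: s_def)
  have ps: "pr (of_real s)" using s(1) by (auto simp: pr_def)
  have "cl (1, 1) (\<lambda>u. of_real s * x u) = of_real (s ^ m * r)" unfolding m(2) r(2) by simp
  hence "cl (1, 1) (\<lambda>u. of_real s * x u) = 1" using s(2) r(1) by simp
  moreover have "(\<lambda>u. of_real s * x u) \<in> PP" unfolding PP_def
  proof (intro CollectI ballI)
    fix v assume v: "v \<in> verts n"
    obtain m where "\<And>s x. cl v (\<lambda>u. s * x u) = s ^ m * cl v x" by (rule cl_homogeneous[OF v]) blast
    thus "pr (cl v (\<lambda>u. of_real s * x u))" using pr_mult[OF pr_power[OF ps] PP_D[OF x v]] by simp
  qed
  ultimately show ?thesis using that by blast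
qed

lemma regular_Mat:
  assumes "set ks \<subseteq> mutable n" "v \<in> verts n"
  shows "regular_on (Mat n) n (snd (fold (mutate (verts n)) ks (B0 n, init_cluster n)) v)"
proof -
  obtain Q H where Q: "Q \<in> pol (verts n)" "H \<in> pol (verts n)" "\<forall>x\<in>PP. H x \<noteq> 0"
    "\<And>x. H x \<noteq> 0 \<Longrightarrow> cv (verts n) (B0 n) ks (\<lambda>w. cl w x) v = Q x"
    using cv_regular assms unfolding mutable_eq by blast
  obtain x where x: "x \<in> PP" by (rule PP_nonempty)
  show ?thesis unfolding regular_on_def
  proof (rule bexI[OF _ pol_polyfun[OF Q(1)]], rule bexI[OF _ pol_polyfun[OF Q(2)]], intro conjI ballI impI)
    show "\<exists>X\<in>Mat n. H (\<lambda>(i, j). X i j) \<noteq> 0"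
    proof (rule bexI[OF _ mat_of(1)])
      show "H (\<lambda>(i, j). mat_of x i j) \<noteq> 0" unfolding mat_of(2)[OF Q(2)] using Q(3) x by blast
    qed
    fix X assume "H (\<lambda>(i, j). X i j) \<noteq> 0"
    from Q(4)[OF this] show "snd (fold (mutate (verts n)) ks (B0 n, init_cluster n)) v X = Q (\<lambda>(i, j). X i j)"
      unfolding fold_mutate init_cl .
  qed
qed

lemma regular_SL:
  assumes ks: "set ks \<subseteq> mutable_SL n" and v: "v \<in> verts_SL n"
  shows "regular_on (SL n) n (snd (fold (mutate (verts_SL n)) ks (B0 n, init_cluster n)) v)"
proof -
  have ks': "set ks \<subseteq> mut" "(1, 1) \<notin> set ks" and v': "v \<in> verts n"
    using ks v unfolding mutable_SL_def verts_SL_def frozen_eq mut_def by auto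
  obtain Q H where Q: "Q \<in> pol (verts n)" "H \<in> pol (verts n)" "\<forall>x\<in>PP. H x \<noteq> 0"
    "\<And>x. H x \<noteq> 0 \<Longrightarrow> cv (verts n) (B0 n) ks (\<lambda>w. cl w x) v = Q x"
    using cv_regular[OF ks'(1) v'] by blast
  have 11: "(1, 1) \<in> verts n" using n2 by (simp add: verts_def)
  obtain x where x: "x \<in> PP" "cl (1, 1) x = 1" by (rule PP_det_1)
  have "detm n (mat_of x) = 1" unfolding cl_11[symmetric] using mat_of(2)[OF cl_pol'[OF 11]] x(2) by simp
  hence mx: "mat_of x \<in> SL n" using mat_of(1) by (simp add: SL_def)
  show ?thesis unfolding regular_on_def
  proof (rule bexI[OF _ pol_polyfun[OF Q(1)]], rule bexI[OF _ pol_polyfun[OF Q(2)]], intro conjI ballI impI)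
    show "\<exists>X\<in>SL n. H (\<lambda>(i, j). X i j) \<noteq> 0"
    proof (rule bexI[OF _ mx])
      show "H (\<lambda>(i, j). mat_of x i j) \<noteq> 0" unfolding mat_of(2)[OF Q(2)] using Q(3) x by blast
    qed
    fix X assume X: "X \<in> SL n" and h: "H (\<lambda>(i, j). X i j) \<noteq> 0"
    have "cl (1, 1) (\<lambda>(i, j). X i j) = 1" unfolding cl_11 using X by (simp add: SL_def)
    from cv_restrict[OF finite_verts, of "\<lambda>w. cl w (\<lambda>(i, j). X i j)", OF this ks'(2), of "B0 n" v] Q(4)[OF h]
    show "snd (fold (mutate (verts_SL n)) ks (B0 n, init_cluster n)) v X = Q (\<lambda>(i, j). X i j)"
      unfolding fold_mutate init_cl verts_SL_def by simp
  qed
qed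

end

lemma regular_1: "regular_on (Mat 1) 1 (init_cluster 1 (1, 1))"
proof -
  have s: "(SOME i. i \<in> {1..1} \<and> pos_theta 1 i = (1, 1)) = (1::nat)"
    by (rule some_equality) (auto simp: pos_theta_def)
  have "init_cluster 1 (1, 1) = theta 1 (SOME i. i \<in> {1..1} \<and> pos_theta 1 i = (1, 1))"
    unfolding init_cluster_def by (simp add: pos_theta_def)
  hence "init_cluster 1 (1, 1) X = minor X 1 1 1" for X unfolding s theta_def by simp
  moreover have "minor X 1 1 1 = X 1 1" for X
    unfolding minor_dt using dt_row_0[of 0 "\<lambda>i j. X (1 + i) (1 + j)"] by simp
  ultimately have e: "init_cluster 1 (1, 1) X = X 1 1" for X by simp
  show ?thesis unfolding regular_on_def e
  proof (rule bexI[OF _ pf_coord[of 1 1 1]], rule bexI[OF _ pf_const[of 1]], intro conjI)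
    show "\<exists>X\<in>Mat 1. (1::complex) \<noteq> 0" by (rule bexI[of _ "\<lambda>i j. 0"]) (auto simp: Mat_def)
  qed auto
qed

theorem theorem5:
  fixes n :: nat
  shows "(\<forall>ks. set ks \<subseteq> mutable n \<longrightarrow>
           (\<forall>v \<in> verts n. regular_on (Mat n) n
              (snd (fold (mutate (verts n)) ks (B0 n, init_cluster n)) v)))
       \<and> (\<forall>ks. set ks \<subseteq> mutable_SL n \<longrightarrow>
           (\<forall>v \<in> verts_SL n. regular_on (SL n) n
              (snd (fold (mutate (verts_SL n)) ks (B0 n, init_cluster n)) v)))"
proof -
  consider "n = 0" | "n = 1" | "2 \<le> n" by linarith
  thus ?thesis
  proof cases
    case 1
    thus ?thesis by (simp add: verts_def verts_SL_def)
  next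
    \<comment> \<open>The only vertex is frozen, and \<open>verts_SL 1\<close> is empty.\<close>
    case 2
    have V: "verts n = {(1, 1)}" "verts_SL n = {}" using 2 by (auto simp: verts_def verts_SL_def)
    have "mutable n = {}" unfolding mutable_def V using 2 by (auto simp: frozen_def pos_theta_def)
    thus ?thesis using V regular_1 2 by simp
  next
    case 3
    then interpret cg n by unfold_locales
    show ?thesis using regular_Mat regular_SL by blast
  qed
qed

end
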